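(* Let $\mathbb{M}$ be a Zariski-like structure whose pregeometry (given by bounded closure) is non-trivial. Then there exists a Galois definable one-dimensional group in $(\mathbb{M}^{eq})^{eq}$.
   Context: QUASIMINIMAL CLASSES. Let $L$ be a countable language; $\mathrm{tp}$ denotes quantifier-free type. An $L$-structure $M$ with a pregeometry $\mathrm{cl}$ is a quasiminimal pregeometry structure if: (QM1) if $a,a'$ are singletons and $\mathrm{tp}(a,b)=\mathrm{tp}(a',b')$, then $a\in\mathrm{cl}(b)$ iff $a'\in\mathrm{cl}(b')$; (QM2) $M$ is infinite-dimensional; (QM3) $\mathrm{cl}(A)$ is countable for finite $A\subseteq M$; (QM4) if $H,H'\subseteq M$ are countable closed sets enumerated so that $\mathrm{tp}(H)=\mathrm{tp}(H')$ and $a\in M\setminus H$, $a'\in M\setminus H'$ are singletons, then $\mathrm{tp}(H,a)=\mathrm{tp}(H',a')$; (QM5) if $H,H'\subseteq M$ are countable closed sets or empty, enumerated so that $\mathrm{tp}(H)=\mathrm{tp}(H')$, $b,b'$ are finite tuples with $\mathrm{tp}(H,b)=\mathrm{tp}(H',b')$ and $a\in\mathrm{cl}(H,b)$ is a singleton, then there is a singleton $a'\in M$ with $\mathrm{tp}(H,b,a)=\mathrm{tp}(H',b',a')$. Weakly quasiminimal: all of these except possibly (QM2). A closed embedding $\theta:M_1\to M_2$ of weakly quasiminimal structures is an isomorphism onto a substructure that is $\mathrm{cl}_{M_2}$-closed, with $\mathrm{cl}_{M_1}$ the restriction of $\mathrm{cl}_{M_2}$. $\mathcal{K}^-(M)$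 is the smallest class of $L$-structures containing $M$ and all its closed substructures and closed under isomorphism; $\mathcal{K}(M)$ is the smallest class containing $\mathcal{K}^-(M)$ and closed also under unions of chains of closed embeddings. A quasiminimal class is $\mathcal{K}=\mathcal{K}(M)$ with all finite-dimensional structures discarded, with $\mathcal{A}\preccurlyeq\mathcal{B}$ iff $\mathcal{A}$ is a closed submodel of $\mathcal{B}$; it is an abstract elementary class (AEC) with Löwenheim–Skolem number $\omega$. Throughout, $\mathbb{M}$ is a quasiminimal pregeometry structure which is a monster model ($\delta$-model homogeneous and $\delta$-universal for a large cardinal $\delta$) for a quasiminimal class $\mathcal{K}$. "Bounded" means of size $<\delta$. In $\mathbb{M}$, $\mathrm{cl}$ equals bounded closure: $a\in\mathrm{bcl}(A)$ iff $t(a/A)$ has only boundedly many realizations. The pregeometry is non-trivial if $\mathrm{bcl}(A)\ne\bigcup_{a\in A}\mathrm{bcl}(\{a\})$ for some non-empty $A$. TYPES AND RANK (also applied with $\mathbb{M}^{eq}$, $(\mathbb{M}^{eq})^{eq}$ in place of $\mathbb{M}$). Models are $\mathcal{A}\preccurlyeq\mathbb{M}$; models and parameter sets are bounded; $a\in X$ may be a finite tuple; juxtaposition denotes union or concatenation. $a,b$ have the same Galois type $t^g$ over $A$ if some $f\in\mathrm{Aut}(\mathbb{M}/A)$ (automorphisms fixing $A$ pointwise) maps $a$ to $b$; they have the same weak type, $t(a/A)=t(b/A)$, if they have the same Galois type over every finite subset of $A$. For $A\subseteq B$, $A$ finite, $t(a/B)$ splits over $A$ if there are $b,c\in B$ with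 $t(b/A)=t(c/A)$ but $t(ab/A)\ne t(ac/A)$. $a\downarrow^{ns}_B C$ means that $t(a/B\cup C)$ does not split over some finite $A\subseteq B$. For a model $\mathcal{A}$: $U(a/\mathcal{A})\ge0$ always; $U(a/\mathcal{A})\ge n+1$ if there is a model $\mathcal{B}\supseteq\mathcal{A}$ with $a\not\downarrow^{ns}_{\mathcal{A}}\mathcal{B}$ and $U(a/\mathcal{B})\ge n$; $U(a/\mathcal A)$ is the largest $n$ with $U(a/\mathcal{A})\ge n$. For finite $A$, $U(a/A)=\max\{U(a/\mathcal{A}) : \mathcal{A}\supset A\text{ a model}\}$; for arbitrary $A$, $U(a/A)=\min\{U(a/B):B\subseteq A\text{ finite}\}$. In $\mathbb{M}$, $U(a/A)=\dim_{\mathrm{bcl}}(a/A)$. An element of a set $C$ Galois definable over $D$ is generic in $C$ if its $U$-rank over $D$ is maximal among elements of $C$. INDEPENDENCE. For finite $A$, $E(A)$ is the set of $\mathrm{Aut}(\mathbb{M}/A)$-invariant equivalence relations on powers $\mathbb{M}^n$ with boundedly many classes; $Lt(a/B)=Lt(b/B)$ means $(a,b)\in E$ for all finite $A\subseteq B$ and $E\in E(A)$. For $A\subseteq B$, $A$ finite, $t(a/B)$ Lascar splits over $A$ if there are $b,c\in B$ with $Lt(b/A)=Lt(c/A)$ and $t(ab/A)\neq t(ac/A)$. $a\downarrow_B C$ means: there is a finite $A\subseteq B$ such that for all $D\supseteq B\cup C$ there is $b$ with $t(b/B\cup C)=t(a/B\cup C)$ and $t(b/D)$ not Lascar splitting over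 $A$. A family is independent over $B$ if each member is $\downarrow_B$-free from the others. A sequence is indiscernible over $B$ if every permutation of it extends to some $f\in\mathrm{Aut}(\mathbb{M}/B)$ (it may be constant). SPECIALIZATIONS. Let $\mathcal{C}$ be a collection of subsets of $\mathbb{M}^n$, $n=1,2,\dots$. For $A\subset\mathbb{M}$, $f:A\to\mathbb{M}$ is a specialization if for all $a_1,\dots,a_n\in A$ and $C\in\mathcal{C}$, $(a_1,\dots,a_n)\in C$ implies $(f(a_1),\dots,f(a_n))\in C$; it is an isomorphism if also the converse implication holds. For indexed families, $(a_i)_{i\in I}\to(b_i)_{i\in I}$ means that $a_i\mapsto b_i$ is a specialization. For finite tuples with $a\to b$, $\mathrm{rk}(a\to b)=\dim(a/\emptyset)-\dim(b/\emptyset)$. Strongly regular specializations are defined recursively: isomorphisms are strongly regular; if $a\to a'$ is a specialization and $a\in\mathbb{M}$ is generic over $\emptyset$, then $a\to a'$ is strongly regular; $aa'\to bb'$ is strongly regular if $a\downarrow_\emptyset a'$ and $a\to b$, $a'\to b'$ are strongly regular. Strongly good specializations are defined recursively: every strongly regular specialization is strongly good; if $a=(a_1,a_2,a_3)\to a'=(a_1',a_2',a_3')$, $(a_1,a_2)\to(a_1',a_2')$ is strongly good, $a_1\to a_1'$ is an isomorphism, and $a_3\in\mathrm{cl}(a_1)$, then $a\to a'$ is strongly good. ZARISKI-LIKE. $\mathbb{M}$ is Zariski-like if there is a countable collection $\mathcal{C}$ of subsets of the $\mathbb{M}^n$ ("irreducible sets") such that (specializations being with respect to $\mathcal{C}$):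 (ZL1) each $C\in\mathcal{C}$ is Galois definable over $\emptyset$. (ZL2) For each $a\in\mathbb{M}$ there is $C\in\mathcal{C}$ such that $a$ is generic in $C$. (ZL3) If $C\in\mathcal{C}$, the generic elements of $C$ have the same Galois type. (ZL4) If $C,D\in\mathcal{C}$, $a\in C$ is generic and $a\in D$, then $C\subseteq D$. (ZL5) If $C_1,C_2\in\mathcal{C}$, $(a,b)\in C_1$ is generic, $a$ is a generic element of $C_2$ and $(a',b')\in C_1$, then $a'\in C_2$. (ZL6) If $C\in\mathcal{C}$, $C\subset\mathbb{M}^n$, and $f$ is a coordinate permutation on $\mathbb{M}^n$, then $f(C)\in\mathcal{C}$. (ZL7) Let $a\to a'$ be a strongly good specialization with $\mathrm{rk}(a\to a')\le1$. Then any specializations $ab\to a'b'$, $ac\to a'c'$ can be amalgamated: there exists $b^*$, independent from $c$ over $a$, such that $t^g(b^*/a)=t^g(b/a)$ and $ab^*c\to a'b'c'$. (ZL8) Let $(a_i:i\in I)$ be independent and indiscernible over $b$. Suppose $(a_i':i\in I)$ is indiscernible over $b'$ and $a_ib\to a_i'b'$ for each $i\in I$. Suppose further that $b\to b'$ is a strongly good specialization and $\mathrm{rk}(b\to b')\le1$. Then $(ba_i:i\in I)\to(b'a_i':i\in I)$. (ZL9) Let $\kappa$ be a (possibly finite) cardinal and $a_i,b_i\in\mathbb{M}$, $i<\kappa$, with $a_0\ne a_1$ and $b_0=b_1$, such that $(a_i)_{i<\kappa}\to(b_i)_{i<\kappa}$. Assume there is an unbounded and directed $S\subset\mathcal{P}_{<\omega}(\kappa)$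 such that (i) $0,1\in X$ for all $X\in S$; (ii) for all $X\subseteq Y$ in $S$ and all sequences $(c_i)_{i\in Y}$ from $\mathbb{M}$: if $c_0=c_1$, $(a_i)_{i\in Y}\to(c_i)_{i\in Y}\to(b_i)_{i\in Y}$ and $\mathrm{rk}((a_i)_{i\in Y}\to(c_i)_{i\in Y})\le1$, then $\mathrm{rk}((a_i)_{i\in X}\to(c_i)_{i\in X})\le1$. Then there are $(c_i)_{i<\kappa}$ with $(a_i)_{i<\kappa}\to(c_i)_{i<\kappa}\to(b_i)_{i<\kappa}$, $c_0=c_1$, and $\mathrm{rk}((a_i)_{i\in X}\to(c_i)_{i\in X})\le1$ for all $X\in S$. IMAGINARIES. Let $\mathcal{E}$ be a countable collection of $\emptyset$-invariant equivalence relations $E\subseteq\mathbb{M}^n\times\mathbb{M}^n$ (various $n$), containing equality, each given by a countable set $G_E$ of Galois types over $\emptyset$ via $(a,b)\in E$ iff $t^g(ab/\emptyset)\in G_E$. For $\mathcal{A}\in\mathcal{K}$, $\mathcal{A}^{eq}=\{a/E: a\in\mathcal{A},E\in\mathcal{E}\}$, with $a$ identified with $a/{=}$, the structure of $\mathcal{A}$ on the copy of $\mathcal{A}$, and additional predicates $P_E$ for $\{a/E:a\in\mathcal{A}\}$ and functions $F_E(a)=a/E$. $\mathcal{K}^{eq}=\{\mathcal{A}^{eq}:\mathcal{A}\in\mathcal{K}\}$, with $\mathcal{A}^{eq}\preccurlyeq^{eq}\mathcal{B}^{eq}$ iff $\mathcal{A}^{eq}$ is a submodel of $\mathcal{B}^{eq}$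 and $\mathcal{A}\preccurlyeq\mathcal{B}$; its monster model is $\mathbb{M}^{eq}$. $(\mathbb{M}^{eq})^{eq}$ is formed from $\mathbb{M}^{eq}$ in the same way. The countable collections $\mathcal{E}$ at both stages are assumed chosen to contain the relations needed (e.g. those providing canonical bases, and the relations "$\mathrm{bcl}(x)=\mathrm{bcl}(y)$" on tuples), so the assertion is for a suitable such choice. DEFINABILITY. A set $B$ is Galois definable over $A$ if every automorphism fixing $A$ pointwise fixes $B$ setwise. A group is Galois definable over $A$ if both its underlying set and its operation are; here "Galois definable" means over some finite set of parameters. The group is one-dimensional if its generic elements have $U$-rank $1$ over these parameters. *)

theory Defs
  imports "HOL-Algebra.Group" "HOL-Library.Extended_Nat" "HOL-Library.Countable_Set"
begin

text \<open>
  Finite tuples are lists. Concatenation of tuples is \<open>@\<close>, and where a tuple is used as a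
  parameter set it is replaced by the set of its entries.
\<close>

definition tuples :: "'a set \<Rightarrow> nat \<Rightarrow> 'a list set" where
  "tuples S n = {xs. length xs = n \<and> set xs \<subseteq> S}"


section \<open>First-order structures and quantifier-free types\<close>

text \<open>A symbol of a language comes with its arity.\<close>

record ('f, 'r) language =
  fun_syms :: "('f \<times> nat) set"
  rel_syms :: "('r \<times> nat) set"

definition countable_language :: "('f, 'r) language \<Rightarrow> bool" where
  "countable_language L \<longleftrightarrow> countable (fun_syms L) \<and> countable (rel_syms L)"

text \<open>
  A structure together with a closure operator. Only the values of the components on (tuples
  from, subsets of) \<open>points M\<close> carry meaning; this is why all comparisons of structures below
  go through \<open>isom\<close> and \<open>closed_embedding\<close> and not through equality of records.
\<close>

record ('f, 'r, 'a) cl_structure =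
  points :: "'a set"
  funs :: "'f \<Rightarrow> 'a list \<Rightarrow> 'a"
  rels :: "'r \<Rightarrow> 'a list \<Rightarrow> bool"
  cl :: "'a set \<Rightarrow> 'a set"

definition is_structure :: "('f, 'r) language \<Rightarrow> ('f, 'r, 'a) cl_structure \<Rightarrow> bool" where
  "is_structure L M \<longleftrightarrow>
     (\<forall>(f, n) \<in> fun_syms L. \<forall>xs \<in> tuples (points M) n. funs M f xs \<in> points M)"

datatype ('f, 'v) trm = Var 'v | Fn 'f "('f, 'v) trm list"

datatype ('f, 'r, 'v) qf =
    Eq "('f, 'v) trm" "('f, 'v) trm"
  | Rel 'r "('f, 'v) trm list"
  | Neg "('f, 'r, 'v) qf"
  | Conj "('f, 'r, 'v) qf" "('f, 'r, 'v) qf"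

fun wf_trm :: "('f, 'r) language \<Rightarrow> 'v set \<Rightarrow> ('f, 'v) trm \<Rightarrow> bool" where
  "wf_trm L V (Var x) \<longleftrightarrow> x \<in> V"
| "wf_trm L V (Fn f ts) \<longleftrightarrow> (f, length ts) \<in> fun_syms L \<and> (\<forall>t \<in> set ts. wf_trm L V t)"

fun wf_qf :: "('f, 'r) language \<Rightarrow> 'v set \<Rightarrow> ('f, 'r, 'v) qf \<Rightarrow> bool" where
  "wf_qf L V (Eq s t) \<longleftrightarrow> wf_trm L V s \<and> wf_trm L V t"
| "wf_qf L V (Rel r ts) \<longleftrightarrow> (r, length ts) \<in> rel_syms L \<and> (\<forall>t \<in> set ts. wf_trm L V t)"
| "wf_qf L V (Neg p) \<longleftrightarrow> wf_qf L V p"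
| "wf_qf L V (Conj p q) \<longleftrightarrow> wf_qf L V p \<and> wf_qf L V q"

fun eval_trm :: "('f, 'r, 'a) cl_structure \<Rightarrow> ('v \<Rightarrow> 'a) \<Rightarrow> ('f, 'v) trm \<Rightarrow> 'a" where
  "eval_trm M v (Var x) = v x"
| "eval_trm M v (Fn f ts) = funs M f (map (eval_trm M v) ts)"

fun sat :: "('f, 'r, 'a) cl_structure \<Rightarrow> ('v \<Rightarrow> 'a) \<Rightarrow> ('f, 'r, 'v) qf \<Rightarrow> bool" where
  "sat M v (Eq s t) \<longleftrightarrow> eval_trm M v s = eval_trm M v t"
| "sat M v (Rel r ts) \<longleftrightarrow> rels M r (map (eval_trm M v) ts)"
| "sat M v (Neg p) \<longleftrightarrow> \<not> sat M v p"
| "sat M v (Conj p q) \<longleftrightarrow> sat M v p \<and> sat M v q"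

text \<open>
  The quantifier-free type of a family indexed by \<open>I\<close>, of a tuple, and of a family followed by
  a tuple. Types of families with different index sets are different.
\<close>

definition qftp :: "('f, 'r) language \<Rightarrow> ('f, 'r, 'a) cl_structure \<Rightarrow> 'v set \<Rightarrow> ('v \<Rightarrow> 'a)
    \<Rightarrow> ('f, 'r, 'v) qf set" where
  "qftp L M I v = {p. wf_qf L I p \<and> sat M v p}"

definition qftp_tuple :: "('f, 'r) language \<Rightarrow> ('f, 'r, 'a) cl_structure \<Rightarrow> 'a list
    \<Rightarrow> ('f, 'r, nat) qf set" where
  "qftp_tuple L M xs = qftp L M {..<length xs} (\<lambda>i. xs ! i)"

definition qftp_fam_tuple :: "('f, 'r) language \<Rightarrow> ('f, 'r, 'a) cl_structure \<Rightarrow> 'v set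
    \<Rightarrow> ('v \<Rightarrow> 'a) \<Rightarrow> 'a list \<Rightarrow> ('f, 'r, 'v + nat) qf set" where
  "qftp_fam_tuple L M I h xs = qftp L M (I <+> {..<length xs}) (case_sum h (\<lambda>i. xs ! i))"


section \<open>Quasiminimal pregeometry structures\<close>

definition pregeometry :: "'a set \<Rightarrow> ('a set \<Rightarrow> 'a set) \<Rightarrow> bool" where
  "pregeometry X c \<longleftrightarrow>
     (\<forall>A \<subseteq> X. A \<subseteq> c A \<and> c A \<subseteq> X) \<and>
     (\<forall>A B. A \<subseteq> B \<and> B \<subseteq> X \<longrightarrow> c A \<subseteq> c B) \<and>
     (\<forall>A \<subseteq> X. c (c A) = c A) \<and>
     (\<forall>A \<subseteq> X. \<forall>x \<in> c A. \<exists>F \<subseteq> A. finite F \<and> x \<in> c F) \<and>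
     (\<forall>A \<subseteq> X. \<forall>x \<in> X. \<forall>y \<in> X. x \<in> c (insert y A) - c A \<longrightarrow> y \<in> c (insert x A))"

definition cl_independent :: "('a set \<Rightarrow> 'a set) \<Rightarrow> 'a set \<Rightarrow> bool" where
  "cl_independent c B \<longleftrightarrow> (\<forall>b \<in> B. b \<notin> c (B - {b}))"

definition infinite_dimensional :: "('f, 'r, 'a) cl_structure \<Rightarrow> bool" where
  "infinite_dimensional M \<longleftrightarrow>
     (\<exists>B \<subseteq> points M. infinite B \<and> cl_independent (cl M) B)"

definition cl_closed :: "('f, 'r, 'a) cl_structure \<Rightarrow> 'a set \<Rightarrow> bool" where
  "cl_closed M H \<longleftrightarrow> H \<subseteq> points M \<and> cl M H = H"

definition QM1 :: "('f, 'r) language \<Rightarrow> ('f, 'r, 'a) cl_structure \<Rightarrow> bool" where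
  "QM1 L M \<longleftrightarrow>
     (\<forall>a \<in> points M. \<forall>a' \<in> points M. \<forall>b \<in> lists (points M). \<forall>b' \<in> lists (points M).
        qftp_tuple L M (a # b) = qftp_tuple L M (a' # b') \<longrightarrow>
        (a \<in> cl M (set b) \<longleftrightarrow> a' \<in> cl M (set b')))"

definition QM3 :: "('f, 'r, 'a) cl_structure \<Rightarrow> bool" where
  "QM3 M \<longleftrightarrow> (\<forall>A \<subseteq> points M. finite A \<longrightarrow> countable (cl M A))"

text \<open>A countable set is enumerated by a family indexed by a set of natural numbers.\<close>

definition QM4 :: "('f, 'r) language \<Rightarrow> ('f, 'r, 'a) cl_structure \<Rightarrow> bool" where
  "QM4 L M \<longleftrightarrow>
     (\<forall>(I :: nat set) h h'.
        cl_closed M (h ` I) \<and> cl_closed M (h' ` I) \<and> qftp L M I h = qftp L M I h' \<longrightarrow>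
        (\<forall>a \<in> points M - h ` I. \<forall>a' \<in> points M - h' ` I.
           qftp_fam_tuple L M I h [a] = qftp_fam_tuple L M I h' [a']))"

definition QM5 :: "('f, 'r) language \<Rightarrow> ('f, 'r, 'a) cl_structure \<Rightarrow> bool" where
  "QM5 L M \<longleftrightarrow>
     (\<forall>(I :: nat set) h h'.
        (cl_closed M (h ` I) \<or> h ` I = {}) \<and> (cl_closed M (h' ` I) \<or> h' ` I = {}) \<and>
        qftp L M I h = qftp L M I h' \<longrightarrow>
        (\<forall>b \<in> lists (points M). \<forall>b' \<in> lists (points M).
           qftp_fam_tuple L M I h b = qftp_fam_tuple L M I h' b' \<longrightarrow>
           (\<forall>a \<in> cl M (h ` I \<union> set b). \<exists>a' \<in> points M.
              qftp_fam_tuple L M I h (b @ [a]) = qftp_fam_tuple L M I h' (b' @ [a']))))"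

definition weakly_quasiminimal :: "('f, 'r) language \<Rightarrow> ('f, 'r, 'a) cl_structure \<Rightarrow> bool" where
  "weakly_quasiminimal L M \<longleftrightarrow>
     is_structure L M \<and> pregeometry (points M) (cl M) \<and> QM1 L M \<and> QM3 M \<and> QM4 L M \<and> QM5 L M"

definition quasiminimal :: "('f, 'r) language \<Rightarrow> ('f, 'r, 'a) cl_structure \<Rightarrow> bool" where
  "quasiminimal L M \<longleftrightarrow> weakly_quasiminimal L M \<and> infinite_dimensional M"


section \<open>Quasiminimal classes\<close>

definition L_isom :: "('f, 'r) language \<Rightarrow> ('a \<Rightarrow> 'b) \<Rightarrow> ('f, 'r, 'a) cl_structure
    \<Rightarrow> ('f, 'r, 'b) cl_structure \<Rightarrow> bool" where
  "L_isom L g M N \<longleftrightarrow>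
     bij_betw g (points M) (points N) \<and>
     (\<forall>(f, n) \<in> fun_syms L. \<forall>xs \<in> tuples (points M) n. g (funs M f xs) = funs N f (map g xs)) \<and>
     (\<forall>(r, n) \<in> rel_syms L. \<forall>xs \<in> tuples (points M) n. rels M r xs \<longleftrightarrow> rels N r (map g xs))"

definition isom :: "('f, 'r) language \<Rightarrow> ('a \<Rightarrow> 'b) \<Rightarrow> ('f, 'r, 'a) cl_structure
    \<Rightarrow> ('f, 'r, 'b) cl_structure \<Rightarrow> bool" where
  "isom L g M N \<longleftrightarrow> L_isom L g M N \<and> (\<forall>A \<subseteq> points M. cl N (g ` A) = g ` cl M A)"

definition closed_substructure :: "('f, 'r) language \<Rightarrow> ('f, 'r, 'a) cl_structure \<Rightarrow> 'a set \<Rightarrow> bool" where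
  "closed_substructure L M S \<longleftrightarrow>
     cl_closed M S \<and> (\<forall>(f, n) \<in> fun_syms L. \<forall>xs \<in> tuples S n. funs M f xs \<in> S)"

abbreviation restr :: "('f, 'r, 'a) cl_structure \<Rightarrow> 'a set \<Rightarrow> ('f, 'r, 'a) cl_structure" where
  "restr M S \<equiv> M\<lparr>points := S\<rparr>"

definition closed_embedding :: "('f, 'r) language \<Rightarrow> ('a \<Rightarrow> 'b) \<Rightarrow> ('f, 'r, 'a) cl_structure
    \<Rightarrow> ('f, 'r, 'b) cl_structure \<Rightarrow> bool" where
  "closed_embedding L g M N \<longleftrightarrow>
     closed_substructure L N (g ` points M) \<and> isom L g M (restr N (g ` points M))"

text \<open>
  A chain of closed embeddings is represented, up to isomorphism, by a non-empty set of
  structures linearly ordered by closed inclusion. On the union the closure operator is the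
  finitary one extending those of the members.
\<close>

definition closed_chain :: "('f, 'r) language \<Rightarrow> ('f, 'r, 'a) cl_structure set \<Rightarrow> bool" where
  "closed_chain L Ns \<longleftrightarrow>
     Ns \<noteq> {} \<and>
     (\<forall>N \<in> Ns. \<forall>N' \<in> Ns. closed_embedding L (\<lambda>x. x) N N' \<or> closed_embedding L (\<lambda>x. x) N' N)"

definition is_chain_union :: "('f, 'r) language \<Rightarrow> ('f, 'r, 'a) cl_structure set
    \<Rightarrow> ('f, 'r, 'a) cl_structure \<Rightarrow> bool" where
  "is_chain_union L Ns U \<longleftrightarrow>
     points U = (\<Union>N \<in> Ns. points N) \<and>
     (\<forall>N \<in> Ns. closed_embedding L (\<lambda>x. x) N U) \<and>
     (\<forall>A \<subseteq> points U. cl U A = (\<Union>F \<in> {F. F \<subseteq> A \<and> finite F}. cl U F))"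

text \<open>
  \<open>\<K>(M\<^sub>0)\<close>, restricted to the structures whose points are of type \<open>'a\<close>. Every member of the
  class of size at most that of \<open>'a\<close> has an isomorphic copy there, and this copy is generated
  within the type, because the members of a chain are contained in its union.
\<close>

inductive generated_class :: "('f, 'r) language \<Rightarrow> ('f, 'r, 'b) cl_structure
    \<Rightarrow> ('f, 'r, 'a) cl_structure \<Rightarrow> bool"
  for L M\<^sub>0 where
  closed_substr: "closed_substructure L M\<^sub>0 S \<Longrightarrow> isom L g (restr M\<^sub>0 S) N
      \<Longrightarrow> generated_class L M\<^sub>0 N"
| isomorphic: "generated_class L M\<^sub>0 N \<Longrightarrow> isom L g N N' \<Longrightarrow> generated_class L M\<^sub>0 N'"
| chain_union: "(\<And>N. N \<in> Ns \<Longrightarrow> generated_class L M\<^sub>0 N) \<Longrightarrow> closed_chain L Ns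
      \<Longrightarrow> is_chain_union L Ns U \<Longrightarrow> generated_class L M\<^sub>0 U"

definition quasiminimal_class :: "('f, 'r) language \<Rightarrow> ('f, 'r, 'b) cl_structure
    \<Rightarrow> ('f, 'r, 'a) cl_structure \<Rightarrow> bool" where
  "quasiminimal_class L M\<^sub>0 N \<longleftrightarrow> generated_class L M\<^sub>0 N \<and> infinite_dimensional N"

text \<open>A model \<open>\<A> \<preccurlyeq> M\<close> is given by its set of points; \<open>\<delta>\<close> is a cardinal.\<close>

definition submodels :: "('f, 'r) language \<Rightarrow> ('f, 'r, 'b) cl_structure \<Rightarrow> 'd rel
    \<Rightarrow> ('f, 'r, 'a) cl_structure \<Rightarrow> 'a set set" where
  "submodels L M\<^sub>0 \<delta> M =
     {S. closed_substructure L M S \<and> quasiminimal_class L M\<^sub>0 (restr M S) \<and> (card_of S, \<delta>) \<in> ordLess}"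

definition automorphisms :: "('f, 'r) language \<Rightarrow> ('f, 'r, 'a) cl_structure \<Rightarrow> ('a \<Rightarrow> 'a) set" where
  "automorphisms L M = {g. L_isom L g M M}"

definition model_homogeneous :: "('f, 'r) language \<Rightarrow> ('f, 'r, 'b) cl_structure \<Rightarrow> 'd rel
    \<Rightarrow> ('f, 'r, 'a) cl_structure \<Rightarrow> bool" where
  "model_homogeneous L M\<^sub>0 \<delta> M \<longleftrightarrow>
     (\<forall>A \<in> submodels L M\<^sub>0 \<delta> M. \<forall>B \<in> submodels L M\<^sub>0 \<delta> M. \<forall>g.
        isom L g (restr M A) (restr M B) \<longrightarrow>
        (\<exists>h \<in> automorphisms L M. \<forall>x \<in> A. h x = g x))"

definition universal_model :: "('f, 'r) language \<Rightarrow> ('f, 'r, 'b) cl_structure \<Rightarrow> 'd rel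
    \<Rightarrow> ('f, 'r, 'a) cl_structure \<Rightarrow> bool" where
  "universal_model L M\<^sub>0 \<delta> M \<longleftrightarrow>
     (\<forall>N :: ('f, 'r, 'a) cl_structure.
        quasiminimal_class L M\<^sub>0 N \<and> (card_of (points N), \<delta>) \<in> ordLess \<longrightarrow>
        (\<exists>g. closed_embedding L g N M))"

text \<open>
  Largeness of \<open>\<delta>\<close> means that \<open>\<delta>\<close> exceeds the Loewenheim-Skolem number. Together with
  homogeneity and universality this forces \<open>M\<close> to have at least \<open>\<delta>\<close> points.
\<close>

definition monster_model :: "('f, 'r) language \<Rightarrow> ('f, 'r, 'b) cl_structure \<Rightarrow> 'd rel
    \<Rightarrow> ('f, 'r, 'a) cl_structure \<Rightarrow> bool" where
  "monster_model L M\<^sub>0 \<delta> M \<longleftrightarrow>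
     Card_order \<delta> \<and> (natLeq, \<delta>) \<in> ordLess \<and> quasiminimal L M \<and> quasiminimal_class L M\<^sub>0 M \<and>
     model_homogeneous L M\<^sub>0 \<delta> M \<and> universal_model L M\<^sub>0 \<delta> M"


section \<open>Types, ranks and independence\<close>

text \<open>
  Galois types, \<open>U\<close>-ranks and the independence notions only depend on the elements of the
  monster model, its automorphism group (whose members are relevant only on the elements), its
  models and the cardinal bound \<open>\<delta>\<close>. This makes them applicable to the monster model and to
  its expansions by imaginaries alike.
\<close>

record ('a, 'd) universe =
  elems :: "'a set"
  auts :: "('a \<Rightarrow> 'a) set"
  models :: "'a set set"
  bound :: "'d rel"

definition monster_universe :: "('f, 'r) language \<Rightarrow> ('f, 'r, 'b) cl_structure \<Rightarrow> 'd rel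
    \<Rightarrow> ('f, 'r, 'a) cl_structure \<Rightarrow> ('a, 'd) universe" where
  "monster_universe L M\<^sub>0 \<delta> M =
     \<lparr>elems = points M, auts = automorphisms L M, models = submodels L M\<^sub>0 \<delta> M, bound = \<delta>\<rparr>"

definition small :: "('a, 'd) universe \<Rightarrow> 'b set \<Rightarrow> bool" where
  "small X S \<longleftrightarrow> (card_of S, bound X) \<in> ordLess"

definition auts_over :: "('a, 'd) universe \<Rightarrow> 'a set \<Rightarrow> ('a \<Rightarrow> 'a) set" where
  "auts_over X A = {f \<in> auts X. \<forall>x \<in> A. f x = x}"

definition same_gtp :: "('a, 'd) universe \<Rightarrow> 'a set \<Rightarrow> 'a list \<Rightarrow> 'a list \<Rightarrow> bool" where
  "same_gtp X A a b \<longleftrightarrow> (\<exists>f \<in> auts_over X A. map f a = b)"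

definition gtp :: "('a, 'd) universe \<Rightarrow> 'a set \<Rightarrow> 'a list \<Rightarrow> 'a list set" where
  "gtp X A a = {b. same_gtp X A a b}"

definition same_tp :: "('a, 'd) universe \<Rightarrow> 'a set \<Rightarrow> 'a list \<Rightarrow> 'a list \<Rightarrow> bool" where
  "same_tp X A a b \<longleftrightarrow> (\<forall>F \<subseteq> A. finite F \<longrightarrow> same_gtp X F a b)"

definition gdefinable :: "('a, 'd) universe \<Rightarrow> 'a set \<Rightarrow> 'a list set \<Rightarrow> bool" where
  "gdefinable X A B \<longleftrightarrow> (\<forall>f \<in> auts_over X A. map f ` B = B)"

definition splits :: "('a, 'd) universe \<Rightarrow> 'a list \<Rightarrow> 'a set \<Rightarrow> 'a set \<Rightarrow> bool" where
  "splits X a B A \<longleftrightarrow>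
     (\<exists>b \<in> lists B. \<exists>c \<in> lists B. same_tp X A b c \<and> \<not> same_tp X A (a @ b) (a @ c))"

definition ns_indep :: "('a, 'd) universe \<Rightarrow> 'a list \<Rightarrow> 'a set \<Rightarrow> 'a set \<Rightarrow> bool" where
  "ns_indep X a B C \<longleftrightarrow> (\<exists>A \<subseteq> B. finite A \<and> \<not> splits X a (B \<union> C) A)"

primrec U_ge :: "('a, 'd) universe \<Rightarrow> nat \<Rightarrow> 'a list \<Rightarrow> 'a set \<Rightarrow> bool" where
  "U_ge X 0 a A \<longleftrightarrow> True"
| "U_ge X (Suc n) a A \<longleftrightarrow> (\<exists>B \<in> models X. A \<subseteq> B \<and> \<not> ns_indep X a A B \<and> U_ge X n a B)"

definition U_model :: "('a, 'd) universe \<Rightarrow> 'a list \<Rightarrow> 'a set \<Rightarrow> enat" where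
  "U_model X a A = Sup {enat n | n. U_ge X n a A}"

text \<open>The \<open>U\<close>-rank over a finite set \<open>A\<close>; a supremum of a bounded set of ranks is attained.\<close>

definition U_rank :: "('a, 'd) universe \<Rightarrow> 'a list \<Rightarrow> 'a set \<Rightarrow> enat" where
  "U_rank X a A = Sup {U_model X a B | B. B \<in> models X \<and> A \<subseteq> B}"

definition generic_in :: "('a, 'd) universe \<Rightarrow> 'a set \<Rightarrow> 'a list set \<Rightarrow> 'a list \<Rightarrow> bool" where
  "generic_in X D C a \<longleftrightarrow> a \<in> C \<and> (\<forall>b \<in> C. U_rank X b D \<le> U_rank X a D)"

definition bcl :: "('a, 'd) universe \<Rightarrow> 'a set \<Rightarrow> 'a set" where
  "bcl X A = {a \<in> elems X. small X {b \<in> elems X. same_tp X A [a] [b]}}"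

text \<open>Parameter sets are bounded; \<open>bcl\<close> is not meaningful for unbounded sets.\<close>

definition nontrivial_pregeometry :: "('a, 'd) universe \<Rightarrow> bool" where
  "nontrivial_pregeometry X \<longleftrightarrow>
     (\<exists>A \<subseteq> elems X. A \<noteq> {} \<and> small X A \<and> bcl X A \<noteq> (\<Union>a \<in> A. bcl X {a}))"

text \<open>The dimension over \<open>\<emptyset>\<close> of a finite set: the size of a largest independent subset.\<close>

definition bdim :: "('a, 'd) universe \<Rightarrow> 'a set \<Rightarrow> nat" where
  "bdim X A = Max {card B | B. B \<subseteq> A \<and> cl_independent (bcl X) B}"

definition bounded_equivs :: "('a, 'd) universe \<Rightarrow> 'a set \<Rightarrow> nat \<Rightarrow> 'a list rel set" where
  "bounded_equivs X A n =
     {E. equiv (tuples (elems X) n) E \<and>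
         (\<forall>f \<in> auts_over X A. \<forall>(x, y) \<in> E. (map f x, map f y) \<in> E) \<and>
         small X (tuples (elems X) n // E)}"

definition same_Lt :: "('a, 'd) universe \<Rightarrow> 'a set \<Rightarrow> 'a list \<Rightarrow> 'a list \<Rightarrow> bool" where
  "same_Lt X B a b \<longleftrightarrow>
     (\<forall>A \<subseteq> B. finite A \<longrightarrow> (\<forall>E \<in> bounded_equivs X A (length a). (a, b) \<in> E))"

definition Lascar_splits :: "('a, 'd) universe \<Rightarrow> 'a list \<Rightarrow> 'a set \<Rightarrow> 'a set \<Rightarrow> bool" where
  "Lascar_splits X a B A \<longleftrightarrow>
     (\<exists>b \<in> lists B. \<exists>c \<in> lists B. same_Lt X A b c \<and> \<not> same_tp X A (a @ b) (a @ c))"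

text \<open>\<open>indep X a B C\<close> is \<open>a \<down>\<^sub>B C\<close>.\<close>

definition indep :: "('a, 'd) universe \<Rightarrow> 'a list \<Rightarrow> 'a set \<Rightarrow> 'a set \<Rightarrow> bool" where
  "indep X a B C \<longleftrightarrow>
     (\<exists>A \<subseteq> B. finite A \<and>
        (\<forall>D. B \<union> C \<subseteq> D \<and> D \<subseteq> elems X \<and> small X D \<longrightarrow>
           (\<exists>b \<in> lists (elems X). same_tp X (B \<union> C) b a \<and> \<not> Lascar_splits X b D A)))"

definition indep_family :: "('a, 'd) universe \<Rightarrow> 'a set \<Rightarrow> 'i set \<Rightarrow> ('i \<Rightarrow> 'a list) \<Rightarrow> bool" where
  "indep_family X B I a \<longleftrightarrow> (\<forall>i \<in> I. indep X (a i) B (\<Union>j \<in> I - {i}. set (a j)))"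

definition indiscernible :: "('a, 'd) universe \<Rightarrow> 'a set \<Rightarrow> 'i set \<Rightarrow> ('i \<Rightarrow> 'a list) \<Rightarrow> bool" where
  "indiscernible X B I a \<longleftrightarrow>
     (\<forall>p. bij_betw p I I \<longrightarrow> (\<exists>f \<in> auts_over X B. \<forall>i \<in> I. map f (a i) = a (p i)))"


section \<open>Specializations\<close>

text \<open>A collection \<open>\<C>\<close> of subsets of the powers of the universe is a set of sets of tuples.\<close>

definition specialization :: "('a, 'd) universe \<Rightarrow> 'a list set set \<Rightarrow> 'a set \<Rightarrow> ('a \<Rightarrow> 'a) \<Rightarrow> bool" where
  "specialization X \<C> A f \<longleftrightarrow>
     A \<subseteq> elems X \<and> f ` A \<subseteq> elems X \<and> (\<forall>C \<in> \<C>. \<forall>as \<in> lists A. as \<in> C \<longrightarrow> map f as \<in> C)"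

definition special_iso :: "('a, 'd) universe \<Rightarrow> 'a list set set \<Rightarrow> 'a set \<Rightarrow> ('a \<Rightarrow> 'a) \<Rightarrow> bool" where
  "special_iso X \<C> A f \<longleftrightarrow>
     specialization X \<C> A f \<and> (\<forall>C \<in> \<C>. \<forall>as \<in> lists A. map f as \<in> C \<longrightarrow> as \<in> C)"

text \<open>Specializations between families of tuples, families of elements, and tuples.\<close>

definition spec_family :: "('a, 'd) universe \<Rightarrow> 'a list set set \<Rightarrow> 'i set \<Rightarrow> ('i \<Rightarrow> 'a list)
    \<Rightarrow> ('i \<Rightarrow> 'a list) \<Rightarrow> bool" where
  "spec_family X \<C> I a b \<longleftrightarrow>
     (\<exists>f. (\<forall>i \<in> I. map f (a i) = b i) \<and> specialization X \<C> (\<Union>i \<in> I. set (a i)) f)"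

abbreviation spec_elems :: "('a, 'd) universe \<Rightarrow> 'a list set set \<Rightarrow> 'i set \<Rightarrow> ('i \<Rightarrow> 'a)
    \<Rightarrow> ('i \<Rightarrow> 'a) \<Rightarrow> bool" where
  "spec_elems X \<C> I a b \<equiv> spec_family X \<C> I (\<lambda>i. [a i]) (\<lambda>i. [b i])"

definition spec :: "('a, 'd) universe \<Rightarrow> 'a list set set \<Rightarrow> 'a list \<Rightarrow> 'a list \<Rightarrow> bool" where
  "spec X \<C> a b \<longleftrightarrow> (\<exists>f. map f a = b \<and> specialization X \<C> (set a) f)"

definition spec_iso :: "('a, 'd) universe \<Rightarrow> 'a list set set \<Rightarrow> 'a list \<Rightarrow> 'a list \<Rightarrow> bool" where
  "spec_iso X \<C> a b \<longleftrightarrow> (\<exists>f. map f a = b \<and> special_iso X \<C> (set a) f)"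

text \<open>The rank of a specialization, in terms of the sets of entries of its two sides.\<close>

definition rk :: "('a, 'd) universe \<Rightarrow> 'a set \<Rightarrow> 'a set \<Rightarrow> int" where
  "rk X A B = int (bdim X A) - int (bdim X B)"

inductive strongly_regular :: "('a, 'd) universe \<Rightarrow> 'a list set set \<Rightarrow> 'a list \<Rightarrow> 'a list \<Rightarrow> bool"
  for X \<C> where
  iso: "spec_iso X \<C> a b \<Longrightarrow> strongly_regular X \<C> a b"
| generic: "spec X \<C> [x] [y] \<Longrightarrow> generic_in X {} (tuples (elems X) 1) [x]
     \<Longrightarrow> strongly_regular X \<C> [x] [y]"
| concat: "spec X \<C> (a @ a') (b @ b') \<Longrightarrow> indep X a {} (set a')
     \<Longrightarrow> strongly_regular X \<C> a b \<Longrightarrow> strongly_regular X \<C> a' b'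
     \<Longrightarrow> strongly_regular X \<C> (a @ a') (b @ b')"

inductive strongly_good :: "('a, 'd) universe \<Rightarrow> 'a list set set \<Rightarrow> 'a list \<Rightarrow> 'a list \<Rightarrow> bool"
  for X \<C> where
  regular: "strongly_regular X \<C> a b \<Longrightarrow> strongly_good X \<C> a b"
| extend: "spec X \<C> (a\<^sub>1 @ a\<^sub>2 @ a\<^sub>3) (b\<^sub>1 @ b\<^sub>2 @ b\<^sub>3)
     \<Longrightarrow> length a\<^sub>1 = length b\<^sub>1 \<Longrightarrow> length a\<^sub>2 = length b\<^sub>2
     \<Longrightarrow> strongly_good X \<C> (a\<^sub>1 @ a\<^sub>2) (b\<^sub>1 @ b\<^sub>2) \<Longrightarrow> spec_iso X \<C> a\<^sub>1 b\<^sub>1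
     \<Longrightarrow> set a\<^sub>3 \<subseteq> bcl X (set a\<^sub>1)
     \<Longrightarrow> strongly_good X \<C> (a\<^sub>1 @ a\<^sub>2 @ a\<^sub>3) (b\<^sub>1 @ b\<^sub>2 @ b\<^sub>3)"


section \<open>Zariski-like structures\<close>

definition ZL1 :: "('a, 'd) universe \<Rightarrow> 'a list set set \<Rightarrow> bool" where
  "ZL1 X \<C> \<longleftrightarrow> (\<forall>C \<in> \<C>. gdefinable X {} C)"

definition ZL2 :: "('a, 'd) universe \<Rightarrow> 'a list set set \<Rightarrow> bool" where
  "ZL2 X \<C> \<longleftrightarrow> (\<forall>a \<in> lists (elems X). a \<noteq> [] \<longrightarrow> (\<exists>C \<in> \<C>. generic_in X {} C a))"

definition ZL3 :: "('a, 'd) universe \<Rightarrow> 'a list set set \<Rightarrow> bool" where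
  "ZL3 X \<C> \<longleftrightarrow>
     (\<forall>C \<in> \<C>. \<forall>a b. generic_in X {} C a \<and> generic_in X {} C b \<longrightarrow> same_gtp X {} a b)"

definition ZL4 :: "('a, 'd) universe \<Rightarrow> 'a list set set \<Rightarrow> bool" where
  "ZL4 X \<C> \<longleftrightarrow> (\<forall>C \<in> \<C>. \<forall>D \<in> \<C>. \<forall>a. generic_in X {} C a \<and> a \<in> D \<longrightarrow> C \<subseteq> D)"

definition ZL5 :: "('a, 'd) universe \<Rightarrow> 'a list set set \<Rightarrow> bool" where
  "ZL5 X \<C> \<longleftrightarrow>
     (\<forall>C\<^sub>1 \<in> \<C>. \<forall>C\<^sub>2 \<in> \<C>. \<forall>a b a' b'.
        generic_in X {} C\<^sub>1 (a @ b) \<and> generic_in X {} C\<^sub>2 a \<and> a' @ b' \<in> C\<^sub>1 \<and>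
        length a' = length a \<longrightarrow> a' \<in> C\<^sub>2)"

definition ZL6 :: "('a, 'd) universe \<Rightarrow> 'a list set set \<Rightarrow> bool" where
  "ZL6 X \<C> \<longleftrightarrow>
     (\<forall>C \<in> \<C>. \<forall>n p. C \<subseteq> tuples (elems X) n \<and> bij_betw p {..<n} {..<n} \<longrightarrow>
        (\<lambda>x. map (\<lambda>i. x ! p i) [0..<n]) ` C \<in> \<C>)"

definition ZL7 :: "('a, 'd) universe \<Rightarrow> 'a list set set \<Rightarrow> bool" where
  "ZL7 X \<C> \<longleftrightarrow>
     (\<forall>a a' b b' c c'.
        strongly_good X \<C> a a' \<and> rk X (set a) (set a') \<le> 1 \<and>
        spec X \<C> (a @ b) (a' @ b') \<and> spec X \<C> (a @ c) (a' @ c') \<longrightarrow>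
        (\<exists>b\<^sub>s. indep X b\<^sub>s (set a) (set c) \<and> same_gtp X (set a) b\<^sub>s b \<and>
              spec X \<C> (a @ b\<^sub>s @ c) (a' @ b' @ c')))"

text \<open>
  The index sets in the last two conditions are subsets of the type of the elements. For the
  first of them this covers all bounded sets; for the second it covers all cardinals up to the
  size of the structure, to which larger ones reduce.
\<close>

definition ZL8 :: "('a, 'd) universe \<Rightarrow> 'a list set set \<Rightarrow> bool" where
  "ZL8 X \<C> \<longleftrightarrow>
     (\<forall>(I :: 'a set) a a' b b'.
        small X I \<and>
        (\<forall>i \<in> I. a i \<in> lists (elems X) \<and> a' i \<in> lists (elems X)) \<and>
        indep_family X (set b) I a \<and> indiscernible X (set b) I a \<and>
        indiscernible X (set b') I a' \<and>
        (\<forall>i \<in> I. spec X \<C> (a i @ b) (a' i @ b')) \<and>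
        strongly_good X \<C> b b' \<and> rk X (set b) (set b') \<le> 1 \<longrightarrow>
        spec_family X \<C> I (\<lambda>i. b @ a i) (\<lambda>i. b' @ a' i))"

text \<open>A set of finite subsets of \<open>I\<close> is unbounded if every finite subset is below a member.\<close>

definition ZL9 :: "('a, 'd) universe \<Rightarrow> 'a list set set \<Rightarrow> bool" where
  "ZL9 X \<C> \<longleftrightarrow>
     (\<forall>(I :: 'a set) i\<^sub>0 i\<^sub>1 a b S.
        i\<^sub>0 \<in> I \<and> i\<^sub>1 \<in> I \<and> a ` I \<subseteq> elems X \<and> b ` I \<subseteq> elems X \<and>
        a i\<^sub>0 \<noteq> a i\<^sub>1 \<and> b i\<^sub>0 = b i\<^sub>1 \<and> spec_elems X \<C> I a b \<and>
        S \<subseteq> {Y. Y \<subseteq> I \<and> finite Y} \<and>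
        (\<forall>F. F \<subseteq> I \<and> finite F \<longrightarrow> (\<exists>Y \<in> S. F \<subseteq> Y)) \<and>
        (\<forall>Y \<in> S. \<forall>Z \<in> S. \<exists>W \<in> S. Y \<union> Z \<subseteq> W) \<and>
        (\<forall>Y \<in> S. i\<^sub>0 \<in> Y \<and> i\<^sub>1 \<in> Y) \<and>
        (\<forall>Y \<in> S. \<forall>Z \<in> S. \<forall>c.
           Z \<subseteq> Y \<and> c ` Y \<subseteq> elems X \<and> c i\<^sub>0 = c i\<^sub>1 \<and>
           spec_elems X \<C> Y a c \<and> spec_elems X \<C> Y c b \<and> rk X (a ` Y) (c ` Y) \<le> 1 \<longrightarrow>
           rk X (a ` Z) (c ` Z) \<le> 1) \<longrightarrow>
        (\<exists>c. c ` I \<subseteq> elems X \<and> spec_elems X \<C> I a c \<and> spec_elems X \<C> I c b \<and>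
             c i\<^sub>0 = c i\<^sub>1 \<and> (\<forall>Y \<in> S. rk X (a ` Y) (c ` Y) \<le> 1)))"

definition Zariski_like :: "('a, 'd) universe \<Rightarrow> bool" where
  "Zariski_like X \<longleftrightarrow>
     (\<exists>\<C>. countable \<C> \<and> (\<forall>C \<in> \<C>. \<exists>n \<ge> 1. C \<subseteq> tuples (elems X) n) \<and>
        ZL1 X \<C> \<and> ZL2 X \<C> \<and> ZL3 X \<C> \<and> ZL4 X \<C> \<and> ZL5 X \<C> \<and>
        ZL6 X \<C> \<and> ZL7 X \<C> \<and> ZL8 X \<C> \<and> ZL9 X \<C>)"


section \<open>Imaginaries\<close>

text \<open>Equality on the universe, as an equivalence relation on 1-tuples.\<close>

definition eq_rel :: "('a, 'd) universe \<Rightarrow> 'a list rel" where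
  "eq_rel X = {([x], [x]) | x. x \<in> elems X}"

definition admissible_rel :: "('a, 'd) universe \<Rightarrow> 'a list rel \<Rightarrow> bool" where
  "admissible_rel X E \<longleftrightarrow>
     (\<exists>n \<ge> 1. equiv (tuples (elems X) n) E \<and>
        (\<forall>f \<in> auts X. \<forall>(x, y) \<in> E. (map f x, map f y) \<in> E) \<and>
        (\<exists>G. countable G \<and> G \<subseteq> gtp X {} ` tuples (elems X) (2 * n) \<and>
           (\<forall>x \<in> tuples (elems X) n. \<forall>y \<in> tuples (elems X) n.
              (x, y) \<in> E \<longleftrightarrow> gtp X {} (x @ y) \<in> G)))"

definition admissible :: "('a, 'd) universe \<Rightarrow> 'a list rel set \<Rightarrow> bool" where
  "admissible X \<E> \<longleftrightarrow> countable \<E> \<and> eq_rel X \<in> \<E> \<and> (\<forall>E \<in> \<E>. admissible_rel X E)"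

text \<open>
  The imaginary \<open>a/E\<close> is the class of \<open>a\<close>, tagged with \<open>E\<close> so that different sorts are
  disjoint. An element \<open>x\<close> is identified with \<open>x/=\<close>.
\<close>

type_synonym 'a imag = "'a list rel \<times> 'a list set"

definition imag :: "'a list rel \<Rightarrow> 'a list \<Rightarrow> 'a imag" where
  "imag E a = (E, E `` {a})"

definition real_imag :: "('a, 'd) universe \<Rightarrow> 'a \<Rightarrow> 'a imag" where
  "real_imag X x = imag (eq_rel X) [x]"

definition imags :: "('a, 'd) universe \<Rightarrow> 'a list rel set \<Rightarrow> 'a set \<Rightarrow> 'a imag set" where
  "imags X \<E> A = {imag E a | E a. E \<in> \<E> \<and> a \<in> Field E \<and> set a \<subseteq> A}"

text \<open>
  An automorphism of the expansion is a permutation which preserves the structure on the copy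
  of \<open>X\<close> (that is, induces an automorphism of \<open>X\<close> there), the predicates \<open>P\<^sub>E\<close> and the
  functions \<open>F\<^sub>E\<close>, in this order below.
\<close>

definition eq_auts :: "('a, 'd) universe \<Rightarrow> 'a list rel set \<Rightarrow> ('a imag \<Rightarrow> 'a imag) set" where
  "eq_auts X \<E> =
     {g. bij_betw g (imags X \<E> (elems X)) (imags X \<E> (elems X)) \<and>
         (\<exists>f \<in> auts X.
            (\<forall>x \<in> elems X. g (real_imag X x) = real_imag X (f x)) \<and>
            (\<forall>E \<in> \<E>. \<forall>z \<in> imags X \<E> (elems X).
               z \<in> imag E ` Field E \<longleftrightarrow> g z \<in> imag E ` Field E) \<and>
            (\<forall>E \<in> \<E>. \<forall>a \<in> Field E. g (imag E a) = imag E (map f a)))}"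

definition eq_universe :: "('a, 'd) universe \<Rightarrow> 'a list rel set \<Rightarrow> ('a imag, 'd) universe" where
  "eq_universe X \<E> =
     \<lparr>elems = imags X \<E> (elems X), auts = eq_auts X \<E>, models = imags X \<E> ` models X,
      bound = bound X\<rparr>"


section \<open>Galois definable groups\<close>

text \<open>A group all of whose data are Galois definable over the finite set \<open>D\<close>.\<close>

definition gdefinable_group :: "('a, 'd) universe \<Rightarrow> 'a set \<Rightarrow> 'a monoid \<Rightarrow> bool" where
  "gdefinable_group X D G \<longleftrightarrow>
     group G \<and> carrier G \<subseteq> elems X \<and> finite D \<and> D \<subseteq> elems X \<and>
     gdefinable X D {[x] | x. x \<in> carrier G} \<and>
     gdefinable X D {[x, y, x \<otimes>\<^bsub>G\<^esub> y] | x y. x \<in> carrier G \<and> y \<in> carrier G}"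

definition one_dimensional :: "('a, 'd) universe \<Rightarrow> 'a set \<Rightarrow> 'a monoid \<Rightarrow> bool" where
  "one_dimensional X D G \<longleftrightarrow>
     (\<exists>x. generic_in X D {[x] | x. x \<in> carrier G} [x]) \<and>
     (\<forall>x. generic_in X D {[x] | x. x \<in> carrier G} [x] \<longrightarrow> U_rank X [x] D = 1)"

end

theory Submission
  imports Defs "HOL-Library.Multiset" "HOL-Library.Countable_Set_Type"
begin

text \<open>Apply ZL8 to a two-element family, with \<open>b = b'\<close> constant and the members of the family
  exchanged: no automorphism fixing a finite set \<open>B\<close> exchanges two distinct points of the
  closure of \<open>B\<close>. This rigidity forces the geometry to be modular over any point \<open>d\<close> outside the
  closure of the empty set. Indeed, a non-modular family of curves yields a family in which two points
  determine a curve, as two points determine a line in a plane. Lines of this kind produce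
  a surface whose parameters lie in the closure of too few of its points.

  Over \<open>d\<close>, non-triviality provides lines with at least three points. A second point \<open>o\<close> is
  used to represent vectors by pairs of points on lines through \<open>o\<close>; their addition, defined by
  incidence for generic pairs only, extends to a group of formal differences. A difference is coded by a
  6-tuple of points modulo an invariant equivalence relation, hence by an imaginary. A code has rank
  at most 1 since over a model containing \<open>d, o\<close> it depends on one point only, and rank at least 1
  since it has conjugates over each finite set.\<close>

subsection \<open>Dimension of tuples\<close>

text \<open>A curve is a tuple \<open>s\<close> together with the conjugates of a pair over
  \<open>K\<close> and \<open>s\<close>, and statements about its parameter become rank computations
  for tuples over countable closed sets of infinite dimension, where types are stationary. Curves
  are many-valued; branches are matched by conjugacy over closed sets. Rigidity enters through
  exchange: two free conjugate tuples on a curve are exchanged by an automorphism fixing that curve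
  and many free copies of it, so these copies do not have the tuples in their closure. This yields
  further points of the curve from which its parameter stays free. The resulting contradiction is
  numerical: the surface has four parameters, and two of its points have rank at most six, but rank
  four over the parameters, so the parameters keep rank two over these points. A third point from
  which the parameters stay free, together with one auxiliary value, determines all of them, which
  leaves rank one. The base \<open>d, o\<close> of the group moves under automorphisms; it is
  therefore part of each code, which makes the coding relation invariant over the empty set.\<close>

lemma finite_subset_chain:
  assumes "\<And>n. A n \<subseteq> A (Suc n)" "finite F" "F \<subseteq> (\<Union>n. A n)"
  shows "\<exists>n. F \<subseteq> A n"
  using assms(2,3)
proof (induction rule: finite_induct)
  case (insert x F)
  then obtain n m where "F \<subseteq> A n" "x \<in> A m" by auto
  hence "insert x F \<subseteq> A (max n m)"
    using lift_Suc_mono_le[of A n "max n m"] lift_Suc_mono_le[of A m "max n m"] assms(1) by auto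
  thus ?case ..
qed simp

abbreviation adjoin :: "'a set \<Rightarrow> 'a list \<Rightarrow> 'a set" (infixl "+@" 65) where
  "S +@ xs \<equiv> S \<union> set xs"

text \<open>The operator is total on the type, without a carrier: elements outside the structure
  will be made loops, so no side condition on subsets has to be carried along.\<close>

locale closure_geometry =
  fixes C :: "'a set \<Rightarrow> 'a set"
  assumes ext: "A \<subseteq> C A"
    and mono: "A \<subseteq> B \<Longrightarrow> C A \<subseteq> C B"
    and idem: "C (C A) = C A"
    and fin: "x \<in> C A \<Longrightarrow> \<exists>F \<subseteq> A. finite F \<and> x \<in> C F"
    and exch: "x \<in> C (insert y A) \<Longrightarrow> x \<notin> C A \<Longrightarrow> y \<in> C (insert x A)"
begin

lemma in_C: "x \<in> A \<Longrightarrow> x \<in> C A"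
  using ext by blast

lemma C_sub: "A \<subseteq> C B \<Longrightarrow> C A \<subseteq> C B"
  using mono[of A "C B"] idem by simp

lemma C_eqI: "A \<subseteq> C B \<Longrightarrow> B \<subseteq> C A \<Longrightarrow> C A = C B"
  using C_sub by blast

lemma C_trans: "x \<in> C A \<Longrightarrow> A \<subseteq> C B \<Longrightarrow> x \<in> C B"
  using C_sub by blast

lemma C_mono_in: "x \<in> C A \<Longrightarrow> A \<subseteq> B \<Longrightarrow> x \<in> C B"
  using mono by blast

lemma C_Un_C [simp]: "C (C A \<union> B) = C (A \<union> B)" "C (B \<union> C A) = C (B \<union> A)"
proof -
  have "C A \<subseteq> C (A \<union> B)" "C A \<subseteq> C (B \<union> A)" "A \<union> B \<subseteq> C (A \<union> B)" "B \<union> A \<subseteq> C (B \<union> A)"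
    "C A \<union> B \<subseteq> C (C A \<union> B)" "B \<union> C A \<subseteq> C (B \<union> C A)" "A \<subseteq> C A"
    by (rule mono ext; blast)+
  thus "C (C A \<union> B) = C (A \<union> B)" "C (B \<union> C A) = C (B \<union> A)"
    by (intro C_eqI; blast)+
qed

lemma C_insert_C [simp]: "C (insert x (C A)) = C (insert x A)"
  using C_Un_C(2)[of "{x}" A] by simp

lemma C_insert_in: "x \<in> C A \<Longrightarrow> C (insert x A) = C A"
  using ext[of A] ext[of "insert x A"] by (intro C_eqI) auto

lemma exch_iff: "x \<notin> C A \<Longrightarrow> y \<notin> C A \<Longrightarrow> x \<in> C (insert y A) \<longleftrightarrow> y \<in> C (insert x A)"
  using exch by blast

text \<open>The rank of a tuple over \<open>S\<close>, counted greedily. Exchange makes the count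
  independent of the order of the entries (\<open>dm_comm\<close>), and it is the size of a basis of
  the tuple over \<open>S\<close> (\<open>ex_basis\<close>).\<close>

primrec dm :: "'a set \<Rightarrow> 'a list \<Rightarrow> nat" where
  "dm S [] = 0"
| "dm S (x # xs) = (if x \<in> C S then 0 else 1) + dm (insert x S) xs"

lemma dm_cong: "C S = C T \<Longrightarrow> dm S xs = dm T xs"
proof (induction xs arbitrary: S T)
  case (Cons x xs)
  have "C (insert x S) = C (insert x T)"
    using C_insert_C[of x S] C_insert_C[of x T] unfolding Cons.prems by simp
  thus ?case using Cons.IH[of "insert x S" "insert x T"] Cons.prems by simp
qed simp

lemma dm_C [simp]: "dm (C S) xs = dm S xs"
  by (rule dm_cong) (simp add: idem)

lemma dm_append: "dm S (xs @ ys) = dm S xs + dm (S +@ xs) ys"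
proof (induction xs arbitrary: S)
  case (Cons x xs)
  have "insert x S +@ xs = S +@ (x # xs)" by auto
  thus ?case using Cons by simp
qed simp

text \<open>If one of the two entries lies in \<open>C S\<close>, adjoining it changes no closure.
  If neither does, exchange says that each becomes dependent after the other or neither
  does.\<close>

lemma dm_swap: "dm S (x # y # zs) = dm S (y # x # zs)"
proof -
  have "(if x \<in> C S then 0 else 1) + (if y \<in> C (insert x S) then 0 else 1) =
    ((if y \<in> C S then 0 else 1) + (if x \<in> C (insert y S) then 0 else 1 :: nat))"
  proof (cases "x \<in> C S \<or> y \<in> C S")
    case True
    thus ?thesis
      using mono[of S "insert x S"] mono[of S "insert y S"] C_insert_in by auto
  next
    case False
    thus ?thesis using exch_iff[of x S y] by auto
  qed
  thus ?thesis by (simp add: insert_commute)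
qed

lemma dm_move: "dm S (x # xs @ ys) = dm S (xs @ x # ys)"
proof (induction xs arbitrary: S)
  case (Cons z xs)
  have "dm S (x # (z # xs) @ ys) = dm S (z # x # xs @ ys)" using dm_swap by simp
  also have "\<dots> = dm S (z # xs @ x # ys)" using Cons by simp
  finally show ?case by simp
qed simp

lemma dm_comm: "dm S (xs @ ys) = dm S (ys @ xs)"
proof (induction xs arbitrary: S)
  case (Cons x xs)
  thus ?case using dm_move by simp
qed simp

lemma dm_antimono: "S \<subseteq> C T \<Longrightarrow> dm T xs \<le> dm S xs"
proof (induction xs arbitrary: S T)
  case (Cons x xs)
  have "insert x S \<subseteq> C (insert x T)"
    using Cons.prems mono[of T "insert x T"] in_C[of x "insert x T"] by blast
  hence "dm (insert x T) xs \<le> dm (insert x S) xs" using Cons.IH by blast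
  moreover have "x \<in> C S \<Longrightarrow> x \<in> C T" using Cons.prems C_sub by blast
  ultimately show ?case by auto
qed simp

lemma dm_0_iff: "dm S xs = 0 \<longleftrightarrow> set xs \<subseteq> C S"
proof (induction xs arbitrary: S)
  case (Cons x xs)
  show ?case
  proof (cases "x \<in> C S")
    case True
    thus ?thesis using Cons[of "insert x S"] C_insert_in by simp
  qed simp
qed simp

lemma dm_zero: "set xs \<subseteq> C S \<Longrightarrow> dm S xs = 0"
  by (simp add: dm_0_iff)

lemma dm_set_cong:
  assumes "C (S +@ xs) = C (S +@ ys)"
  shows "dm S xs = dm S ys"
proof -
  have "set ys \<subseteq> C (S +@ xs)" "set xs \<subseteq> C (S +@ ys)"
    using assms ext[of "S +@ xs"] ext[of "S +@ ys"] by blast+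
  hence "dm (S +@ xs) ys = 0" "dm (S +@ ys) xs = 0"
    by (simp_all add: dm_zero)
  thus ?thesis using dm_append[of S xs ys] dm_append[of S ys xs] dm_comm[of S xs ys] by simp
qed

lemma dm_mono:
  assumes "set xs \<subseteq> C (S +@ ys)"
  shows "dm S xs \<le> dm S ys"
proof -
  have "dm (S +@ ys) xs = 0" using assms by (simp add: dm_zero)
  thus ?thesis using dm_append[of S xs ys] dm_append[of S ys xs] dm_comm[of S xs ys] by simp
qed

lemma dm_le_length: "dm S xs \<le> length xs"
proof (induction xs arbitrary: S)
  case (Cons x xs)
  show ?case using Cons[of "insert x S"] by (cases "x \<in> C S") auto
qed simp

lemma dm_single: "dm S [x] = (if x \<in> C S then 0 else 1)"
  by simp

text \<open>Additivity read in both orders. Freeness of \<open>xs\<close> from \<open>ys\<close>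
  over \<open>S\<close> is always expressed as \<open>dm (S +@ ys) xs = dm S xs\<close>, and this
  identity makes it symmetric.\<close>

lemma dm_sym: "dm S xs + dm (S +@ xs) ys = dm S ys + dm (S +@ ys) xs"
  using dm_append[of S xs ys] dm_append[of S ys xs] dm_comm[of S xs ys] by simp

lemma dm_free_sym: "dm (S +@ ys) xs = dm S xs \<longleftrightarrow> dm (S +@ xs) ys = dm S ys"
  using dm_sym[of S xs ys] by linarith

text \<open>A common element \<open>z\<close> of the two closures can be adjoined to
  \<open>ys\<close> without changing a rank, so \<open>xs\<close> is free from \<open>z\<close> over
  \<open>S\<close>. By symmetry \<open>z\<close> has the same rank over \<open>S\<close> as over
  \<open>S\<close> and \<open>xs\<close>, where it is 0.\<close>

lemma free_closure:
  assumes "dm (S +@ ys) xs = dm S xs" "z \<in> C (S +@ xs)" "z \<in> C (S +@ ys)"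
  shows "z \<in> C S"
proof -
  have "dm S (z # ys) = dm S ys"
    by (rule dm_set_cong) (use assms(3) in \<open>simp add: C_insert_in\<close>)
  moreover have "dm (S +@ xs) (z # ys) = dm (S +@ xs) ys"
    using assms(2) dm_cong[of "insert z (S +@ xs)" "S +@ xs" ys] C_insert_in by simp
  moreover have "dm (S +@ xs) ys = dm S ys" using assms(1) dm_free_sym by blast
  ultimately have "dm (S +@ xs) (z # ys) = dm S (z # ys)" by simp
  hence "dm (S +@ (z # ys)) xs = dm S xs" using dm_free_sym by blast
  moreover have "dm (insert z S) xs \<ge> dm (S +@ (z # ys)) xs"
    by (rule dm_antimono) (use ext[of "insert z (S +@ ys)"] in auto)
  moreover have "dm (insert z S) xs \<le> dm S xs"
    by (rule dm_antimono) (use ext[of "insert z S"] in auto)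
  ultimately have "dm (S +@ [z]) xs = dm S xs" by simp
  hence "dm (S +@ xs) [z] = dm S [z]" using dm_free_sym by blast
  thus ?thesis using assms(2) by (auto split: if_splits)
qed

definition indl :: "'a set \<Rightarrow> 'a list \<Rightarrow> bool" where
  "indl S xs \<longleftrightarrow> dm S xs = length xs"

lemma indl_Cons: "indl S (x # xs) \<longleftrightarrow> x \<notin> C S \<and> indl (insert x S) xs"
  using dm_le_length[of "insert x S" xs] by (auto simp: indl_def)

lemma indl_Nil [simp]: "indl S []"
  by (simp add: indl_def)

lemma indl_append: "indl S (xs @ ys) \<longleftrightarrow> indl S xs \<and> indl (S +@ xs) ys"
  using dm_le_length[of S xs] dm_le_length[of "S +@ xs" ys]
  by (auto simp: indl_def dm_append)

lemma ex_basis: "\<exists>bs. set bs \<subseteq> set xs \<and> indl S bs \<and> set xs \<subseteq> C (S +@ bs) \<and> length bs = dm S xs"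
proof (induction xs arbitrary: S)
  case (Cons x xs)
  obtain bs where bs: "set bs \<subseteq> set xs" "indl (insert x S) bs"
    "set xs \<subseteq> C (insert x S +@ bs)" "length bs = dm (insert x S) xs" using Cons by blast
  show ?case
  proof (cases "x \<in> C S")
    case True
    hence eq: "C (insert x S) = C S" by (simp add: C_insert_in)
    have "indl S bs" using bs(2) dm_cong[OF eq] by (simp add: indl_def)
    moreover have "C (insert x S +@ bs) = C (S +@ bs)" using eq C_Un_C(1) by metis
    moreover have "x \<in> C (S +@ bs)" using True mono[of S "S +@ bs"] by blast
    ultimately show ?thesis using bs True dm_cong[OF eq]
      by (intro exI[of _ bs]) auto
  next
    case False
    thus ?thesis using bs ext[of "insert x S +@ bs"]
      by (intro exI[of _ "x # bs"]) (auto simp: indl_Cons)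
  qed
qed simp

lemma indl_antimono: "indl T xs \<Longrightarrow> S \<subseteq> C T \<Longrightarrow> indl S xs"
  using dm_antimono[of S T xs] dm_le_length[of S xs] by (simp add: indl_def)

end

subsection \<open>Homogeneous geometries\<close>

abbreviation iv :: "('a \<Rightarrow> 'b) \<Rightarrow> 'b \<Rightarrow> 'a" where
  "iv f \<equiv> inv_into UNIV f"

text \<open>Elements off \<open>P\<close> are loops fixed by all automorphisms.
  \<open>generic\<close> is the uniqueness of the non-algebraic type over a countably generated
  closed set, also along an automorphism. \<open>homogeneous\<close> is a compactness property: a
  map on such a set and finitely many more points, with closed image of the set, is induced by an
  automorphism as soon as all its finite parts are.\<close>

locale homogeneous_geometry = closure_geometry C for C :: "'a set \<Rightarrow> 'a set" +
  fixes Aut :: "('a \<Rightarrow> 'a) set" and P :: "'a set"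
  assumes G_id: "id \<in> Aut"
    and G_comp: "f \<in> Aut \<Longrightarrow> g \<in> Aut \<Longrightarrow> f \<circ> g \<in> Aut"
    and G_bij: "f \<in> Aut \<Longrightarrow> bij f"
    and G_inv: "f \<in> Aut \<Longrightarrow> iv f \<in> Aut"
    and G_C: "f \<in> Aut \<Longrightarrow> f ` C A = C (f ` A)"
    and off_loop: "x \<notin> P \<Longrightarrow> x \<in> C {}"
    and off_fix: "f \<in> Aut \<Longrightarrow> x \<notin> P \<Longrightarrow> f x = x"
    and C_ctbl: "countable A \<Longrightarrow> countable (C A \<inter> P)"
    and unctbl: "countable A \<Longrightarrow> \<exists>x. x \<notin> C A"
    and generic: "countable A \<Longrightarrow> f \<in> Aut \<Longrightarrow> x \<notin> C A \<Longrightarrow> x' \<notin> C (f ` A) \<Longrightarrow>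
      \<exists>g \<in> Aut. (\<forall>y \<in> C A. g y = f y) \<and> g x = x'"
    and homogeneous: "countable A \<Longrightarrow> C (\<phi> ` C A) = \<phi> ` C A \<Longrightarrow>
      (\<And>F. finite F \<Longrightarrow> F \<subseteq> C A +@ bs \<Longrightarrow> \<exists>f \<in> Aut. \<forall>x \<in> F. f x = \<phi> x) \<Longrightarrow>
      \<exists>f \<in> Aut. \<forall>x \<in> C A +@ bs. f x = \<phi> x"
begin

definition fixg :: "'a set \<Rightarrow> ('a \<Rightarrow> 'a) set" where
  "fixg S = {g \<in> Aut. \<forall>x \<in> S. g x = x}"

definition eqv :: "'a set \<Rightarrow> 'a list \<Rightarrow> 'a list \<Rightarrow> bool" where
  "eqv S a b \<longleftrightarrow> (\<exists>g \<in> fixg S. map g a = b)"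

definition ctbl_gen :: "'a set \<Rightarrow> bool" where
  "ctbl_gen H \<longleftrightarrow> (\<exists>A. countable A \<and> H = C A)"

text \<open>A countable model, up to the loops off \<open>P\<close>; infinite dimension is phrased
  as not being covered by the closure of a finite set.\<close>

definition model :: "'a set \<Rightarrow> bool" where
  "model H \<longleftrightarrow> ctbl_gen H \<and> (\<forall>F. finite F \<longrightarrow> \<not> H \<subseteq> C F)"

lemma inv_app [simp]: "f \<in> Aut \<Longrightarrow> iv f (f x) = x" "f \<in> Aut \<Longrightarrow> f (iv f x) = x"
  using G_bij by (auto simp: bij_is_inj bij_is_surj surj_f_inv_f)

lemma G_inj: "f \<in> Aut \<Longrightarrow> f x = f y \<longleftrightarrow> x = y"
  using G_bij bij_is_inj inj_eq by metis

lemma fixgD: "g \<in> fixg S \<Longrightarrow> g \<in> Aut" "g \<in> fixg S \<Longrightarrow> x \<in> S \<Longrightarrow> g x = x"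
  by (auto simp: fixg_def)

lemma fixg_id: "id \<in> fixg S"
  using G_id by (simp add: fixg_def)

lemma fixg_comp: "f \<in> fixg S \<Longrightarrow> g \<in> fixg S \<Longrightarrow> f \<circ> g \<in> fixg S"
  using G_comp by (simp add: fixg_def)

lemma fixg_inv:
  assumes "f \<in> fixg S" shows "iv f \<in> fixg S"
proof -
  have "iv f x = x" if "x \<in> S" for x
    using assms that inv_app(1)[of f x] by (simp add: fixg_def)
  thus ?thesis using assms G_inv by (simp add: fixg_def)
qed

lemma fixg_mono: "S \<subseteq> T \<Longrightarrow> fixg T \<subseteq> fixg S"
  by (auto simp: fixg_def)

lemma fixg_image: "g \<in> fixg S \<Longrightarrow> A \<subseteq> S \<Longrightarrow> g ` A = A"
  by (force simp: fixg_def image_def)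

lemma fixg_map: "g \<in> fixg S \<Longrightarrow> set a \<subseteq> S \<Longrightarrow> map g a = a"
  by (simp add: fixg_def map_idI subset_iff)

lemma indl_C [simp]: "indl (C S) xs \<longleftrightarrow> indl S xs"
  by (simp add: indl_def)

lemma eqvI: "g \<in> fixg S \<Longrightarrow> map g a = b \<Longrightarrow> eqv S a b"
  by (auto simp: eqv_def)

lemma eqvE:
  assumes "eqv S a b" obtains g where "g \<in> fixg S" "map g a = b"
  using assms by (auto simp: eqv_def)

lemma eqv_refl: "eqv S a a"
  by (rule eqvI[OF fixg_id]) simp

lemma eqv_sym: "eqv S a b \<Longrightarrow> eqv S b a"
proof (elim eqvE)
  fix g assume g: "g \<in> fixg S" "map g a = b"
  have "map (iv g) b = a" using g fixgD(1) by (auto simp: map_idI)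
  thus "eqv S b a" using eqvI fixg_inv g(1) by blast
qed

lemma eqv_trans: "eqv S a b \<Longrightarrow> eqv S b c \<Longrightarrow> eqv S a c"
proof (elim eqvE)
  fix g h assume g: "g \<in> fixg S" "map g a = b" "h \<in> fixg S" "map h b = c"
  thus "eqv S a c" by (intro eqvI[OF fixg_comp[of h S g]]) auto
qed

lemma eqv_mono: "eqv T a b \<Longrightarrow> S \<subseteq> T \<Longrightarrow> eqv S a b"
  using fixg_mono[of S T] by (auto simp: eqv_def)

lemma eqv_length: "eqv S a b \<Longrightarrow> length a = length b"
  by (auto simp: eqv_def)

lemma eqv_appendD:
  assumes "eqv S (a @ b) (a' @ b')" "length a = length a'"
  shows "eqv S a a'" "eqv S b b'"
  using assms by (auto simp: eqv_def)

lemma eqv_param: "eqv (S +@ b) a a' \<longleftrightarrow> eqv S (b @ a) (b @ a')"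
proof -
  have "map g b = b \<longleftrightarrow> (\<forall>x \<in> set b. g x = x)" for g :: "'a \<Rightarrow> 'a"
    by (metis map_idI map_eq_conv list.map_ident)
  thus ?thesis by (auto simp: eqv_def fixg_def ball_Un)
qed

lemma G_C_mem: "f \<in> Aut \<Longrightarrow> f x \<in> C (f ` A) \<longleftrightarrow> x \<in> C A"
  using G_C[of f A] G_inj[of f] by (metis image_iff)

lemma dm_image: "f \<in> Aut \<Longrightarrow> dm (f ` S) (map f xs) = dm S xs"
proof (induction xs arbitrary: S)
  case (Cons x xs)
  thus ?case using Cons.IH[of "insert x S"] G_C_mem[of f x S] by simp
qed simp

lemma dm_fixg: "f \<in> fixg S \<Longrightarrow> dm S (map f xs) = dm S xs"
  using dm_image[of f S xs] fixgD(1) fixg_image[of f S S] by simp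

lemma dm_eqv: "eqv S a b \<Longrightarrow> dm S a = dm S b"
  using dm_fixg by (auto simp: eqv_def)

lemma fixg_C_image: "f \<in> fixg S \<Longrightarrow> f ` C (S \<union> T) = C (S \<union> f ` T)"
  using G_C[of f "S \<union> T"] fixgD(1) fixg_image[of f S S] by (simp add: image_Un)

lemma fixg_C_mem: "f \<in> fixg S \<Longrightarrow> x \<in> C (S \<union> T) \<Longrightarrow> f x \<in> C (S \<union> f ` T)"
  using fixg_C_image by blast

lemma eqv_C:
  assumes "eqv S (x # a) (y # b)"
  shows "x \<in> C (S +@ a) \<longleftrightarrow> y \<in> C (S +@ b)"
proof -
  obtain g where g: "g \<in> fixg S" "g x = y" "map g a = b" using assms by (auto simp: eqv_def)
  have "g ` (S +@ a) = S +@ b" using g fixg_image[of g S S] by auto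
  thus ?thesis using G_C_mem[of g x "S +@ a"] g fixgD(1) by simp
qed

lemma ctbl_genD: "ctbl_gen H \<Longrightarrow> C H = H"
  by (auto simp: ctbl_gen_def idem)

lemma ctbl_gen_ctbl: "ctbl_gen H \<Longrightarrow> countable (H \<inter> P)"
  using C_ctbl by (auto simp: ctbl_gen_def)

lemma ctbl_gen_C: "ctbl_gen H \<Longrightarrow> countable Z \<Longrightarrow> ctbl_gen (C (H \<union> Z))"
proof -
  assume "ctbl_gen H" "countable Z"
  then obtain A where "countable A" "H = C A" by (auto simp: ctbl_gen_def)
  hence "C (H \<union> Z) = C (A \<union> Z)" "countable (A \<union> Z)" using \<open>countable Z\<close> by auto
  thus ?thesis by (auto simp: ctbl_gen_def)
qed

lemma ctbl_gen_C0: "countable Z \<Longrightarrow> ctbl_gen (C Z)"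
  by (auto simp: ctbl_gen_def)

lemma modelD: "model H \<Longrightarrow> ctbl_gen H" "model H \<Longrightarrow> C H = H"
  by (auto simp: model_def ctbl_genD)

lemma model_C: "model H \<Longrightarrow> countable Z \<Longrightarrow> model (C (H \<union> Z))"
  using ctbl_gen_C[of H Z] ext[of "H \<union> Z"] by (fastforce simp: model_def)

lemma unctbl_gen: "ctbl_gen H \<Longrightarrow> countable Z \<Longrightarrow> \<exists>x. x \<notin> C (H \<union> Z)"
  using ctbl_gen_C[of H Z] unctbl by (auto simp: ctbl_gen_def)

lemma generic_list:
  assumes "countable A" "f \<in> Aut" "indl A xs" "indl (f ` A) ys" "length xs = length ys"
  shows "\<exists>g \<in> Aut. (\<forall>y \<in> C A. g y = f y) \<and> map g xs = ys"
  using assms(5) assms(1-4)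
proof (induction xs ys arbitrary: A f rule: list_induct2)
  case Nil
  thus ?case by auto
next
  case (Cons x xs y ys)
  have x: "x \<notin> C A" "indl (insert x A) xs" "y \<notin> C (f ` A)" "indl (insert y (f ` A)) ys"
    using Cons.prems by (auto simp: indl_Cons)
  obtain g where g: "g \<in> Aut" "\<forall>y \<in> C A. g y = f y" "g x = y"
    using generic[OF Cons.prems(1,2) x(1,3)] by auto
  have "g ` A = f ` A" using g(2) in_C[of _ A] by (intro image_cong) auto
  hence "g ` insert x A = insert y (f ` A)" using g(3) by simp
  then obtain h where h: "h \<in> Aut" "\<forall>y \<in> C (insert x A). h y = g y" "map h xs = ys"
    using Cons.IH[of "insert x A" g] x g(1) Cons.prems(1) by auto
  have "h y = f y" if "y \<in> C A" for y
    using that h(2) g(2) C_mono_in[OF that subset_insertI] by metis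
  moreover have "h x = y" using h(2) g(3) in_C[of x "insert x A"] by auto
  ultimately show ?case using h by auto
qed

lemma generic_list_fix:
  assumes "ctbl_gen H" "indl H xs" "indl H ys" "length xs = length ys"
  shows "\<exists>g \<in> fixg H. map g xs = ys"
proof -
  obtain A where A: "countable A" "H = C A" using assms by (auto simp: ctbl_gen_def)
  have "indl A xs" "indl A ys" using assms A by (auto simp: indl_def)
  then obtain g where "g \<in> Aut" "\<forall>y \<in> C A. g y = id y" "map g xs = ys"
    using generic_list[OF A(1) G_id, of xs ys] assms(4) by auto
  thus ?thesis using A by (auto simp: fixg_def)
qed

text \<open>Free extensions exist: an entry outside \<open>H\<close> is moved over \<open>H\<close>
  to a point generic over \<open>H\<close> and \<open>Z\<close>, and the remaining entries are
  treated over the closure of \<open>H\<close> and that point. Hence the induction varies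
  \<open>H\<close>.\<close>

lemma copy:
  assumes "ctbl_gen H" "countable Z"
  shows "\<exists>g \<in> fixg H. dm (H \<union> Z) (map g a) = dm H a"
  using assms(1)
proof (induction "length a" arbitrary: a H)
  case 0
  thus ?case using fixg_id by auto
next
  case (Suc n)
  then obtain x b where xb: "a = x # b" "length b = n" by (cases a) auto
  show ?case
  proof (cases "x \<in> H")
    case True
    obtain g where g: "g \<in> fixg H" "dm (H \<union> Z) (map g b) = dm H b" using Suc.hyps(1)[of b H] Suc.prems xb by blast
    have "g x = x" using g True by (auto simp: fixg_def)
    moreover have "insert x (H \<union> Z) = H \<union> Z" "insert x H = H" using True by auto
    moreover have "x \<in> C H" "x \<in> C (H \<union> Z)" using True in_C by blast+
    ultimately show ?thesis using g xb(1) by (intro bexI[of _ g]) auto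
  next
    case False
    hence xH: "x \<notin> C H" using Suc.prems ctbl_genD by blast
    obtain y where y: "y \<notin> C (H \<union> Z)" using unctbl_gen Suc.prems assms(2) by blast
    have yH: "y \<notin> C H" using y mono[of H "H \<union> Z"] by blast
    obtain g where g: "g \<in> fixg H" "g x = y"
      using generic_list_fix[OF Suc.prems, of "[x]" "[y]"] xH yH by (auto simp: indl_Cons)
    have "ctbl_gen (C (H \<union> {y}))" by (rule ctbl_gen_C[OF Suc.prems]) simp
    moreover have "n = length (map g b)" using xb by simp
    ultimately obtain h where h: "h \<in> fixg (C (H \<union> {y}))"
      "dm (C (H \<union> {y}) \<union> Z) (map h (map g b)) = dm (C (H \<union> {y})) (map g b)"
      using Suc.hyps(1)[of "map g b" "C (H \<union> {y})"] by blast
    have hH: "h \<in> fixg H" "h y = y"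
      using h(1) in_C[of _ "H \<union> {y}"] by (auto simp: fixg_def)
    have "C (C (H \<union> {y}) \<union> Z) = C (insert y (H \<union> Z))" by (simp add: Un_assoc)
    from dm_cong[OF this] have "dm (insert y (H \<union> Z)) (map h (map g b)) = dm (insert y H) (map g b)"
      using h(2) by simp
    also have "\<dots> = dm (g ` insert x H) (map g b)"
      using g fixg_image[of g H H] by simp
    also have "\<dots> = dm (insert x H) b" using dm_image g(1) fixgD(1) by blast
    finally have "dm (H \<union> Z) (map (h \<circ> g) a) = dm H a"
      using y xH g(2) hH(2) xb(1) by simp
    thus ?thesis using fixg_comp[OF hH(1) g(1)] by blast
  qed
qed

lemma copy_eqv:
  assumes "ctbl_gen H" "countable Z"
  obtains b where "eqv H a b" "dm (H \<union> Z) b = dm H a"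
  using copy[OF assms, of a] by (auto simp: eqv_def)

lemma model_indl:
  assumes "model H" "finite F"
  shows "\<exists>ds. set ds \<subseteq> H \<and> indl F ds \<and> length ds = n"
proof (induction n)
  case (Suc n)
  then obtain ds where ds: "set ds \<subseteq> H" "indl F ds" "length ds = n" by blast
  have "\<not> H \<subseteq> C (F +@ ds)" using assms by (simp add: model_def)
  then obtain x where "x \<in> H" "x \<notin> C (F +@ ds)" by blast
  thus ?case using ds by (intro exI[of _ "ds @ [x]"]) (auto simp: indl_append indl_Cons)
qed simp

text \<open>A basis \<open>c0\<close> of \<open>c\<close> over \<open>F\<close> stays independent
  over \<open>F\<close> and \<open>w\<close> because \<open>c\<close> is free from \<open>w\<close>.
  An independent tuple \<open>d0\<close> of the same length inside \<open>H\<close> also does,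
  because \<open>w\<close> is independent over \<open>H\<close>. So \<open>c0\<close> can be moved
  to \<open>d0\<close> over the closure of \<open>F\<close> and \<open>w\<close>, and the rest of
  \<open>c\<close> follows it into the closed set \<open>H\<close>.\<close>

lemma into_model:
  assumes H: "model H" and F: "finite F" "F \<subseteq> H" and w: "indl H w"
    and c: "dm (F +@ w) c = dm F c"
  shows "\<exists>g \<in> fixg (C (F +@ w)). set (map g c) \<subseteq> H"
proof -
  obtain c0 where c0: "set c0 \<subseteq> set c" "indl F c0" "set c \<subseteq> C (F +@ c0)" "length c0 = dm F c"
    using ex_basis by blast
  obtain d0 where d0: "set d0 \<subseteq> H" "indl F d0" "length d0 = length c0"
    using model_indl[OF H F(1)] by blast
  have sub: "F +@ d0 \<subseteq> C H" using F d0 modelD[OF H] by auto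
  have "indl (F +@ d0) w" using indl_antimono[OF w sub] .
  moreover have "indl F w" by (rule indl_antimono[OF w]) (use F modelD[OF H] in auto)
  ultimately have "dm (F +@ d0) w = dm F w" by (simp add: indl_def)
  hence "dm (F +@ w) d0 = dm F d0" using dm_free_sym by blast
  hence d1: "indl (F +@ w) d0" using d0 by (simp add: indl_def)
  have "set c0 \<subseteq> C (F +@ w +@ c)" using c0(1) ext[of "F +@ w +@ c"] by auto
  moreover have "set c \<subseteq> C (F +@ w +@ c0)"
    using c0(3) mono[of "F +@ c0" "F +@ w +@ c0"] by auto
  ultimately have "dm (F +@ w) c0 = dm (F +@ w) c"
    using dm_mono by (intro antisym) auto
  hence c1: "indl (F +@ w) c0" using c c0(4) by (simp add: indl_def)
  have cg: "ctbl_gen (C (F +@ w))" using F(1) by (intro ctbl_gen_C0 countable_finite) simp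
  obtain g where g: "g \<in> fixg (C (F +@ w))" "map g c0 = d0"
    using generic_list_fix[OF cg, of c0 d0] c1 d1 d0(3) unfolding indl_C by metis
  have gF: "g \<in> fixg F" using g(1) in_C[of _ "F +@ w"] by (auto simp: fixg_def)
  have "set (map g c) \<subseteq> C (F \<union> g ` set c0)"
    using fixg_C_mem[OF gF] c0(3) by auto
  also have "\<dots> \<subseteq> C H" using sub g(2) C_sub[of "F +@ d0" H] by auto
  finally show ?thesis using g(1) modelD[OF H] by auto
qed

lemma into_model0:
  assumes H: "model H" and F: "finite F" "F \<subseteq> H"
  obtains d where "eqv F c d" "set d \<subseteq> H"
proof -
  obtain g where g: "g \<in> fixg (C F)" "set (map g c) \<subseteq> H"
    using into_model[OF assms, of "[]" c] by auto
  moreover have "g \<in> fixg F" using g(1) in_C[of _ F] by (auto simp: fixg_def)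
  ultimately show ?thesis using that[of "map g c"] by (auto simp: eqv_def)
qed

end

section \<open>Back-and-forth inside countable models, and types that do not split\<close>

context homogeneous_geometry
begin

text \<open>On a finite set the union of the coherent approximations agrees with one of them, so
  \<open>homogeneous\<close> applies to it. That the approximations exhaust \<open>K\<close> on both
  sides makes the image of \<open>K\<close> closed.\<close>

lemma limit_automorphism:
  assumes K: "ctbl_gen K"
    and k: "\<And>n. k n \<in> Aut" and A: "\<And>n. A n \<subseteq> K" "\<And>n. A n \<subseteq> A (Suc n)" "\<And>n. k n ` A n \<subseteq> K"
    and agree: "\<And>n x. x \<in> A n \<Longrightarrow> k (Suc n) x = k n x"
    and cover: "K \<inter> P \<subseteq> (\<Union>n. A n)" "K \<inter> P \<subseteq> (\<Union>n. k n ` A n)"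
  shows "\<exists>f \<in> Aut. f ` K = K \<and> (\<forall>n. \<forall>x \<in> A n. f x = k n x)"
proof -
  have Amono: "A n \<subseteq> A m" if "n \<le> m" for n m
    using that A(2) lift_Suc_mono_le[of A] by blast
  have agree': "k m x = k n x" if "x \<in> A n" "n \<le> m" for n m x
    using that(2,1)
  proof (induction rule: dec_induct)
    case (step m)
    thus ?case using agree[of x m] Amono[of n m] by auto
  qed simp
  \<comment> \<open>Outside all \<open>A n\<close> the value is the argument itself; within
    \<open>K\<close> this concerns only elements off \<open>P\<close>, which every automorphism
    fixes anyway.\<close>
  define \<phi> where "\<phi> x = (if \<exists>n. x \<in> A n then k (LEAST n. x \<in> A n) x else x)" for x
  have phi: "\<phi> x = k n x" if "x \<in> A n" for x n
    using that agree'[of x "LEAST n. x \<in> A n" n] LeastI[of "\<lambda>n. x \<in> A n" n]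
      Least_le[of "\<lambda>n. x \<in> A n" n] by (auto simp: \<phi>_def)
  have off: "\<phi> x = x" if "x \<notin> P" for x
    using that off_fix k by (auto simp: \<phi>_def)
  have onto: "\<phi> ` K = K"
  proof
    show "\<phi> ` K \<subseteq> K"
    proof clarify
      fix x assume "x \<in> K"
      show "\<phi> x \<in> K"
      proof (cases "x \<in> P")
        case True
        then obtain n where "x \<in> A n" using cover \<open>x \<in> K\<close> by auto
        thus ?thesis using phi A(3)[of n] by auto
      qed (use off \<open>x \<in> K\<close> in auto)
    qed
    show "K \<subseteq> \<phi> ` K"
    proof
      fix y assume "y \<in> K"
      show "y \<in> \<phi> ` K"
      proof (cases "y \<in> P")
        case True
        then obtain n x where "x \<in> A n" "y = k n x" using cover \<open>y \<in> K\<close> by blast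
        hence "y = \<phi> x" "x \<in> K" using phi[of x n] A(1)[of n] by auto
        thus ?thesis by blast
      next
        case False
        thus ?thesis using off[of y] \<open>y \<in> K\<close> by (metis image_eqI)
      qed
    qed
  qed
  obtain B where B: "countable B" "K = C B" using K by (auto simp: ctbl_gen_def)
  have "\<exists>f \<in> Aut. \<forall>x \<in> F. f x = \<phi> x" if F: "finite F" "F \<subseteq> C B +@ []" for F
  proof -
    have "finite (F \<inter> P)" "F \<inter> P \<subseteq> (\<Union>n. A n)" using F B cover by auto
    from finite_subset_chain[OF A(2) this] obtain n where n: "F \<inter> P \<subseteq> A n" by blast
    have "k n x = \<phi> x" if "x \<in> F" for x
      using that n phi[of x n] off[of x] off_fix[OF k, of x n] by (cases "x \<in> P") auto
    thus ?thesis using k by blast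
  qed
  moreover have "C (\<phi> ` C B) = \<phi> ` C B" using onto ctbl_genD[OF K] unfolding B(2) by simp
  ultimately obtain f where f: "f \<in> Aut" "\<forall>x \<in> C B +@ []. f x = \<phi> x"
    using homogeneous[OF B(1), of \<phi> "[]"] by blast
  hence "f ` K = K" using onto B(2) by (auto simp: image_iff)
  moreover have "f x = k n x" if "x \<in> A n" for x n
    using that phi f B(2) A(1)[of n] by auto
  ultimately show ?thesis using f(1) by blast
qed

lemma model_nonempty: "model K \<Longrightarrow> K \<inter> P \<noteq> {}"
proof -
  assume "model K"
  hence "\<not> K \<subseteq> C {}" by (simp add: model_def)
  thus ?thesis using off_loop by blast
qed

text \<open>The image of an algebraic \<open>y\<close> is forced to lie in the closed set
  \<open>K\<close>. A generic \<open>y\<close> can be sent to a point of \<open>K\<close> outside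
  the closure of the finite image, because \<open>K\<close> has infinite dimension.\<close>

lemma model_forth:
  assumes "model K" "k \<in> Aut" "finite A" "A \<subseteq> K" "k ` A \<subseteq> K" "y \<in> K"
  shows "\<exists>k' \<in> Aut. (\<forall>x \<in> A. k' x = k x) \<and> k' y \<in> K"
proof (cases "y \<in> C A")
  case True
  have "k y \<in> C (k ` A)" using True G_C_mem[OF assms(2)] by blast
  hence "k y \<in> K" using C_sub[of "k ` A" K] assms(5) modelD(2)[OF assms(1)] by auto
  thus ?thesis using assms(2) by blast
next
  case False
  have "\<not> K \<subseteq> C (k ` A)" using assms(1,3) by (simp add: model_def)
  then obtain z where z: "z \<in> K" "z \<notin> C (k ` A)" by blast
  obtain g where "g \<in> Aut" "\<forall>y \<in> C A. g y = k y" "g y = z"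
    using generic[OF countable_finite[OF assms(3)] assms(2) False z(2)] by blast
  thus ?thesis using z(1) in_C[of _ A] by blast
qed

text \<open>Back-and-forth along an enumeration of the points of \<open>K\<close>; the step back is
  \<open>model_forth\<close> applied to the inverse of the current approximation.\<close>

lemma model_homogeneous_inside:
  assumes K: "model K" and f: "f \<in> Aut" and F: "finite F" "F \<subseteq> K" "f ` F \<subseteq> K"
  shows "\<exists>k \<in> Aut. (\<forall>x \<in> F. k x = f x) \<and> k ` K = K"
proof -
  define e where "e = from_nat_into (K \<inter> P)"
  have e: "range e = K \<inter> P"
    unfolding e_def using range_from_nat_into model_nonempty[OF K] ctbl_gen_ctbl modelD(1)[OF K] by metis
  define I where "I n s \<longleftrightarrow> fst s \<in> Aut \<and> finite (snd s) \<and> snd s \<subseteq> K \<and> fst s ` snd s \<subseteq> K \<and> F \<subseteq> snd s \<and>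
      (\<forall>x \<in> F. fst s x = f x)" for n :: nat and s :: "('a \<Rightarrow> 'a) \<times> 'a set"
  define Q where "Q n s t \<longleftrightarrow> snd s \<subseteq> snd t \<and> (\<forall>x \<in> snd s. fst t x = fst s x) \<and>
      e n \<in> snd t \<and> e n \<in> fst t ` snd t" for n and s t :: "('a \<Rightarrow> 'a) \<times> 'a set"
  have "\<exists>t. I (Suc n) t \<and> Q n s t" if I: "I n s" for n s
  proof -
    obtain k A where s: "s = (k, A)" by (cases s)
    have kA: "k \<in> Aut" "finite A" "A \<subseteq> K" "k ` A \<subseteq> K" "F \<subseteq> A" "\<forall>x \<in> F. k x = f x"
      using I by (auto simp: I_def s)
    have en: "e n \<in> K" using e by blast
    obtain k1 where k1: "k1 \<in> Aut" "\<forall>x \<in> A. k1 x = k x" "k1 (e n) \<in> K"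
      using model_forth[OF K kA(1-4) en] by blast
    define A1 where "A1 = insert (e n) A"
    have A1: "finite A1" "A1 \<subseteq> K" "k1 ` A1 \<subseteq> K" using kA k1 en by (auto simp: A1_def)
    have "iv k1 ` k1 ` A1 \<subseteq> K" using A1(2) k1(1) by auto
    then obtain j where j: "j \<in> Aut" "\<forall>x \<in> k1 ` A1. j x = iv k1 x" "j (e n) \<in> K"
      using model_forth[OF K G_inv[OF k1(1)], of "k1 ` A1" "e n"] A1 en by auto
    define k2 where "k2 = iv j"
    have k2: "k2 \<in> Aut" using j G_inv by (simp add: k2_def)
    have k2x: "k2 x = k1 x" if "x \<in> A1" for x
    proof -
      have "j (k1 x) = x" using that j(2) k1(1) by auto
      thus ?thesis using inv_app(1)[OF j(1), of "k1 x"] by (simp add: k2_def)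
    qed
    have k2e: "k2 (j (e n)) = e n" using j(1) by (simp add: k2_def)
    define A2 where "A2 = insert (j (e n)) A1"
    have "k2 ` A2 \<subseteq> K" using k2x k2e A1(3) en by (auto simp: A2_def)
    moreover have "k2 x = k x" if "x \<in> A" for x using that k2x[of x] k1(2) by (simp add: A1_def)
    ultimately have "I (Suc n) (k2, A2)" "Q n s (k2, A2)"
      using k2 A1 j(3) kA k2e by (auto simp: I_def Q_def A2_def A1_def s image_iff)
    thus ?thesis by blast
  qed
  moreover have "I 0 (f, F)" using f F by (simp add: I_def)
  ultimately have "\<exists>s. \<forall>n. I n (s n) \<and> Q n (s n) (s (Suc n))"
    by (intro dependent_nat_choice) blast+
  then obtain s where s: "\<And>n. I n (s n)" "\<And>n. Q n (s n) (s (Suc n))" by blast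
  have "\<exists>g \<in> Aut. g ` K = K \<and> (\<forall>n. \<forall>x \<in> snd (s n). g x = fst (s n) x)"
  proof (rule limit_automorphism)
    show "ctbl_gen K" using modelD K by blast
    have "e n \<in> snd (s (Suc n)) \<and> e n \<in> fst (s (Suc n)) ` snd (s (Suc n))" for n
      using s(2)[of n] unfolding Q_def by blast
    thus "K \<inter> P \<subseteq> (\<Union>n. snd (s n))" "K \<inter> P \<subseteq> (\<Union>n. fst (s n) ` snd (s n))"
      unfolding e[symmetric] by blast+
    show "fst (s n) \<in> Aut" "snd (s n) \<subseteq> K" "fst (s n) ` snd (s n) \<subseteq> K" for n
      using s(1)[of n] unfolding I_def by blast+
    show "snd (s n) \<subseteq> snd (s (Suc n))" for n
      using s(2)[of n] unfolding Q_def by blast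
    show "fst (s (Suc n)) x = fst (s n) x" if "x \<in> snd (s n)" for n x
      using s(2)[of n] that unfolding Q_def by blast
  qed
  then obtain g where g: "g \<in> Aut" "g ` K = K" "\<forall>n. \<forall>x \<in> snd (s n). g x = fst (s n) x" by auto
  have "F \<subseteq> snd (s 0)" "\<forall>x \<in> F. fst (s 0) x = f x" using s(1)[of 0] unfolding I_def by blast+
  hence "\<forall>x \<in> F. g x = f x" using g(3) by auto
  thus ?thesis using g(1,2) by blast
qed

lemma independent_sequence:
  assumes K: "ctbl_gen K"
  shows "\<exists>es. \<forall>n. indl K (es n) \<and> length (es n) = n \<and> set (es n) \<subseteq> set (es (Suc n))"
proof -
  define es where "es = rec_nat [] (\<lambda>_ xs. xs @ [SOME x. x \<notin> C (K +@ xs)])"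
  have es0: "es 0 = []" and esS: "es (Suc n) = es n @ [SOME x. x \<notin> C (K +@ (es n))]" for n
    by (simp_all add: es_def)
  have "indl K (es n) \<and> length (es n) = n" for n
  proof (induction n)
    case (Suc n)
    have "\<exists>x. x \<notin> C (K +@ (es n))" using unctbl_gen[OF K] by (simp add: countable_finite)
    hence "(SOME x. x \<notin> C (K +@ (es n))) \<notin> C (K +@ (es n))" by (rule someI_ex)
    thus ?case using Suc by (simp add: esS indl_append indl_Cons)
  qed (simp add: es0)
  moreover have "set (es n) \<subseteq> set (es (Suc n))" for n by (auto simp: esS)
  ultimately show ?thesis by (intro exI[of _ es]) simp
qed

lemma infinite_dim_model:
  assumes D: "countable D" and es: "\<And>n. \<exists>es. set es \<subseteq> C D \<and> indl {} es \<and> length es = n"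
  shows "model (C D)"
  unfolding model_def
proof (intro conjI allI impI)
  show "ctbl_gen (C D)" using D by (auto simp: ctbl_gen_def)
  fix F :: "'a set" assume "finite F"
  then obtain fs where fs: "set fs = F" using finite_list by blast
  obtain es where es: "set es \<subseteq> C D" "indl {} es" "length es = Suc (length fs)" using es by blast
  show "\<not> C D \<subseteq> C F"
  proof
    assume "C D \<subseteq> C F"
    hence "set es \<subseteq> C ({} +@ fs)" using es(1) fs by simp
    hence "dm {} es \<le> dm {} fs" by (rule dm_mono)
    thus False using es(2,3) dm_le_length[of "{}" fs] by (simp add: indl_def)
  qed
qed

text \<open>A basis of \<open>w\<close> over \<open>K\<close> is moved onto a segment of one fixed
  sequence independent over \<open>K\<close>. The whole tuple then lands in the closure of
  \<open>K\<close> and this sequence, which has only countably many points.\<close>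

lemma countably_many_types:
  assumes K: "ctbl_gen K"
  shows "\<exists>W. countable W \<and> (\<forall>w. set w \<subseteq> P \<longrightarrow> (\<exists>g \<in> fixg K. map g w \<in> W))"
proof -
  obtain es where es: "\<And>n. indl K (es n)" "\<And>n. length (es n) = n"
    "\<And>n. set (es n) \<subseteq> set (es (Suc n))"
    using independent_sequence[OF K] by auto
  define K' where "K' = C (K \<union> (\<Union>n. set (es n)))"
  have "ctbl_gen K'" unfolding K'_def by (rule ctbl_gen_C[OF K]) (simp add: countable_finite)
  hence "countable (lists (K' \<inter> P))" using ctbl_gen_ctbl by blast
  moreover have "\<exists>g \<in> fixg K. map g w \<in> lists (K' \<inter> P)" if w: "set w \<subseteq> P" for w
  proof -
    obtain w0 where w0: "indl K w0" "set w \<subseteq> C (K +@ w0)"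
      using ex_basis[of w K] by blast
    obtain g where g: "g \<in> fixg K" "map g w0 = es (length w0)"
      using generic_list_fix[OF K w0(1) es(1)[of "length w0"]] es(2) by auto
    have "g x \<in> K' \<inter> P" if "x \<in> set w" for x
    proof
      have "g x \<in> C (K \<union> g ` set w0)" using fixg_C_mem[OF g(1)] w0(2) that by blast
      moreover have "g ` set w0 = set (es (length w0))" using g(2) by (metis set_map)
      ultimately have "g x \<in> C (K +@ (es (length w0)))" by simp
      thus "g x \<in> K'" unfolding K'_def by (rule C_mono_in) blast
      show "g x \<in> P"
      proof (rule ccontr)
        assume "g x \<notin> P"
        hence "g (g x) = g x" using off_fix g fixgD by blast
        thus False using G_inj[OF fixgD(1)[OF g(1)]] w that \<open>g x \<notin> P\<close> by auto
      qed
    qed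
    hence "set (map g w) \<subseteq> K' \<inter> P" by auto
    thus ?thesis using g(1) by (auto simp: lists_eq_set)
  qed
  ultimately show ?thesis by blast
qed

text \<open>Otherwise one builds an automorphism of the countable model \<open>K\<close> moving the type of \<open>w\<close>
  away from each of the countably many types over \<open>K\<close>.\<close>

lemma nonsplitting_base:
  assumes K: "model K" and w: "set w \<subseteq> P"
  shows "\<exists>A. finite A \<and> A \<subseteq> K \<and>
    (\<forall>b c. set b \<subseteq> K \<longrightarrow> set c \<subseteq> K \<longrightarrow> eqv A b c \<longrightarrow> eqv A (w @ b) (w @ c))"
proof (rule ccontr)
  assume neg: "\<not> ?thesis"
  obtain W where W: "countable W" "\<And>w. set w \<subseteq> P \<Longrightarrow> \<exists>g \<in> fixg K. map g w \<in> W"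
    using countably_many_types modelD(1)[OF K] by metis
  have "W \<noteq> {}" using W(2)[of w] w by auto
  define v where "v = from_nat_into W"
  have v: "range v = W"
    unfolding v_def using range_from_nat_into \<open>W \<noteq> {}\<close> W(1) by metis
  define e where "e = from_nat_into (K \<inter> P)"
  have e: "range e = K \<inter> P"
    unfolding e_def using range_from_nat_into model_nonempty[OF K] ctbl_gen_ctbl modelD(1)[OF K] by metis
  define I where "I n s \<longleftrightarrow> fst s \<in> Aut \<and> fst s ` K = K \<and> finite (snd s) \<and> snd s \<subseteq> K"
    for n :: nat and s :: "('a \<Rightarrow> 'a) \<times> 'a set"
  define Q where "Q n s t \<longleftrightarrow> snd s \<subseteq> snd t \<and> (\<forall>x \<in> snd s. fst t x = fst s x) \<and>
      e n \<in> snd t \<and> e n \<in> fst t ` snd t \<and>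
      \<not> (\<exists>h \<in> Aut. map h (v n) = w \<and> (\<forall>x \<in> snd t. h x = fst t x))"
    for n and s t :: "('a \<Rightarrow> 'a) \<times> 'a set"
  have "\<exists>t. I (Suc n) t \<and> Q n s t" if I: "I n s" for n s
  proof -
    obtain g A where s: "s = (g, A)" by (cases s)
    have gA: "g \<in> Aut" "g ` K = K" "finite A" "A \<subseteq> K" using I by (auto simp: I_def s)
    define F where "F = g ` A"
    have F: "finite F" "F \<subseteq> K" using gA by (auto simp: F_def)
    have "\<not> (\<forall>b c. set b \<subseteq> K \<longrightarrow> set c \<subseteq> K \<longrightarrow> eqv F b c \<longrightarrow> eqv F (w @ b) (w @ c))"
      using neg F by simp
    then obtain b c where bc: "set b \<subseteq> K" "set c \<subseteq> K" "eqv F b c" "\<not> eqv F (w @ b) (w @ c)"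
      by auto
    obtain k0 where k0: "k0 \<in> fixg F" "map k0 b = c" using bc(3) by (rule eqvE)
    have k0b: "k0 ` set b = set c" using k0(2) by (metis set_map)
    have "\<exists>k \<in> Aut. (\<forall>x \<in> F +@ b. k x = k0 x) \<and> k ` K = K"
      by (rule model_homogeneous_inside[OF K fixgD(1)[OF k0(1)]])
        (use F bc k0b fixg_image[OF k0(1), of F] in \<open>auto simp: image_Un\<close>)
    then obtain k where k: "k \<in> Aut" "\<forall>x \<in> F +@ b. k x = k0 x" "k ` K = K" by blast
    have kF: "k x = x" if "x \<in> F" for x using that k(2) k0(1) by (auto simp: fixg_def)
    have kb: "map k b = c" using k(2) k0(2) by (auto intro: map_cong)
    \<comment> \<open>The two possible continuations \<open>g\<close> and \<open>k \<circ> g\<close>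
      agree on \<open>A\<close>, since \<open>k\<close> fixes its image, but send \<open>E\<close>
      to \<open>b\<close> and to \<open>c\<close> respectively.\<close>
    define E where "E = map (iv g) b"
    have gE: "map g E = b" using gA(1) by (simp add: E_def comp_def)
    have ivK: "iv g x \<in> K" if "x \<in> K" for x
    proof -
      have "x \<in> g ` K" using that gA(2) by simp
      then obtain y where "y \<in> K" "x = g y" by blast
      thus ?thesis using gA(1) by simp
    qed
    have E: "set E \<subseteq> K" using bc(1) ivK by (auto simp: E_def)
    define bad where "bad g' \<longleftrightarrow> (\<exists>h \<in> Aut. map h (v n) = w \<and> (\<forall>x \<in> A +@ E. h x = g' x))"
      for g' :: "'a \<Rightarrow> 'a"
    \<comment> \<open>If both continuations could be extended by sending \<open>v n\<close> to
      \<open>w\<close>, the quotient of the two extensions would fix \<open>F\<close> and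
      \<open>w\<close> and send \<open>b\<close> to \<open>c\<close>, against the choice of
      \<open>b\<close> and \<open>c\<close>. So one continuation omits \<open>v n\<close>.\<close>
    have "\<not> (bad g \<and> bad (k \<circ> g))"
    proof
      assume "bad g \<and> bad (k \<circ> g)"
      then obtain h0 h1 where h: "h0 \<in> Aut" "map h0 (v n) = w" "\<forall>x \<in> A +@ E. h0 x = g x"
        "h1 \<in> Aut" "map h1 (v n) = w" "\<forall>x \<in> A +@ E. h1 x = k (g x)"
        by (auto simp: bad_def)
      define h where "h = h1 \<circ> iv h0"
      have hG: "h \<in> Aut" using h G_comp G_inv by (simp add: h_def)
      have hx: "h (h0 x) = h1 x" for x using h(1) by (simp add: h_def)
      have "h x = x" if "x \<in> F" for x
      proof -
        have "x \<in> g ` A" using that by (simp add: F_def)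
        then obtain a where a: "a \<in> A" "x = g a" by blast
        hence "h (g a) = k (g a)" using hx[of a] h by auto
        thus ?thesis using a that kF by simp
      qed
      hence "h \<in> fixg F" using hG by (simp add: fixg_def)
      moreover have "map h w = w"
      proof -
        have "map h (map h0 (v n)) = map h1 (v n)" using hx by simp
        thus ?thesis using h by simp
      qed
      moreover have "map h b = c"
      proof -
        have "map h (map h0 E) = map h1 E" using hx by simp
        moreover have "map h0 E = b" using h(3) gE by (auto intro: map_cong)
        moreover have "map h1 E = map k (map g E)" using h(6) by auto
        ultimately show ?thesis using gE kb by simp
      qed
      ultimately show False using bc(4) eqvI[of h F "w @ b" "w @ c"] by simp
    qed
    then obtain g' where g': "g' = g \<or> g' = k \<circ> g" "\<not> bad g'" by blast
    have "(k \<circ> g) ` K = K" using gA(2) k(3) image_comp[of k g K] by simp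
    hence g'G: "g' \<in> Aut" "g' ` K = K" using g'(1) gA(1,2) k(1) G_comp by auto
    have g'A: "g' x = g x" if "x \<in> A" for x using g'(1) kF that by (auto simp: F_def)
    obtain y where y: "y \<in> K" "g' y = e n"
    proof -
      have "e n \<in> g' ` K" using g'G(2) e by auto
      thus ?thesis using that by auto
    qed
    define A' where "A' = insert y (insert (e n) (A +@ E))"
    have "I (Suc n) (g', A')" using g'G gA E y e by (auto simp: I_def A'_def)
    moreover have "Q n s (g', A')"
      using g'A y g'(2) by (auto simp: Q_def A'_def s bad_def image_iff)
    ultimately show ?thesis by blast
  qed
  moreover have "I 0 (id, {})" using G_id by (simp add: I_def)
  ultimately have "\<exists>s. \<forall>n. I n (s n) \<and> Q n (s n) (s (Suc n))"
    by (intro dependent_nat_choice) blast+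
  then obtain s where s: "\<And>n. I n (s n)" "\<And>n. Q n (s n) (s (Suc n))" by blast
  have "\<exists>g \<in> Aut. g ` K = K \<and> (\<forall>n. \<forall>x \<in> snd (s n). g x = fst (s n) x)"
  proof (rule limit_automorphism)
    show "ctbl_gen K" using modelD K by blast
    have "e n \<in> snd (s (Suc n)) \<and> e n \<in> fst (s (Suc n)) ` snd (s (Suc n))" for n
      using s(2)[of n] unfolding Q_def by blast
    thus "K \<inter> P \<subseteq> (\<Union>n. snd (s n))" "K \<inter> P \<subseteq> (\<Union>n. fst (s n) ` snd (s n))"
      unfolding e[symmetric] by blast+
    show "fst (s n) \<in> Aut" "snd (s n) \<subseteq> K" "fst (s n) ` snd (s n) \<subseteq> K" for n
      using s(1)[of n] unfolding I_def by blast+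
    show "snd (s n) \<subseteq> snd (s (Suc n))" for n
      using s(2)[of n] unfolding Q_def by blast
    show "fst (s (Suc n)) x = fst (s n) x" if "x \<in> snd (s n)" for n x
      using s(2)[of n] that unfolding Q_def by blast
  qed
  then obtain g where g: "g \<in> Aut" "g ` K = K" "\<And>n x. x \<in> snd (s n) \<Longrightarrow> g x = fst (s n) x" by auto
  have "set (map (iv g) w) \<subseteq> P"
  proof clarsimp
    fix x assume "x \<in> set w"
    hence "x \<in> P" using w by blast
    show "iv g x \<in> P"
    proof (rule ccontr)
      assume "iv g x \<notin> P"
      hence "g (iv g x) = iv g x" using off_fix g(1) by blast
      thus False using g(1) \<open>x \<in> P\<close> \<open>iv g x \<notin> P\<close> by simp
    qed
  qed
  \<comment> \<open>The pullback of \<open>w\<close> under the limit \<open>g\<close> is conjugate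
    over \<open>K\<close> to a listed tuple \<open>v n\<close>. Composing with \<open>g\<close>
    gives an automorphism that stage \<open>n\<close> has excluded.\<close>
  then obtain j where j: "j \<in> fixg K" "map j (map (iv g) w) \<in> W" using W(2) by blast
  then obtain n where n: "v n = map j (map (iv g) w)" using v by (metis imageE)
  define h where "h = g \<circ> iv j"
  have "h \<in> Aut" using g(1) j(1) G_comp G_inv fixgD by (simp add: h_def)
  moreover have "map h (v n) = w" using fixgD(1)[OF j(1)] g(1) by (simp add: n h_def comp_def)
  moreover have "h x = fst (s (Suc n)) x" if "x \<in> snd (s (Suc n))" for x
  proof -
    have "x \<in> K" using s(1)[of "Suc n"] that by (auto simp: I_def)
    hence "iv j x = x" using fixg_inv[OF j(1)] fixgD(2) by blast
    thus ?thesis using g(3)[OF that] by (simp add: h_def)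
  qed
  ultimately show False using s(2)[of n] by (auto simp: Q_def)
qed

end

section \<open>Bases of types, stationarity over models, and exchange of free conjugates\<close>

context homogeneous_geometry
begin

lemma fin_C_Un:
  assumes "finite T" "T \<subseteq> C (S \<union> V)"
  shows "\<exists>F \<subseteq> S. finite F \<and> T \<subseteq> C (F \<union> V)"
  using assms
proof (induction rule: finite_induct)
  case (insert x T)
  then obtain F where F: "F \<subseteq> S" "finite F" "T \<subseteq> C (F \<union> V)" by auto
  obtain G where G: "G \<subseteq> S \<union> V" "finite G" "x \<in> C G" using fin[of x "S \<union> V"] insert(4) by auto
  have "C G \<subseteq> C (F \<union> (G \<inter> S) \<union> V)" "C (F \<union> V) \<subseteq> C (F \<union> (G \<inter> S) \<union> V)"
    using G(1) by (intro mono; blast)+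
  thus ?case using F G by (intro exI[of _ "F \<union> (G \<inter> S)"]) auto
qed auto

lemma eqv_swap: "eqv S (x @ y) (x' @ y') \<Longrightarrow> length x = length x' \<Longrightarrow> eqv S (y @ x) (y' @ x')"
  by (auto simp: eqv_def)

lemma eqv_map: "g \<in> fixg S \<Longrightarrow> eqv S a (map g a)"
  by (auto simp: eqv_def)

text \<open>The glued map is \<open>h\<close> on \<open>Y\<close> and some automorphism taking
  \<open>c\<close> to \<open>d\<close> elsewhere. The hypothesis on finite sets makes both agree on
  entries of \<open>c\<close> in \<open>Y\<close> and makes each finite part of the glued map
  automorphic; the image of \<open>Y\<close> is closed because \<open>h\<close> is an
  automorphism.\<close>

lemma hom_ext:
  assumes Y: "ctbl_gen Y" and h: "h \<in> Aut"
    and F: "\<And>F. finite F \<Longrightarrow> F \<subseteq> Y \<Longrightarrow> \<exists>f \<in> Aut. (\<forall>x \<in> F. f x = h x) \<and> map f c = d"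
  shows "\<exists>f \<in> Aut. (\<forall>x \<in> Y. f x = h x) \<and> map f c = d"
proof -
  obtain A where A: "countable A" "Y = C A" using Y by (auto simp: ctbl_gen_def)
  obtain j where j: "j \<in> Aut" "map j c = d" using F[of "{}"] by auto
  define \<phi> where "\<phi> x = (if x \<in> Y then h x else j x)" for x
  have phi: "f x = \<phi> x" if "x \<in> set c" "map f c = d" "\<And>x. x \<in> F \<Longrightarrow> f x = h x" "x \<in> Y \<Longrightarrow> x \<in> F" for f x F
  proof -
    have "map f c = map j c" using that j by simp
    hence "f x = j x" using that(1) by simp
    thus ?thesis using that(3)[of x] that(4) by (auto simp: \<phi>_def)
  qed
  have im: "\<phi> ` C A = h ` C A" using A by (auto simp: \<phi>_def)
  have "C (\<phi> ` C A) = \<phi> ` C A" unfolding im G_C[OF h] by (rule idem)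
  moreover have "\<exists>f \<in> Aut. \<forall>x \<in> G. f x = \<phi> x" if G: "finite G" "G \<subseteq> C A +@ c" for G
  proof -
    obtain f where f: "f \<in> Aut" "\<forall>x \<in> G \<inter> Y. f x = h x" "map f c = d" using F[of "G \<inter> Y"] G by auto
    have "f x = \<phi> x" if "x \<in> G" for x
    proof (cases "x \<in> Y")
      case True
      thus ?thesis using f(2) that by (auto simp: \<phi>_def)
    next
      case False
      hence "x \<in> set c" using G that A by auto
      thus ?thesis using phi[of x f "{}"] f(3) False by simp
    qed
    thus ?thesis using f(1) by blast
  qed
  ultimately obtain f where f: "f \<in> Aut" "\<forall>x \<in> C A +@ c. f x = \<phi> x"
    using homogeneous[OF A(1), of \<phi> c] by blast
  have "map f c = map \<phi> c" using f(2) by simp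
  also have "\<dots> = d"
  proof -
    have "\<phi> x = j x" if x: "x \<in> set c" for x
    proof (cases "x \<in> Y")
      case True
      then obtain f where "\<forall>y \<in> {x}. f y = h y" "map f c = d" using F[of "{x}"] by auto
      thus ?thesis using phi[OF x, of f "{x}"] j x True by (metis map_eq_conv singletonD singletonI)
    qed (simp add: \<phi>_def)
    hence "map \<phi> c = map j c" by simp
    thus ?thesis using j by simp
  qed
  finally show ?thesis using f A by (intro bexI[of _ f]) (auto simp: \<phi>_def)
qed

lemma hom_eqv:
  assumes "ctbl_gen H" "\<And>F. finite F \<Longrightarrow> F \<subseteq> H \<Longrightarrow> eqv F w w'"
  shows "eqv H w w'"
proof -
  have "\<exists>f \<in> Aut. (\<forall>x \<in> F. f x = id x) \<and> map f w = w'" if "finite F" "F \<subseteq> H" for F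
    using assms(2)[OF that] by (auto simp: eqv_def fixg_def)
  then obtain f where "f \<in> Aut" "\<forall>x \<in> H. f x = id x" "map f w = w'"
    using hom_ext[OF assms(1) G_id, of w w'] by blast
  thus ?thesis by (auto simp: eqv_def fixg_def)
qed

text \<open>Non-splitting over \<open>A\<close>, stated for arbitrary parameters jointly free from
  \<open>w\<close> over \<open>A\<close> instead of parameters in a model. In this form it passes to
  conjugates of \<open>w\<close> over \<open>A\<close>.\<close>

definition base :: "'a set \<Rightarrow> 'a list \<Rightarrow> bool" where
  "base A w \<longleftrightarrow> (\<forall>b c. eqv A b c \<longrightarrow> dm (A +@ b +@ c) w = dm A w \<longrightarrow> eqv A (w @ b) (w @ c))"

lemma base_eqv:
  assumes "base A w" "eqv A w w'"
  shows "base A w'"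
  unfolding base_def
proof (intro allI impI)
  fix b c assume bc: "eqv A b c" "dm (A +@ b +@ c) w' = dm A w'"
  obtain g where g: "g \<in> fixg A" "map g w' = w" using eqvE eqv_sym[OF assms(2)] by blast
  have gG: "g \<in> Aut" using g fixgD by blast
  have "eqv A (map g b) (map g c)"
    using eqv_map[OF g(1), of b] eqv_map[OF g(1), of c] bc(1) eqv_sym eqv_trans by blast
  moreover have "dm (A +@ (map g b) +@ (map g c)) w = dm A w"
  proof -
    have "g ` (A +@ b +@ c) = A +@ (map g b) +@ (map g c)"
      using fixg_image[OF g(1), of A] by (simp add: image_Un)
    hence "dm (A +@ (map g b) +@ (map g c)) w = dm (A +@ b +@ c) w'"
      using dm_image[OF gG, of "A +@ b +@ c" w'] g(2) by simp
    moreover have "dm A w = dm A w'" using dm_eqv[OF assms(2)] by simp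
    ultimately show ?thesis using bc(2) by simp
  qed
  ultimately have "eqv A (w @ map g b) (w @ map g c)" using assms(1) by (simp add: base_def)
  moreover have "eqv A (w' @ b) (w @ map g b)" "eqv A (w' @ c) (w @ map g c)"
    using g by (auto intro!: eqvI)
  ultimately show "eqv A (w' @ b) (w' @ c)" using eqv_sym eqv_trans by blast
qed

text \<open>\<open>A0\<close> is a set over which \<open>w\<close> does not split in
  \<open>H\<close>, and \<open>A1\<close> is added so that the rank of \<open>w\<close> over
  \<open>A\<close> is already its rank over \<open>H\<close>. Parameters free from \<open>w\<close>
  are then carried into \<open>H\<close> by an automorphism fixing \<open>A\<close> and
  \<open>w\<close>, where non-splitting applies.\<close>

lemma ex_base:
  assumes H: "model H" and w: "set w \<subseteq> P"
  obtains A where "finite A" "A \<subseteq> H" "dm A w = dm H w" "base A w"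
proof -
  have CH: "C H = H" using modelD(2)[OF H] .
  obtain A0 where A0: "finite A0" "A0 \<subseteq> H"
    "\<And>b c. set b \<subseteq> H \<Longrightarrow> set c \<subseteq> H \<Longrightarrow> eqv A0 b c \<Longrightarrow> eqv A0 (w @ b) (w @ c)"
    using nonsplitting_base[OF H w] by auto
  obtain w0 where w0: "set w0 \<subseteq> set w" "indl H w0" "set w \<subseteq> C (H +@ w0)" "length w0 = dm H w"
    using ex_basis by blast
  obtain A1 where A1: "A1 \<subseteq> H" "finite A1" "set w \<subseteq> C (A1 +@ w0)"
    using fin_C_Un[OF _ w0(3)] by auto
  define A where "A = A0 \<union> A1"
  have A: "finite A" "A \<subseteq> H" using A0 A1 by (auto simp: A_def)
  have wA: "set w \<subseteq> C (A +@ w0)" using A1(3) mono[of "A1 +@ w0" "A +@ w0"] by (auto simp: A_def)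
  have "dm A w \<le> length w0" using dm_mono[OF wA] dm_le_length[of A w0] by simp
  moreover have "dm H w \<le> dm A w" using dm_antimono[of A H w] A CH by simp
  ultimately have dmA: "dm A w = dm H w" using w0(4) by simp
  have nonsplit: "eqv A (w @ b) (w @ c)" if bc: "set b \<subseteq> H" "set c \<subseteq> H" "eqv A b c" for b c
  proof -
    obtain a where a: "set a = A" using finite_list A(1) by blast
    have A0a: "A0 +@ a = A" using a by (auto simp: A_def)
    have "eqv A0 (a @ b) (a @ c)" using eqv_param[of A0 a b c] bc(3) A0a by simp
    hence "eqv A0 (w @ a @ b) (w @ a @ c)" using A0(3)[of "a @ b" "a @ c"] bc a A by simp
    hence "eqv A0 (a @ w @ b) (a @ w @ c)" by (auto simp: eqv_def)
    thus ?thesis using eqv_param[of A0 a "w @ b" "w @ c"] A0a by simp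
  qed
  have "base A w"
    unfolding base_def
  proof (intro allI impI)
    fix b c assume bc: "eqv A b c" "dm (A +@ b +@ c) w = dm A w"
    have "set w \<subseteq> C (A +@ b +@ c +@ w0)"
      using wA mono[of "A +@ w0" "A +@ b +@ c +@ w0"] by auto
    hence "dm (A +@ b +@ c) w \<le> dm (A +@ b +@ c) w0" by (rule dm_mono)
    hence i1: "indl (A +@ (b @ c)) w0"
      using bc(2) dmA w0(4) dm_le_length[of "A +@ b +@ c" w0] by (simp add: indl_def Un_assoc)
    moreover have "indl A w0" by (rule indl_antimono[OF w0(2)]) (use A CH in auto)
    ultimately have "dm (A +@ (b @ c)) w0 = dm A w0" by (simp add: indl_def)
    hence "dm (A +@ w0) (b @ c) = dm A (b @ c)" using dm_free_sym by blast
    then obtain g where g: "g \<in> fixg (C (A +@ w0))" "set (map g (b @ c)) \<subseteq> H"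
      using into_model[OF H A w0(2), of "b @ c"] by blast
    have gA: "g \<in> fixg A" using g(1) in_C[of _ "A +@ w0"] by (auto simp: fixg_def)
    have gw: "map g w = w" using fixg_map[OF g(1) wA] .
    have "eqv A (map g b) (map g c)"
      using eqv_map[OF gA, of b] eqv_map[OF gA, of c] bc(1) eqv_sym eqv_trans by blast
    hence "eqv A (w @ map g b) (w @ map g c)" using nonsplit g(2) by simp
    moreover have "eqv A (w @ b) (w @ map g b)" "eqv A (w @ c) (w @ map g c)"
      using gA gw by (auto intro!: eqvI)
    ultimately show "eqv A (w @ b) (w @ c)" using eqv_sym eqv_trans by blast
  qed
  thus ?thesis using that A dmA by blast
qed

text \<open>A finite part of \<open>H\<close> has to be compared with its preimage \<open>v\<close>
  under a map from \<open>w\<close> to \<open>w'\<close>. Each of the two is free from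
  \<open>w\<close>, but perhaps not jointly, as \<open>base\<close> requires. Both are therefore
  compared with a third conjugate \<open>u\<close>, chosen free from everything.\<close>

lemma isolated:
  assumes H: "model H" and w: "set w \<subseteq> P"
  obtains A where "finite A" "A \<subseteq> H" "\<And>w'. eqv A w w' \<Longrightarrow> dm H w' = dm H w \<Longrightarrow> eqv H w w'"
proof -
  have CH: "C H = H" using modelD(2)[OF H] .
  obtain A where A: "finite A" "A \<subseteq> H" "dm A w = dm H w" "base A w" using ex_base[OF assms] .
  have "eqv H w w'" if w': "eqv A w w'" "dm H w' = dm H w" for w'
  proof (rule hom_eqv)
    show "ctbl_gen H" using modelD(1)[OF H] .
    fix F assume F: "finite F" "F \<subseteq> H"
    obtain fl where fl: "set fl = F" using finite_list F(1) by blast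
    obtain j where j: "j \<in> fixg A" "map j w = w'" using w'(1) by (rule eqvE)
    define v where "v = map (iv j) fl"
    have jv: "map j v = fl" using j(1) fixgD by (simp add: v_def comp_def)
    have flv: "eqv A fl v" unfolding v_def by (rule eqv_map[OF fixg_inv[OF j(1)]])
    have cA: "ctbl_gen (C A)" using ctbl_gen_C0 A(1) countable_finite by blast
    have "countable (set w \<union> F +@ v)" using F(1) by (simp add: countable_finite)
    then obtain u where u: "eqv (C A) fl u" "dm (C A \<union> (set w \<union> F +@ v)) u = dm (C A) fl"
      using copy_eqv[OF cA] by blast
    have uA: "eqv A fl u" using eqv_mono[OF u(1)] in_C by blast
    have dmu: "dm (A \<union> (set w \<union> F +@ v)) u = dm A u"
    proof -
      have "dm (C A \<union> (set w \<union> F +@ v)) u = dm (A \<union> (set w \<union> F +@ v)) u"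
        by (rule dm_cong) simp
      thus ?thesis using u(2) dm_eqv[OF uA] by simp
    qed
    have free: "dm (A +@ x +@ u) w = dm A w"
      if x: "set x \<subseteq> F +@ v" "dm (A +@ x) w = dm A w" for x
    proof -
      have "dm (A +@ x) u \<le> dm A u" by (rule dm_antimono) (use ext[of "A +@ x"] in auto)
      moreover have "dm (A \<union> (set w \<union> F +@ v)) u \<le> dm (A +@ x +@ w) u"
        by (rule dm_antimono) (use x(1) ext[of "A \<union> (set w \<union> F +@ v)"] in auto)
      moreover have "dm (A +@ x +@ w) u \<le> dm (A +@ x) u"
        by (rule dm_antimono) (use ext[of "A +@ x +@ w"] in auto)
      ultimately have "dm (A +@ x +@ w) u = dm (A +@ x) u" using dmu by simp
      thus ?thesis using dm_free_sym[of "A +@ x" w u] x(2) by simp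
    qed
    have "dm (A \<union> F) w = dm A w"
      using dm_antimono[of "A \<union> F" H w] dm_antimono[of A "A \<union> F" w] A F CH ext[of "A \<union> F"] by simp
    hence "dm (A +@ fl +@ u) w = dm A w" using free[of fl] fl by simp
    hence e1: "eqv A (w @ fl) (w @ u)" using A(4) uA by (simp add: base_def)
    have dw': "dm A w' = dm A w" using dm_eqv[OF w'(1)] by simp
    have "dm (A \<union> F) w' = dm A w'"
      using dm_antimono[of "A \<union> F" H w'] dm_antimono[of A "A \<union> F" w'] A F CH ext[of "A \<union> F"] w'(2) dw' by simp
    moreover have "j ` (A +@ v) = A \<union> F"
      using fixg_image[OF j(1), of A] jv fl by (metis image_Un order_refl set_map)
    ultimately have "dm (A +@ v) w = dm A w"
      using dm_image[OF fixgD(1)[OF j(1)], of "A +@ v" w] j(2) dw' by simp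
    hence "dm (A +@ v +@ u) w = dm A w" using free[of v] by simp
    moreover have "eqv A v u" using flv uA eqv_sym eqv_trans by blast
    ultimately have e2: "eqv A (w @ v) (w @ u)" using A(4) by (simp add: base_def)
    have "eqv A (w @ v) (w' @ fl)" using j jv by (intro eqvI) auto
    hence "eqv A (w @ fl) (w' @ fl)" using e1 e2 eqv_sym eqv_trans by blast
    hence "eqv A (fl @ w) (fl @ w')" using eqv_swap[of A w fl w' fl] eqv_length[OF w'(1)] by simp
    hence "eqv (A +@ fl) w w'" using eqv_param by blast
    thus "eqv F w w'" by (rule eqv_mono) (use fl in auto)
  qed
  thus ?thesis using that A by blast
qed

text \<open>Over a finite part of \<open>H\<close>, the tuple \<open>c\<close> has a copy
  \<open>d\<close> inside \<open>H\<close>. A common base of \<open>a\<close> and \<open>a'\<close>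
  lets each of them replace \<open>c\<close> by \<open>d\<close>, and with \<open>d\<close> in place
  of \<open>c\<close> the two agree because they are conjugate over \<open>H\<close>.\<close>

lemma stationary:
  assumes H: "model H" and a: "set a \<subseteq> P" "eqv H a a'"
    and free: "dm (H +@ c) a = dm H a" "dm (H +@ c) a' = dm H a'"
  shows "eqv (H +@ c) a a'"
proof -
  have CH: "C H = H" using modelD(2)[OF H] .
  obtain A where A: "finite A" "A \<subseteq> H" "dm A a = dm H a" "base A a" using ex_base[OF H a(1)] .
  have base': "base A a'" using base_eqv[OF A(4) eqv_mono[OF a(2) A(2)]] .
  have dmA': "dm A a' = dm H a'" using A(3) dm_eqv[OF a(2)] dm_eqv[OF eqv_mono[OF a(2) A(2)]] by simp
  have "eqv H (c @ a) (c @ a')"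
  proof (rule hom_eqv)
    show "ctbl_gen H" using modelD(1)[OF H] .
    fix F assume F: "finite F" "F \<subseteq> H"
    obtain fl where fl: "set fl = F \<union> A" using finite_list F(1) A(1) by (metis finite_Un)
    have flH: "set fl \<subseteq> H" using fl F A by auto
    obtain d where d: "eqv (set fl) c d" "set d \<subseteq> H" using into_model0[OF H _ flH] by auto
    have "eqv (A +@ fl) c d" using d(1) fl by (simp add: Un_absorb1)
    hence cd: "eqv A (fl @ c) (fl @ d)" using eqv_param by blast
    have "dm (A +@ (fl @ c) +@ (fl @ d)) b = dm A b" if "dm (H +@ c) b = dm H b" "dm A b = dm H b" for b
    proof -
      have "dm (H +@ c) b \<le> dm (A +@ (fl @ c) +@ (fl @ d)) b"
        by (rule dm_antimono) (use flH d A ext[of "H +@ c"] in auto)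
      moreover have "dm (A +@ (fl @ c) +@ (fl @ d)) b \<le> dm A b"
        by (rule dm_antimono) (use ext[of "A +@ (fl @ c) +@ (fl @ d)"] in auto)
      ultimately show ?thesis using that by simp
    qed
    hence e: "eqv A (a @ fl @ c) (a @ fl @ d)" "eqv A (a' @ fl @ c) (a' @ fl @ d)"
      using A(3,4) base' dmA' free cd by (simp_all add: base_def)
    obtain g where g: "g \<in> fixg H" "map g a = a'" using a(2) by (rule eqvE)
    have "eqv H (a @ fl @ d) (a' @ fl @ d)"
      by (rule eqvI[OF g(1)]) (simp add: g(2) fixg_map[OF g(1) flH] fixg_map[OF g(1) d(2)])
    hence "eqv A (a @ fl @ d) (a' @ fl @ d)" using A(2) by (rule eqv_mono)
    hence "eqv A (a @ fl @ c) (a' @ fl @ c)" using e eqv_sym eqv_trans by blast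
    hence "eqv A (fl @ c @ a) (fl @ c @ a')" using eqv_swap[of A a "fl @ c" a' "fl @ c"] eqv_length[OF a(2)] by simp
    hence "eqv (A +@ fl) (c @ a) (c @ a')" using eqv_param by blast
    thus "eqv F (c @ a) (c @ a')" by (rule eqv_mono) (use fl in auto)
  qed
  thus ?thesis using eqv_param by blast
qed

lemma G_P: "g \<in> Aut \<Longrightarrow> g x \<in> P \<longleftrightarrow> x \<in> P"
  using off_fix[of g x] off_fix[of g "g x"] G_inj[of g "g x" x] by metis

lemma eqv_P: "eqv S a b \<Longrightarrow> set a \<subseteq> P \<Longrightarrow> set b \<subseteq> P"
  using G_P fixgD(1) by (fastforce simp: eqv_def)

text \<open>A map from \<open>a\<close> to \<open>b\<close> sends \<open>b\<close> to some
  \<open>c\<close>, and \<open>a\<close>, \<open>c\<close> are conjugate over \<open>H\<close> and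
  both free from \<open>b\<close>. By stationarity \<open>c\<close> can be moved to \<open>a\<close>
  with \<open>b\<close> fixed; the composite exchanges \<open>a\<close> and
  \<open>b\<close>.\<close>

lemma stationary_swap:
  assumes H: "model H" and a: "set a \<subseteq> P" "eqv H a b" and free: "dm (H +@ b) a = dm H a"
  shows "\<exists>g \<in> fixg H. map g a = b \<and> map g b = a"
proof -
  obtain f where f: "f \<in> fixg H" "map f a = b" using a(2) by (rule eqvE)
  define c where "c = map f b"
  have bc: "eqv H b c" unfolding c_def by (rule eqv_map[OF f(1)])
  have "f ` (H +@ b) = H +@ c" using fixg_image[OF f(1), of H] by (simp add: image_Un c_def)
  hence "dm (H +@ c) b = dm (H +@ b) a"
    using dm_image[OF fixgD(1)[OF f(1)], of "H +@ b" a] f(2) by simp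
  also have "\<dots> = dm H b" using free dm_eqv[OF a(2)] by simp
  finally have "dm (H +@ b) c = dm H c" using dm_free_sym by blast
  hence "eqv (H +@ b) a c"
    using stationary[OF H a(1), of c b] eqv_trans[OF a(2) bc] free by blast
  hence "eqv H (b @ a) (b @ c)" using eqv_param by blast
  then obtain h where h: "h \<in> fixg H" "map h b = b" "map h c = a"
    using eqv_sym[of H "b @ a" "b @ c"] eqvE[of H "b @ c" "b @ a"] by (metis append_eq_append_conv length_map map_append)
  have "map (h \<circ> f) a = b" "map (h \<circ> f) b = a" using f(2) h by (auto simp: c_def simp flip: map_map)
  thus ?thesis using fixg_comp[OF h(1) f(1)] by blast
qed

end

subsection \<open>Rigidity and lines\<close>

declare (in closure_geometry) idem [simp]

context homogeneous_geometry
begin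

lemma fixg_conj:
  assumes g: "g \<in> Aut" and h: "h \<in> fixg S"
  shows "g \<circ> h \<circ> iv g \<in> fixg (g ` S)"
proof -
  have "g (h (iv g (g x))) = g x" if "x \<in> S" for x
    using that g fixgD(2)[OF h] by simp
  moreover have "g \<circ> h \<circ> iv g \<in> Aut" using g G_comp G_inv fixgD(1)[OF h] by blast
  ultimately show ?thesis by (auto simp: fixg_def)
qed

lemma eqv_image:
  assumes "g \<in> Aut" "eqv S a b"
  shows "eqv (g ` S) (map g a) (map g b)"
proof -
  obtain h where h: "h \<in> fixg S" "map h a = b" using assms(2) by (rule eqvE)
  have "map (g \<circ> h \<circ> iv g) (map g a) = map g b"
    using h(2) assms(1) by (auto simp: comp_def)
  thus ?thesis by (rule eqvI[OF fixg_conj[OF assms(1) h(1)]])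
qed

text \<open>The list grows at the front: each new copy of \<open>s\<close> over the closure of
  \<open>K\<close> and \<open>Q\<close> is free from \<open>s\<close> and from all earlier
  copies.\<close>

primrec free_copies :: "'a set \<Rightarrow> 'a set \<Rightarrow> 'a list \<Rightarrow> 'a list list \<Rightarrow> bool" where
  "free_copies K Q s [] \<longleftrightarrow> True"
| "free_copies K Q s (t # ts) \<longleftrightarrow> free_copies K Q s ts \<and> eqv (C (K \<union> Q)) s t \<and>
     dm (K \<union> Q +@ s +@ (concat ts)) t = dm (K \<union> Q) t"

end

locale rigid_geometry = homogeneous_geometry +
  assumes no_swap: "finite B \<Longrightarrow> x \<in> C B \<Longrightarrow> y \<in> C B \<Longrightarrow> f \<in> Aut \<Longrightarrow> (\<And>b. b \<in> B \<Longrightarrow> f b = b) \<Longrightarrow>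
      f x = y \<Longrightarrow> f y = x \<Longrightarrow> x = y"
begin

text \<open>An exchange \<open>\<tau>\<close> for the shorter list preserves \<open>Q\<close> as a
  set and fixes \<open>s\<close>, so it sends the next copy \<open>t\<close> to another copy of
  \<open>s\<close> over \<open>H\<close> that is still free from \<open>s\<close> and the earlier
  copies. Stationarity over \<open>H\<close> provides a correction that moves this image back to
  \<open>t\<close> and fixes \<open>p1\<close> and \<open>p2\<close>.\<close>

lemma swap_fixing_copies:
  assumes K: "model K" and P: "set s \<subseteq> P" "set p1 \<subseteq> P"
    and p: "eqv (C (K +@ s)) p1 p2" "dm (K +@ s +@ p2) p1 = dm (K +@ s) p1"
    and ts: "free_copies K (set p1 +@ p2) s ts"
  shows "\<exists>\<tau> \<in> fixg (K +@ s +@ (concat ts)). map \<tau> p1 = p2 \<and> map \<tau> p2 = p1"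
  using ts
proof (induction ts)
  case Nil
  have M: "model (C (K +@ s))" by (rule model_C[OF K]) (simp add: countable_finite)
  have "dm (C (K +@ s) +@ p2) p1 = dm (K +@ s +@ p2) p1" by (rule dm_cong) simp
  then obtain g where g: "g \<in> fixg (C (K +@ s))" "map g p1 = p2" "map g p2 = p1"
    using stationary_swap[OF M P(2) p(1)] p(2) by auto
  hence "g \<in> fixg (K +@ s)" using in_C[of _ "K +@ s"] by (auto simp: fixg_def)
  thus ?case using g by auto
next
  case (Cons t ts)
  define Q where "Q = set p1 +@ p2"
  define H where "H = C (K \<union> Q)"
  define c where "c = s @ concat ts"
  have t: "eqv H s t" "dm (K \<union> Q +@ c) t = dm (K \<union> Q) t"
    using Cons.prems by (simp_all add: Q_def H_def c_def Un_assoc)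
  have "\<exists>\<tau> \<in> fixg (K +@ s +@ (concat ts)). map \<tau> p1 = p2 \<and> map \<tau> p2 = p1"
    using Cons by simp
  then obtain \<tau> where \<tau>: "\<tau> \<in> fixg (K +@ c)" "map \<tau> p1 = p2" "map \<tau> p2 = p1"
    by (auto simp: c_def Un_assoc)
  have \<tau>G: "\<tau> \<in> Aut" using \<tau> fixgD by blast
  have MH: "model H" unfolding H_def by (rule model_C[OF K]) (simp add: Q_def countable_finite)
  have \<tau>K: "\<tau> ` K = K" "\<tau> ` set c = set c" using fixg_image[OF \<tau>(1)] by auto
  have "\<tau> ` set p1 = set p2" "\<tau> ` set p2 = set p1" using \<tau>(2,3) by (metis set_map)+
  hence \<tau>Q: "\<tau> ` Q = Q" by (auto simp: Q_def image_Un)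
  have \<tau>H: "\<tau> ` H = H" using G_C[OF \<tau>G, of "K \<union> Q"] \<tau>K \<tau>Q by (simp add: H_def image_Un)
  have \<tau>s: "map \<tau> s = s" by (rule fixg_map[OF \<tau>(1)]) (auto simp: c_def)
  define t' where "t' = map \<tau> t"
  have "eqv H s t'" using eqv_image[OF \<tau>G t(1)] \<tau>H \<tau>s by (simp add: t'_def)
  hence tt': "eqv H t t'" using t(1) eqv_sym eqv_trans by blast
  have tP: "set t \<subseteq> P" using eqv_P[OF t(1) P(1)] .
  have ft: "dm (H +@ c) t = dm H t"
  proof -
    have "dm (H +@ c) t = dm (K \<union> Q +@ c) t" unfolding H_def by (rule dm_cong) simp
    thus ?thesis using t(2) by (simp add: H_def)
  qed
  moreover have "dm (H +@ c) t' = dm (H +@ c) t"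
    using dm_image[OF \<tau>G, of "H +@ c" t] \<tau>H \<tau>K by (simp add: t'_def image_Un)
  ultimately have "eqv (H +@ c) t t'"
    using stationary[OF MH tP tt', of c] dm_eqv[OF tt'] by simp
  then obtain \<kappa> where \<kappa>: "\<kappa> \<in> fixg (H +@ c)" "map \<kappa> t' = t" using eqvE eqv_sym by metis
  have KQ: "K \<union> Q \<subseteq> H" using ext by (simp add: H_def)
  have "map \<kappa> p1 = p1" "map \<kappa> p2 = p2" by (rule fixg_map[OF \<kappa>(1)]; use KQ in \<open>auto simp: Q_def\<close>)+
  hence sw: "map (\<kappa> \<circ> \<tau>) p1 = p2" "map (\<kappa> \<circ> \<tau>) p2 = p1" using \<tau>(2,3) by (simp_all flip: map_map)
  have "\<kappa> \<in> fixg (K +@ c)" using fixg_mono[of "K +@ c" "H +@ c"] \<kappa>(1) KQ by blast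
  hence "\<kappa> \<circ> \<tau> \<in> fixg (K +@ c)" using fixg_comp \<tau>(1) by blast
  moreover have "map (\<kappa> \<circ> \<tau>) t = t" using \<kappa>(2) by (simp add: t'_def flip: map_map)
  ultimately have "\<kappa> \<circ> \<tau> \<in> fixg (K +@ s +@ (concat (t # ts)))"
    using map_eq_conv[of "\<kappa> \<circ> \<tau>" t id] by (auto simp: fixg_def c_def)
  thus ?case using sw by blast
qed

text \<open>If the coordinate were algebraic over the fixed set, so would be its image, and a finite
  part of that set would have the two exchanged points in its closure. Rigidity makes them equal,
  and then freeness of \<open>p1\<close> from \<open>p2\<close> puts the coordinate into
  \<open>C (K +@ s)\<close>.\<close>

lemma swapped_not_in_closure:
  assumes K: "model K" and P: "set s \<subseteq> P" "set p1 \<subseteq> P"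
    and p: "eqv (C (K +@ s)) p1 p2" "dm (K +@ s +@ p2) p1 = dm (K +@ s) p1"
    and ts: "free_copies K (set p1 +@ p2) s ts"
    and i: "i < length p1" "p1 ! i \<notin> C (K +@ s)"
  shows "p1 ! i \<notin> C (K +@ s +@ (concat ts))"
proof
  define B where "B = K +@ s +@ (concat ts)"
  assume x: "p1 ! i \<in> C (K +@ s +@ (concat ts))"
  hence x: "p1 ! i \<in> C B" by (simp add: B_def)
  obtain \<tau> where \<tau>: "\<tau> \<in> fixg B" "map \<tau> p1 = p2" "map \<tau> p2 = p1"
    using swap_fixing_copies[OF assms(1-6)] by (auto simp: B_def)
  have len: "length p2 = length p1" using \<tau>(2) by auto
  have y: "\<tau> (p1 ! i) = p2 ! i" "\<tau> (p2 ! i) = p1 ! i"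
    using \<tau>(2,3) i(1) len by (metis nth_map)+
  have "p2 ! i \<in> C B" using fixg_C_mem[OF \<tau>(1), of "p1 ! i" "{}"] x y by simp
  then obtain F where F: "F \<subseteq> B" "finite F" "{p1 ! i, p2 ! i} \<subseteq> C F"
    using fin_C_Un[of "{p1 ! i, p2 ! i}" B "{}"] x by auto
  have "p1 ! i = p2 ! i"
    by (rule no_swap[of F _ _ \<tau>]) (use F y \<tau>(1) fixgD[OF \<tau>(1)] in auto)
  hence "p1 ! i \<in> set p2" using i(1) len by simp
  hence "p1 ! i \<in> C (K +@ s +@ p2)" by (intro in_C) simp
  moreover have "p1 ! i \<in> C (K +@ s +@ p1)" using i(1) by (intro in_C) simp
  ultimately have "p1 ! i \<in> C (K +@ s)" using free_closure[OF p(2)] by blast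
  thus False using i(2) by blast
qed

text \<open>Free copies of \<open>s\<close> over \<open>p1, p2\<close> are added until the dimension of \<open>p1, p2\<close> over them is
  stationary. The next copy then passes through further copies of \<open>p1\<close> from which it is free.\<close>

lemma free_incident_copy:
  assumes K: "model K" and P: "set s \<subseteq> P" "set p1 \<subseteq> P"
    and p: "eqv (C (K +@ s)) p1 p2" "dm (K +@ s +@ p2) p1 = dm (K +@ s) p1"
  shows "\<exists>q. eqv (C (K +@ s)) p1 q \<and>
    dm (K +@ p1 +@ p2 +@ q) s = dm (K +@ p1 +@ p2) s \<and>
    (\<forall>i < length p1. p1 ! i \<notin> C (K +@ s) \<longrightarrow> q ! i \<notin> C (K +@ s +@ p1 +@ p2))"
proof -
  define Q where "Q = set p1 +@ p2"
  define pp where "pp = p1 @ p2"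
  have ppQ: "set pp = Q" by (simp add: pp_def Q_def)
  define d where "d ts = dm (K +@ s +@ (concat ts)) pp" for ts
  have KQ: "ctbl_gen (C (K \<union> Q))"
    by (rule ctbl_gen_C[OF modelD(1)[OF K]]) (simp add: Q_def countable_finite)
  obtain ts where ts: "free_copies K Q s ts" "\<And>us. free_copies K Q s us \<Longrightarrow> d ts \<le> d us"
    using ex_has_least_nat[of "free_copies K Q s" "[]" d] by auto
  have "countable (set s +@ (concat ts))" by (simp add: countable_finite)
  then obtain t where t: "eqv (C (K \<union> Q)) s t"
    "dm (C (K \<union> Q) \<union> (set s +@ (concat ts))) t = dm (C (K \<union> Q)) s"
    using copy_eqv[OF KQ] by blast
  have "dm (K \<union> Q +@ s +@ (concat ts)) t = dm (C (K \<union> Q) \<union> (set s +@ (concat ts))) t"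
    by (rule dm_cong) (simp add: Un_assoc)
  moreover have "dm (K \<union> Q) t = dm (K \<union> Q) s" using dm_eqv[OF t(1)] by simp
  ultimately have tts: "free_copies K Q s (t # ts)" using ts(1) t by simp
  define B where "B = K +@ s +@ (concat ts)"
  have "dm (B +@ t) pp \<le> dm B pp" by (rule dm_antimono) (use ext[of "B +@ t"] in auto)
  moreover have "d ts \<le> d (t # ts)" using ts(2) tts by blast
  moreover have "d (t # ts) = dm (B +@ t) pp" by (simp add: d_def B_def Un_ac)
  ultimately have stable: "dm (B +@ t) pp = dm B pp" by (simp add: d_def B_def)
  have BtG: "ctbl_gen (C (B +@ t))"
  proof -
    have "B +@ t = K \<union> (set s +@ (concat ts) +@ t)" by (auto simp: B_def)
    thus ?thesis using ctbl_gen_C[OF modelD(1)[OF K]] by (simp add: countable_finite)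
  qed
  have "countable Q" by (simp add: Q_def countable_finite)
  then obtain pp' where pp': "eqv (C (B +@ t)) pp pp'"
    "dm (C (B +@ t) \<union> Q) pp' = dm (C (B +@ t)) pp"
    using copy_eqv[OF BtG] by blast
  have f1: "dm (B +@ t \<union> Q) pp' = dm (B +@ t) pp'"
  proof -
    have "dm (C (B +@ t) \<union> Q) pp' = dm (B +@ t \<union> Q) pp'" by (rule dm_cong) simp
    thus ?thesis using pp'(2) dm_eqv[OF pp'(1)] by simp
  qed
  have BsubC: "B \<subseteq> C (B +@ t)" "K +@ t \<subseteq> C (B +@ t)" using ext[of "B +@ t"] by (auto simp: B_def)
  have "dm B pp' = dm B pp" using dm_eqv[OF eqv_mono[OF pp'(1) BsubC(1)]] by simp
  moreover have "dm (B +@ t) pp' = dm (B +@ t) pp" using dm_eqv[OF pp'(1)] by simp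
  moreover have "dm (B \<union> Q) pp' \<le> dm B pp'" by (rule dm_antimono) (use ext[of "B \<union> Q"] in auto)
  moreover have "dm (B +@ t \<union> Q) pp' \<le> dm (B \<union> Q) pp'"
    by (rule dm_antimono) (use ext[of "B +@ t \<union> Q"] in auto)
  \<comment> \<open>By minimality of the list, \<open>t\<close> does not lower the rank of
    \<open>pp\<close> over \<open>B\<close>, nor that of its conjugate \<open>pp'\<close>. As
    \<open>pp'\<close> is also free from \<open>Q\<close> over \<open>B\<close> and
    \<open>t\<close>, its ranks over \<open>B\<close>, over \<open>B\<close> with \<open>Q\<close>,
    and over all three coincide.\<close>
  ultimately have "dm (B \<union> Q +@ t) pp' = dm (B \<union> Q) pp'"
    using f1 stable by (simp add: Un_ac)
  hence "dm (B \<union> Q +@ pp') t = dm (B \<union> Q) t" using dm_free_sym by blast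
  moreover have "B \<union> Q = K \<union> Q +@ s +@ (concat ts)" by (auto simp: B_def)
  ultimately have f2: "dm (B \<union> Q +@ pp') t = dm (K \<union> Q) t" using tts by simp
  have "length pp' = length pp" using eqv_length[OF pp'(1)] by simp
  then obtain p1' p2' where p': "pp' = p1' @ p2'" "length p1' = length p1"
    by (metis append_take_drop_id length_append length_take le_add1 min.absorb2 pp_def)
  have e1: "eqv (C (B +@ t)) p1 p1'" using eqv_appendD(1) pp'(1) p' by (simp add: pp_def)
  have "dm (B \<union> Q +@ pp') t \<le> dm (K \<union> Q +@ p1') t"
    by (rule dm_antimono) (use ext[of "B \<union> Q +@ pp'"] p' in \<open>auto simp: B_def\<close>)
  moreover have "dm (K \<union> Q +@ p1') t \<le> dm (K \<union> Q) t"
    by (rule dm_antimono) (use ext[of "K \<union> Q +@ p1'"] in auto)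
  ultimately have f3: "dm (K \<union> Q +@ p1') t = dm (K \<union> Q) t" using f2 by simp
  \<comment> \<open>Since \<open>pp'\<close> is free from \<open>pp\<close> over \<open>B\<close>
    and \<open>t\<close>, such a membership would descend to \<open>C (B +@ t)\<close> and then hold
    for the conjugate coordinate of \<open>p1\<close>, which is excluded by the previous lemma for
    the list extended by \<open>t\<close>.\<close>
  have comp: "p1' ! i \<notin> C (K +@ t \<union> Q)" if i: "i < length p1" "p1 ! i \<notin> C (K +@ s)" for i
  proof
    assume "p1' ! i \<in> C (K +@ t \<union> Q)"
    hence x: "p1' ! i \<in> C (B +@ t +@ pp)"
      using C_mono_in[of _ "K +@ t \<union> Q" "B +@ t +@ pp"] ppQ by (auto simp: B_def)
    have "dm (B +@ t +@ pp) pp' = dm (B +@ t) pp'" using f1 ppQ by simp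
    moreover have "p1' ! i \<in> C (B +@ t +@ pp')" using i(1) p' by (intro in_C) auto
    ultimately have "p1' ! i \<in> C (B +@ t)" using free_closure x by blast
    moreover have "eqv (B +@ t) [p1 ! i] [p1' ! i]"
      using e1 i(1) p'(2) eqv_mono[OF _ ext] by (auto simp: eqv_def fixg_def subset_iff in_C)
    ultimately have "p1 ! i \<in> C (B +@ t)" using eqv_C[of "B +@ t" "p1 ! i" "[]" "p1' ! i" "[]"] by simp
    hence "p1 ! i \<in> C (K +@ s +@ (concat (t # ts)))" by (simp add: B_def Un_ac)
    moreover have "free_copies K (set p1 +@ p2) s (t # ts)" using tts by (simp add: Q_def)
    ultimately show False using swapped_not_in_closure[OF assms] i by blast
  qed
  \<comment> \<open>Moving the copy \<open>t\<close> back to \<open>s\<close> while fixing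
    \<open>K\<close>, \<open>p1\<close> and \<open>p2\<close> turns the new point \<open>p1'\<close>
    incident with \<open>t\<close> into a point \<open>q\<close> incident with
    \<open>s\<close>.\<close>
  obtain g where g: "g \<in> fixg (C (K \<union> Q))" "map g t = s" using eqvE eqv_sym[OF t(1)] by blast
  have gG: "g \<in> Aut" using fixgD g by blast
  have gx: "g x = x" if "x \<in> K \<union> Q" for x using fixgD(2)[OF g(1)] in_C[OF that] by blast
  have gK: "g ` K = K" "g ` Q = Q" using gx by force+
  have gt: "g ` set t = set s" using g(2) by (metis set_map)
  define q where "q = map g p1'"
  have "eqv (C (K +@ t)) p1 p1'"
    by (rule eqv_mono[OF e1]) (use BsubC in \<open>simp add: C_sub\<close>)
  hence "eqv (g ` C (K +@ t)) (map g p1) q" unfolding q_def by (rule eqv_image[OF gG])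
  moreover have "map g p1 = p1" using gx by (simp add: map_idI Q_def)
  ultimately have 1: "eqv (C (K +@ s)) p1 q" using G_C[OF gG] gK gt by (simp add: image_Un)
  have "dm (g ` (K \<union> Q +@ p1')) (map g t) = dm (K \<union> Q +@ p1') t" by (rule dm_image[OF gG])
  moreover have "dm (g ` (K \<union> Q)) (map g t) = dm (K \<union> Q) t" by (rule dm_image[OF gG])
  moreover have "g ` (K \<union> Q +@ p1') = K \<union> Q +@ q" using gK by (simp add: image_Un q_def)
  ultimately have 2: "dm (K \<union> Q +@ q) s = dm (K \<union> Q) s" using f3 g(2) gK by (simp add: image_Un)
  have 3: "q ! i \<notin> C (K +@ s \<union> Q)" if "i < length p1" "p1 ! i \<notin> C (K +@ s)" for i
  proof -
    have "g (p1' ! i) \<notin> C (g ` (K +@ t \<union> Q))" using comp[OF that] G_C_mem[OF gG] by blast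
    thus ?thesis using gK gt that(1) p'(2) by (simp add: image_Un q_def)
  qed
  show ?thesis using 1 2 3 by (intro exI[of _ q]) (auto simp: Q_def Un_assoc)
qed

lemma third_point_aux:
  assumes K: "model K" and s: "set s \<subseteq> P" and x: "x \<notin> C (K +@ s)" and y: "y \<in> C (K +@ s \<union> {x})"
    and e: "eqv (C (K +@ s)) [x, y] [x', y']"
  shows "y' \<in> C (K +@ s \<union> {x'})" "x' \<notin> C (K +@ s)"
proof -
  have e': "eqv (K +@ s) [x, y] [x', y']" using eqv_mono[OF e] ext by blast
  have "eqv (K +@ s) [y, x] [y', x']" using eqv_swap[of _ "[x]" "[y]" "[x']" "[y']"] e' by simp
  thus "y' \<in> C (K +@ s \<union> {x'})" using eqv_C[of "K +@ s" y "[x]" y' "[x']"] y by simp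
  have "eqv (K +@ s) [x] [x']" using eqv_appendD(1)[of _ "[x]" "[y]" "[x']" "[y']"] e' by simp
  thus "x' \<notin> C (K +@ s)" using eqv_C[of "K +@ s" x "[]" x' "[]"] x by simp
qed

text \<open>This is the form in which two points determine the curve given by \<open>s\<close>: they
  determine its value at any further point. The curve passes through some \<open>(x', y')\<close>
  from which \<open>s\<close> is free over the two given points, so \<open>y'\<close> is algebraic
  over these and \<open>x'\<close> without the help of \<open>s\<close>. Stationarity over
  \<open>K\<close> and \<open>s\<close> transfers this to \<open>(x3, y3)\<close>.\<close>

lemma third_point:
  assumes K: "model K" and s: "set s \<subseteq> P" and x: "x \<notin> C (K +@ s)" and y: "y \<in> C (K +@ s \<union> {x})" "y \<in> P"
    and p2: "eqv (C (K +@ s)) [x, y] [x2, y2]" "x2 \<notin> C (K +@ s \<union> {x})"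
    and p3: "eqv (C (K +@ s)) [x, y] [x3, y3]" "x3 \<notin> C (K +@ s \<union> {x, x2})"
  shows "y3 \<in> C (K \<union> {x, y, x2, y2, x3})"
proof -
  define H where "H = C (K +@ s)"
  have MH: "model H" unfolding H_def by (rule model_C[OF K]) (simp add: countable_finite)
  have xP: "x \<in> P" using off_loop[of x] x C_mono_in[of x "{}"] by blast
  have y2: "y2 \<in> C (K +@ s \<union> {x2})" using third_point_aux[OF K s x y(1) p2(1)] by blast
  have y3: "y3 \<in> C (K +@ s \<union> {x3})" using third_point_aux[OF K s x y(1) p3(1)] by blast
  have x2: "x2 \<notin> C (K +@ s)" using p2(2) C_mono_in[of x2 "K +@ s"] by blast
  have pair: "dm T [a, b] = 1" if "a \<notin> C T" "b \<in> C (insert a T)" for T a b using that by simp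
  have "C (K +@ s \<union> {x2, y2}) = C (K +@ s \<union> {x2})"
    using C_insert_in[OF y2] by (simp add: insert_commute)
  hence "x \<notin> C (K +@ s \<union> {x2, y2})"
    using exch_iff[OF x x2] p2(2) by simp
  hence "dm (K +@ s +@ [x2, y2]) [x, y] = dm (K +@ s) [x, y]"
    using pair[of x "K +@ s +@ [x2, y2]" y] pair[of x "K +@ s" y] x y(1)
      C_mono_in[OF y(1), of "insert x (K +@ s +@ [x2, y2])"] by auto
  from free_incident_copy[OF K s _ p2(1) this] obtain q where q: "eqv H [x, y] q"
    "dm (K +@ [x, y] +@ [x2, y2] +@ q) s = dm (K +@ [x, y] +@ [x2, y2]) s"
    "\<forall>i < length [x, y]. [x, y] ! i \<notin> C (K +@ s) \<longrightarrow>
      q ! i \<notin> C (K +@ s +@ [x, y] +@ [x2, y2])"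
    using xP y(2) unfolding H_def by auto
  have "length q = 2" using eqv_length[OF q(1)] by simp
  then obtain x' y' where q': "q = [x', y']" by (metis One_nat_def Suc_1 length_0_conv length_Suc_conv)
  define c where "c = [x, y, x2, y2]"
  have cQ: "set c = set [x, y] +@ [x2, y2]" by (auto simp: c_def)
  have x': "x' \<notin> C (K +@ s +@ c)" using q(3) x q' cQ by (auto simp: Un_assoc)
  have y': "y' \<in> C (K +@ s \<union> {x'})"
    using third_point_aux[OF K s x y(1)] q(1) q' H_def by auto
  have d1: "dm (K +@ c \<union> {x', y'}) s = dm (K +@ c) s" using q(2) q' cQ by (simp add: Un_assoc)
  have "dm (K +@ c \<union> {x', y'}) s \<le> dm (K +@ c \<union> {x'}) s"
    by (rule dm_antimono) (use ext[of "K +@ c \<union> {x', y'}"] in auto)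
  moreover have "dm (K +@ c \<union> {x'}) s \<le> dm (K +@ c) s"
    by (rule dm_antimono) (use ext[of "K +@ c \<union> {x'}"] in auto)
  \<comment> \<open>Freeness of \<open>s\<close> from \<open>y'\<close> over \<open>K\<close>,
    \<open>c\<close> and \<open>x'\<close> is read symmetrically: \<open>y'\<close> has the same
    rank with and without \<open>s\<close>, and with \<open>s\<close> this rank is 0.\<close>
  ultimately have "dm (K +@ c \<union> {x'} +@ [y']) s = dm (K +@ c \<union> {x'}) s"
    using d1 by (simp add: insert_commute)
  hence "dm (K +@ c \<union> {x'} +@ s) [y'] = dm (K +@ c \<union> {x'}) [y']"
    using dm_free_sym by blast
  moreover have "y' \<in> C (K +@ c \<union> {x'} +@ s)" by (rule C_mono_in[OF y']) auto
  ultimately have main: "y' \<in> C (K +@ c \<union> {x'})" by (auto simp: dm_single split: if_splits)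
  have xy: "eqv H [x', y'] [x3, y3]" using q(1) q' p3(1) H_def eqv_sym eqv_trans by blast
  have free: "dm (H +@ c) [a, b] = dm H [a, b]"
    if "a \<notin> C (K +@ s +@ c)" "b \<in> C (K +@ s \<union> {a})" for a b
  proof -
    have "dm (H +@ c) [a, b] = dm (K +@ s +@ c) [a, b]" unfolding H_def by (rule dm_cong) simp
    moreover have "dm H [a, b] = dm (K +@ s) [a, b]" unfolding H_def by simp
    moreover have "a \<notin> C (K +@ s)" using that(1) C_mono_in[of a "K +@ s"] by blast
    moreover have "b \<in> C (insert a (K +@ s +@ c))" by (rule C_mono_in[OF that(2)]) auto
    ultimately show ?thesis using pair that by simp
  qed
  have "C (K +@ s +@ c) = C (K +@ s \<union> {x, x2})"
  proof (rule C_eqI)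
    show "K +@ s \<union> {x, x2} \<subseteq> C (K +@ s +@ c)" using ext[of "K +@ s +@ c"] by (auto simp: c_def)
    have "y \<in> C (K +@ s \<union> {x, x2})" "y2 \<in> C (K +@ s \<union> {x, x2})"
      by (rule C_mono_in[OF y(1)], force) (rule C_mono_in[OF y2], force)
    thus "K +@ s +@ c \<subseteq> C (K +@ s \<union> {x, x2})"
      using ext[of "K +@ s \<union> {x, x2}"] by (auto simp: c_def)
  qed
  hence x3: "x3 \<notin> C (K +@ s +@ c)" using p3(2) by simp
  have x'y'P: "set [x', y'] \<subseteq> P" using eqv_P[OF q(1)] q' xP y(2) by simp
  have "eqv (H +@ c) [x', y'] [x3, y3]"
    by (rule stationary[OF MH x'y'P xy]) (rule free[OF x' y'], rule free[OF x3 y3])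
  hence "eqv (K +@ c) [x', y'] [x3, y3]"
    by (rule eqv_mono) (use ext[of "K +@ s"] in \<open>auto simp: H_def\<close>)
  hence "eqv (K +@ c) [y', x'] [y3, x3]"
    using eqv_swap[of _ "[x']" "[y']" "[x3]" "[y3]"] by simp
  hence "y3 \<in> C (K +@ c \<union> {x3})"
    using eqv_C[of "K +@ c" y' "[x']" y3 "[x3]"] main by simp
  moreover have "K +@ c \<union> {x3} = K \<union> {x, y, x2, y2, x3}" by (auto simp: c_def)
  ultimately show ?thesis by simp
qed

end

section \<open>From a non-modular curve to a line\<close>

context rigid_geometry
begin

lemma not_loop_P: "x \<notin> C A \<Longrightarrow> x \<in> P"
  using off_loop[of x] C_mono_in[of x "{}" A] by blast

lemma pair_stationary:
  assumes H: "model H" and u: "u \<in> P" "v \<in> P" "v \<in> C (insert u H)" "v' \<in> C (insert u' H)"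
    and e: "eqv H [u, v] [u', v']" and c: "u \<notin> C (H +@ c)" "u' \<notin> C (H +@ c)"
  shows "eqv (H +@ c) [u, v] [u', v']"
proof (rule stationary[OF H _ e])
  have *: "dm (H +@ c) [a, b] = dm H [a, b]" if "a \<notin> C (H +@ c)" "b \<in> C (insert a H)" for a b
  proof -
    have "a \<notin> C H" using that(1) C_mono_in[of a H] by blast
    moreover have "b \<in> C (insert a (H +@ c))" by (rule C_mono_in[OF that(2)]) auto
    ultimately show ?thesis using that by simp
  qed
  show "dm (H +@ c) [u, v] = dm H [u, v]" "dm (H +@ c) [u', v'] = dm H [u', v']"
    using * u c by blast+
qed (use u in simp)

lemma eqv_pair_C:
  assumes "eqv H [u, v] [u', v']" "H' \<subseteq> H"
  shows "v \<in> C (insert u H') \<longleftrightarrow> v' \<in> C (insert u' H')" "u \<in> C H' \<longleftrightarrow> u' \<in> C H'"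
proof -
  have e: "eqv H' [u, v] [u', v']" using assms by (rule eqv_mono)
  have "eqv H' [v, u] [v', u']" using eqv_swap[of _ "[u]" "[v]" "[u']" "[v']"] e by simp
  thus "v \<in> C (insert u H') \<longleftrightarrow> v' \<in> C (insert u' H')" using eqv_C[of H' v "[u]" v' "[u']"] by simp
  have "eqv H' [u] [u']" using eqv_appendD(1)[of _ "[u]" "[v]" "[u']" "[v']"] e by simp
  thus "u \<in> C H' \<longleftrightarrow> u' \<in> C H'" using eqv_C[of H' u "[]" u' "[]"] by simp
qed

text \<open>\<open>y\<close> is the value at \<open>x\<close> of a curve from a family in which two generic points
  determine the curve; \<open>b1, b2\<close> are its values at two points of the base.\<close>

definition line :: "'a set \<Rightarrow> 'a \<Rightarrow> 'a \<Rightarrow> 'a \<Rightarrow> 'a \<Rightarrow> bool" where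
  "line K x b1 b2 y \<longleftrightarrow> indl K [b1, b2, x] \<and> y \<in> P \<and> y \<in> C (K \<union> {x, b1, b2}) \<and>
     y \<notin> C (K \<union> {x, b1}) \<and> y \<notin> C (K \<union> {x, b2}) \<and>
     (\<forall>x' y'. eqv (C (K \<union> {b1, b2})) [x, y] [x', y'] \<longrightarrow> x' \<notin> C (K \<union> {b1, b2, x}) \<longrightarrow>
        {b1, b2} \<subseteq> C (K \<union> {x, y, x', y'}))"

lemma line_eqv:
  assumes "line K x b1 b2 y" "eqv K [x, b1, b2, y] [x', b1', b2', y']"
  shows "line K x' b1' b2' y'"
proof -
  obtain g where g: "g \<in> fixg K" "g x = x'" "g b1 = b1'" "g b2 = b2'" "g y = y'"
    using assms(2) by (auto simp: eqv_def)
  have gG: "g \<in> Aut" using g fixgD by blast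
  have gK: "g ` K = K" using fixg_image[OF g(1)] by blast
  have mem: "g z \<in> C (K \<union> g ` A) \<longleftrightarrow> z \<in> C (K \<union> A)" for z A
    using G_C_mem[OF gG, of z "K \<union> A"] gK by (simp add: image_Un)
  have "indl K [b1', b2', x']"
    using assms(1) dm_fixg[OF g(1), of "[b1, b2, x]"] g by (simp add: line_def indl_def)
  moreover have "y' \<in> P" using assms(1) G_P[OF gG, of y] g by (simp add: line_def)
  moreover have "y' \<in> C (K \<union> {x', b1', b2'})" "y' \<notin> C (K \<union> {x', b1'})" "y' \<notin> C (K \<union> {x', b2'})"
    using assms(1) mem[of y "{x, b1, b2}"] mem[of y "{x, b1}"] mem[of y "{x, b2}"] g by (auto simp: line_def)
  moreover have "{b1', b2'} \<subseteq> C (K \<union> {x', y', u, v})"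
    if uv: "eqv (C (K \<union> {b1', b2'})) [x', y'] [u, v]" "u \<notin> C (K \<union> {b1', b2', x'})" for u v
  proof -
    define u0 v0 where "u0 = iv g u" and "v0 = iv g v"
    have gu: "g u0 = u" "g v0 = v" using gG by (simp_all add: u0_def v0_def)
    have "iv g ` C (K \<union> {b1', b2'}) = C (K \<union> {b1, b2})"
    proof -
      have "g ` C (K \<union> {b1, b2}) = C (K \<union> {b1', b2'})" using G_C[OF gG] gK g by (simp add: image_Un)
      hence "iv g ` C (K \<union> {b1', b2'}) = (\<lambda>x. iv g (g x)) ` C (K \<union> {b1, b2})" by (metis image_image)
      thus ?thesis using gG by simp
    qed
    hence "eqv (C (K \<union> {b1, b2})) [x, y] [u0, v0]"
      using eqv_image[OF G_inv[OF gG] uv(1)] g gG u0_def v0_def inv_app(1)[OF gG] by auto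
    moreover have "u0 \<notin> C (K \<union> {b1, b2, x})" using mem[of u0 "{b1, b2, x}"] uv(2) gu g by simp
    ultimately have "{b1, b2} \<subseteq> C (K \<union> {x, y, u0, v0})" using assms(1) by (simp add: line_def)
    thus ?thesis using mem[of b1 "{x, y, u0, v0}"] mem[of b2 "{x, y, u0, v0}"] g gu by simp
  qed
  ultimately show ?thesis by (simp add: line_def)
qed

lemma indl_set_cong: "indl S xs \<Longrightarrow> set xs = set ys \<Longrightarrow> length xs = length ys \<Longrightarrow> indl S ys"
  using dm_set_cong[of S xs ys] by (simp add: indl_def)

lemma indl_comm: "indl S (xs @ ys) \<longleftrightarrow> indl S (ys @ xs)"
  using dm_comm[of S xs ys] by (simp add: indl_def add.commute)

text \<open>The hypothesis \<open>bad\<close> says that one point does not determine the curve. By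
  stationarity every pair of independent points of the curve is conjugate over \<open>K\<close> and
  \<open>s\<close> to the given pair, so the last of the four coordinates is never algebraic over
  the other three.\<close>

lemma independent_pair:
  assumes K: "model K" and s: "set s \<subseteq> P" and x: "x \<notin> C (K +@ s)" and y: "y \<in> C (K +@ s \<union> {x})" "y \<in> P"
    and p2: "eqv (C (K +@ s)) [x, y] [x2, y2]" "x2 \<notin> C (K +@ s \<union> {x})"
    and bad: "y2 \<notin> C (K \<union> {x, y, x2})"
    and u: "eqv (C (K +@ s)) [x, y] [u, v]" and u': "eqv (C (K +@ s)) [x, y] [u', v']"
    and uu: "u' \<notin> C (K +@ s \<union> {u})"
  shows "indl K [u, v, u', v']"
proof -
  define H where "H = C (K +@ s)"
  have MH: "model H" unfolding H_def by (rule model_C[OF K]) (simp add: countable_finite)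
  have KH: "K \<subseteq> H" using ext[of "K +@ s"] by (auto simp: H_def)
  have insC: "C (insert a H) = C (K +@ s \<union> {a})" for a by (simp add: H_def)
  have insC2: "C (H +@ [a, b]) = C (K +@ s \<union> {a})" if "b \<in> C (K +@ s \<union> {a})" for a b
  proof -
    have "C (H \<union> {a, b}) = C (K +@ s \<union> {a, b})" unfolding H_def by (rule C_Un_C(1))
    hence "C (H +@ [a, b]) = C (insert b (K +@ s \<union> {a}))" by (simp add: insert_commute)
    thus ?thesis using C_insert_in[OF that] by simp
  qed
  have xP: "x \<in> P" using not_loop_P x by blast
  have v: "v \<in> C (insert u H)" "v' \<in> C (insert u' H)" "u \<notin> C H"
    using eqv_pair_C[OF u, of H] eqv_pair_C[OF u', of H] y x insC by (auto simp: H_def)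
  obtain g where g: "g \<in> fixg H" "g x = u" "g y = v" using u by (auto simp: eqv_def H_def)
  have gG: "g \<in> Aut" using g fixgD by blast
  define a b where "a = g x2" and "b = g y2"
  have ab: "eqv H [x2, y2] [a, b]" using g(1) by (auto simp: eqv_def a_def b_def)
  have "eqv H [x, y] [a, b]" using p2(1) ab eqv_trans by (simp add: H_def)
  hence abu: "eqv H [a, b] [u', v']" using u' eqv_sym eqv_trans unfolding H_def by blast
  have b: "b \<in> C (insert a H)" using eqv_pair_C(1)[OF abu, of H] v by simp
  have "g ` (K +@ s \<union> {x}) = K +@ s \<union> {u}"
    using fixg_image[OF g(1), of "K +@ s"] ext[of "K +@ s"] g(2) by (simp add: H_def image_Un)
  hence a: "a \<notin> C (K +@ s \<union> {u})" using G_C_mem[OF gG, of x2 "K +@ s \<union> {x}"] p2(2) by (simp add: a_def)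
  have aP: "a \<in> P" using not_loop_P a by blast
  have "g ` (K \<union> {x, y, x2}) = K \<union> {u, v, a}"
    using fixg_image[OF g(1) KH] g by (simp add: image_Un a_def)
  hence b2: "b \<notin> C (K \<union> {u, v, a})" using G_C_mem[OF gG, of y2 "K \<union> {x, y, x2}"] bad by (simp add: b_def)
  have bP: "b \<in> P" using not_loop_P b2 by blast
  have vC: "v \<in> C (K +@ s \<union> {u})" using v insC by simp
  have "eqv (H +@ [u, v]) [a, b] [u', v']"
    by (rule pair_stationary[OF MH aP bP b v(2) abu]) (use a uu insC2[OF vC] in simp_all)
  hence "eqv (insert u (insert v H)) [a, b] [u', v']" by simp
  hence v'1: "v' \<notin> C (K \<union> {u, v, u'})"
    using eqv_pair_C(1)[of _ a b u' v' "K \<union> {u, v}"] b2 KH by (simp add: insert_commute subset_iff)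
  have u1: "u \<notin> C K" using v(3) C_mono_in[OF _ KH] by blast
  have u'1: "u' \<notin> C (K \<union> {u, v})"
  proof
    assume "u' \<in> C (K \<union> {u, v})"
    hence "u' \<in> C (H +@ [u, v])" by (rule C_mono_in) (use KH in auto)
    thus False using uu insC2[OF vC] by simp
  qed
  have "v \<notin> C (insert u K)"
  proof
    assume "v \<in> C (insert u K)"
    hence "y \<in> C (insert x K)" using eqv_pair_C(1)[OF u, of K] KH by (simp add: H_def)
    hence "y2 \<in> C (insert x2 K)" using eqv_pair_C(1)[OF p2(1), of K] KH by (simp add: H_def)
    hence "y2 \<in> C (K \<union> {x, y, x2})" by (rule C_mono_in) auto
    thus False using bad by blast
  qed
  thus ?thesis using u1 u'1 v'1 by (simp add: indl_Cons insert_commute)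
qed

text \<open>Two points of the curve determine it and one does not. Adding the abscissas of two
  points to the base therefore makes their ordinates an independent pair of parameters for the
  curve.\<close>

lemma ex_line:
  assumes K: "model K" and s: "set s \<subseteq> P" and x: "x \<notin> C (K +@ s)" and y: "y \<in> C (K +@ s \<union> {x})" "y \<in> P"
    and p2: "eqv (C (K +@ s)) [x, y] [x2, y2]" "x2 \<notin> C (K +@ s \<union> {x})"
    and bad: "y2 \<notin> C (K \<union> {x, y, x2})"
  shows "\<exists>K' x b1 b2 y. model K' \<and> line K' x b1 b2 y"
proof -
  define H where "H = C (K +@ s)"
  have MH: "model H" unfolding H_def by (rule model_C[OF K]) (simp add: countable_finite)
  have KH: "K \<subseteq> H" using ext[of "K +@ s"] by (auto simp: H_def)
  have CH: "C H = H" using modelD(2)[OF MH] .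
  have insC: "C (insert a H) = C (insert a (K +@ s))" for a by (simp add: H_def)
  define a1 b1 a2 b2 where "a1 = x" and "b1 = y" and "a2 = x2" and "b2 = y2"
  note indep4 = independent_pair[OF assms, folded H_def]
  have HA: "ctbl_gen (C (H \<union> {a1, a2}))" by (rule ctbl_gen_C[OF modelD(1)[OF MH]]) simp
  obtain x3 where x3: "x3 \<notin> C (H \<union> {a1, a2})" using unctbl_gen[OF modelD(1)[OF MH], of "{a1, a2}"] by auto
  have x3H: "x3 \<notin> C H" using x3 C_mono_in[of x3 H] by blast
  have a1H: "a1 \<notin> C H" using x by (simp add: a1_def H_def)
  obtain g3 where g3: "g3 \<in> fixg H" "map g3 [a1] = [x3]"
    using generic_list_fix[OF modelD(1)[OF MH], of "[a1]" "[x3]"] x3H a1H by (auto simp: indl_Cons)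
  define y3 where "y3 = g3 b1"
  have p3: "eqv H [a1, b1] [x3, y3]" using g3 by (auto simp: eqv_def y3_def)
  obtain x4 where x4: "x4 \<notin> C (C (H \<union> {a1, a2}) \<union> {x3})" using unctbl_gen[OF HA, of "{x3}"] by auto
  have x4H: "x4 \<notin> C (H \<union> {a1, a2, x3})" using x4 by (simp add: insert_commute)
  have x4H': "x4 \<notin> C (H \<union> {a1, a2})" using x4H C_mono_in[of x4 "H \<union> {a1, a2}" "H \<union> {a1, a2, x3}"] by blast
  obtain g4 where g4: "g4 \<in> fixg (C (H \<union> {a1, a2}))" "map g4 [x3] = [x4]"
    using generic_list_fix[OF HA, of "[x3]" "[x4]"] x3 x4H' by (auto simp: indl_Cons)
  define y4 where "y4 = g4 y3"
  have p43: "eqv (C (H \<union> {a1, a2})) [x3, y3] [x4, y4]" using g4 by (auto simp: eqv_def y4_def)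
  have HsubA: "H \<subseteq> C (H \<union> {a1, a2})" using ext[of "H \<union> {a1, a2}"] by auto
  have p4: "eqv H [a1, b1] [x4, y4]" using p3 eqv_mono[OF p43 HsubA] eqv_trans by blast
  have p1: "eqv H [a1, b1] [a1, b1]" by (rule eqv_refl)
  have p2': "eqv H [a1, b1] [a2, b2]" using p2(1) by (simp add: H_def a1_def b1_def a2_def b2_def)
  have a2H: "a2 \<notin> C (H \<union> {a1})" using p2(2) by (simp add: insC a1_def a2_def)
  have val: "v \<in> C (H \<union> {u})" if "eqv H [a1, b1] [u, v]" for u v
    using eqv_pair_C(1)[OF that, of H] y(1) by (simp add: insC a1_def b1_def)
  have b1: "b1 \<in> C (H \<union> {a1})" and b2: "b2 \<in> C (H \<union> {a2})" and y3: "y3 \<in> C (H \<union> {x3})" and y4: "y4 \<in> C (H \<union> {x4})"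
    using val p1 p2' p3 p4 by blast+
  have into: "z \<in> C (H \<union> A)" if "z \<in> C (K \<union> B)" "B \<subseteq> C (H \<union> A)" for z A B
  proof (rule C_trans[OF that(1)])
    show "K \<union> B \<subseteq> C (H \<union> A)" using that(2) KH ext[of "H \<union> A"] by auto
  qed
  \<comment> \<open>The abscissas \<open>a1\<close>, \<open>a2\<close> become constants, and the
    ordinates \<open>b1\<close>, \<open>b2\<close> remain independent over them because the four
    coordinates are independent over \<open>K\<close>.\<close>
  define K' where "K' = C (K \<union> {a1, a2})"
  have MK': "model K'" unfolding K'_def by (rule model_C[OF K]) simp
  have K'C: "C (K' \<union> A) = C (K \<union> {a1, a2} \<union> A)" for A by (simp add: K'_def)
  have i12: "indl K [a1, b1, a2, b2]" using indep4[OF p1[unfolded a1_def b1_def] p2'[unfolded a1_def b1_def]] a2H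
    by (simp add: insC a1_def b1_def)
  have ind: "indl K [u, v, u', v']" if "eqv H [a1, b1] [u, v]" "eqv H [a1, b1] [u', v']" "u' \<notin> C (H \<union> {u})" for u v u' v'
    using indep4[of u v u' v'] that by (simp add: insC a1_def b1_def)
  have "indl K [a1, a2, b1, b2]" by (rule indl_set_cong[OF i12]) auto
  hence bb: "indl K' [b1, b2]" using K'C[of "{}"] K'C[of "{b1}"] by (simp add: indl_Cons insert_commute)
  have bA: "b1 \<in> C (H \<union> {a1, a2})" "b2 \<in> C (H \<union> {a1, a2})"
    by (rule C_mono_in[OF b1], force) (rule C_mono_in[OF b2], force)
  have x3b: "x3 \<notin> C (K' \<union> {b1, b2})"
  proof
    assume "x3 \<in> C (K' \<union> {b1, b2})"
    hence "x3 \<in> C (K \<union> {a1, a2, b1, b2})" using K'C[of "{b1, b2}"] by (simp add: insert_commute)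
    hence "x3 \<in> C (H \<union> {a1, a2})" by (rule into) (use bA in \<open>auto intro: in_C\<close>)
    thus False using x3 by blast
  qed
  have i3: "indl K' [b1, b2, x3]" using bb x3b indl_append[of K' "[b1, b2]" "[x3]"] by (simp add: indl_Cons)
  have "C (H \<union> {x, x2}) = C (K +@ s \<union> {x, x2})" unfolding H_def by (rule C_Un_C(1))
  hence x3': "x3 \<notin> C (K +@ s \<union> {x, x2})" using x3 by (simp add: a1_def a2_def)
  have yin: "y3 \<in> C (K \<union> {a1, b1, a2, b2, x3})"
    unfolding a1_def b1_def a2_def b2_def
    by (rule third_point[OF K s x y p2 _ x3']) (use p3 in \<open>simp add: H_def a1_def b1_def\<close>)
  hence y3in: "y3 \<in> C (K' \<union> {x3, b1, b2})"
    using K'C[of "{x3, b1, b2}"] C_mono_in[OF yin, of "K \<union> {a1, a2} \<union> {x3, b1, b2}"] by auto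
  \<comment> \<open>With only one ordinate \<open>b\<close>, the value \<open>y3\<close> could be
    algebraic only through the other abscissa \<open>a'\<close>. Exchange would then make
    \<open>a'\<close> algebraic over \<open>H\<close>, \<open>a\<close> and \<open>x3\<close>, but
    it was chosen generic over these.\<close>
  have y3out: "y3 \<notin> C (K' \<union> {x3, b})" if b: "eqv H [a1, b1] [a, b]" "{a, a'} = {a1, a2}"
      "x3 \<notin> C (H \<union> {a})" "a' \<notin> C (H \<union> {a, x3})" for a b a'
  proof
    assume "y3 \<in> C (K' \<union> {x3, b})"
    hence 1: "y3 \<in> C (insert a' (K \<union> {a, x3, b}))" using K'C[of "{x3, b}"] b(2) by (auto simp: insert_commute doubleton_eq_iff)
    have "indl K [a, b, x3, y3]" using ind[OF b(1) p3 b(3)] .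
    hence 2: "y3 \<notin> C (K \<union> {a, x3, b})" by (simp add: indl_Cons insert_commute)
    have "a' \<in> C (insert y3 (K \<union> {a, x3, b}))" using exch[OF 1 2] .
    hence "a' \<in> C (K \<union> {y3, a, x3, b})" by simp
    hence "a' \<in> C (H \<union> {a, x3})"
    proof (rule into)
      show "{y3, a, x3, b} \<subseteq> C (H \<union> {a, x3})"
        using C_mono_in[OF y3, of "H \<union> {a, x3}"] C_mono_in[OF val[OF b(1)], of "H \<union> {a, x3}"]
        by (auto intro: in_C)
    qed
    thus False using b(4) by blast
  qed
  have x3a: "x3 \<notin> C (H \<union> {a1})" "x3 \<notin> C (H \<union> {a2})"
    using x3 C_mono_in[of x3 "H \<union> {a1}" "H \<union> {a1, a2}"] C_mono_in[of x3 "H \<union> {a2}" "H \<union> {a1, a2}"] by auto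
  have a2': "a2 \<notin> C (H \<union> {a1, x3})"
    using exch_iff[of a2 "H \<union> {a1}" x3] a2H x3a x3 by (auto simp: insert_commute)
  have a2H0: "a2 \<notin> C H" using a2H C_mono_in[of a2 H] by blast
  have "a1 \<notin> C (H \<union> {a2})" using exch_iff[OF a1H a2H0] a2H by simp
  hence a1': "a1 \<notin> C (H \<union> {a2, x3})"
    using exch_iff[of a1 "H \<union> {a2}" x3] x3a x3 by (auto simp: insert_commute)
  have out1: "y3 \<notin> C (K' \<union> {x3, b1})" by (rule y3out[OF p1 _ x3a(1) a2']) simp
  have out2: "y3 \<notin> C (K' \<union> {x3, b2})" by (rule y3out[OF p2' _ x3a(2) a1']) auto
  have y3P: "y3 \<in> P" using not_loop_P out1 by blast
  have x3P: "x3 \<in> P" using not_loop_P x3 by blast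
  have p43': "eqv (C (K' \<union> {b1, b2})) [x3, y3] [x4, y4]"
  proof (rule eqv_mono[OF p43])
    show "C (K' \<union> {b1, b2}) \<subseteq> C (H \<union> {a1, a2})"
      using bA KH ext[of "H \<union> {a1, a2}"] K'C[of "{b1, b2}"] by (auto intro!: C_sub)
  qed
  \<comment> \<open>Over \<open>K'\<close> the coordinates of two points on the curve have rank 4.
    They and the parameters all lie in the closure of \<open>x3\<close>, \<open>x4\<close>,
    \<open>b1\<close>, \<open>b2\<close>, which has rank at most 4, so the parameters add nothing to
    the two points.\<close>
  have bin: "{b1, b2} \<subseteq> C (K' \<union> {x3, y3, x4, y4})"
  proof -
    have x4x3: "x4 \<notin> C (H \<union> {x3})" using x4H C_mono_in[of x4 "H \<union> {x3}" "H \<union> {a1, a2, x3}"] by auto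
    have "indl K [x3, y3, x4, y4]" using ind[OF p3 p4 x4x3] .
    moreover have "indl (K +@ [x3, y3, x4, y4]) [a1, a2]"
    proof -
      have "indl H [a1, a2, x3, x4]" using a1H a2H x3 x4H by (simp add: indl_Cons insert_commute)
      hence "indl H [x3, x4, a1, a2]" by (rule indl_set_cong) auto
      hence "indl (H \<union> {x3, x4}) [a1, a2]" using indl_append[of H "[x3, x4]" "[a1, a2]"] by simp
      thus ?thesis
      proof (rule indl_antimono)
        show "K +@ [x3, y3, x4, y4] \<subseteq> C (H \<union> {x3, x4})"
          using C_mono_in[OF y3, of "H \<union> {x3, x4}"] C_mono_in[OF y4, of "H \<union> {x3, x4}"] KH
          by (auto intro: in_C)
      qed
    qed
    ultimately have "indl K ([x3, y3, x4, y4] @ [a1, a2])" by (simp only: indl_append)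
    hence "indl K ([a1, a2] @ [x3, y3, x4, y4])" by (rule indl_comm[THEN iffD1])
    hence "indl (K +@ [a1, a2]) [x3, y3, x4, y4]" unfolding indl_append by blast
    hence "indl (K \<union> {a1, a2}) [x3, y3, x4, y4]" by simp
    hence i: "indl K' [x3, y3, x4, y4]" by (simp add: K'_def)
    have y4in: "y4 \<in> C (K' \<union> {x4, b1, b2})"
      using eqv_pair_C(1)[OF p43', of "K' \<union> {b1, b2}"] y3in ext[of "K' \<union> {b1, b2}"] by (simp add: insert_commute)
    have "dm K' ([x3, y3, x4, y4] @ [b1, b2]) \<le> dm K' [x3, x4, b1, b2]"
    proof (rule dm_mono)
      show "set ([x3, y3, x4, y4] @ [b1, b2]) \<subseteq> C (K' +@ [x3, x4, b1, b2])"
        using C_mono_in[OF y3in, of "K' \<union> {x3, x4, b1, b2}"] C_mono_in[OF y4in, of "K' \<union> {x3, x4, b1, b2}"]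
        by (auto intro: in_C)
    qed
    also have "\<dots> \<le> 4" using dm_le_length[of K' "[x3, x4, b1, b2]"] by simp
    finally have "dm (K' +@ [x3, y3, x4, y4]) [b1, b2] = 0"
      using i dm_append[of K' "[x3, y3, x4, y4]" "[b1, b2]"] unfolding indl_def by simp
    thus ?thesis unfolding dm_0_iff by simp
  qed
  define H' where "H' = C (K' \<union> {b1, b2})"
  have MH': "model H'" unfolding H'_def by (rule model_C[OF MK']) simp
  \<comment> \<open>Every admissible second point \<open>(u, v)\<close> is conjugate to
    \<open>(x4, y4)\<close> over \<open>H'\<close> and the first point, by stationarity over
    \<open>H'\<close>; the inclusion just proved is carried over by such a conjugation, which fixes
    \<open>b1\<close> and \<open>b2\<close>.\<close>
  have "{b1, b2} \<subseteq> C (K' \<union> {x3, y3, u, v})"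
    if uv: "eqv (C (K' \<union> {b1, b2})) [x3, y3] [u, v]" "u \<notin> C (K' \<union> {b1, b2, x3})" for u v
  proof -
    have y3in': "y3 \<in> C (K' \<union> {b1, b2} \<union> {x3})" using y3in by (simp add: insert_commute)
    have y3H: "y3 \<in> C (insert x3 H')" using y3in' by (simp add: H'_def)
    have "C (H' +@ [x3, y3]) = C (K' \<union> {b1, b2} +@ [x3, y3])" unfolding H'_def by (rule C_Un_C(1))
    hence C3: "C (H' +@ [x3, y3]) = C (K' \<union> {b1, b2, x3})"
      using C_insert_in[OF y3in'] by (simp add: insert_commute)
    have x4': "x4 \<notin> C (K' \<union> {b1, b2, x3})"
    proof
      assume "x4 \<in> C (K' \<union> {b1, b2, x3})"
      hence "x4 \<in> C (K \<union> {a1, a2, b1, b2, x3})" using K'C[of "{b1, b2, x3}"] by (simp add: insert_commute)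
      hence "x4 \<in> C (H \<union> {a1, a2, x3})"
        by (rule into) (use C_mono_in[OF bA(1), of "H \<union> {a1, a2, x3}"] C_mono_in[OF bA(2), of "H \<union> {a1, a2, x3}"] in \<open>auto intro: in_C\<close>)
      thus False using x4H by blast
    qed
    have e: "eqv H' [x4, y4] [u, v]" using p43' uv(1) eqv_sym eqv_trans unfolding H'_def by blast
    have vin: "y4 \<in> C (insert x4 H')" "v \<in> C (insert u H')"
      using eqv_pair_C(1)[OF p43'[folded H'_def], of H'] eqv_pair_C(1)[OF uv(1)[folded H'_def], of H'] y3H by auto
    have "eqv (H' +@ [x3, y3]) [x4, y4] [u, v]"
      by (rule pair_stationary[OF MH' _ _ vin e])
        (use x4' uv(2) C3 not_loop_P[OF x4'] eqv_P[OF p43'] x3P y3P in auto)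
    then obtain h where h: "h \<in> fixg (H' +@ [x3, y3])" "h x4 = u" "h y4 = v" by (auto simp: eqv_def)
    have sub: "K' \<union> {b1, b2} \<subseteq> H'" using ext by (simp add: H'_def)
    have hb: "h b1 = b1" "h b2 = b2" "h x3 = x3" "h y3 = y3"
      using fixgD(2)[OF h(1)] sub by auto
    have hK: "h \<in> fixg K'" using fixg_mono[of K' "H' +@ [x3, y3]"] sub h(1) by blast
    have "h b \<in> C (K' \<union> h ` {x3, y3, x4, y4})" if "b \<in> {b1, b2}" for b
      using fixg_C_mem[OF hK, of b "{x3, y3, x4, y4}"] bin that by blast
    from this[of b1] this[of b2] show ?thesis using hb h(2,3) by simp
  qed
  hence "line K' x3 b1 b2 y3" using i3 y3P y3in out1 out2 by (simp add: line_def)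
  thus ?thesis using MK' by blast
qed

end

subsection \<open>Surfaces and modularity\<close>

context rigid_geometry
begin

lemma free_sub:
  assumes f: "dm (S +@ ys) xs = dm S xs" and sub: "set ys' \<subseteq> C (S +@ ys)" "set xs' \<subseteq> C (S +@ xs)"
  shows "dm (S +@ ys') xs' = dm S xs'"
proof -
  have A: "dm (T +@ xs') xs + dm T xs' = dm T xs" if "set xs' \<subseteq> C (T +@ xs)" for T
    using dm_sym[of T xs xs'] dm_zero[OF that] by simp
  have sub': "set xs' \<subseteq> C (S +@ ys +@ xs)"
    using sub(2) mono[of "S +@ xs" "S +@ ys +@ xs"] by auto
  have "dm (S +@ ys) xs' \<le> dm S xs'" by (rule dm_antimono) (use ext[of "S +@ ys"] in auto)
  moreover have "dm (S +@ ys +@ xs') xs \<le> dm (S +@ xs') xs"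
    by (rule dm_antimono) (use ext[of "S +@ ys +@ xs'"] in auto)
  ultimately have "dm (S +@ ys) xs' = dm S xs'" using A[OF sub(2)] A[OF sub'] f by simp
  moreover have "dm (S +@ ys) xs' \<le> dm (S +@ ys') xs'"
    by (rule dm_antimono) (use sub(1) ext[of "S +@ ys"] in auto)
  moreover have "dm (S +@ ys') xs' \<le> dm S xs'" by (rule dm_antimono) (use ext[of "S +@ ys'"] in auto)
  ultimately show ?thesis by simp
qed

text \<open>The third coordinate of a surface is many-valued; \<open>z\<close> is a value at \<open>(x1, y2)\<close> on the
  branch of \<open>w1\<close> over \<open>x1\<close> and on the branch of \<open>w2\<close> over \<open>y2\<close>.\<close>

lemma common_branch:
  assumes N: "model N" and P: "{x1, y1, w1} \<subseteq> P"
    and e: "eqv N [x1, y1, w1] [x2, y2, w2]"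
    and i: "y1 \<notin> C (N \<union> {x1})" "y1 \<notin> C N" "w1 \<in> C (N \<union> {x1, y1})" "x1 \<notin> C (N \<union> {y2})"
  shows "\<exists>z. eqv (C (N \<union> {x1})) [y1, w1] [y2, z] \<and> eqv (C (N \<union> {y2})) [x2, w2] [x1, z]"
proof -
  define X where "X = C (N \<union> {x1})"
  define Y where "Y = C (N \<union> {y2})"
  have CN: "C N = N" using modelD(2)[OF N] .
  have MX: "model X" unfolding X_def by (rule model_C[OF N]) simp
  have gY: "ctbl_gen Y" unfolding Y_def by (rule ctbl_gen_C[OF modelD(1)[OF N]]) simp
  have NX: "N \<subseteq> X" "x1 \<in> X" using ext[of "N \<union> {x1}"] by (auto simp: X_def)
  have NY: "N \<subseteq> Y" "y2 \<in> Y" using ext[of "N \<union> {y2}"] by (auto simp: Y_def)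
  have "eqv N [y1] [y2]" using e by (auto simp: eqv_def)
  hence y2: "y2 \<notin> C N" using eqv_C[of N y1 "[]" y2 "[]"] i(2) by simp
  have x1: "x1 \<notin> C N" using i(4) C_mono_in[of x1 N] by blast
  have y2X: "y2 \<notin> C (N \<union> {x1})" using exch_iff[OF x1 y2] i(4) by simp
  have PP: "set [y1, w1] \<subseteq> P" using P by simp
  \<comment> \<open>Over the closed set \<open>X\<close> the type of \<open>(y1, w1)\<close> is
    controlled by the finite set \<open>A\<close>, so later only \<open>x1\<close> and
    \<open>A\<close> have to be fixed in order to stay on the branch over \<open>x1\<close>.\<close>
  obtain A where A: "finite A" "A \<subseteq> X"
    "\<And>w'. eqv A [y1, w1] w' \<Longrightarrow> dm X w' = dm X [y1, w1] \<Longrightarrow> eqv X [y1, w1] w'"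
    using isolated[OF MX PP] by blast
  have "indl X [y1]" "indl X [y2]" using i(1) y2X by (simp_all add: indl_Cons X_def)
  then obtain g where g: "g \<in> fixg X" "g y1 = y2"
    using generic_list_fix[OF modelD(1)[OF MX], of "[y1]" "[y2]"] by auto
  define z0 where "z0 = g w1"
  have gx1: "g x1 = x1" using g(1) NX fixgD(2) by blast
  have gN: "g \<in> fixg N" using fixg_mono[OF NX(1)] g(1) by blast
  have ez0: "eqv X [y1, w1] [y2, z0]" using g by (auto simp: eqv_def z0_def)
  have "eqv N [x1, y1, w1] [x1, y2, z0]" using gN gx1 g(2) by (auto simp: eqv_def z0_def)
  hence "eqv N [x2, y2, w2] [x1, y2, z0]" using e eqv_sym eqv_trans by blast
  \<comment> \<open>\<open>h\<close> fixes \<open>N\<close> and \<open>y2\<close> and takes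
    \<open>(x2, w2)\<close> to \<open>(x1, z0)\<close>, but it may permute the closure
    \<open>Y\<close> of \<open>N\<close> and \<open>y2\<close>. The branch over \<open>y2\<close> is
    a type over \<open>Y\<close>, so this motion has to be undone.\<close>
  then obtain h where h: "h \<in> fixg N" "h x2 = x1" "h y2 = y2" "h w2 = z0" by (auto simp: eqv_def)
  have hG: "h \<in> Aut" using h fixgD by blast
  have hN: "h ` N = N" using fixg_image[OF h(1)] by blast
  have hY: "h ` Y = Y" using G_C[OF hG, of "N \<union> {y2}"] hN h(3) by (simp add: Y_def image_Un)
  have ivN: "iv h \<in> fixg N" using fixg_inv[OF h(1)] .
  obtain c where c: "set c = insert x1 A" using finite_list A(1) by (metis finite_insert)
  have cX: "set c \<subseteq> C (N +@ [x1])" using c A(2) NX by (auto simp: X_def)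
  have free0: "dm (N +@ [x1]) [y2] = dm N [y2]" using y2X y2 by simp
  have Yim: "iv h x \<in> Y" if x: "x \<in> Y" for x
  proof -
    have "x \<in> h ` Y" using x hY by simp
    thus ?thesis using hG by auto
  qed
  \<comment> \<open>The inverse of \<open>h\<close> on \<open>Y\<close> and the identity on
    \<open>x1\<close> and \<open>A\<close> are compatible: \<open>c\<close> lies in the closure of
    \<open>N\<close> and \<open>x1\<close>, which is free from \<open>Y\<close> over
    \<open>N\<close>, and stationarity over \<open>N\<close> applies to each finite part of
    \<open>Y\<close>.\<close>
  have fin: "\<exists>f \<in> Aut. (\<forall>x \<in> F. f x = iv h x) \<and> map f c = c" if F: "finite F" "F \<subseteq> Y" for F
  proof -
    obtain fl where fl: "set fl = F \<inter> P" using finite_list F(1) by (metis finite_Int)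
    define fl' where "fl' = map (iv h) fl"
    have e': "eqv N fl fl'" unfolding fl'_def by (rule eqv_map[OF ivN])
    have flY: "set fl \<subseteq> C (N +@ [y2])" using fl F by (auto simp: Y_def)
    have fl'Y: "set fl' \<subseteq> C (N +@ [y2])" using fl F Yim by (auto simp: Y_def fl'_def)
    have flP: "set fl \<subseteq> P" using fl by simp
    have "eqv (N +@ c) fl fl'"
      by (rule stationary[OF N flP e' free_sub[OF free0 cX flY] free_sub[OF free0 cX fl'Y]])
    then obtain f where f: "f \<in> fixg (N +@ c)" "map f fl = fl'" by (rule eqvE)
    have fG: "f \<in> Aut" using f fixgD by blast
    have "f x = iv h x" if "x \<in> F" for x
    proof (cases "x \<in> P")
      case True
      thus ?thesis using f(2) fl that by (simp add: fl'_def)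
    next
      case False
      thus ?thesis using off_fix[OF fG] off_fix[OF G_inv[OF hG]] by simp
    qed
    moreover have "map f c = c" by (rule fixg_map[OF f(1)]) simp
    ultimately show ?thesis using fG by blast
  qed
  obtain j where j: "j \<in> Aut" "\<forall>x \<in> Y. j x = iv h x" "map j c = c"
    using hom_ext[OF gY G_inv[OF hG] fin] by blast
  have jc: "j x = x" if "x \<in> set c" for x using j(3) that by (metis map_eq_conv map_ident)
  have jN: "j x = x" if "x \<in> N" for x using j(2) that NY fixgD(2)[OF ivN] by auto
  have jy2: "j y2 = y2" using j(2) NY h(3) inv_app(1)[OF hG, of y2] by simp
  define z where "z = j z0"
  have "j \<in> fixg A" using j(1) jc c by (auto simp: fixg_def)
  hence "eqv A [y2, z0] [y2, z]" using jy2 by (auto simp: eqv_def z_def)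
  hence eA: "eqv A [y1, w1] [y2, z]" using eqv_mono[OF ez0 A(2)] eqv_trans by blast
  have jNx: "j \<in> fixg (N \<union> {x1})" using j(1) jN jc[of x1] c by (auto simp: fixg_def)
  have "w1 \<in> C (insert y1 X)" using i(3) by (simp add: X_def insert_commute)
  hence "z0 \<in> C (insert y2 X)" using eqv_pair_C(1)[OF ez0 order_refl] by simp
  hence "z0 \<in> C (N \<union> {x1} \<union> {y2})" by (simp add: X_def)
  hence "z \<in> C (N \<union> {x1} \<union> {y2})" using fixg_C_mem[OF jNx, of z0 "{y2}"] jy2 by (simp add: z_def)
  hence "z \<in> C (insert y2 X)" by (simp add: X_def)
  moreover have "y2 \<notin> C X" "y1 \<notin> C X" using y2X i(1) by (simp_all add: X_def)
  ultimately have "dm X [y2, z] = dm X [y1, w1]" using \<open>w1 \<in> C (insert y1 X)\<close> by simp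
  hence 1: "eqv X [y1, w1] [y2, z]" using A(3)[OF eA] by blast
  have "j (h x) = x" if "x \<in> Y" for x
  proof -
    have "h x \<in> Y" using that hY by blast
    thus ?thesis using j(2) hG by simp
  qed
  hence "j \<circ> h \<in> fixg Y" using j(1) hG G_comp by (simp add: fixg_def)
  moreover have "j x1 = x1" using jc c by simp
  ultimately have "eqv Y [x2, w2] [x1, z]"
    using eqvI[of "j \<circ> h" Y "[x2, w2]" "[x1, z]"] by (simp add: h(2,4) z_def)
  thus ?thesis using 1 by (auto simp: X_def Y_def)
qed

text \<open>Lines are composed. Two free conjugate lines with the same abscissa \<open>n\<close>
  have independent ordinates \<open>t1\<close>, \<open>t2\<close>, which serve as the parameters of
  a third line with new abscissa \<open>r\<close>. The value \<open>l\<close> becomes a function of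
  \<open>(r, n)\<close> with the four parameters of the first two lines.\<close>

lemma ex_surface:
  assumes K: "model K" and L: "line K x b1 b2 y"
  shows "\<exists>n w11 w12 w21 w22 t1 t2 r l. indl K [w11, w12, w21, w22, n, r] \<and>
    line K n w11 w12 t1 \<and> line K n w21 w22 t2 \<and> line K r t1 t2 l"
proof -
  have KG: "ctbl_gen K" "C K = K" using modelD[OF K] by auto
  define H where "H = C (K \<union> {x})"
  have HG: "ctbl_gen H" unfolding H_def by (rule ctbl_gen_C[OF KG(1)]) simp
  have KH: "K \<subseteq> H" "x \<in> H" using ext[of "K \<union> {x}"] by (auto simp: H_def)
  have ib: "indl K [b1, b2, x]" and y: "y \<in> C (K \<union> {x, b1, b2})" "y \<notin> C (K \<union> {x, b1})" "y \<notin> C (K \<union> {x, b2})"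
    using L by (auto simp: line_def)
  have "indl K [x, b1, b2]" by (rule indl_set_cong[OF ib]) auto
  hence x: "x \<notin> C K" and b: "b1 \<notin> C (K \<union> {x})" "b2 \<notin> C (K \<union> {x, b1})"
    by (simp_all add: indl_Cons insert_commute)
  have "dm H [b1, b2, y] = dm (K \<union> {x}) [b1, b2, y]" unfolding H_def by (rule dm_C)
  hence dH: "dm H [b1, b2, y] = 2" using b y(1) by (simp add: insert_commute)
  \<comment> \<open>A second line at the same abscissa \<open>x\<close>, free from the first one
    over the closure of \<open>K\<close> and \<open>x\<close>.\<close>
  obtain g where g: "g \<in> fixg H" "dm (H \<union> {b1, b2, y}) (map g [b1, b2, y]) = dm H [b1, b2, y]"
    using copy[OF HG, of "{b1, b2, y}" "[b1, b2, y]"] by auto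
  define w21 w22 t2 where "w21 = g b1" and "w22 = g b2" and "t2 = g y"
  have gx: "g x = x" using g(1) KH fixgD(2) by blast
  have gK: "g \<in> fixg K" using fixg_mono[OF KH(1)] g(1) by blast
  have "eqv K [x, b1, b2, y] [x, w21, w22, t2]" using gK gx by (auto simp: eqv_def w21_def w22_def t2_def)
  hence L2: "line K x w21 w22 t2" using line_eqv[OF L] by blast
  have t2: "t2 \<in> C (K \<union> {x, w21, w22})" "t2 \<notin> C (K \<union> {x, w21})" using L2 by (auto simp: line_def)
  define S where "S = K \<union> {x, b1, b2}"
  have "C (H \<union> {b1, b2, y}) = C (K \<union> {x} \<union> {b1, b2, y})" unfolding H_def by (rule C_Un_C(1))
  also have "\<dots> = C (insert y S)" by (simp add: S_def insert_commute)
  also have "\<dots> = C S" using C_insert_in y(1) S_def by simp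
  finally have "dm S (map g [b1, b2, y]) = dm (H \<union> {b1, b2, y}) (map g [b1, b2, y])"
    by (rule dm_cong[symmetric])
  hence "dm S (map g [b1, b2, y]) = 2" unfolding g(2) dH .
  hence dS: "dm S [w21, w22, t2] = 2" unfolding w21_def w22_def t2_def list.map .
  have "t2 \<in> C (insert w22 (insert w21 S))" by (rule C_mono_in[OF t2(1)]) (auto simp: S_def)
  hence iw: "indl S [w21, w22]" using dS by (simp add: indl_def)
  have t2S: "t2 \<notin> C S"
  proof
    assume t: "t2 \<in> C S"
    have "w22 \<in> C (insert t2 (K \<union> {x, w21}))" by (rule exch) (use t2 in \<open>simp_all add: insert_commute\<close>)
    hence "w22 \<in> C (insert t2 (insert w21 S))" by (rule C_mono_in) (auto simp: S_def)
    moreover have "C (insert t2 (insert w21 S)) = C (insert w21 S)"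
      by (rule C_insert_in) (rule C_mono_in[OF t], auto)
    ultimately show False using iw by (simp add: indl_Cons)
  qed
  have "indl K ([x, b1, b2] @ [w21, w22])" unfolding indl_append
    using \<open>indl K [x, b1, b2]\<close> iw by (simp add: S_def)
  hence i5: "indl K ([b1, b2, w21, w22] @ [x])"
    by (rule indl_set_cong) auto
  define T where "T = K \<union> {x, b1, b2, w21, w22}"
  have "countable {x, b1, b2, w21, w22}" by simp
  then obtain r where r: "r \<notin> C T" unfolding T_def using unctbl_gen[OF KG(1)] by blast
  have "indl (K +@ ([b1, b2, w21, w22] @ [x])) [r]" using r by (simp add: indl_Cons T_def insert_commute)
  hence i6: "indl K (([b1, b2, w21, w22] @ [x]) @ [r])" using i5 indl_append by blast
  have t1T: "y \<in> C T" by (rule C_mono_in[OF y(1)]) (auto simp: T_def)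
  have t2T: "t2 \<in> C T" by (rule C_mono_in[OF t2(1)]) (auto simp: T_def)
  have "y \<notin> C K" using y(2) C_mono_in[of y K] by blast
  moreover have "t2 \<notin> C (insert y K)"
  proof
    assume "t2 \<in> C (insert y K)"
    moreover have "insert y K \<subseteq> C S" using y(1) ext[of S] by (auto simp: S_def)
    ultimately show False using t2S C_sub by blast
  qed
  moreover have "r \<notin> C (insert t2 (insert y K))"
  proof
    assume "r \<in> C (insert t2 (insert y K))"
    moreover have "insert t2 (insert y K) \<subseteq> C T" using t1T t2T ext[of T] by (auto simp: T_def)
    ultimately show False using r C_sub by blast
  qed
  ultimately have "indl K [y, t2, r]" by (simp add: indl_Cons)
  \<comment> \<open>The two ordinates and \<open>r\<close> are independent over \<open>K\<close>,
    hence conjugate to the parameters and the abscissa of the given line, and this conjugation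
    carries its value along.\<close>
  then obtain k where k: "k \<in> fixg K" "map k [b1, b2, x] = [y, t2, r]"
    using generic_list_fix[OF KG(1) ib, of "[y, t2, r]"] by auto
  have "eqv K [x, b1, b2, y] [r, y, t2, k y]" using k by (auto simp: eqv_def)
  hence "line K r y t2 (k y)" using line_eqv[OF L] by blast
  moreover have "indl K [b1, b2, w21, w22, x, r]" using i6 by simp
  ultimately show ?thesis using L L2 by blast
qed

text \<open>Over the four parameters \<open>W\<close> two generic points of the surface have rank 4,
  while their six coordinates have rank at most 6 over \<open>K\<close>. Hence \<open>W\<close> has
  rank at least 2 over the two points. A third point \<open>q3\<close> from which \<open>W\<close>
  stays free does not lower this rank, yet \<open>q3\<close> and the single value \<open>t13\<close>
  are enough to recover \<open>W\<close>.\<close>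

lemma no_line:
  assumes K: "model K" and L: "line K x b1 b2 y"
  shows False
proof -
  obtain n w11 w12 w21 w22 t1 t2 r l where S: "indl K [w11, w12, w21, w22, n, r]"
    "line K n w11 w12 t1" "line K n w21 w22 t2" "line K r t1 t2 l"
    using ex_surface[OF assms] by blast
  define W where "W = [w11, w12, w21, w22]"
  define N where "N = C (K +@ W)"
  have MN: "model N" unfolding N_def by (rule model_C[OF K]) (simp add: countable_finite)
  have CN: "C N = N" using modelD(2)[OF MN] .
  have KN: "K \<subseteq> N" "set W \<subseteq> N" using ext[of "K +@ W"] by (auto simp: N_def)
  have NC: "C (N \<union> A) = C (K +@ W \<union> A)" for A unfolding N_def by (rule C_Un_C(1))
  have intoN: "z \<in> C (N \<union> A)" if "z \<in> C (K \<union> B)" "B \<subseteq> C (N \<union> A)" for z A B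
  proof (rule C_trans[OF that(1)])
    show "K \<union> B \<subseteq> C (N \<union> A)" using that(2) KN ext[of "N \<union> A"] by auto
  qed
  have iW: "indl K W" "indl N [n, r]"
  proof -
    have "indl K (W @ [n, r])" using S(1) by (simp add: W_def)
    thus "indl K W" "indl N [n, r]" unfolding indl_append by (simp_all add: N_def)
  qed
  have WP: "set W \<subseteq> P"
  proof -
    have "z \<in> P" if "z \<in> set zs" "indl K' zs" for z zs K'
      using that
    proof (induction zs arbitrary: K')
      case (Cons a zs)
      thus ?case using not_loop_P by (auto simp: indl_Cons)
    qed simp
    thus ?thesis using iW(1) by blast
  qed
  have t1: "t1 \<in> C (K \<union> {n, w11, w12})" and t2: "t2 \<in> C (K \<union> {n, w21, w22})"
    and om: "l \<in> C (K \<union> {r, t1, t2})" using S by (auto simp: line_def)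
  have "{n, w11, w12} \<subseteq> C (N \<union> {n})" "{n, w21, w22} \<subseteq> C (N \<union> {n})"
    using KN(2) ext[of "N \<union> {n}"] by (auto simp: W_def)
  hence tN: "t1 \<in> C (N \<union> {n})" "t2 \<in> C (N \<union> {n})" using intoN t1 t2 by blast+
  have tN': "t1 \<in> C (N \<union> {r, n})" "t2 \<in> C (N \<union> {r, n})"
    using C_mono_in[OF tN(1), of "N \<union> {r, n}"] C_mono_in[OF tN(2), of "N \<union> {r, n}"] by auto
  have omN: "l \<in> C (N \<union> {r, n})" by (rule intoN[OF om]) (use tN' in \<open>auto intro: in_C\<close>)
  have eta: "n \<notin> C N" "r \<notin> C (N \<union> {n})" using iW(2) by (simp_all add: indl_Cons)
  have xi: "r \<notin> C N" using eta(2) C_mono_in[of r N] by blast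
  have eta2: "n \<notin> C (N \<union> {r})" using exch_iff[OF eta(1) xi] eta(2) by simp
  have qP: "{r, n, l} \<subseteq> P" using eta not_loop_P S(4) by (auto simp: line_def)
  define q where "q = [r, n, l, t1, t2]"
  obtain g where g: "g \<in> fixg N" "dm (N +@ q) (map g q) = dm N q"
    using copy[OF modelD(1)[OF MN], of "set q" q] by (auto simp: countable_finite)
  define r2 n2 l2 t12 t22 where "r2 = g r" "n2 = g n" "l2 = g l" "t12 = g t1" "t22 = g t2"
  note g_defs = this
  have gG: "g \<in> Aut" using g fixgD by blast
  have e12: "eqv N [r, n, l, t1, t2] [r2, n2, l2, t12, t22]" using g(1) by (auto simp: eqv_def g_defs)
  have mem_g: "g z \<in> C (N \<union> g ` A) \<longleftrightarrow> z \<in> C (N \<union> A)" for z A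
    using G_C_mem[OF gG, of z "N \<union> A"] fixg_image[OF g(1), of N] by (simp add: image_Un)
  have tN2: "t12 \<in> C (N \<union> {n2})" "t22 \<in> C (N \<union> {n2})" "l2 \<in> C (N \<union> {r2, n2})"
    using mem_g[of t1 "{n}"] mem_g[of t2 "{n}"] mem_g[of l "{r, n}"] tN omN by (simp_all add: g_defs)
  have span_q: "set [r, n, l, t1, t2] \<subseteq> C (N +@ [r, n])"
    using tN' omN in_C[of r "N \<union> {r, n}"] in_C[of n "N \<union> {r, n}"] by simp
  have d2: "dm N q = 2"
  proof -
    have "dm N q = dm N [r, n]" unfolding q_def
      by (rule antisym) (rule dm_mono[OF span_q], rule dm_mono, use in_C[of _ "N +@ [r, n, l, t1, t2]"] in simp)
    thus ?thesis using xi eta2 by simp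
  qed
  have ind4: "indl N [r, n, r2, n2]"
  proof -
    have "set (map g q) \<subseteq> C (N +@ q +@ [r2, n2])"
    proof -
      have "g z \<in> C (N \<union> g ` set [r, n])" if "z \<in> set q" for z
        using mem_g[of z "set [r, n]"] span_q that unfolding q_def by blast
      hence "set (map g q) \<subseteq> C (N +@ [r2, n2])" by (auto simp: g_defs)
      thus ?thesis using mono[of "N +@ [r2, n2]" "N +@ q +@ [r2, n2]"] by blast
    qed
    hence "2 \<le> dm (N +@ q) [r2, n2]" using dm_mono g(2) d2 by fastforce
    hence "indl (N +@ q) [r2, n2]" using dm_le_length[of "N +@ q" "[r2, n2]"] by (simp add: indl_def)
    hence "indl (N +@ [r, n]) [r2, n2]"
      by (rule indl_antimono) (use ext[of "N +@ q"] in \<open>auto simp: q_def\<close>)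
    moreover have "indl N [r, n]" using xi eta2 by (simp add: indl_Cons)
    ultimately have "indl N ([r, n] @ [r2, n2])" unfolding indl_append by blast
    thus ?thesis by simp
  qed
  define p1 p2 where "p1 = [r, n, l]" and "p2 = [r2, n2, l2]"
  define Q where "Q = set p1 +@ p2"
  have ep: "eqv N p1 p2" using e12 by (auto simp: eqv_def p1_def p2_def)
  have p1P: "set p1 \<subseteq> P" using qP by (simp add: p1_def)
  have free: "dm (K +@ W +@ p2) p1 = dm (K +@ W) p1"
  proof -
    have "indl N ([r2, n2] @ [r, n])" by (rule indl_comm[THEN iffD1]) (use ind4 in simp)
    hence "indl N [r2, n2]" "indl (N +@ [r2, n2]) [r, n]" unfolding indl_append by blast+
    moreover have "indl N [r, n]" using xi eta2 by (simp add: indl_Cons)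
    ultimately have "dm (N +@ [r2, n2]) [r, n] = dm N [r, n]" by (simp add: indl_def)
    hence "dm (N +@ p2) p1 = dm N p1"
      by (rule free_sub)
        (use span_q tN2(3) in_C[of r2 "N \<union> {r2, n2}"] in_C[of n2 "N \<union> {r2, n2}"] in \<open>auto simp: p1_def p2_def\<close>)
    moreover have "dm (N +@ p2) p1 = dm (K +@ W +@ p2) p1" by (rule dm_cong) (rule NC)
    ultimately show ?thesis by (simp add: N_def)
  qed
  \<comment> \<open>Rigidity is used here: it supplies the third point of the surface from which
    \<open>W\<close> is free over the first two, while its coordinate \<open>n3\<close> is generic
    over \<open>N\<close> and these two points.\<close>
  obtain q3 where q3: "eqv N p1 q3" "dm (K +@ p1 +@ p2 +@ q3) W = dm (K +@ p1 +@ p2) W"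
    "\<forall>i < length p1. p1 ! i \<notin> C (K +@ W) \<longrightarrow> q3 ! i \<notin> C (K +@ W +@ p1 +@ p2)"
    using free_incident_copy[OF K WP p1P ep[unfolded N_def] free] unfolding N_def by blast
  obtain h where h: "h \<in> fixg N" "map h p1 = q3" using q3(1) by (rule eqvE)
  define r3 n3 l3 t13 t23 where "r3 = h r" "n3 = h n" "l3 = h l" "t13 = h t1" "t23 = h t2"
  note h_defs = this
  have q3': "q3 = [r3, n3, l3]" using h(2) by (simp add: p1_def h_defs)
  have e13: "eqv N [r, n, l, t1, t2] [r3, n3, l3, t13, t23]" using h(1) by (auto simp: eqv_def h_defs)
  have eta3: "n3 \<notin> C (N \<union> Q)"
    using q3(3)[rule_format, of 1] eta(1) NC[of Q] by (simp add: q3' p1_def N_def Q_def Un_assoc)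
  have hG: "h \<in> Aut" using h fixgD by blast
  have mem_h: "h z \<in> C (N \<union> h ` A) \<longleftrightarrow> z \<in> C (N \<union> A)" for z A
    using G_C_mem[OF hG, of z "N \<union> A"] fixg_image[OF h(1), of N] by (simp add: image_Un)
  have tN3: "t13 \<in> C (N \<union> {n3})" "t23 \<in> C (N \<union> {n3})"
    using mem_h[of t1 "{n}"] mem_h[of t2 "{n}"] tN by (simp_all add: h_defs)
  have i: "r2 \<notin> C (N \<union> {r, n})" "n2 \<notin> C (N \<union> {r, n, r2})"
    using ind4 by (simp_all add: indl_Cons insert_commute)
  have ind4': "indl N [r2, n2, r, n]" by (rule indl_set_cong[OF ind4]) auto
  hence i': "r \<notin> C (N \<union> {r2, n2})" "n \<notin> C (N \<union> {r2, n2, r})" "n2 \<notin> C (N \<union> {r2})" "r2 \<notin> C N"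
    by (simp_all add: indl_Cons insert_commute)
  have sub: "z \<notin> C (N \<union> B)" if "z \<notin> C (N \<union> A)" "B \<subseteq> A" for z A B
    using that C_mono_in[of z "N \<union> B" "N \<union> A"] by blast
  have eta2N: "n2 \<notin> C N" using sub[OF i'(3), of "{}"] by simp
  have eta3N: "n3 \<notin> C N" using sub[OF eta3, of "{}"] by simp
  have exN: "a \<notin> C (N \<union> insert b A)" if "a \<notin> C (N \<union> A)" "b \<notin> C (N \<union> insert a A)" for a b A
    using that exch[of a b "N \<union> A"] by auto
  have q2P: "{r2, n2, l2} \<subseteq> P" using eqv_P[OF ep p1P] by (simp add: p2_def)
  have e123: "eqv N [r, n, l] [r2, n2, l2]" "eqv N [r, n, l] [r3, n3, l3]"
    using ep q3(1) by (simp_all add: p1_def p2_def q3')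
  have e213: "eqv N [r2, n2, l2] [r, n, l]" "eqv N [r2, n2, l2] [r3, n3, l3]"
    using e123 eqv_sym eqv_trans by blast+
  have xi_eta3: "r \<notin> C (N \<union> {n3})"
    using exN[of r "{}" n3] xi sub[OF eta3, of "{r}"] by (auto simp: Q_def p1_def)
  have xi2_eta3: "r2 \<notin> C (N \<union> {n3})"
    using exN[of r2 "{}" n3] i'(4) sub[OF eta3, of "{r2}"] by (auto simp: Q_def p2_def)
  \<comment> \<open>\<open>u\<close>, \<open>m1\<close>, \<open>v\<close>, \<open>m2\<close> are
    values of the surface at \<open>(r, n2)\<close>, \<open>(r, n3)\<close>, \<open>(r2, n)\<close>,
    \<open>(r2, n3)\<close>. Each lies on the required branches of both slices through its argument,
    which is what \<open>common_branch\<close> provides.\<close>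
  obtain u where u: "eqv (C (N \<union> {r})) [n, l] [n2, u]" "eqv (C (N \<union> {n2})) [r2, l2] [r, u]"
    using common_branch[OF MN qP e123(1) eta2 eta(1) omN] sub[OF i'(1), of "{n2}"] by auto
  obtain m1 where m1: "eqv (C (N \<union> {r})) [n, l] [n3, m1]" "eqv (C (N \<union> {n3})) [r3, l3] [r, m1]"
    using common_branch[OF MN qP e123(2) eta2 eta(1) omN xi_eta3] by auto
  obtain v where v: "eqv (C (N \<union> {r2})) [n2, l2] [n, v]" "eqv (C (N \<union> {n})) [r, l] [r2, v]"
    using common_branch[OF MN q2P e213(1) i'(3) eta2N tN2(3)] sub[OF i(1), of "{n}"] by auto
  obtain m2 where m2: "eqv (C (N \<union> {r2})) [n2, l2] [n3, m2]" "eqv (C (N \<union> {n3})) [r3, l3] [r2, m2]"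
    using common_branch[OF MN q2P e213(2) i'(3) eta2N tN2(3) xi2_eta3] by auto
  \<comment> \<open>A slice with fixed first coordinate is a curve whose parameter is
    \<open>W\<close> together with that coordinate, so two of its points determine a third
    value.\<close>
  have slice: "z \<in> C (K \<union> {y1, w1, n3, m, y2})"
    if "x1 \<in> P" "w1 \<in> P" "y1 \<notin> C (N \<union> {x1})" "w1 \<in> C (N \<union> {x1, y1})"
      "eqv (C (N \<union> {x1})) [y1, w1] [n3, m]" "eqv (C (N \<union> {x1})) [y1, w1] [y2, z]"
      "y2 \<notin> C (N \<union> {x1, y1})" "{x1, y1, y2} \<subseteq> Q" for x1 y1 w1 y2 m z
  proof -
    define s where "s = x1 # W"
    have sC: "C (K +@ s \<union> A) = C (N \<union> insert x1 A)" for A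
    proof -
      have "K +@ s \<union> A = K +@ W \<union> insert x1 A" by (auto simp: s_def)
      thus ?thesis using NC[of "insert x1 A"] by simp
    qed
    have s0: "C (K +@ s) = C (N \<union> {x1})" using sC[of "{}"] by simp
    have e3: "n3 \<notin> C (N \<union> {x1, y1})" "n3 \<notin> C (N \<union> {y2, x1, y1})"
      using sub[OF eta3, of "{x1, y1}"] sub[OF eta3, of "{y2, x1, y1}"] that(8) by auto
    have "y2 \<notin> C (N \<union> insert n3 {x1, y1})" by (rule exN) (use that(7) e3 in auto)
    hence y2: "y2 \<notin> C (N \<union> {x1, y1, n3})" by (simp add: insert_commute)
    show ?thesis
    proof (rule third_point[OF K, of s y1 w1 n3 m y2 z])
      show "set s \<subseteq> P" using WP that(1) by (simp add: s_def)
      show "w1 \<in> C (K +@ s \<union> {y1})" using sC[of "{y1}"] that(4) by simp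
      show "n3 \<notin> C (K +@ s \<union> {y1})" using sC[of "{y1}"] e3 by simp
      show "y2 \<notin> C (K +@ s \<union> {y1, n3})" using sC[of "{y1, n3}"] y2 by simp
    qed (use that s0 in auto)
  qed
  have Qm: "{r, n, l, r2, n2, l2} = Q" by (auto simp: Q_def p1_def p2_def)
  \<comment> \<open>Three points of the surface and one parameter of the slice at \<open>n3\<close>:
    from these all of \<open>W\<close> is recovered below.\<close>
  define Z where "Z = K \<union> Q +@ q3 \<union> {t13}"
  have inZ: "z \<in> C Z" if "z \<in> C (K \<union> B)" "B \<subseteq> C Z" for z B
  proof (rule C_trans[OF that(1)])
    show "K \<union> B \<subseteq> C Z" using that(2) ext[of Z] by (auto simp: Z_def)
  qed
  have Zm: "Q \<subseteq> C Z" "set q3 \<subseteq> C Z" "t13 \<in> C Z" using ext[of Z] by (auto simp: Z_def)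
  have Zm': "r \<in> C Z" "n \<in> C Z" "l \<in> C Z" "r2 \<in> C Z" "n2 \<in> C Z" "l2 \<in> C Z" "r3 \<in> C Z" "n3 \<in> C Z" "l3 \<in> C Z"
    using Zm Qm q3' by auto
  have eK: "eqv K a b" if "eqv N a b" for a b using eqv_mono[OF that KN(1)] .
  have L3: "line K r3 t13 t23 l3"
    by (rule line_eqv[OF S(4)]) (use eK[OF e13] in \<open>auto simp: eqv_def\<close>)
  have L2: "line K r2 t12 t22 l2"
    by (rule line_eqv[OF S(4)]) (use eK[OF e12] in \<open>auto simp: eqv_def\<close>)
  \<comment> \<open>The slice at \<open>n3\<close> is a line with parameters \<open>t13\<close>,
    \<open>t23\<close>; its value \<open>l3\<close> depends on each of them, so exchange yields the
    second from the first.\<close>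
  have t23: "t23 \<in> C Z"
  proof -
    have "l3 \<in> C (insert t23 (K \<union> {r3, t13}))" "l3 \<notin> C (K \<union> {r3, t13})"
      using L3 by (auto simp: line_def insert_commute)
    hence "t23 \<in> C (K \<union> {l3, r3, t13})" using exch by fastforce
    thus ?thesis by (rule inZ) (use Zm Zm' in auto)
  qed
  \<comment> \<open>Both parameters of the slice at \<open>n3\<close> are now known, hence also its
    values at \<open>r\<close> and at \<open>r2\<close>.\<close>
  have mZ: "m \<in> C Z" if "eqv (C (N \<union> {n3})) [r3, l3] [a, m]" "a \<in> C Z" for a m
  proof -
    have "K \<union> {t13, t23} \<subseteq> C (N \<union> {n3})" using tN3 KN ext[of "N \<union> {n3}"] by auto
    moreover have "l3 \<in> C (insert r3 (K \<union> {t13, t23}))" using L3 by (simp add: line_def)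
    ultimately have "m \<in> C (insert a (K \<union> {t13, t23}))" using eqv_pair_C(1)[OF that(1)] by blast
    hence "m \<in> C (K \<union> {a, t13, t23})" by simp
    thus ?thesis by (rule inZ) (use that(2) Zm t23 in auto)
  qed
  have mm: "m1 \<in> C Z" "m2 \<in> C Z" using mZ m1(2) m2(2) Zm' by blast+
  \<comment> \<open>Along the slice at \<open>r\<close> the values at \<open>n\<close> and
    \<open>n3\<close> determine the value at \<open>n2\<close>; likewise, along the slice at
    \<open>r2\<close>, the values at \<open>n2\<close> and \<open>n3\<close> determine the value at
    \<open>n\<close>.\<close>
  have uZ: "u \<in> C Z"
  proof -
    have "u \<in> C (K \<union> {n, l, n3, m1, n2})"
      by (rule slice[of r]) (use qP eta2 omN m1 u sub[OF i(2), of "{r, n}"] Qm in auto)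
    thus ?thesis by (rule inZ) (use Zm' mm in auto)
  qed
  have vZ: "v \<in> C Z"
  proof -
    have "v \<in> C (K \<union> {n2, l2, n3, m2, n})"
      by (rule slice[of r2]) (use q2P i'(3) tN2(3) m2 v sub[OF i'(2), of "{r2, n2}"] Qm in auto)
    thus ?thesis by (rule inZ) (use Zm' mm in auto)
  qed
  have line_in: "{b1, b2} \<subseteq> C Z"
    if "line K x b1 b2 y" "eqv (C (N \<union> A)) [x, y] [x', y']" "x' \<notin> C (N \<union> insert x A)"
      "{b1, b2} \<subseteq> C (N \<union> A)" "x \<in> C Z" "y \<in> C Z" "x' \<in> C Z" "y' \<in> C Z" for x b1 b2 y x' y' A
  proof -
    have "C (K \<union> {b1, b2}) \<subseteq> C (N \<union> A)" by (rule C_sub) (use that(4) KN ext[of "N \<union> A"] in auto)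
    hence "eqv (C (K \<union> {b1, b2})) [x, y] [x', y']" using that(2) eqv_mono by blast
    moreover have "x' \<notin> C (K \<union> {b1, b2, x})"
    proof
      assume "x' \<in> C (K \<union> {b1, b2, x})"
      hence "x' \<in> C (N \<union> insert x A)"
        by (rule intoN) (use that(4) mono[of "N \<union> A" "N \<union> insert x A"] in_C[of x "N \<union> insert x A"] in auto)
      thus False using that(3) by blast
    qed
    ultimately have "{b1, b2} \<subseteq> C (K \<union> {x, y, x', y'})" using that(1) unfolding line_def by blast
    thus ?thesis using inZ[of _ "{x, y, x', y'}"] that(5-8) by blast
  qed
  \<comment> \<open>The slice at \<open>n\<close> is a line containing the two known points
    \<open>(r, l)\<close> and \<open>(r2, v)\<close>, so its parameters are known. The slice at
    \<open>n2\<close> is treated with \<open>(r2, l2)\<close> and \<open>(r, u)\<close>.\<close>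
  have "{t1, t2} \<subseteq> C Z"
    by (rule line_in[OF S(4) v(2)]) (use sub[OF i(1), of "{r, n}"] tN Zm' vZ in auto)
  moreover have "{t12, t22} \<subseteq> C Z"
    by (rule line_in[OF L2 u(2)]) (use sub[OF i'(1), of "{r2, n2}"] tN2 Zm' uZ in auto)
  ultimately have tZ: "t1 \<in> C Z" "t2 \<in> C Z" "t12 \<in> C Z" "t22 \<in> C Z" by auto
  have eN: "eqv (C (N \<union> {})) [n, t1] [n2, t12]" "eqv (C (N \<union> {})) [n, t2] [n2, t22]"
    using e12 CN by (auto simp: eqv_def)
  have eta2eta: "n2 \<notin> C (N \<union> insert n {})" by (rule sub[OF i(2)]) auto
  have WN: "{w11, w12} \<subseteq> C (N \<union> {})" "{w21, w22} \<subseteq> C (N \<union> {})" using KN CN by (auto simp: W_def)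
  \<comment> \<open>The parameters of the slices are themselves points on the two original lines, at
    the abscissas \<open>n\<close> and \<open>n2\<close>; two points give back the parameters of
    each line.\<close>
  have "{w11, w12} \<subseteq> C Z" by (rule line_in[OF S(2) eN(1) eta2eta WN(1)]) (use Zm' tZ in auto)
  moreover have "{w21, w22} \<subseteq> C Z" by (rule line_in[OF S(3) eN(2) eta2eta WN(2)]) (use Zm' tZ in auto)
  ultimately have WZ: "set W \<subseteq> C (K \<union> Q +@ q3 +@ [t13])" by (simp add: W_def Z_def)
  \<comment> \<open>The rank of \<open>W\<close> over the two points is not changed by adding
    \<open>q3\<close>, and then \<open>t13\<close> alone spans it. The count
    \<open>4 + 4 - 6\<close> below gives the opposite bound 2.\<close>
  have "dm (K \<union> Q +@ q3) W \<le> dm (K \<union> Q +@ q3) [t13]" by (rule dm_mono[OF WZ])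
  hence le1: "dm (K \<union> Q) W \<le> 1" using q3(2) dm_le_length[of "K \<union> Q +@ q3" "[t13]"] by (simp add: Q_def Un_assoc)
  have "dm K (p1 @ p2) \<le> 6" using dm_le_length[of K "p1 @ p2"] by (simp add: p1_def p2_def)
  moreover have "4 \<le> dm (K +@ W) (p1 @ p2)"
  proof -
    have "dm N [r, n, r2, n2] \<le> dm N (p1 @ p2)"
      by (rule dm_mono) (use in_C[of _ "N +@ (p1 @ p2)"] in \<open>auto simp: p1_def p2_def\<close>)
    thus ?thesis using ind4 by (simp add: indl_def N_def)
  qed
  moreover have "dm K W = 4" using iW(1) by (simp add: indl_def W_def)
  moreover have "dm K W + dm (K +@ W) (p1 @ p2) = dm K (p1 @ p2) + dm (K +@ (p1 @ p2)) W"
    by (rule dm_sym)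
  ultimately have "2 \<le> dm (K +@ (p1 @ p2)) W" by linarith
  thus False using le1 by (simp add: Q_def)
qed

text \<open>One generic point determines the curve: were the second value independent of it, the
  previous construction would give a line.\<close>

theorem modular_over_model:
  assumes K: "model K" and s: "set s \<subseteq> P" and x: "x \<notin> C (K +@ s)" and y: "y \<in> C (K +@ s \<union> {x})" "y \<in> P"
    and p2: "eqv (C (K +@ s)) [x, y] [x2, y2]" "x2 \<notin> C (K +@ s \<union> {x})"
  shows "y2 \<in> C (K \<union> {x, y, x2})"
  using ex_line[OF assms] no_line by blast

end

section \<open>Modularity over a single point\<close>

context rigid_geometry
begin

lemma C_P: "C (A \<inter> P) = C A"
proof (rule C_eqI)
  show "A \<inter> P \<subseteq> C A" using ext[of A] by blast
  show "A \<subseteq> C (A \<inter> P)"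
  proof
    fix x assume "x \<in> A"
    thus "x \<in> C (A \<inter> P)"
      using off_loop[of x] C_mono_in[of x "{}" "A \<inter> P"] in_C[of x "A \<inter> P"] by blast
  qed
qed

lemma free_over_sub:
  assumes "dm K ts = dm {} ts" "set us \<subseteq> C (set ts)"
  shows "dm K us = dm {} us"
proof -
  have A: "dm (T +@ us) ts + dm T us = dm T ts" if "set us \<subseteq> C (T +@ ts)" for T
    using dm_sym[of T ts us] dm_zero[OF that] by simp
  have "set us \<subseteq> C (K +@ ts)" using assms(2) mono[of "set ts" "K +@ ts"] by blast
  note A[OF this]
  moreover note A[of "{}"]
  moreover have "dm (K +@ us) ts \<le> dm ({} +@ us) ts"
    by (rule dm_antimono) (use ext[of "K +@ us"] in auto)
  moreover have "dm K us \<le> dm {} us" by (rule dm_antimono) simp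
  ultimately show ?thesis using assms by simp
qed

lemma free_over_mem:
  assumes "dm K ts = dm {} ts" "set us \<subseteq> C (set ts)" "z \<in> C (set ts)" "z \<in> C (K +@ us)"
  shows "z \<in> C (set us)"
proof -
  have "dm K us = dm {} us" using free_over_sub[OF assms(1,2)] .
  moreover have "dm K (us @ [z]) = dm {} (us @ [z])" by (rule free_over_sub[OF assms(1)]) (use assms in simp)
  moreover have "dm K (us @ [z]) = dm K us" "dm {} (us @ [z]) = dm {} us + dm (set us) [z]"
    using assms(4) by (simp_all add: dm_append)
  ultimately have "dm (set us) [z] = 0" by linarith
  thus ?thesis by (simp split: if_splits)
qed

text \<open>The closure of an infinite sequence independent over \<open>ts\<close>. By finite
  character the rank of \<open>ts\<close> over it is already attained over a segment of the
  sequence, and each segment is free from \<open>ts\<close>.\<close>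

lemma ex_free_model: "\<exists>K. model K \<and> dm K ts = dm {} ts"
proof -
  have "ctbl_gen (C (set ts))" by (rule ctbl_gen_C0) (simp add: countable_finite)
  from independent_sequence[OF this] obtain es where es: "\<And>n. indl (C (set ts)) (es n)" "\<And>n. length (es n) = n"
    "\<And>n. set (es n) \<subseteq> set (es (Suc n))"
    by auto
  have es1: "indl (set ts) (es n)" for n using es(1)[of n] by simp
  have es0: "indl {} (es n)" for n by (rule indl_antimono[OF es1]) simp
  define E where "E = (\<Union>n. set (es n))"
  have M: "model (C E)"
  proof (rule infinite_dim_model)
    show "countable E" by (simp add: E_def countable_finite)
    show "\<exists>l. set l \<subseteq> C E \<and> indl {} l \<and> length l = n" for n
      using es0[of n] es(2)[of n] ext[of E] by (intro exI[of _ "es n"]) (auto simp: E_def)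
  qed
  obtain bs where bs: "set ts \<subseteq> C (E +@ bs)" "length bs = dm E ts" using ex_basis by blast
  obtain F where F: "F \<subseteq> E" "finite F" "set ts \<subseteq> C (F +@ bs)" using fin_C_Un[OF _ bs(1)] by auto
  obtain n where n: "F \<subseteq> set (es n)" using finite_subset_chain[of "\<lambda>n. set (es n)", OF es(3) F(2)] F(1) E_def by auto
  have "set ts \<subseteq> C (set (es n) +@ bs)" using F(3) n mono[of "F +@ bs" "set (es n) +@ bs"] by blast
  hence "dm (set (es n)) ts \<le> dm E ts" using dm_mono[of ts "set (es n)" bs] dm_le_length[of "set (es n)" bs] bs(2) by simp
  moreover have "dm ({} +@ (es n)) ts = dm {} ts"
    using es1[of n] es0[of n] dm_free_sym[of "{}" "es n" ts] by (simp add: indl_def)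
  moreover have "dm E ts \<le> dm {} ts" by (rule dm_antimono) simp
  ultimately have "dm (C E) ts = dm {} ts" by simp
  thus ?thesis using M by blast
qed

text \<open>The relation between \<open>x\<close> and \<open>y\<close> is viewed as a curve with
  parameter in the closure of \<open>d\<close> and \<open>S\<close>. A generic point
  \<open>(x1, y1)\<close> of it determines the curve; evaluating the curve at the abscissa
  \<open>d\<close> gives \<open>e\<close>, and the point \<open>(d, e)\<close> determines it again.
  So \<open>e\<close> is the required parameter, and \<open>d\<close> is the point where the curve
  is evaluated.\<close>

theorem modular_over_point:
  assumes d: "d \<notin> C {}" and S: "finite S" and y: "y \<in> C (insert d (insert x S))"
  shows "\<exists>e \<in> C (insert d S). y \<in> C {d, x, e}"
proof -
  consider "y \<in> C {d, x}" | "y \<in> C (insert d S)" | "x \<in> C (insert d S)"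
    | "y \<notin> C {d, x}" "y \<notin> C (insert d S)" "x \<notin> C (insert d S)" by blast
  thus ?thesis
  proof cases
    case 1
    thus ?thesis using in_C[of d "insert d S"] by (intro bexI[of _ d]) (simp_all add: insert_commute)
  next
    case 2
    thus ?thesis using in_C[of y "{d, x, y}"] by blast
  next
    case 3
    hence "y \<in> C (insert d S)" using y C_insert_in[OF 3] by (simp add: insert_commute)
    thus ?thesis using in_C[of y "{d, x, y}"] by blast
  next
    case 4
    have dP: "d \<in> P" "x \<in> P" "y \<in> P" using not_loop_P d 4 by blast+
    obtain s where s: "set s = insert d S \<inter> P" using finite_list S by (metis finite_Int finite_insert)
    have sP: "set s \<subseteq> P" "d \<in> set s" using s dP by auto
    have Cs: "C (set s) = C (insert d S)" unfolding s by (rule C_P)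
    have Csx: "C (set s \<union> {x}) = C (insert d (insert x S))"
      using C_Un_C(1)[of "set s" "{x}"] C_Un_C(1)[of "insert d S" "{x}"] Cs by (simp add: insert_commute)
    define ts where "ts = [x, y] @ s"
    obtain K where K: "model K" "dm K ts = dm {} ts" using ex_free_model by blast
    have KG: "ctbl_gen K" using modelD K by blast
    define H where "H = C (K +@ s)"
    have HG: "ctbl_gen H" unfolding H_def by (rule ctbl_gen_C[OF KG]) (simp add: countable_finite)
    have CH: "C H = H" by (simp add: H_def)
    have HC: "C (H \<union> A) = C (K +@ s \<union> A)" for A unfolding H_def by (rule C_Un_C(1))
    have KH: "K \<subseteq> H" "set s \<subseteq> H" using ext[of "K +@ s"] by (auto simp: H_def)
    have tsC: "set s \<subseteq> C (set ts)" "x \<in> C (set ts)" "y \<in> C (set ts)"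
      using ext[of "set ts"] by (auto simp: ts_def)
    have xH: "x \<notin> C H"
    proof
      assume "x \<in> C H"
      hence "x \<in> C (set s)" using free_over_mem[OF K(2) tsC(1,2)] by (simp add: H_def)
      thus False using Cs 4 by blast
    qed
    have ys: "y \<in> C (set s \<union> {x})" using y Csx by simp
    have yH: "y \<in> C (insert x H)" by (rule C_mono_in[OF ys]) (use KH in auto)
    obtain x1 where x1: "x1 \<notin> C (H \<union> {x})" using unctbl_gen[OF HG, of "{x}"] by auto
    have x1H: "x1 \<notin> C H" using x1 C_mono_in[of x1 H] by blast
    obtain g where g: "g \<in> fixg H" "g x = x1"
      using generic_list_fix[OF HG, of "[x]" "[x1]"] xH x1H by (auto simp: indl_Cons)
    define y1 where "y1 = g y"
    have e1: "eqv H [x, y] [x1, y1]" using g by (auto simp: eqv_def y1_def)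
    have xx1: "x \<notin> C (H \<union> {x1})" using exch_iff[OF xH x1H] x1 by simp
    have y1H: "y1 \<in> C (insert x1 H)" using eqv_pair_C(1)[OF e1, of H] yH by simp
    have P1: "x1 \<in> P" "y1 \<in> P" using eqv_P[OF e1] dP by auto
    have y1s: "y1 \<in> C (insert x1 (set s))" using eqv_pair_C(1)[OF e1 KH(2)] ys by simp
    \<comment> \<open>Modularity over \<open>K\<close> says that \<open>(x1, y1)\<close> determines
      the value at \<open>x\<close>. As \<open>K\<close> is free from all the points involved, it is
      removed afterwards.\<close>
    have yK1: "y \<in> C (K \<union> {x1, y1, x})"
    proof (rule modular_over_model[OF K(1) sP(1)])
      show "x1 \<notin> C (K +@ s)" using x1H by (simp add: H_def)
      show "y1 \<in> C (K +@ s \<union> {x1})" using y1H HC[of "{x1}"] by simp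
      show "eqv (C (K +@ s)) [x1, y1] [x, y]" using eqv_sym[OF e1] by (simp add: H_def)
      show "x \<notin> C (K +@ s \<union> {x1})" using xx1 HC[of "{x1}"] by simp
    qed (rule P1)
    define ts1 where "ts1 = ts @ [x1, y1]"
    have Kts1: "dm K ts1 = dm {} ts1"
    proof -
      have ts_sub: "K +@ ts \<subseteq> C (H \<union> {x})" using KH yH in_C[of _ "H \<union> {x}"] by (auto simp: ts_def)
      have a: "x1 \<notin> C (K +@ ts)" using x1 C_sub[OF ts_sub] by blast
      hence b: "x1 \<notin> C (set ts)" using C_mono_in[of x1 "set ts" "K +@ ts"] by blast
      have c: "y1 \<in> C (insert x1 (set ts))" by (rule C_mono_in[OF y1s]) (auto simp: ts_def)
      have "y1 \<in> C (insert x1 (K +@ ts))" by (rule C_mono_in[OF c]) auto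
      hence "dm (K +@ ts) [x1, y1] = dm ({} +@ ts) [x1, y1]" using a b c by simp
      thus ?thesis using K(2) dm_append[of K ts "[x1, y1]"] dm_append[of "{}" ts "[x1, y1]"] by (simp add: ts1_def)
    qed
    have ts1C: "set ts \<subseteq> C (set ts1)" "x1 \<in> C (set ts1)" "y1 \<in> C (set ts1)" "x \<in> C (set ts1)"
      "y \<in> C (set ts1)" "d \<in> C (set ts1)"
      using ext[of "set ts1"] sP(2) by (auto simp: ts1_def ts_def)
    have yx1: "y \<in> C (set [x1, y1, x])"
      by (rule free_over_mem[OF Kts1]) (use yK1 ts1C in simp_all)
    define M where "M = C (K \<union> {x1, y1})"
    have MG: "ctbl_gen M" unfolding M_def by (rule ctbl_gen_C[OF KG]) simp
    have MC: "C (M \<union> A) = C (K \<union> {x1, y1} \<union> A)" for A unfolding M_def by (rule C_Un_C(1))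
    have MH: "M \<subseteq> C (H \<union> {x1})" unfolding M_def
      by (rule C_sub) (use KH y1H in_C[of _ "H \<union> {x1}"] in auto)
    have xM: "x \<notin> C M" using xx1 C_sub[OF MH] by blast
    have dK: "d \<notin> C K"
    proof
      assume "d \<in> C K"
      hence "d \<in> C (set [])" using free_over_mem[OF Kts1, of "[]" d] ts1C by simp
      thus False using d by simp
    qed
    have x1d: "x1 \<notin> C (insert d K)" using x1H C_mono_in[of x1 "insert d K" H] KH sP by auto
    hence "x1 \<notin> C K" using C_mono_in[of x1 K "insert d K"] by blast
    hence dx1: "d \<notin> C (insert x1 K)" using exch_iff[OF dK] x1d by blast
    have dM: "d \<notin> C M"
    proof
      assume "d \<in> C M"
      hence "d \<in> C (insert y1 (insert x1 K))" by (simp add: M_def insert_commute)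
      hence "y1 \<in> C (insert d (insert x1 K))" using exch dx1 by blast
      hence "y1 \<in> C (insert x1 (K \<union> {d}))" by (simp add: insert_commute)
      moreover have "K \<union> {d} \<subseteq> H" using KH sP by auto
      ultimately have "y \<in> C (insert x (K \<union> {d}))" using eqv_pair_C(1)[OF e1] by blast
      hence "y \<in> C (K +@ [d, x])" by (simp add: insert_commute)
      hence "y \<in> C (set [d, x])" using free_over_mem[OF Kts1, of "[d, x]" y] ts1C by simp
      thus False using 4 by simp
    qed
    \<comment> \<open>Both \<open>x\<close> and \<open>d\<close> are generic over \<open>K\<close>,
      \<open>x1\<close> and \<open>y1\<close>, so the curve determined by \<open>(x1, y1)\<close>
      has a value \<open>e\<close> at \<open>d\<close> conjugate to its value \<open>y\<close> at
      \<open>x\<close>.\<close>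
    obtain h where h: "h \<in> fixg M" "h x = d"
      using generic_list_fix[OF MG, of "[x]" "[d]"] xM dM by (auto simp: indl_Cons)
    define e where "e = h y"
    have ed: "eqv M [x, y] [d, e]" using h by (auto simp: eqv_def e_def)
    have subM: "K \<union> {x1, y1} \<subseteq> M" "{x1, y1} \<subseteq> M" using ext[of "K \<union> {x1, y1}"] by (auto simp: M_def)
    have "y \<in> C (insert x {x1, y1})" using yx1 by (simp add: insert_commute)
    hence eC: "e \<in> C (insert d {x1, y1})" using eqv_pair_C(1)[OF ed subM(2)] by blast
    hence eM: "e \<in> C (K \<union> {x1, y1} \<union> {d})" by (rule C_mono_in) auto
    have eP: "e \<in> P" using eqv_P[OF ed] dP by simp
    have yK2: "y \<in> C (K \<union> {d, e, x})"
    proof (rule modular_over_model[OF K(1)])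
      show "set [x1, y1] \<subseteq> P" using P1 by simp
      show "d \<notin> C (K +@ [x1, y1])" using dM by (simp add: M_def)
      show "e \<in> C (K +@ [x1, y1] \<union> {d})" using eM by simp
      show "eqv (C (K +@ [x1, y1])) [d, e] [x, y]" using eqv_sym[OF ed] by (simp add: M_def)
      show "x \<notin> C (K +@ [x1, y1] \<union> {d})"
      proof
        assume "x \<in> C (K +@ [x1, y1] \<union> {d})"
        hence "x \<in> C (H \<union> {x1})"
          by (rule C_trans) (use KH sP y1H in_C[of _ "H \<union> {x1}"] in auto)
        thus False using xx1 by blast
      qed
    qed (rule eP)
    have eT: "e \<in> C (set ts1)" by (rule C_trans[OF eC]) (use ts1C in simp)
    have ye: "y \<in> C (set [d, e, x])"
      by (rule free_over_mem[OF Kts1]) (use yK2 ts1C eT in simp_all)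
    \<comment> \<open>Otherwise \<open>e\<close> would depend on \<open>x1\<close> over
      \<open>s\<close>, hence \<open>x1\<close> on \<open>e\<close> over \<open>s\<close>. But
      \<open>e\<close> is algebraic over \<open>d\<close>, \<open>x\<close>, \<open>y\<close> and so
      over \<open>s\<close> and \<open>x\<close>, while \<open>x1\<close> was chosen generic over
      these.\<close>
    have "e \<in> C (set s)"
    proof (rule ccontr)
      assume ne: "e \<notin> C (set s)"
      have "e \<in> C (insert x1 (set s))"
        by (rule C_trans[OF eC]) (use sP y1s in_C[of _ "insert x1 (set s)"] in auto)
      hence x1e: "x1 \<in> C (insert e (set s))" using exch ne by blast
      have "y \<in> C (insert e {d, x})" using ye by (simp add: insert_commute)
      hence "e \<in> C (insert y {d, x})" using exch 4 by blast
      hence "e \<in> C (set s \<union> {x})"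
        by (rule C_trans) (use sP ys in_C[of _ "set s \<union> {x}"] in auto)
      hence "insert e (set s) \<subseteq> C (set s \<union> {x})" using in_C[of _ "set s \<union> {x}"] by auto
      hence "x1 \<in> C (set s \<union> {x})" using x1e C_sub by blast
      hence "x1 \<in> C (H \<union> {x})" by (rule C_mono_in) (use KH in auto)
      thus False using x1 by blast
    qed
    thus ?thesis using ye Cs by (intro bexI[of _ e]) (simp_all add: insert_commute)
  qed
qed

end

subsection \<open>Vectors in a modular geometry\<close>

context closure_geometry
begin

lemma span_eq:
  assumes "indl S xs" "set xs \<subseteq> C (S +@ ys)" "length ys \<le> length xs"
  shows "C (S +@ xs) = C (S +@ ys)"
proof -
  have "dm S (ys @ xs) = dm S ys" using dm_append[of S ys xs] dm_zero[OF assms(2)] by simp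
  moreover have "dm S (ys @ xs) = dm S xs + dm (S +@ xs) ys" using dm_comm[of S ys xs] dm_append[of S xs ys] by simp
  ultimately have "dm (S +@ xs) ys = 0"
    using assms(1,3) dm_le_length[of S ys] by (simp add: indl_def)
  hence "set ys \<subseteq> C (S +@ xs)" by (simp add: dm_0_iff)
  thus ?thesis using assms(2) ext[of "S +@ xs"] ext[of "S +@ ys"] by (intro C_eqI) auto
qed

lemma point_eq: "z \<in> C {e} \<Longrightarrow> z \<notin> C {} \<Longrightarrow> C {z} = C {e}"
  using span_eq[of "{}" "[z]" "[e]"] by (simp add: indl_Cons)

lemma line_eq:
  assumes "z \<in> C {p, q}" "w \<in> C {p, q}" "z \<notin> C {}" "w \<notin> C {z}"
  shows "C {z, w} = C {p, q}"
  using span_eq[of "{}" "[z, w]" "[p, q]"] assms by (simp add: indl_Cons)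

lemma C_point_sub: "x \<in> C A \<Longrightarrow> C {x} \<subseteq> C A"
  by (rule C_sub) simp

lemma not_in_empty: "x \<notin> C A \<Longrightarrow> x \<notin> C {}"
  using C_mono_in[of x "{}" A] by blast

lemma exch2: "x \<in> C {y, a} \<Longrightarrow> x \<notin> C {a} \<Longrightarrow> y \<in> C {x, a}"
  using exch[of x y "{a}"] by blast

end

text \<open>\<open>modular\<close> is the projective axiom: a point in the span of \<open>x\<close>
  and a subspace lies on a line joining \<open>x\<close> to a point of that subspace.
  \<open>third\<close> excludes lines with two points only; it supplies the second component of a
  vector.\<close>

locale modular_geometry = closure_geometry C for C :: "'a set \<Rightarrow> 'a set" +
  fixes pz :: 'a
  assumes modular: "finite S \<Longrightarrow> y \<in> C (insert x S) \<Longrightarrow> \<exists>e \<in> C S. y \<in> C {x, e}"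
    and third: "x \<notin> C {} \<Longrightarrow> y \<notin> C {x} \<Longrightarrow> \<exists>z \<in> C {x, y}. z \<notin> C {x} \<and> z \<notin> C {y}"
    and infdim: "finite F \<Longrightarrow> \<exists>x. x \<notin> C F"
    and pz: "pz \<notin> C {}"
begin

text \<open>If the geometry is that of a vector space \<open>V\<close> and \<open>pz\<close> is spanned by \<open>e\<close>, then a vector
  \<open>v\<close> which is not a multiple of \<open>e\<close> is represented by the points spanned by \<open>v\<close> and \<open>e + v\<close>.\<close>

definition vrep :: "'a \<Rightarrow> 'a \<Rightarrow> bool" where
  "vrep x x' \<longleftrightarrow> x \<notin> C {pz} \<and> x' \<in> C {pz, x} \<and> x' \<notin> C {pz} \<and> x' \<notin> C {x}"

definition vect :: "('a set \<times> 'a set) set" where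
  "vect = {(C {x}, C {x'}) | x x'. vrep x x'}"

text \<open>With \<open>pz\<close> spanned by \<open>e\<close>, the points of \<open>v\<close>,
  \<open>e + v\<close> and of \<open>w\<close>, \<open>e + w\<close> are given. The line through
  \<open>e + v\<close> and \<open>w\<close> meets the line through \<open>v\<close> and
  \<open>e + w\<close> in \<open>e + v + w\<close>, which is \<open>r\<close>; the line through
  \<open>v\<close> and \<open>w\<close> meets the line through \<open>e\<close> and \<open>r\<close>
  in \<open>v + w\<close>.\<close>

definition vadd :: "'a set \<times> 'a set \<Rightarrow> 'a set \<times> 'a set \<Rightarrow> 'a set \<times> 'a set" where
  "vadd v w = (let r = C (snd v \<union> fst w) \<inter> C (fst v \<union> snd w) in
     (C (fst v \<union> fst w) \<inter> C (insert pz r), r))"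

text \<open>The vector is outside the subspace spanned by \<open>pz\<close> and \<open>F\<close>.
  Only first components enter, because the second component of a vector lies on the line joining
  \<open>pz\<close> to the first.\<close>

definition vgen :: "'a set \<times> 'a set \<Rightarrow> ('a set \<times> 'a set) set \<Rightarrow> bool" where
  "vgen u F \<longleftrightarrow> u \<in> vect \<and> \<not> fst u \<subseteq> C (insert pz (\<Union>(fst ` F)))"

lemma vrepD:
  assumes "vrep x x'"
  shows "x \<notin> C {pz}" "x' \<in> C {pz, x}" "x' \<notin> C {pz}" "x' \<notin> C {x}" "x \<notin> C {}" "x' \<notin> C {}"
    "x \<in> C {pz, x'}" "pz \<in> C {x, x'}" "pz \<notin> C {x}" "pz \<notin> C {x'}" "x \<notin> C {x'}"
proof -
  show *: "x \<notin> C {pz}" "x' \<in> C {pz, x}" "x' \<notin> C {pz}" "x' \<notin> C {x}" using assms by (auto simp: vrep_def)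
  show x: "x \<notin> C {}" "x' \<notin> C {}" using * not_in_empty by blast+
  show "x \<in> C {pz, x'}" using exch2[of x' x pz] * by (simp add: insert_commute)
  show "pz \<in> C {x, x'}" using exch2[of x' pz x] * by (simp add: insert_commute)
  show "pz \<notin> C {x}" using exch_iff[of pz "{}" x] pz x *(1) by simp
  show "pz \<notin> C {x'}" using exch_iff[of pz "{}" x'] pz x *(3) by simp
  show "x \<notin> C {x'}" using exch_iff[of x "{}" x'] x *(4) by simp
qed

lemma C_points: "C (C {x} \<union> C {y}) = C {x, y}" "C (insert z (C {x})) = C {z, x}"
  by (simp_all add: insert_commute)

lemma vadd_rep_eq:
  "vadd (C {x}, C {x'}) (C {y}, C {y'}) =
    (C {x, y} \<inter> C (insert pz (C {x', y} \<inter> C {x, y'})), C {x', y} \<inter> C {x, y'})"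
  by (simp add: vadd_def Let_def insert_commute)

text \<open>The main fact is \<open>gen\<close>: a point on the line \<open>pz, x\<close> and a
  point on the line \<open>pz, y\<close>, both different from \<open>pz\<close>, are not collinear
  with \<open>pz\<close>, since the two lines are distinct.\<close>

lemma triangle:
  assumes "vrep x x'" "vrep y y'" "y \<notin> C {pz, x}"
  shows "pz \<notin> C {x, y}" "pz \<notin> C {x', y}" "pz \<notin> C {x, y'}" "pz \<notin> C {x', y'}"
    "x \<notin> C {pz, y}" "y' \<notin> C {pz, x}" "x' \<notin> C {pz, y}" "x' \<notin> C {y}" "y' \<notin> C {x}" "x \<notin> C {y}" "y \<notin> C {x}"
    "x' \<notin> C {x, y}" "y' \<notin> C {x, y}" "x' \<notin> C {y'}"
proof -
  note x = vrepD[OF assms(1)] and y = vrepD[OF assms(2)]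
  have gen: "pz \<notin> C {p, q}" if "p \<in> C {pz, x}" "q \<in> C {pz, y}" "p \<notin> C {pz}" "q \<notin> C {pz}" for p q
  proof
    assume "pz \<in> C {p, q}"
    have "pz \<notin> C {q}" using exch_iff[of pz "{}" q] pz that(4) not_in_empty[OF that(4)] by simp
    hence "p \<in> C {pz, q}" using exch2[OF \<open>pz \<in> C {p, q}\<close>] by simp
    hence "q \<in> C {pz, p}" using exch2[of p q pz] that(3) by (simp add: insert_commute)
    moreover have "{pz, p} \<subseteq> C {pz, x}" using that(1) in_C[of pz "{pz, x}"] by simp
    ultimately have qx: "q \<in> C {pz, x}" using C_sub by blast
    have "y \<in> C {pz, q}" using exch2[of q y pz] that(2,4) by (simp add: insert_commute)
    moreover have "{pz, q} \<subseteq> C {pz, x}" using qx in_C[of pz "{pz, x}"] by simp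
    ultimately show False using C_sub assms(3) by blast
  qed
  have m: "x \<in> C {pz, x}" "y \<in> C {pz, y}" by (intro in_C; simp)+
  show pxy: "pz \<notin> C {x, y}" and p1: "pz \<notin> C {x', y}" and p2: "pz \<notin> C {x, y'}" and "pz \<notin> C {x', y'}"
    using gen m x y by blast+
  show xy: "x \<notin> C {pz, y}" using exch_iff[of x "{pz}" y] x(1) y(1) assms(3) by (simp add: insert_commute)
  show yx: "y' \<notin> C {pz, x}"
  proof
    assume "y' \<in> C {pz, x}"
    hence "{pz, y'} \<subseteq> C {pz, x}" using in_C[of pz "{pz, x}"] by simp
    thus False using y(7) C_sub assms(3) by blast
  qed
  show x'y: "x' \<notin> C {pz, y}"
  proof
    assume "x' \<in> C {pz, y}"
    hence "{pz, x'} \<subseteq> C {pz, y}" using in_C[of pz "{pz, y}"] by simp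
    thus False using x(7) C_sub xy by blast
  qed
  have mono1: "z \<notin> C {a}" if "z \<notin> C {pz, a}" for z a using that C_mono_in[of z "{a}" "{pz, a}"] by blast
  show "x' \<notin> C {y}" "y' \<notin> C {x}" "x \<notin> C {y}" "y \<notin> C {x}" using mono1 x'y yx xy assms(3) by blast+
  show "x' \<notin> C {x, y}"
  proof
    assume "x' \<in> C {x, y}"
    hence "{x, x'} \<subseteq> C {x, y}" using in_C[of x "{x, y}"] by simp
    thus False using x(8) C_sub pxy by blast
  qed
  show "y' \<notin> C {x, y}"
  proof
    assume "y' \<in> C {x, y}"
    hence "{y, y'} \<subseteq> C {x, y}" using in_C[of y "{x, y}"] by simp
    thus False using y(8) C_sub pxy by blast
  qed
  show "x' \<notin> C {y'}"
  proof
    assume "x' \<in> C {y'}"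
    moreover have "{y'} \<subseteq> C {pz, y}" using y(2) by simp
    ultimately show False using x'y C_sub by blast
  qed
qed

text \<open>Modularity makes the lines in the plane of \<open>pz\<close>, \<open>x\<close>,
  \<open>y\<close> that define the sum meet, and \<open>triangle\<close> makes the lines distinct,
  so each of the two intersections is exactly one point.\<close>

lemma vadd_rep:
  assumes x: "vrep x x'" and y: "vrep y y'" and ind: "y \<notin> C {pz, x}"
  obtains r r' where "vadd (C {x}, C {x'}) (C {y}, C {y'}) = (C {r}, C {r'})" "vrep r r'"
    "r' \<in> C {x', y}" "r' \<in> C {x, y'}" "r \<in> C {x, y}" "r \<in> C {pz, r'}" "r \<notin> C {x}" "r \<notin> C {y}"
    "r' \<notin> C {x'}" "r' \<notin> C {x}"
proof -
  note t = triangle[OF assms] and xD = vrepD[OF x] and yD = vrepD[OF y]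
  \<comment> \<open>The point \<open>x'\<close> lies in the plane of \<open>y\<close> and the line
    \<open>x, y'\<close>; modularity then gives a point \<open>r'\<close> of that line on the line
    \<open>x', y\<close>.\<close>
  have "x' \<in> C (insert y {x, y'})"
  proof (rule C_trans[OF xD(2)])
    have "pz \<in> C {y, x, y'}" by (rule C_mono_in[OF yD(8)]) auto
    thus "{pz, x} \<subseteq> C (insert y {x, y'})" using in_C[of x "{y, x, y'}"] by simp
  qed
  then obtain r' where r': "r' \<in> C {x, y'}" "x' \<in> C {y, r'}" using modular[of "{x, y'}" x' y] by auto
  have r'1: "r' \<in> C {x', y}" using exch2[of x' r' y] r'(2) t(8) by (simp add: insert_commute)
  have r'0: "r' \<notin> C {}"
  proof
    assume "r' \<in> C {}"
    hence "C {y, r'} = C {y}" using C_insert_in[of r' "{y}"] C_mono_in[of r' "{}" "{y}"] by (simp add: insert_commute)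
    thus False using r'(2) t(8) by simp
  qed
  have eq1: "C {x', y} \<inter> C {x, y'} = C {r'}"
  proof
    show "C {r'} \<subseteq> C {x', y} \<inter> C {x, y'}" using C_point_sub r'(1) r'1 by blast
    show "C {x', y} \<inter> C {x, y'} \<subseteq> C {r'}"
    proof (rule ccontr)
      assume "\<not> ?thesis"
      then obtain z where z: "z \<in> C {x', y}" "z \<in> C {x, y'}" "z \<notin> C {r'}" by blast
      have "C {x', y} = C {x, y'}" using line_eq[OF r'1 z(1) r'0 z(3)] line_eq[OF r'(1) z(2) r'0 z(3)] by simp
      hence "{y, y'} \<subseteq> C {x', y}" using in_C[of y' "{x, y'}"] in_C[of y "{x', y}"] by simp
      thus False using yD(8) C_sub t(2) by blast
    qed
  qed
  have pr': "r' \<notin> C {pz}"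
  proof
    assume "r' \<in> C {pz}"
    hence "C {r'} = C {pz}" using point_eq r'0 by blast
    thus False using C_point_sub[OF r'1] in_C[of pz "{pz}"] t(2) by auto
  qed
  \<comment> \<open>The same argument with vertex \<open>pz\<close>: projecting \<open>r'\<close>
    from \<open>pz\<close> to the line \<open>x, y\<close> gives the first component
    \<open>r\<close>.\<close>
  have "r' \<in> C (insert pz {x, y})"
  proof (rule C_trans[OF r'1])
    have "x' \<in> C {pz, x, y}" by (rule C_mono_in[OF xD(2)]) auto
    thus "{x', y} \<subseteq> C (insert pz {x, y})" using in_C[of y "{pz, x, y}"] by simp
  qed
  then obtain r where r: "r \<in> C {x, y}" "r' \<in> C {pz, r}" using modular[of "{x, y}" r' pz] by auto
  have r1: "r \<in> C {pz, r'}" using exch2[of r' r pz] r(2) pr' by (simp add: insert_commute)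
  have r0: "r \<notin> C {}"
  proof
    assume "r \<in> C {}"
    hence "C {pz, r} = C {pz}" using C_insert_in[of r "{pz}"] C_mono_in[of r "{}" "{pz}"] by (simp add: insert_commute)
    thus False using r(2) pr' by simp
  qed
  have eq2: "C {x, y} \<inter> C {pz, r'} = C {r}"
  proof
    show "C {r} \<subseteq> C {x, y} \<inter> C {pz, r'}" using C_point_sub r(1) r1 by blast
    show "C {x, y} \<inter> C {pz, r'} \<subseteq> C {r}"
    proof (rule ccontr)
      assume "\<not> ?thesis"
      then obtain z where z: "z \<in> C {x, y}" "z \<in> C {pz, r'}" "z \<notin> C {r}" by blast
      have "C {x, y} = C {pz, r'}" using line_eq[OF r(1) z(1) r0 z(3)] line_eq[OF r1 z(2) r0 z(3)] by simp
      thus False using t(1) in_C[of pz "{pz, r'}"] by simp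
    qed
  qed
  have xr': "r' \<notin> C {x'}"
  proof
    assume "r' \<in> C {x'}"
    hence "C {r'} = C {x'}" using point_eq r'0 by blast
    hence "x' \<in> C {x, y'}" using C_point_sub[OF r'(1)] in_C[of x' "{x'}"] by auto
    hence "{x, x'} \<subseteq> C {x, y'}" using in_C[of x "{x, y'}"] by simp
    thus False using xD(8) C_sub t(3) by blast
  qed
  have xr'2: "r' \<notin> C {x}"
  proof
    assume "r' \<in> C {x}"
    hence "C {r'} = C {x}" using point_eq r'0 by blast
    hence "x \<in> C {x', y}" using C_point_sub[OF r'1] in_C[of x "{x}"] by auto
    hence "{x, x'} \<subseteq> C {x', y}" using in_C[of x' "{x', y}"] by simp
    thus False using xD(8) C_sub t(2) by blast
  qed
  have sub_line: "{x, x'} \<subseteq> C {pz, x}" "{y, y'} \<subseteq> C {pz, y}"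
    using xD(2) yD(2) in_C[of x "{pz, x}"] in_C[of y "{pz, y}"] by auto
  have rx: "r \<notin> C {x}"
  proof
    assume "r \<in> C {x}"
    hence "{pz, r} \<subseteq> C {pz, x}" using C_mono_in[of r "{x}" "{pz, x}"] in_C[of pz "{pz, x}"] by auto
    hence a: "r' \<in> C {pz, x}" using r(2) C_sub by blast
    have "y' \<in> C {r', x}" using exch2[of r' y' x] r'(1) xr'2 by (simp add: insert_commute)
    moreover have "{r', x} \<subseteq> C {pz, x}" using a in_C[of x "{pz, x}"] by simp
    ultimately show False using t(6) C_sub by blast
  qed
  have ry: "r \<notin> C {y}"
  proof
    assume "r \<in> C {y}"
    hence "{pz, r} \<subseteq> C {pz, y}" using C_mono_in[of r "{y}" "{pz, y}"] in_C[of pz "{pz, y}"] by auto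
    hence a: "r' \<in> C {pz, y}" using r(2) C_sub by blast
    have "r' \<notin> C {y}"
    proof
      assume "r' \<in> C {y}"
      hence "C {r'} = C {y}" using point_eq r'0 by blast
      hence "y \<in> C {x, y'}" using C_point_sub[OF r'(1)] in_C[of y "{y}"] by auto
      hence "{y, y'} \<subseteq> C {x, y'}" using in_C[of y' "{x, y'}"] by simp
      thus False using yD(8) C_sub t(3) by blast
    qed
    hence "x' \<in> C {r', y}" using exch2[of r' x' y] r'1 by (simp add: insert_commute)
    moreover have "{r', y} \<subseteq> C {pz, y}" using a in_C[of y "{pz, y}"] by simp
    ultimately show False using t(7) C_sub by blast
  qed
  have pr: "r \<notin> C {pz}"
  proof
    assume "r \<in> C {pz}"
    hence "C {r} = C {pz}" using point_eq r0 by blast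
    thus False using C_point_sub[OF r(1)] in_C[of pz "{pz}"] t(1) by auto
  qed
  have r'r: "r' \<notin> C {r}"
  proof
    assume "r' \<in> C {r}"
    hence a: "r' \<in> C {x, y}" using C_point_sub[OF r(1)] by blast
    have "x' \<in> C {r', y}" if "r' \<notin> C {y}" using exch2[of r' x' y] r'1 that by (simp add: insert_commute)
    moreover have "{r', y} \<subseteq> C {x, y}" using a in_C[of y "{x, y}"] by simp
    ultimately have "r' \<in> C {y}" using t(12) C_sub by blast
    hence "C {r'} = C {y}" using point_eq r'0 by blast
    moreover have "C {r'} = C {r}" using point_eq \<open>r' \<in> C {r}\<close> r'0 by blast
    ultimately show False using ry in_C[of r "{r}"] by auto
  qed
  have "vrep r r'" using pr r(2) pr' r'r by (simp add: vrep_def)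
  moreover have "vadd (C {x}, C {x'}) (C {y}, C {y'}) = (C {r}, C {r'})"
    unfolding vadd_rep_eq eq1 using eq2 by simp
  ultimately show ?thesis using that r'1 r'(1) r(1) r1 rx ry xr' xr'2 by blast
qed

end

section \<open>Laws of the generic vector addition\<close>

context modular_geometry
begin

definition vspan :: "('a set \<times> 'a set) set \<Rightarrow> 'a set" where
  "vspan F = C (insert pz (\<Union>(fst ` F)))"

lemma vectE:
  assumes "v \<in> vect" obtains x x' where "v = (C {x}, C {x'})" "vrep x x'"
  using assms by (auto simp: vect_def)

lemma vectI: "vrep x x' \<Longrightarrow> (C {x}, C {x'}) \<in> vect"
  by (auto simp: vect_def)

lemma C_in_iff: "C {x} \<subseteq> C A \<longleftrightarrow> x \<in> C A"
  using C_point_sub[of x A] in_C[of x "{x}"] by blast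

lemma vgen_rep: "vrep x x' \<Longrightarrow> vgen (C {x}, C {x'}) F \<longleftrightarrow> x \<notin> vspan F"
  by (simp add: vgen_def vectI vspan_def C_in_iff)

lemma vspan_insert: "vspan (insert (C {x}, q) F) = C (insert x (insert pz (\<Union>(fst ` F))))"
proof -
  have "insert pz (\<Union>(fst ` insert (C {x}, q) F)) = C {x} \<union> insert pz (\<Union>(fst ` F))" by auto
  hence "vspan (insert (C {x}, q) F) = C (C {x} \<union> insert pz (\<Union>(fst ` F)))"
    by (simp only: vspan_def)
  also have "\<dots> = C ({x} \<union> insert pz (\<Union>(fst ` F)))" by (rule C_Un_C)
  finally show ?thesis by (simp add: insert_commute)
qed

lemma vspan_single: "vspan {(C {x}, q)} = C {pz, x}"
  using vspan_insert[of x q "{}"] by (simp add: insert_commute)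

lemma vspan_mono: "F \<subseteq> G \<Longrightarrow> vspan F \<subseteq> vspan G"
  unfolding vspan_def by (intro mono) auto

lemma C_vspan: "C (vspan F) = vspan F"
  by (simp add: vspan_def)

lemma pz_vspan: "pz \<in> vspan F"
  unfolding vspan_def by (intro in_C) simp

lemma rep_vspan: "(C {x}, q) \<in> F \<Longrightarrow> x \<in> vspan F"
  unfolding vspan_def using in_C[of x "{x}"] by (intro in_C) force

lemma C_sub_vspan: "A \<subseteq> vspan F \<Longrightarrow> C A \<subseteq> vspan F"
  using C_sub[of A "vspan F"] C_vspan by simp

lemma vgen_mono: "vgen u G \<Longrightarrow> F \<subseteq> G \<Longrightarrow> vgen u F"
  using vspan_mono[of F G] by (auto simp: vgen_def vspan_def)

lemma vgen_vect: "vgen u F \<Longrightarrow> u \<in> vect"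
  by (simp add: vgen_def)

lemma ind_sym: "vrep x x' \<Longrightarrow> vrep y y' \<Longrightarrow> x \<notin> C {pz, y} \<Longrightarrow> y \<notin> C {pz, x}"
  using triangle(5) by blast

lemma vadd_comm: "vadd v w = vadd w v"
  by (simp add: vadd_def Let_def Un_commute Int_commute)

lemma ex_vgen:
  assumes "finite F" "F \<subseteq> vect"
  shows "\<exists>u. vgen u F"
proof -
  have "\<exists>G. finite G \<and> vspan F = C G"
    using assms
  proof (induction rule: finite_induct)
    case empty
    thus ?case by (intro exI[of _ "{pz}"]) (simp add: vspan_def)
  next
    case (insert v F)
    then obtain G where G: "finite G" "vspan F = C G" by auto
    obtain x x' where x: "v = (C {x}, C {x'})" using insert(4) by (auto simp: vect_def)
    have "vspan (insert v F) = C (insert x (vspan F))"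
      unfolding x vspan_insert by (simp add: vspan_def)
    thus ?case using G by (intro exI[of _ "insert x G"]) simp
  qed
  then obtain G where G: "finite G" "vspan F = C G" by blast
  obtain x where x: "x \<notin> C G" using infdim G(1) by blast
  have "C {pz} \<subseteq> C G" unfolding G(2)[symmetric] by (rule C_sub_vspan) (simp add: pz_vspan)
  hence x1: "x \<notin> C {pz}" using x by blast
  obtain x' where "x' \<in> C {pz, x}" "x' \<notin> C {pz}" "x' \<notin> C {x}" using third[OF pz x1] by blast
  hence "vrep x x'" using x1 by (simp add: vrep_def)
  thus ?thesis using vgen_rep x G(2) by blast
qed

lemma vadd_vgen:
  assumes u: "vgen u F" and v: "v \<in> F" "v \<in> vect"
  shows "vgen (vadd u v) F"
proof -
  obtain x x' where x: "u = (C {x}, C {x'})" "vrep x x'" using vectE vgen_vect[OF u] by blast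
  obtain y y' where y: "v = (C {y}, C {y'})" "vrep y y'" using vectE[OF v(2)] by blast
  have xF: "x \<notin> vspan F" using u x vgen_rep by blast
  have yF: "y \<in> vspan F" using v(1) y(1) rep_vspan by blast
  have "C {pz, y} \<subseteq> vspan F" using C_sub_vspan yF pz_vspan by simp
  hence "x \<notin> C {pz, y}" using xF by blast
  hence ind: "y \<notin> C {pz, x}" using ind_sym x y by blast
  obtain r r' where r: "vadd u v = (C {r}, C {r'})" "vrep r r'" "r \<in> C {x, y}" "r \<notin> C {y}"
    using vadd_rep[OF x(2) y(2) ind] x(1) y(1) by metis
  have "x \<in> C {r, y}" using exch2[of r x y] r by simp
  moreover have "r \<in> vspan F \<Longrightarrow> C {r, y} \<subseteq> vspan F" using C_sub_vspan yF by simp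
  ultimately have "r \<notin> vspan F" using xF by blast
  thus ?thesis using r vgen_rep by simp
qed

lemma vgen_exch:
  assumes u: "vgen u F" and t: "vgen t (insert u F)"
  shows "vgen u (insert t F)"
proof -
  obtain x x' where x: "u = (C {x}, C {x'})" "vrep x x'" using vectE vgen_vect[OF u] by blast
  obtain y y' where y: "t = (C {y}, C {y'})" "vrep y y'" using vectE vgen_vect[OF t] by blast
  define A where "A = insert pz (\<Union>(fst ` F))"
  have "x \<notin> C A" using u x vgen_rep vspan_def A_def by metis
  moreover have "y \<notin> C (insert x A)" using t x y vgen_rep vspan_insert A_def by metis
  ultimately have "x \<notin> C (insert y A)" using exch by blast
  thus ?thesis using x y vgen_rep vspan_insert A_def by metis
qed

lemma rank_contra:
  assumes "indl {} l" "set l \<subseteq> C (set m)" "length m < length l"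
  shows False
  using dm_mono[of l "{}" m] dm_le_length[of "{}" m] assms by (simp add: indl_def)

text \<open>Two different common points together with \<open>z\<close>, which is not in the third
  plane, would span both of the first two planes. Their common plane would contain \<open>x\<close>
  and \<open>x'\<close>, hence \<open>pz\<close>, and so four independent points.\<close>

lemma three_planes:
  assumes x: "vrep x x'" and y: "vrep y y'" and z: "vrep z z'" and i: "indl {} [pz, x, y, z]"
    and p: "p \<in> C {x', y, z}" "p \<in> C {x, y', z}" "p \<in> C {x, y, z'}" "p \<notin> C {}"
    and q: "q \<in> C {x', y, z}" "q \<in> C {x, y', z}" "q \<in> C {x, y, z'}"
  shows "q \<in> C {p}"
proof (rule ccontr)
  assume qp: "q \<notin> C {p}"
  have "z \<notin> C {x, y, z'}"
  proof
    assume "z \<in> C {x, y, z'}"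
    moreover have xyz': "{x, y, z'} \<subseteq> C {x, y, z'}" by (rule ext)
    ultimately have "{z, z'} \<subseteq> C {x, y, z'}" by simp
    hence "pz \<in> C {x, y, z'}" using vrepD(8)[OF z] C_sub by blast
    thus False using rank_contra[OF i, of "[x, y, z']"] \<open>z \<in> C {x, y, z'}\<close> xyz' by simp
  qed
  moreover have "C {p, q} \<subseteq> C {x, y, z'}" by (rule C_sub) (use p q in simp)
  ultimately have zpq: "z \<notin> C {p, q}" by blast
  have i3: "indl {} [p, q, z]" using p(4) qp zpq by (simp add: indl_Cons insert_commute)
  have zin: "z \<in> C {x', y, z}" "z \<in> C {x, y', z}" "x \<in> C {x, y', z}" "x' \<in> C {x', y, z}" "y \<in> C {x', y, z}"
    by (intro in_C; simp)+
  have "C {p, q, z} = C {x', y, z}" using span_eq[OF i3, of "[x', y, z]"] p q zin by simp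
  moreover have "C {p, q, z} = C {x, y', z}" using span_eq[OF i3, of "[x, y', z]"] p q zin by simp
  ultimately have "{x, x'} \<subseteq> C {x', y, z}" using zin by simp
  hence "{pz, x} \<subseteq> C {x', y, z}" using vrepD(8)[OF x] C_sub by blast
  thus False using rank_contra[OF i, of "[x', y, z]"] zin by simp
qed

text \<open>Both second components represent \<open>e\<close> plus the threefold sum and lie in the
  planes \<open>x', y, z\<close>, \<open>x, y', z\<close> and \<open>x, y, z'\<close>, which share
  at most a point. The first components are then equal because a line through \<open>pz\<close>
  meets the plane \<open>x, y, z\<close>, which omits \<open>pz\<close>, in at most one
  point.\<close>

lemma vadd_assoc:
  assumes v: "vgen v {w}" and w: "w \<in> vect" and u: "vgen u {v, w}"
  shows "vadd (vadd u v) w = vadd u (vadd v w)"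
proof -
  obtain x x' where x: "u = (C {x}, C {x'})" "vrep x x'" using vectE vgen_vect[OF u] by blast
  obtain y y' where y: "v = (C {y}, C {y'})" "vrep y y'" using vectE vgen_vect[OF v] by blast
  obtain z z' where z: "w = (C {z}, C {z'})" "vrep z z'" using vectE[OF w] by blast
  have yz: "y \<notin> C {pz, z}" using v y z vgen_rep vspan_single by metis
  have "x \<notin> vspan (insert v {w})" using u x vgen_rep by blast
  moreover have "vspan (insert v {w}) = C {pz, y, z}"
  proof -
    have "vspan (insert v {w}) = C (C {z} \<union> {pz, y})"
      unfolding y(1) z(1) vspan_insert by (rule arg_cong[of _ _ C]) auto
    also have "\<dots> = C ({z} \<union> {pz, y})" by (rule C_Un_C)
    finally show ?thesis by (simp add: insert_commute)
  qed
  ultimately have xyz: "x \<notin> C {pz, y, z}" by blast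
  have "indl {} [pz, z, y, x]" using pz vrepD(1)[OF z(2)] yz xyz by (simp add: indl_Cons insert_commute)
  hence "dm {} [pz, z, y, x] = 4" by (simp add: indl_def)
  moreover have "dm {} [pz, z, y, x] = dm {} [pz, x, y, z]" by (rule dm_set_cong) (simp add: insert_commute)
  ultimately have i: "indl {} [pz, x, y, z]" by (simp add: indl_def)
  have zyx: "z \<notin> C {pz, x, y}" and xy: "y \<notin> C {pz, x}" using i by (simp_all add: indl_Cons insert_commute)
  have zy: "z \<notin> C {pz, y}" using ind_sym[OF y(2) z(2) yz] .
  have pxyz: "pz \<notin> C {x, y, z}"
  proof
    assume "pz \<in> C {x, y, z}"
    thus False using rank_contra[OF i, of "[x, y, z]"] ext[of "{x, y, z}"] by simp
  qed
  obtain r r' where r: "vadd u v = (C {r}, C {r'})" "vrep r r'" "r' \<in> C {x', y}" "r' \<in> C {x, y'}" "r \<in> C {x, y}"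
    using vadd_rep[OF x(2) y(2) xy] x(1) y(1) by metis
  have "C {pz, r} \<subseteq> C {pz, x, y}"
    by (rule C_sub) (use C_mono_in[OF r(5), of "{pz, x, y}"] in_C[of pz "{pz, x, y}"] in auto)
  hence zr: "z \<notin> C {pz, r}" using zyx by blast
  obtain s s' where s: "vadd (vadd u v) w = (C {s}, C {s'})" "vrep s s'" "s' \<in> C {r', z}" "s' \<in> C {r, z'}"
    "s \<in> C {r, z}" "s \<in> C {pz, s'}"
    using vadd_rep[OF r(2) z(2) zr] r(1) z(1) by metis
  obtain m m' where m: "vadd v w = (C {m}, C {m'})" "vrep m m'" "m' \<in> C {y', z}" "m' \<in> C {y, z'}" "m \<in> C {y, z}"
    using vadd_rep[OF y(2) z(2) zy] y(1) z(1) by metis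
  have "m \<notin> C {pz, x}"
  proof
    assume "m \<in> C {pz, x}"
    hence "x \<in> C {pz, m}" using exch2[of m x pz] vrepD(1)[OF m(2)] by (simp add: insert_commute)
    moreover have "{pz, m} \<subseteq> C {pz, y, z}"
      using C_mono_in[OF m(5), of "{pz, y, z}"] in_C[of pz "{pz, y, z}"] by auto
    ultimately show False using xyz C_sub by blast
  qed
  then obtain t t' where t: "vadd u (vadd v w) = (C {t}, C {t'})" "vrep t t'" "t' \<in> C {x', m}" "t' \<in> C {x, m'}"
    "t \<in> C {x, m}" "t \<in> C {pz, t'}"
    using vadd_rep[OF x(2) m(2)] x(1) m(1) by metis
  have tr: "a \<in> C D" if "a \<in> C {b, c}" "b \<in> C {d, e}" "{d, e, c} \<subseteq> D" for a b c d e D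
  proof -
    have "{d, e, c} \<subseteq> C D" using that(3) ext by blast
    hence "{b, c} \<subseteq> C D" using that(2) C_sub[of "{d, e}" D] by auto
    thus ?thesis using that(1) C_sub by blast
  qed
  have sp: "s' \<in> C {x', y, z}" "s' \<in> C {x, y', z}" "s' \<in> C {x, y, z'}" "s \<in> C {x, y, z}"
    using tr[OF s(3) r(3)] tr[OF s(3) r(4)] tr[OF s(4) r(5)] tr[OF s(5) r(5)] by simp_all
  have tp: "t' \<in> C {x', y, z}" "t' \<in> C {x, y', z}" "t' \<in> C {x, y, z'}" "t \<in> C {x, y, z}"
    using tr[of t' m x' y z "{x', y, z}"] tr[of t' m' x y' z "{x, y', z}"] tr[of t' m' x y z' "{x, y, z'}"]
      tr[of t m x y z "{x, y, z}"] t(3-5) m(3-5) by (simp_all add: insert_commute)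
  have s'0: "s' \<notin> C {}" using vrepD(6)[OF s(2)] .
  have t'0: "t' \<notin> C {}" using vrepD(6)[OF t(2)] .
  have "t' \<in> C {s'}" using three_planes[OF x(2) y(2) z(2) i sp(1-3) s'0 tp(1-3)] .
  hence eq': "C {t'} = C {s'}" using point_eq t'0 by blast
  have "C {pz, t'} = C {pz, s'}" using C_insert_C[of pz "{t'}"] C_insert_C[of pz "{s'}"] eq' by simp
  hence ts: "t \<in> C {pz, s'}" using t(6) by simp
  have "t \<in> C {s}"
  proof (rule ccontr)
    assume n: "t \<notin> C {s}"
    have "C {s, t} = C {pz, s'}" using line_eq[OF s(6) ts vrepD(5)[OF s(2)] n] .
    hence "pz \<in> C {s, t}" using in_C[of pz "{pz, s'}"] by simp
    thus False using pxyz C_sub[of "{s, t}" "{x, y, z}"] sp(4) tp(4) by auto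
  qed
  hence "C {t} = C {s}" using point_eq vrepD(5)[OF t(2)] by blast
  thus ?thesis using s(1) t(1) eq' by simp
qed

text \<open>The summand is recovered from \<open>u\<close> and the sum \<open>(r, r')\<close>: its
  first point is where the lines \<open>x, r\<close> and \<open>x', r'\<close> meet, and its second
  point is where the line \<open>x, r'\<close> meets the line through \<open>pz\<close> and the
  first.\<close>

lemma vadd_cancel:
  assumes v: "vgen u {v}" "v \<in> vect" and w: "vgen u {w}" "w \<in> vect" and eq: "vadd u v = vadd u w"
  shows "v = w"
proof -
  obtain x x' where x: "u = (C {x}, C {x'})" "vrep x x'" using vectE vgen_vect[OF v(1)] by blast
  obtain y y' where y: "v = (C {y}, C {y'})" "vrep y y'" using vectE[OF v(2)] by blast
  obtain z z' where z: "w = (C {z}, C {z'})" "vrep z z'" using vectE[OF w(2)] by blast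
  have xy: "x \<notin> C {pz, y}" using v x y vgen_rep vspan_single by metis
  have xz: "x \<notin> C {pz, z}" using w x z vgen_rep vspan_single by metis
  obtain r r' where r: "vadd u v = (C {r}, C {r'})" "vrep r r'" "r' \<in> C {x', y}" "r' \<in> C {x, y'}" "r \<in> C {x, y}"
    "r \<notin> C {x}" "r' \<notin> C {x'}" "r' \<notin> C {x}"
    using vadd_rep[OF x(2) y(2) ind_sym[OF x(2) y(2) xy]] x(1) y(1) by metis
  obtain s s' where s: "vadd u w = (C {s}, C {s'})" "s' \<in> C {x', z}" "s' \<in> C {x, z'}" "s \<in> C {x, z}"
    "s \<notin> C {x}" "s' \<notin> C {x'}" "s' \<notin> C {x}"
    using vadd_rep[OF x(2) z(2) ind_sym[OF x(2) z(2) xz]] x(1) z(1) by metis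
  have rs: "C {s} = C {r}" "C {s'} = C {r'}" using eq r(1) s(1) by auto
  have ins: "C {a, s} = C {a, r}" "C {a, s'} = C {a, r'}" for a
    using C_insert_C[of a "{s}"] C_insert_C[of a "{r}"] C_insert_C[of a "{s'}"] C_insert_C[of a "{r'}"] rs by simp_all
  have yin: "y \<in> C {x, r}" "y \<in> C {x', r'}" "y' \<in> C {x, r'}"
    using exch2[of r y x] exch2[of r' y x'] exch2[of r' y' x] r by (simp_all add: insert_commute)
  have "z \<in> C {x, s}" "z \<in> C {x', s'}" "z' \<in> C {x, s'}"
    using exch2[of s z x] exch2[of s' z x'] exch2[of s' z' x] s by (simp_all add: insert_commute)
  hence zin: "z \<in> C {x, r}" "z \<in> C {x', r'}" "z' \<in> C {x, r'}" using ins by simp_all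
  have "z \<in> C {y}"
  proof (rule ccontr)
    assume n: "z \<notin> C {y}"
    have "C {x, r} = C {x', r'}"
      using line_eq[OF yin(1) zin(1) vrepD(5)[OF y(2)] n] line_eq[OF yin(2) zin(2) vrepD(5)[OF y(2)] n] by simp
    hence "{x, x'} \<subseteq> C {x, r}" using in_C[of x "{x, r}"] in_C[of x' "{x', r'}"] by simp
    moreover have "C {x, r} \<subseteq> C {x, y}" by (rule C_sub) (use r(5) in_C[of x "{x, y}"] in simp)
    ultimately have "pz \<in> C {x, y}" using vrepD(8)[OF x(2)] C_sub by blast
    thus False using triangle(1)[OF x(2) y(2) ind_sym[OF x(2) y(2) xy]] by blast
  qed
  hence zy: "C {z} = C {y}" using point_eq vrepD(5)[OF z(2)] by blast
  have "C {pz, z} = C {pz, y}" using C_insert_C[of pz "{z}"] C_insert_C[of pz "{y}"] zy by simp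
  hence z': "z' \<in> C {pz, y}" using vrepD(2)[OF z(2)] by simp
  have "z' \<in> C {y'}"
  proof (rule ccontr)
    assume n: "z' \<notin> C {y'}"
    have "C {x, r'} = C {pz, y}"
      using line_eq[OF yin(3) zin(3) vrepD(6)[OF y(2)] n] line_eq[OF vrepD(2)[OF y(2)] z' vrepD(6)[OF y(2)] n] by simp
    thus False using xy in_C[of x "{x, r'}"] by simp
  qed
  hence "C {z'} = C {y'}" using point_eq vrepD(6)[OF z(2)] by blast
  thus ?thesis using zy y(1) z(1) by simp
qed

text \<open>The difference of \<open>u\<close> and \<open>v\<close> is constructed from its two
  points: \<open>q\<close> is where the lines \<open>x, y\<close> and \<open>x', y'\<close> meet,
  and \<open>q'\<close> is where the lines \<open>pz, q\<close> and \<open>x', y\<close> meet. In a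
  vector space these are spanned by \<open>u - v\<close> and \<open>e + u - v\<close>.\<close>

lemma vsub:
  assumes u: "vgen u F" and v: "v \<in> F" "v \<in> vect"
  shows "\<exists>w. vgen w F \<and> vadd w v = u"
proof -
  obtain x x' where x: "u = (C {x}, C {x'})" "vrep x x'" using vectE vgen_vect[OF u] by blast
  obtain y y' where y: "v = (C {y}, C {y'})" "vrep y y'" using vectE[OF v(2)] by blast
  have xF: "x \<notin> vspan F" using u x vgen_rep by blast
  have yF: "y \<in> vspan F" using v(1) y(1) rep_vspan by blast
  have "C {pz, y} \<subseteq> vspan F" using C_sub_vspan yF pz_vspan by simp
  hence xy: "x \<notin> C {pz, y}" using xF by blast
  have yx: "y \<notin> C {pz, x}" using ind_sym x y xy by blast
  note t = triangle[OF x(2) y(2) yx] and xD = vrepD[OF x(2)] and yD = vrepD[OF y(2)]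
  have "x' \<in> C (insert y' {x, y})"
  proof (rule C_trans[OF xD(2)])
    have "pz \<in> C {y', x, y}" by (rule C_mono_in[OF yD(8)]) auto
    thus "{pz, x} \<subseteq> C (insert y' {x, y})" using in_C[of x "{y', x, y}"] by simp
  qed
  then obtain q where q: "q \<in> C {x, y}" "x' \<in> C {y', q}" using modular[of "{x, y}" x' y'] by auto
  have x'y': "x' \<notin> C {y'}" using t(14) .
  have q1: "q \<in> C {x', y'}" using exch2[of x' q y'] q(2) x'y' by (simp add: insert_commute)
  have q0: "q \<notin> C {}"
  proof
    assume "q \<in> C {}"
    hence "C {y', q} = C {y'}" using C_insert_in[of q "{y'}"] C_mono_in[of q "{}" "{y'}"] by (simp add: insert_commute)
    thus False using q(2) x'y' by simp
  qed
  have pq: "q \<notin> C {pz}"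
  proof
    assume "q \<in> C {pz}"
    hence "C {q} = C {pz}" using point_eq q0 by blast
    thus False using C_point_sub[OF q(1)] in_C[of pz "{pz}"] t(1) by auto
  qed
  have qy: "q \<notin> C {y}"
  proof
    assume "q \<in> C {y}"
    hence "q \<in> C {pz, y}" by (rule C_mono_in) auto
    hence "{y', q} \<subseteq> C {pz, y}" using yD(2) by simp
    thus False using q(2) t(7) C_sub by blast
  qed
  have xqy: "x \<in> C {q, y}" using exch2[of q x y] q(1) qy by simp
  have "x' \<in> C (insert y {pz, q})"
  proof (rule C_trans[OF xD(2)])
    show "{pz, x} \<subseteq> C (insert y {pz, q})"
      using C_mono_in[OF xqy, of "{y, pz, q}"] in_C[of pz "{y, pz, q}"] by auto
  qed
  then obtain q' where q': "q' \<in> C {pz, q}" "x' \<in> C {y, q'}" using modular[of "{pz, q}" x' y] by auto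
  have q'1: "q' \<in> C {x', y}" using exch2[of x' q' y] q'(2) t(8) by (simp add: insert_commute)
  have q'0: "q' \<notin> C {}"
  proof
    assume "q' \<in> C {}"
    hence "C {y, q'} = C {y}" using C_insert_in[of q' "{y}"] C_mono_in[of q' "{}" "{y}"] by (simp add: insert_commute)
    thus False using q'(2) t(8) by simp
  qed
  have pq': "q' \<notin> C {pz}"
  proof
    assume "q' \<in> C {pz}"
    hence "C {q'} = C {pz}" using point_eq q'0 by blast
    thus False using C_point_sub[OF q'1] in_C[of pz "{pz}"] t(2) by auto
  qed
  have q'q: "q' \<notin> C {q}"
  proof
    assume "q' \<in> C {q}"
    hence "q' \<in> C {x, y}" using C_point_sub[OF q(1)] by blast
    moreover have "C {q'} = C {q}" using point_eq \<open>q' \<in> C {q}\<close> q'0 by blast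
    hence "q' \<notin> C {y}" using qy point_eq[of q' y] q'0 in_C[of q "{q}"] by auto
    hence "x' \<in> C {q', y}" using exch2[of q' x' y] q'1 by simp
    moreover have "{q', y} \<subseteq> C {x, y}" using calculation(1) in_C[of y "{x, y}"] by simp
    ultimately show False using t(12) C_sub by blast
  qed
  have w: "vrep q q'" using pq q'(1) pq' q'q by (simp add: vrep_def)
  have "q \<notin> vspan F"
  proof
    assume "q \<in> vspan F"
    hence "C {q, y} \<subseteq> vspan F" using C_sub_vspan yF by simp
    thus False using xqy xF by blast
  qed
  hence wF: "vgen (C {q}, C {q'}) F" using vgen_rep w by blast
  hence "q \<notin> C {pz, y}" using vgen_rep[OF w] \<open>C {pz, y} \<subseteq> vspan F\<close> by blast
  hence yq: "y \<notin> C {pz, q}" using ind_sym w y(2) by blast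
  obtain r r' where r: "vadd (C {q}, C {q'}) v = (C {r}, C {r'})" "vrep r r'"
    using vadd_rep[OF w y(2) yq] y(1) by metis
  have rr: "C {r'} = C {q', y} \<inter> C {q, y'}" "C {r} = C {q, y} \<inter> C (insert pz (C {r'}))"
    using r(1) unfolding y(1) vadd_rep_eq by auto
  have q'y: "q' \<notin> C {y}" using triangle(8)[OF w y(2) yq] .
  have "x' \<in> C {q', y}" using exch2[of q' x' y] q'1 q'y by simp
  moreover have "x' \<in> C {q, y'}" using q(2) by (simp add: insert_commute)
  ultimately have "x' \<in> C {r'}" using rr(1) by blast
  hence x'r': "C {x'} = C {r'}" using point_eq xD(6) by blast
  have "C (insert pz (C {r'})) = C {pz, x'}" using C_insert_C[of pz "{x'}"] x'r' by simp
  hence "x \<in> C {r}" using rr(2) xqy xD(7) by blast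
  hence "C {x} = C {r}" using point_eq xD(5) by blast
  hence "vadd (C {q}, C {q'}) v = u" using r(1) x(1) x'r' by simp
  thus ?thesis using wF by blast
qed

end

subsection \<open>Groups of differences\<close>

text \<open>A generically defined cancellative commutative addition. Formal differences of elements,
  which are compared by their action on generic elements, form a group.\<close>

locale generic_addition =
  fixes X :: "'v set" and add :: "'v \<Rightarrow> 'v \<Rightarrow> 'v" and gen :: "'v \<Rightarrow> 'v set \<Rightarrow> bool"
  assumes gen_X: "gen u F \<Longrightarrow> u \<in> X"
    and gen_empty: "u \<in> X \<Longrightarrow> gen u {}"
    and gen_mono: "gen u G \<Longrightarrow> F \<subseteq> G \<Longrightarrow> gen u F"
    and ex_gen: "finite F \<Longrightarrow> F \<subseteq> X \<Longrightarrow> \<exists>u. gen u F"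
    and gen_exch: "gen u F \<Longrightarrow> gen t (insert u F) \<Longrightarrow> gen u (insert t F)"
    and gen_insert: "gen u F \<Longrightarrow> v \<in> F \<Longrightarrow> gen v {w} \<Longrightarrow> w \<in> F \<Longrightarrow> w \<in> X \<Longrightarrow> gen u (insert (add v w) F)"
    and add_comm: "add v w = add w v"
    and add_gen: "gen u F \<Longrightarrow> v \<in> F \<Longrightarrow> v \<in> X \<Longrightarrow> gen (add u v) F"
    and add_assoc: "gen v {w} \<Longrightarrow> w \<in> X \<Longrightarrow> gen u {v, w} \<Longrightarrow> add (add u v) w = add u (add v w)"
    and add_cancel: "gen u {v} \<Longrightarrow> v \<in> X \<Longrightarrow> gen u {w} \<Longrightarrow> w \<in> X \<Longrightarrow> add u v = add u w \<Longrightarrow> v = w"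
    and add_sub: "gen u F \<Longrightarrow> v \<in> F \<Longrightarrow> v \<in> X \<Longrightarrow> \<exists>w. gen w F \<and> add w v = u"
begin

lemma gen_sym: "gen u {v} \<Longrightarrow> v \<in> X \<Longrightarrow> gen v {u}"
  using gen_exch[of v "{}" u] gen_empty by blast

lemma add_right_commute:
  assumes u: "gen u F" and v: "v \<in> F" "v \<in> X" and w: "w \<in> F" "w \<in> X"
  shows "add (add u v) w = add (add u w) v"
proof -
  have u': "gen u {v, w}" using gen_mono[OF u] v w by simp
  obtain t where t: "gen t {u, v, w}" using ex_gen[of "{u, v, w}"] gen_X[OF u] v w by auto
  have "gen u {t, v, w}" using gen_exch[OF u'] t by blast
  then obtain y where y: "gen y {t, v, w}" "add y t = u" using add_sub[of u "{t, v, w}" t] gen_X[OF t] by blast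
  have t3: "gen t {y, v, w}" by (rule gen_exch[OF _ y(1)]) (rule gen_mono[OF t], simp)
  have "add (add (add a b) c) e = add (add b c) (add a e)"
    if "gen a {b, c, e}" "gen b {a, c, e}" "c \<in> X" "e \<in> X" for a b c e
  proof -
    have "add (add a b) c = add a (add b c)"
      by (rule add_assoc) (use gen_mono[OF that(2), of "{c}"] gen_mono[OF that(1), of "{b, c}"] that in auto)
    moreover have "add (add (add b c) a) e = add (add b c) (add a e)"
      by (rule add_assoc) (use gen_mono[OF that(1), of "{e}"] gen_mono[OF add_gen[OF that(2), of c], of "{a, e}"] that in auto)
    ultimately show ?thesis using add_comm[of "add b c" a] by simp
  qed
  from this[of y t v w] this[of t y w v] show ?thesis
    using y t3 v(2) w(2) add_comm[of y t] add_comm[of "add y w" "add t v"] by (simp add: insert_commute)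
qed

definition act :: "'v \<Rightarrow> 'v list \<Rightarrow> 'v" where
  "act u A = foldl add u A"

lemma act_simps [simp]: "act u [] = u" "act u (v # A) = act (add u v) A" "act u (A @ B) = act (act u A) B"
  by (simp_all add: act_def)

lemma act_gen: "gen u F \<Longrightarrow> set A \<subseteq> F \<inter> X \<Longrightarrow> gen (act u A) F"
  by (induction A arbitrary: u) (auto intro: add_gen)

lemma act_surj: "gen u F \<Longrightarrow> set A \<subseteq> F \<inter> X \<Longrightarrow> \<exists>w. gen w F \<and> act w A = u"
proof (induction A arbitrary: u)
  case (Cons v A)
  then obtain w where w: "gen w F" "act w A = u" by auto
  thus ?case using add_sub[of w F v] Cons.prems by auto
qed auto

lemma act_inj: "gen u F \<Longrightarrow> gen w F \<Longrightarrow> set A \<subseteq> F \<inter> X \<Longrightarrow> act u A = act w A \<Longrightarrow> u = w"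
proof (induction A arbitrary: u w)
  case (Cons v A)
  have v: "v \<in> F" "v \<in> X" using Cons.prems by auto
  have "add u v = add w v" using Cons.IH[of "add u v" "add w v"] add_gen v Cons.prems by simp
  hence "add v u = add v w" by (simp add: add_comm)
  thus ?case
    using add_cancel[of v u w] gen_sym[of u v] gen_sym[of w v] gen_mono[of _ F "{v}"] Cons.prems(1,2) v gen_X by simp
qed simp

lemma act_move: "gen u F \<Longrightarrow> insert v (set A) \<subseteq> F \<inter> X \<Longrightarrow> act u (v # A) = add (act u A) v"
proof (induction A arbitrary: u)
  case (Cons w A)
  have "act u (v # w # A) = act (add u w) (v # A)"
    using add_right_commute[of u F v w] Cons.prems by simp
  also have "\<dots> = add (act (add u w) A) v"
    by (rule Cons.IH) (use Cons.prems add_gen in auto)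
  finally show ?case by simp
qed simp

lemma act_mset: "gen u F \<Longrightarrow> set A \<subseteq> F \<inter> X \<Longrightarrow> mset A = mset B \<Longrightarrow> act u A = act u B"
proof (induction A arbitrary: u B)
  case (Cons v A)
  have "v \<in> set B" using Cons.prems(3) by (metis list.set_intros(1) set_mset_mset)
  then obtain B1 B2 where B: "B = B1 @ v # B2" by (auto simp: in_set_conv_decomp)
  have set: "set B \<subseteq> F \<inter> X" using Cons.prems(2,3) by (metis set_mset_mset)
  have "gen (add u v) F" using add_gen Cons.prems by auto
  moreover have "mset A = mset (B1 @ B2)" using Cons.prems(3) B by simp
  ultimately have "act u (v # A) = act (act u (v # B1)) B2" using Cons.IH[of "add u v" "B1 @ B2"] Cons.prems(2) by simp
  also have "act u (v # B1) = add (act u B1) v" by (rule act_move[OF Cons.prems(1)]) (use set B in auto)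
  finally show ?case using B by simp
qed simp

lemma act_left: "gen u F \<Longrightarrow> gen s (insert u F) \<Longrightarrow> set A \<subseteq> F \<inter> X \<Longrightarrow> act (add s u) A = add s (act u A)"
proof (induction A arbitrary: u)
  case (Cons v A)
  have v: "v \<in> F" "v \<in> X" using Cons.prems by auto
  have uv: "gen u {v}" using gen_mono Cons.prems(1) v by simp
  have "add (add s u) v = add s (add u v)"
    by (rule add_assoc) (use gen_mono[OF Cons.prems(2), of "{u, v}"] v uv in auto)
  moreover have "gen s (insert (add u v) F)"
    using gen_mono[OF gen_insert[OF Cons.prems(2) _ uv]] v by blast
  ultimately show ?case using Cons.IH[of "add u v"] add_gen[OF Cons.prems(1) v] Cons.prems(3) by simp
qed simp

text \<open>Formal sums of lists are compared by adding them to a generic element, because the sum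
  of the entries themselves may be undefined. One generic witness suffices by the next
  lemma.\<close>

definition eqact :: "'v list \<Rightarrow> 'v list \<Rightarrow> bool" where
  "eqact A B \<longleftrightarrow> (\<exists>u. gen u (set A +@ B) \<and> act u A = act u B)"

text \<open>An element \<open>w\<close> generic over the witness \<open>u\<close> is
  \<open>s + u\<close> with \<open>s\<close> generic, and adding \<open>s\<close> on the left
  commutes with the action. For other \<open>w\<close> one passes through an element generic over
  both.\<close>

lemma eqact_all:
  assumes "eqact A B" "set A \<subseteq> X" "set B \<subseteq> X" "gen w (set A +@ B)"
  shows "act w A = act w B"
proof -
  define F where "F = set A +@ B"
  have *: "act w A = act w B" if a: "gen u F" "act u A = act u B" and b: "gen w (insert u F)" for u w
  proof -
    obtain s where s: "gen s (insert u F)" "add s u = w" using add_sub[OF b, of u] gen_X[OF a(1)] by blast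
    have "act (add s u) A = add s (act u A)" "act (add s u) B = add s (act u B)"
      by (rule act_left[OF a(1) s(1)]; use assms(2,3) in \<open>simp add: F_def\<close>)+
    thus ?thesis using s(2) a(2) by simp
  qed
  obtain u where u: "gen u F" "act u A = act u B" using assms(1) by (auto simp: eqact_def F_def)
  have w: "gen w F" using assms(4) by (simp add: F_def)
  obtain v where v: "gen v (insert u (insert w F))"
    using ex_gen[of "insert u (insert w F)"] gen_X u w assms(2,3) F_def by auto
  have "act v A = act v B" using *[OF u] gen_mono[OF v] by blast
  moreover have "gen v F" "gen w (insert v F)" using gen_mono[OF v] gen_exch[OF w] by blast+
  ultimately show ?thesis using * by blast
qed

lemma eqactI:
  assumes "gen u F" "set A +@ B \<subseteq> F" "act u A = act u B"
  shows "eqact A B"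
  using assms gen_mono unfolding eqact_def by blast

lemma eqact_gen:
  assumes "eqact A B" "set A \<subseteq> X" "set B \<subseteq> X" "gen w F" "set A +@ B \<subseteq> F"
  shows "act w A = act w B"
  using eqact_all[OF assms(1-3)] gen_mono assms(4,5) by blast

text \<open>The action does not depend on the order of the list, so multisets may be used;
  rearranging sums of differences then becomes multiset arithmetic.\<close>

definition meq :: "'v multiset \<Rightarrow> 'v multiset \<Rightarrow> bool" where
  "meq A B \<longleftrightarrow> (\<exists>l m. mset l = A \<and> mset m = B \<and> eqact l m)"

lemma meq_mset:
  assumes "set l \<subseteq> X" "set m \<subseteq> X"
  shows "meq (mset l) (mset m) \<longleftrightarrow> eqact l m"
proof
  assume "meq (mset l) (mset m)"
  then obtain l' m' where *: "mset l' = mset l" "mset m' = mset m" "eqact l' m'" by (auto simp: meq_def)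
  hence set: "set l' = set l" "set m' = set m" using mset_eq_setD by blast+
  obtain u where u: "gen u (set l +@ m)" using ex_gen[of "set l +@ m"] assms by auto
  have "act u l = act u l'" "act u m = act u m'"
    using act_mset[OF u, of l l'] act_mset[OF u, of m m'] assms * by auto
  moreover have "act u l' = act u m'" using eqact_all[OF *(3)] set assms u by simp
  ultimately show "eqact l m" using eqactI[OF u] by simp
qed (auto simp: meq_def)

abbreviation overX :: "'v multiset \<Rightarrow> bool" where
  "overX A \<equiv> set_mset A \<subseteq> X"

lemma meq_refl: "overX A \<Longrightarrow> meq A A"
proof -
  assume A: "overX A"
  obtain l where l: "mset l = A" using ex_mset by blast
  hence "set l \<subseteq> X" using A by auto
  then obtain u where "gen u (set l)" using ex_gen[of "set l"] by auto
  thus "meq A A" using l eqactI[of u "set l" l l] by (auto simp: meq_def)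
qed

lemma meq_sym: "meq A B \<Longrightarrow> meq B A"
  by (fastforce simp: meq_def eqact_def Un_commute)

lemma meq_trans: 
  assumes "meq A B" "meq B D" "overX A" "overX B" "overX D"
  shows "meq A D"
proof -
  obtain l m n where lmn: "mset l = A" "mset m = B" "mset n = D" using ex_mset by metis
  hence X: "set l \<subseteq> X" "set m \<subseteq> X" "set n \<subseteq> X" using assms by auto
  have e: "eqact l m" "eqact m n" using assms(1,2) lmn meq_mset X by auto
  obtain u where u: "gen u (set l +@ m +@ n)" using ex_gen[of "set l +@ m +@ n"] X by auto
  have "act u l = act u m" "act u m = act u n" using eqact_gen[OF e(1) _ _ u] eqact_gen[OF e(2) _ _ u] X by auto
  thus ?thesis using eqactI[OF u, of l n] lmn by (auto simp: meq_def)
qed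

text \<open>On generic elements the action of a list is injective, so a common tail can be
  removed.\<close>

lemma meq_add_cancel:
  assumes "overX A" "overX B" "overX D"
  shows "meq (A + D) (B + D) \<longleftrightarrow> meq A B"
proof -
  obtain l m n where lmn: "mset l = A" "mset m = B" "mset n = D" using ex_mset by metis
  hence X: "set l \<subseteq> X" "set m \<subseteq> X" "set n \<subseteq> X" using assms by auto
  obtain u where u: "gen u (set l +@ m +@ n)" using ex_gen[of "set l +@ m +@ n"] X by auto
  have "gen (act u l) (set l +@ m +@ n)" "gen (act u m) (set l +@ m +@ n)" 
    using act_gen[OF u] X by auto
  hence inj: "act u (l @ n) = act u (m @ n) \<longleftrightarrow> act u l = act u m"
    using act_inj[of "act u l" "set l +@ m +@ n" "act u m" n] X by auto
  have "eqact (l @ n) (m @ n) \<longleftrightarrow> act u (l @ n) = act u (m @ n)"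
    using eqact_gen[OF _ _ _ u, of "l @ n" "m @ n"] eqactI[OF u, of "l @ n" "m @ n"] X by auto
  moreover have "eqact l m \<longleftrightarrow> act u l = act u m"
    using eqact_gen[OF _ _ _ u, of "l" "m"] eqactI[OF u, of "l" "m"] X by auto
  moreover have "meq (mset (l @ n)) (mset (m @ n)) \<longleftrightarrow> eqact (l @ n) (m @ n)"
    by (rule meq_mset) (use X in auto)
  ultimately show ?thesis using inj meq_mset[of l m] X lmn by simp
qed

lemma meq_add:
  assumes "meq A B" "meq D E" "overX A" "overX B" "overX D" "overX E"
  shows "meq (A + D) (B + E)"
proof (rule meq_trans)
  show "meq (A + D) (B + D)" using assms meq_add_cancel by simp
  show "meq (B + D) (B + E)" using assms meq_add_cancel[of D E B] by (simp add: add.commute)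
qed (use assms in auto)

text \<open>The action of \<open>A\<close> is onto the generic elements, so the element reached from
  \<open>t\<close> by \<open>B\<close> has a preimage \<open>y\<close>; adding a further generic
  element on the left turns this equality into an equality of actions.\<close>

lemma meq_solve:
  assumes "finite F" "F \<subseteq> X" "gen t F" "overX A" "overX B" "set_mset A \<subseteq> F" "set_mset B \<subseteq> F"
  shows "\<exists>y. gen y F \<and> meq ({#y#} + A) ({#t#} + B)"
proof -
  obtain l m where lm: "mset l = A" "mset m = B" using ex_mset by metis
  hence X: "set l \<subseteq> F \<inter> X" "set m \<subseteq> F \<inter> X" using assms by auto
  obtain y where y: "gen y F" "act y l = act t m" using act_surj[OF act_gen[OF assms(3) X(2)] X(1)] by blast
  obtain u where u: "gen u (insert y (insert t F))" 
    using ex_gen[of "insert y (insert t F)"] y assms gen_X by auto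
  have "act u (y # l) = add u (act y l)" "act u (t # m) = add u (act t m)"
    using act_left[OF y(1) gen_mono[OF u] X(1)] act_left[OF assms(3) gen_mono[OF u] X(2)] by auto
  hence "eqact (y # l) (t # m)" using eqactI[OF u, of "y # l" "t # m"] y(2) X by auto
  hence "meq (mset (y # l)) (mset (t # m))" unfolding meq_def by blast
  thus ?thesis using y(1) lm by auto
qed

lemma meq_single:
  assumes "meq {#y#} {#z#}" "y \<in> X" "z \<in> X"
  shows "y = z"
proof -
  have "eqact [y] [z]" using assms meq_mset[of "[y]" "[z]"] by simp
  then obtain u where "gen u {y, z}" "add u y = add u z" by (auto simp: eqact_def insert_commute)
  thus ?thesis using add_cancel[of u y z] gen_mono[of u "{y, z}"] assms by auto
qed

text \<open>The pair \<open>p\<close> stands for the difference \<open>fst p - snd p\<close>;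
  subtracted terms are moved to the other side, here and in \<open>dsum\<close>.\<close>

definition deq :: "'v \<times> 'v \<Rightarrow> 'v \<times> 'v \<Rightarrow> bool" where
  "deq p q \<longleftrightarrow> p \<in> X \<times> X \<and> q \<in> X \<times> X \<and> meq {#fst p, snd q#} {#fst q, snd p#}"

definition dsum :: "'v \<times> 'v \<Rightarrow> 'v \<times> 'v \<Rightarrow> 'v \<times> 'v \<Rightarrow> bool" where
  "dsum p q r \<longleftrightarrow> p \<in> X \<times> X \<and> q \<in> X \<times> X \<and> r \<in> X \<times> X \<and>
     meq {#fst r, snd p, snd q#} {#snd r, fst p, fst q#}"

text \<open>The elimination step for equations between differences: after adding \<open>E\<close> to
  both sides, the common part \<open>D\<close> is cancelled.\<close>

lemma meq_combine:
  assumes "meq A B" "overX A" "overX B" "A + E = A' + D" "B + E = B' + D" "overX E" "overX D" "overX A'" "overX B'"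
  shows "meq A' B'"
proof -
  have "meq (A + E) (B + E)" using assms(1-3,6) meq_add_cancel by simp
  hence "meq (A' + D) (B' + D)" unfolding assms(4,5) .
  thus ?thesis using meq_add_cancel[OF assms(8,9,7)] by simp
qed

lemma deq_refl: "p \<in> X \<times> X \<Longrightarrow> deq p p"
  unfolding deq_def using meq_refl[of "{#fst p, snd p#}"] by auto

lemma deq_sym: "deq p q \<Longrightarrow> deq q p"
  unfolding deq_def using meq_sym by blast

lemma deq_trans: "deq p q \<Longrightarrow> deq q r \<Longrightarrow> deq p r"
proof -
  assume pq: "deq p q" and qr: "deq q r"
  hence X: "p \<in> X \<times> X" "q \<in> X \<times> X" "r \<in> X \<times> X" by (simp_all add: deq_def)
  have "meq ({#fst p, snd q#} + {#fst q, snd r#}) ({#fst q, snd p#} + {#fst r, snd q#})"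
    by (rule meq_add) (use pq qr X in \<open>auto simp: deq_def\<close>)
  hence "meq {#fst p, snd r#} {#fst r, snd p#}"
    by (rule meq_combine[where E = "{#}" and D = "{#fst q, snd q#}"]) (use X in auto)
  thus ?thesis using X by (simp add: deq_def)
qed

lemma dsum_cong:
  assumes "dsum p q r" "deq p p'" "deq q q'" "deq r r'"
  shows "dsum p' q' r'"
proof -
  have X: "p \<in> X \<times> X" "q \<in> X \<times> X" "r \<in> X \<times> X" "p' \<in> X \<times> X" "q' \<in> X \<times> X" "r' \<in> X \<times> X"
    using assms by (simp_all add: deq_def dsum_def)
  have "meq ({#fst r, snd p, snd q#} + {#fst r', snd r#}) ({#snd r, fst p, fst q#} + {#fst r, snd r'#})"
    by (rule meq_add) (use assms(1,4) X in \<open>auto simp: deq_def dsum_def intro: meq_sym\<close>)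
  moreover have "meq ({#fst p, snd p'#} + {#fst q, snd q'#}) ({#fst p', snd p#} + {#fst q', snd q#})"
    by (rule meq_add) (use assms X in \<open>auto simp: deq_def\<close>)
  ultimately have "meq (({#fst r, snd p, snd q#} + {#fst r', snd r#}) + ({#fst p, snd p'#} + {#fst q, snd q'#}))
    (({#snd r, fst p, fst q#} + {#fst r, snd r'#}) + ({#fst p', snd p#} + {#fst q', snd q#}))"
    by (rule meq_add) (use X in auto)
  hence "meq {#fst r', snd p', snd q'#} {#snd r', fst p', fst q'#}"
    by (rule meq_combine[where E = "{#}" and D = "{#fst r, snd r, fst p, snd p, fst q, snd q#}"]) (use X in auto)
  thus ?thesis using X by (simp add: dsum_def)
qed

lemma dsum_unique:
  assumes "dsum p q r" "dsum p q r'"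
  shows "deq r r'"
proof -
  have X: "p \<in> X \<times> X" "q \<in> X \<times> X" "r \<in> X \<times> X" "r' \<in> X \<times> X"
    using assms by (simp_all add: dsum_def)
  have "meq ({#fst r, snd p, snd q#} + {#snd r', fst p, fst q#}) ({#snd r, fst p, fst q#} + {#fst r', snd p, snd q#})"
    by (rule meq_add) (use assms X in \<open>auto simp: dsum_def intro: meq_sym\<close>)
  hence "meq {#fst r, snd r'#} {#fst r', snd r#}"
    by (rule meq_combine[where E = "{#}" and D = "{#fst p, snd p, fst q, snd q#}"]) (use X in auto)
  thus ?thesis using X by (simp add: deq_def)
qed

lemma dsum_ex:
  assumes "p \<in> X \<times> X" "q \<in> X \<times> X"
  shows "\<exists>r. dsum p q r"
proof -
  define F where "F = {fst p, snd p, fst q, snd q}"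
  have F: "finite F" "F \<subseteq> X" using assms by (auto simp: F_def)
  obtain t where t: "gen t F" using ex_gen F by blast
  obtain y where "gen y F" "meq ({#y#} + {#snd p, snd q#}) ({#t#} + {#fst p, fst q#})"
    using meq_solve[OF F t, of "{#snd p, snd q#}" "{#fst p, fst q#}"] assms by (auto simp: F_def)
  hence "y \<in> X" "meq {#y, snd p, snd q#} {#t, fst p, fst q#}" using gen_X by (auto simp: add_mset_commute)
  hence "dsum p q (y, t)" using assms gen_X[OF t] by (simp add: dsum_def)
  thus ?thesis by blast
qed

text \<open>The subtrahend can be any sufficiently generic vector. With the subtrahend fixed, the
  minuend is unique by \<open>deq_inj\<close>; this is how a difference comes to depend on a single
  vector.\<close>

lemma deq_rep:
  assumes "p \<in> X \<times> X" "gen t {fst p, snd p}"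
  shows "\<exists>y. gen y {fst p, snd p} \<and> deq (y, t) p"
proof -
  obtain y where "gen y {fst p, snd p}" "meq ({#y#} + {#snd p#}) ({#t#} + {#fst p#})"
    using meq_solve[of "{fst p, snd p}" t "{#snd p#}" "{#fst p#}"] assms by auto
  thus ?thesis using assms gen_X by (auto simp: deq_def add_mset_commute)
qed

lemma deq_inj:
  assumes "deq (y, t) (z, t)"
  shows "y = z"
proof -
  have X: "y \<in> X" "t \<in> X" "z \<in> X" using assms by (auto simp: deq_def)
  have "meq ({#y#} + {#t#}) ({#z#} + {#t#})" using assms by (simp add: deq_def add_mset_commute)
  hence "meq {#y#} {#z#}" using meq_add_cancel[of "{#y#}" "{#z#}" "{#t#}"] X by simp
  thus ?thesis using meq_single X by blast
qed

lemma dsum_assoc: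
  assumes "dsum p q a" "dsum a r b" "dsum q r c"
  shows "dsum p c b"
proof -
  have X: "p \<in> X \<times> X" "q \<in> X \<times> X" "r \<in> X \<times> X" "a \<in> X \<times> X" "b \<in> X \<times> X" "c \<in> X \<times> X"
    using assms by (simp_all add: dsum_def)
  have "meq ({#fst a, snd p, snd q#} + {#fst b, snd a, snd r#}) ({#snd a, fst p, fst q#} + {#snd b, fst a, fst r#})"
    by (rule meq_add) (use assms X in \<open>auto simp: dsum_def\<close>)
  hence "meq (({#fst a, snd p, snd q#} + {#fst b, snd a, snd r#}) + {#snd c, fst q, fst r#})
     (({#snd a, fst p, fst q#} + {#snd b, fst a, fst r#}) + {#fst c, snd q, snd r#})"
    by (rule meq_add) (use assms X in \<open>auto simp: dsum_def intro: meq_sym\<close>)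
  hence "meq {#fst b, snd p, snd c#} {#snd b, fst p, fst c#}"
    by (rule meq_combine[where E = "{#}" and D = "{#fst a, snd a, fst q, snd q, fst r, snd r#}"]) (use X in auto)
  thus ?thesis using X by (simp add: dsum_def)
qed

lemma dsum_zero: "u \<in> X \<Longrightarrow> p \<in> X \<times> X \<Longrightarrow> dsum (u, u) p p"
  unfolding dsum_def using meq_refl[of "{#fst p, u, snd p#}"] by (auto simp: add_mset_commute)

lemma dsum_inverse: "u \<in> X \<Longrightarrow> p \<in> X \<times> X \<Longrightarrow> dsum (snd p, fst p) p (u, u)"
  unfolding dsum_def using meq_refl[of "{#u, fst p, snd p#}"] by (auto simp: add_mset_commute)

text \<open>The map \<open>k\<close> will send a pair to the code of its difference, so that the
  elements of the group are imaginaries instead of classes. The choice in the product is harmless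
  when \<open>k\<close> identifies exactly the equal differences.\<close>

definition dgroup :: "('v \<times> 'v \<Rightarrow> 'c) \<Rightarrow> 'c monoid" where
  "dgroup k = \<lparr>carrier = k ` (X \<times> X),
     monoid.mult = (\<lambda>a b. SOME c. \<exists>p q r. k p = a \<and> k q = b \<and> k r = c \<and> dsum p q r),
     one = k (SOME p. \<exists>u \<in> X. p = (u, u))\<rparr>"

lemma dgroup_mult:
  assumes k: "\<forall>p \<in> X \<times> X. \<forall>q \<in> X \<times> X. k p = k q \<longleftrightarrow> deq p q" and "dsum p q r"
  shows "monoid.mult (dgroup k) (k p) (k q) = k r"
proof -
  have *: "c = k r" if "k p' = k p" "k q' = k q" "k r' = c" "dsum p' q' r'" for p' q' r' c
  proof -
    have X: "p \<in> X \<times> X" "q \<in> X \<times> X" "r \<in> X \<times> X" "p' \<in> X \<times> X" "q' \<in> X \<times> X" "r' \<in> X \<times> X"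
      using that(4) assms(2) by (simp_all add: dsum_def)
    hence "deq p' p" "deq q' q" using that k by blast+
    hence "dsum p q r'" using dsum_cong[OF that(4)] deq_refl[OF X(6)] by blast
    hence "deq r r'" using dsum_unique assms(2) by blast
    thus ?thesis using that(3) k X(3,6) by metis
  qed
  have "(SOME c. \<exists>p' q' r'. k p' = k p \<and> k q' = k q \<and> k r' = c \<and> dsum p' q' r') = k r"
  proof (rule some_equality)
    show "\<exists>p' q' r'. k p' = k p \<and> k q' = k q \<and> k r' = k r \<and> dsum p' q' r'"
      using assms(2) by (intro exI[of _ p] exI[of _ q] exI[of _ r]) simp
  qed (elim exE conjE, rule *)
  thus ?thesis by (simp add: dgroup_def)
qed

lemma dgroup_group:
  assumes k: "\<forall>p \<in> X \<times> X. \<forall>q \<in> X \<times> X. k p = k q \<longleftrightarrow> deq p q"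
  shows "group (dgroup k)"
proof -
  note m = dgroup_mult[OF k]
  have car: "x \<in> carrier (dgroup k) \<longleftrightarrow> (\<exists>p \<in> X \<times> X. x = k p)" for x by (auto simp: dgroup_def)
  have ds: "p \<in> X \<times> X" "q \<in> X \<times> X" "r \<in> X \<times> X" if "dsum p q r" for p q r
    using that by (simp_all add: dsum_def)
  obtain u0 where "gen u0 {}" using ex_gen[of "{}"] by blast
  hence "\<exists>p. \<exists>u \<in> X. p = (u, u)" using gen_X by blast
  hence "\<exists>u \<in> X. (SOME p. \<exists>u \<in> X. p = (u, u)) = (u, u)" by (rule someI_ex)
  then obtain u where u: "u \<in> X" "one (dgroup k) = k (u, u)" by (auto simp: dgroup_def)
  show ?thesis
  proof (rule groupI)
    show "one (dgroup k) \<in> carrier (dgroup k)" using u car by auto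
    fix x assume "x \<in> carrier (dgroup k)"
    then obtain p where p: "p \<in> X \<times> X" "x = k p" using car by blast
    show "monoid.mult (dgroup k) (one (dgroup k)) x = x" using m[OF dsum_zero[OF u(1) p(1)]] p u by simp
    have "(snd p, fst p) \<in> X \<times> X" using p by auto
    thus "\<exists>y \<in> carrier (dgroup k). monoid.mult (dgroup k) y x = one (dgroup k)"
      using m[OF dsum_inverse[OF u(1) p(1)]] p u car by auto
    fix y assume "y \<in> carrier (dgroup k)"
    then obtain q where q: "q \<in> X \<times> X" "y = k q" using car by blast
    obtain a where a: "dsum p q a" using dsum_ex p q by blast
    show "monoid.mult (dgroup k) x y \<in> carrier (dgroup k)" using m[OF a] ds[OF a] p q car by auto
    fix z assume "z \<in> carrier (dgroup k)"
    then obtain r where r: "r \<in> X \<times> X" "z = k r" using car by blast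
    obtain b where b: "dsum a r b" using dsum_ex ds[OF a] r by blast
    obtain c where c: "dsum q r c" using dsum_ex q r by blast
    show "monoid.mult (dgroup k) (monoid.mult (dgroup k) x y) z = monoid.mult (dgroup k) x (monoid.mult (dgroup k) y z)"
      using m[OF a] m[OF b] m[OF c] m[OF dsum_assoc[OF a b c]] p q r by simp
  qed
qed

lemma dgroup_graph:
  assumes k: "\<forall>p \<in> X \<times> X. \<forall>q \<in> X \<times> X. k p = k q \<longleftrightarrow> deq p q"
  shows "{[x, y, monoid.mult (dgroup k) x y] | x y. x \<in> carrier (dgroup k) \<and> y \<in> carrier (dgroup k)} =
    {[k p, k q, k r] | p q r. dsum p q r}" (is "?L = ?R")
proof
  note m = dgroup_mult[OF k]
  show "?L \<subseteq> ?R"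
  proof
    fix l assume "l \<in> ?L"
    then obtain p q where pq: "p \<in> X \<times> X" "q \<in> X \<times> X" "l = [k p, k q, monoid.mult (dgroup k) (k p) (k q)]"
      by (auto simp: dgroup_def)
    obtain r where "dsum p q r" using dsum_ex pq by blast
    thus "l \<in> ?R" using m pq by blast
  qed
  show "?R \<subseteq> ?L"
  proof
    fix l assume "l \<in> ?R"
    then obtain p q r where pqr: "dsum p q r" "l = [k p, k q, k r]" by blast
    hence "p \<in> X \<times> X" "q \<in> X \<times> X" by (simp_all add: dsum_def)
    thus "l \<in> ?L" using m[OF pqr(1)] pqr(2) by (auto simp: dgroup_def)
  qed
qed

end

section \<open>Transport of differences along maps between generic additions\<close>

locale addition_map = A: generic_addition X add gen + B: generic_addition Y add' gen'
  for X :: "'v set" and add gen and Y :: "'w set" and add' gen' +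
  fixes h :: "'v \<Rightarrow> 'w"
  assumes h_X: "u \<in> X \<Longrightarrow> h u \<in> Y"
    and h_add: "h (add u v) = add' (h u) (h v)"
    and h_gen: "gen u F \<Longrightarrow> gen' (h u) (h ` F)"
begin

lemma h_act: "B.act (h u) (map h l) = h (A.act u l)"
  by (induction l arbitrary: u) (simp_all add: h_add[symmetric])

lemma h_eqact: "A.eqact l m \<Longrightarrow> B.eqact (map h l) (map h m)"
  using h_gen h_act unfolding A.eqact_def B.eqact_def by (metis image_Un list.set_map)

lemma h_meq: "A.meq M N \<Longrightarrow> B.meq (image_mset h M) (image_mset h N)"
  using h_eqact unfolding A.meq_def B.meq_def by (metis mset_map)

lemma h_deq: "A.deq p q \<Longrightarrow> B.deq (map_prod h h p) (map_prod h h q)"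
  using h_meq[of "{#fst p, snd q#}" "{#fst q, snd p#}"] h_X by (auto simp: A.deq_def B.deq_def)

lemma h_dsum: "A.dsum p q r \<Longrightarrow> B.dsum (map_prod h h p) (map_prod h h q) (map_prod h h r)"
  using h_meq[of "{#fst r, snd p, snd q#}" "{#snd r, fst p, fst q#}"] h_X by (auto simp: A.dsum_def B.dsum_def)

end

sublocale modular_geometry \<subseteq> vec: generic_addition vect vadd vgen
proof unfold_locales
  fix u v w F G and t :: "'a set \<times> 'a set"
  show "vgen u F \<Longrightarrow> u \<in> vect" by (rule vgen_vect)
  show "vgen u {}" if "u \<in> vect"
    using that vgen_rep vrepD(1) by (elim vectE) (simp add: vspan_def)
  show "vgen u F" if "vgen u G" "F \<subseteq> G" using vgen_mono that .
  show "\<exists>u. vgen u F" if "finite F" "F \<subseteq> vect" using ex_vgen that .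
  show "vgen u (insert t F)" if "vgen u F" "vgen t (insert u F)" using vgen_exch that .
  show "vgen u (insert (vadd v w) F)" if u: "vgen u F" "v \<in> F" "vgen v {w}" "w \<in> F" "w \<in> vect" for u v w F
  proof -
    obtain x x' where x: "v = (C {x}, C {x'})" "vrep x x'" using vectE vgen_vect[OF u(3)] by blast
    obtain y y' where y: "w = (C {y}, C {y'})" "vrep y y'" using vectE[OF u(5)] by blast
    have "x \<notin> C {pz, y}" using u(3) x y vgen_rep vspan_single by metis
    then obtain r r' where r: "vadd v w = (C {r}, C {r'})" "r \<in> C {x, y}"
      using vadd_rep[OF x(2) y(2) ind_sym[OF x(2) y(2)]] x(1) y(1) by metis
    have "{x, y} \<subseteq> vspan F" using u(2,4) x(1) y(1) rep_vspan by blast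
    hence "r \<in> vspan F" using r(2) C_sub_vspan by blast
    hence "C {r} \<subseteq> vspan F" using C_sub_vspan by simp
    moreover have "insert pz (\<Union>(fst ` F)) \<subseteq> vspan F" unfolding vspan_def by (rule ext)
    ultimately have "insert pz (\<Union>(fst ` insert (vadd v w) F)) \<subseteq> vspan F" using r(1) by auto
    hence "vspan (insert (vadd v w) F) \<subseteq> vspan F"
      unfolding vspan_def[of "insert _ _"] by (rule C_sub_vspan)
    thus ?thesis using u(1) by (auto simp: vgen_def vspan_def)
  qed
  show "vadd v w = vadd w v" by (rule vadd_comm)
  show "vgen (vadd u v) F" if "vgen u F" "v \<in> F" "v \<in> vect" using vadd_vgen that .
  show "vadd (vadd u v) w = vadd u (vadd v w)" if "vgen v {w}" "w \<in> vect" "vgen u {v, w}" using vadd_assoc that .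
  show "v = w" if "vgen u {v}" "v \<in> vect" "vgen u {w}" "w \<in> vect" "vadd u v = vadd u w" using vadd_cancel that .
  show "\<exists>w. vgen w F \<and> vadd w v = u" if "vgen u F" "v \<in> F" "v \<in> vect" using vsub that .
qed

text \<open>Addition is defined from closures, unions and intersections. All of these are preserved
  by direct image under an injection compatible with the closures; injectivity is needed for the
  intersections. The two base points may differ, since an automorphism moves the base.\<close>

lemma geometry_iso_addition:
  assumes M: "modular_geometry C p" "modular_geometry D q"
    and f: "inj f" "\<And>A. f ` C A = D (f ` A)" "f p = q"
  shows "addition_map (modular_geometry.vect C p) (modular_geometry.vadd C p) (modular_geometry.vgen C p)
    (modular_geometry.vect D q) (modular_geometry.vadd D q) (modular_geometry.vgen D q)
    (map_prod ((`) f) ((`) f))"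
proof -
  interpret A: modular_geometry C p by fact
  interpret B: modular_geometry D q by fact
  have mem: "f x \<in> D (f ` A) \<longleftrightarrow> x \<in> C A" for x A
    using inj_image_mem_iff[OF f(1), of x "C A"] by (simp only: f(2))
  have rep: "B.vrep (f x) (f x')" if "A.vrep x x'" for x x'
    using that mem[of x "{p}"] mem[of x' "{p, x}"] mem[of x' "{p}"] mem[of x' "{x}"]
    by (simp add: A.vrep_def B.vrep_def f(3))
  have pt: "f ` C {x} = D {f x}" for x using f(2)[of "{x}"] by simp
  show ?thesis
  proof unfold_locales
    fix u v F
    show X: "map_prod ((`) f) ((`) f) u \<in> B.vect" if "u \<in> A.vect" for u
      using that by (elim A.vectE) (simp add: pt B.vectI[OF rep])
    show "map_prod ((`) f) ((`) f) (A.vadd u v) = B.vadd (map_prod ((`) f) ((`) f) u) (map_prod ((`) f) ((`) f) v)"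
      by (cases u; cases v) (simp add: A.vadd_def B.vadd_def Let_def image_Int[OF f(1)] f(2) image_Un f(3))
    show "B.vgen (map_prod ((`) f) ((`) f) u) (map_prod ((`) f) ((`) f) ` F)" if u: "A.vgen u F"
    proof -
      have "f ` insert p (\<Union>(fst ` F)) = insert q (\<Union>(fst ` map_prod ((`) f) ((`) f) ` F))"
        using f(3) by (auto simp: image_iff) (metis+)?
      hence "f ` C (insert p (\<Union>(fst ` F))) = D (insert q (\<Union>(fst ` map_prod ((`) f) ((`) f) ` F)))"
        by (simp only: f(2))
      moreover have "\<not> f ` fst u \<subseteq> f ` C (insert p (\<Union>(fst ` F)))"
        using u inj_image_subset_iff[OF f(1)] by (simp add: A.vgen_def)
      ultimately show ?thesis using X[OF A.vgen_vect[OF u]] unfolding B.vgen_def by simp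
    qed
  qed
qed

subsection \<open>Quantifier-free types\<close>

lemma finite_trm_vars: "finite (set2_trm t)"
  by (induction t) auto

lemma finite_qf_vars: "finite (set3_qf p)"
  by (induction p) (auto simp: finite_trm_vars)

lemma wf_trm_iff: "wf_trm L V t \<longleftrightarrow> wf_trm L UNIV t \<and> set2_trm t \<subseteq> V"
  by (induction t) auto

lemma wf_qf_iff: "wf_qf L V p \<longleftrightarrow> wf_qf L UNIV p \<and> set3_qf p \<subseteq> V"
proof (induction p)
  case (Eq s t)
  thus ?case using wf_trm_iff[of L V s] wf_trm_iff[of L V t] by auto
next
  case (Rel r ts)
  have "(\<forall>t \<in> set ts. wf_trm L V t) \<longleftrightarrow> (\<forall>t \<in> set ts. wf_trm L UNIV t) \<and> (\<Union>t \<in> set ts. set2_trm t) \<subseteq> V"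
    using wf_trm_iff[of L V] by blast
  thus ?case by auto
qed auto

lemma wf_map_trm: "wf_trm L UNIV (map_trm (\<lambda>f. f) g t) \<longleftrightarrow> wf_trm L UNIV t"
  by (induction t) auto

lemma wf_map_qf: "wf_qf L UNIV (map_qf (\<lambda>f. f) (\<lambda>r. r) g p) \<longleftrightarrow> wf_qf L UNIV p"
  by (induction p) (auto simp: wf_map_trm)

lemma eval_map_trm: "eval_trm M v (map_trm (\<lambda>f. f) g t) = eval_trm M (v \<circ> g) t"
  by (induction t) (auto intro!: arg_cong2[where f = "funs M"])

lemma sat_map_qf: "sat M v (map_qf (\<lambda>f. f) (\<lambda>r. r) g p) \<longleftrightarrow> sat M (v \<circ> g) p"
  by (induction p) (simp_all add: eval_map_trm comp_def)

lemma eval_cong: "(\<And>x. x \<in> set2_trm t \<Longrightarrow> v x = w x) \<Longrightarrow> eval_trm M v t = eval_trm M w t"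
proof (induction t)
  case (Fn f ts)
  hence "map (eval_trm M v) ts = map (eval_trm M w) ts" by auto
  thus ?case by (simp del: map_eq_conv)
qed simp

lemma sat_cong: "(\<And>x. x \<in> set3_qf p \<Longrightarrow> v x = w x) \<Longrightarrow> sat M v p \<longleftrightarrow> sat M w p"
proof (induction p)
  case (Eq s t)
  thus ?case using eval_cong[of s v w M] eval_cong[of t v w M] by simp
next
  case (Rel r ts)
  hence "eval_trm M v t = eval_trm M w t" if "t \<in> set ts" for t using that by (intro eval_cong) auto
  hence "map (eval_trm M v) ts = map (eval_trm M w) ts" by auto
  thus ?case by (simp del: map_eq_conv)
next
  case (Conj p q)
  thus ?case by auto
qed simp

lemma qftp_eq_iff: "qftp L M V v = qftp L M V w \<longleftrightarrow> (\<forall>p. wf_qf L V p \<longrightarrow> sat M v p = sat M w p)"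
  by (auto simp: qftp_def)

text \<open>A partial map given by its graph. Functionality and injectivity follow from equality
  formulas (\<open>elementary_pair\<close>), and the enumerations that occur in the axioms
  disappear.\<close>

definition elementary :: "('f, 'r) language \<Rightarrow> ('f, 'r, 'a) cl_structure \<Rightarrow> ('a \<times> 'a) set \<Rightarrow> bool" where
  "elementary L M R \<longleftrightarrow>
     R \<subseteq> points M \<times> points M \<and> (\<forall>l \<in> lists R. qftp_tuple L M (map fst l) = qftp_tuple L M (map snd l))"

text \<open>A formula contains finitely many variables, so the type of an indexed family amounts to
  the types of its finite tuples, by renaming variables to positions and back.\<close>

lemma qftp_elementary:
  assumes "v ` V \<subseteq> points M" "w ` V \<subseteq> points M"
  shows "qftp L M V v = qftp L M V w \<longleftrightarrow> elementary L M ((\<lambda>i. (v i, w i)) ` V)"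
proof
  assume eq: "qftp L M V v = qftp L M V w"
  have "qftp_tuple L M (map fst l) = qftp_tuple L M (map snd l)" if "l \<in> lists ((\<lambda>i. (v i, w i)) ` V)" for l
  proof -
    have "l \<in> map (\<lambda>i. (v i, w i)) ` lists V" using that by (simp only: lists_image)
    then obtain vs where l: "l = map (\<lambda>i. (v i, w i)) vs" and "vs \<in> lists V" by (elim imageE)
    hence vs: "set vs \<subseteq> V" "l = map (\<lambda>i. (v i, w i)) vs" by (simp_all only: in_lists_conv_set subset_code(1))
    have "sat M (\<lambda>i. map fst l ! i) p = sat M (\<lambda>i. map snd l ! i) p" if p: "wf_qf L {..<length l} p" for p
    proof -
      have sub: "set3_qf p \<subseteq> {..<length vs}" "wf_qf L UNIV p" using p wf_qf_iff[of L "{..<length l}" p] vs by auto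
      define q where "q = map_qf (\<lambda>f. f) (\<lambda>r. r) (\<lambda>i. vs ! i) p"
      have "vs ! i \<in> V" if "i \<in> set3_qf p" for i using that sub(1) vs(1) nth_mem[of i vs] by blast
      hence "set3_qf q \<subseteq> V" by (auto simp: q_def qf.set_map)
      hence "wf_qf L V q" using sub wf_qf_iff[of L V q] by (simp add: q_def wf_map_qf)
      hence "sat M v q = sat M w q" using eq qftp_eq_iff by blast
      moreover have "sat M (\<lambda>i. map fst l ! i) p = sat M v q"
        unfolding q_def sat_map_qf by (rule sat_cong) (use sub vs in auto)
      moreover have "sat M (\<lambda>i. map snd l ! i) p = sat M w q"
        unfolding q_def sat_map_qf by (rule sat_cong) (use sub vs in auto)
      ultimately show ?thesis by simp
    qed
    thus ?thesis by (simp add: qftp_tuple_def qftp_eq_iff)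
  qed
  thus "elementary L M ((\<lambda>i. (v i, w i)) ` V)" using assms by (auto simp: elementary_def)
next
  assume el: "elementary L M ((\<lambda>i. (v i, w i)) ` V)"
  have "sat M v p = sat M w p" if p: "wf_qf L V p" for p
  proof -
    have sub: "set3_qf p \<subseteq> V" "wf_qf L UNIV p" using p wf_qf_iff[of L V p] by auto
    obtain vs where vs: "set vs = set3_qf p" using finite_list[OF finite_qf_vars[of p]] by (elim exE)
    define idx where "idx x = (SOME i. i < length vs \<and> vs ! i = x)" for x
    have idx: "idx x < length vs" "vs ! idx x = x" if "x \<in> set3_qf p" for x
    proof -
      have "x \<in> set vs" using that vs by simp
      hence "\<exists>i. i < length vs \<and> vs ! i = x" by (simp only: in_set_conv_nth)
      from someI_ex[OF this] show "idx x < length vs" "vs ! idx x = x" by (simp_all add: idx_def)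
    qed
    define q where "q = map_qf (\<lambda>f. f) (\<lambda>r. r) idx p"
    define l where "l = map (\<lambda>i. (v i, w i)) vs"
    have "set3_qf q \<subseteq> {..<length l}" using idx(1) by (auto simp: q_def qf.set_map l_def)
    hence wf: "wf_qf L {..<length l} q" using sub wf_qf_iff[of L _ q] by (simp add: q_def wf_map_qf)
    have "set l \<subseteq> (\<lambda>i. (v i, w i)) ` V" unfolding l_def set_map vs using sub(1) by (rule image_mono)
    hence "l \<in> lists ((\<lambda>i. (v i, w i)) ` V)" by (simp only: in_lists_conv_set subset_code(1))
    hence "qftp_tuple L M (map fst l) = qftp_tuple L M (map snd l)" using el by (simp add: elementary_def)
    hence "sat M (\<lambda>i. map fst l ! i) q = sat M (\<lambda>i. map snd l ! i) q"
      using wf by (auto simp: qftp_tuple_def qftp_eq_iff)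
    moreover have "sat M (\<lambda>i. map fst l ! i) q = sat M v p"
      unfolding q_def sat_map_qf by (rule sat_cong) (use idx in \<open>auto simp: l_def\<close>)
    moreover have "sat M (\<lambda>i. map snd l ! i) q = sat M w p"
      unfolding q_def sat_map_qf by (rule sat_cong) (use idx in \<open>auto simp: l_def\<close>)
    ultimately show ?thesis by simp
  qed
  thus "qftp L M V v = qftp L M V w" by (simp add: qftp_eq_iff)
qed

lemma elementary_mono: "elementary L M R \<Longrightarrow> S \<subseteq> R \<Longrightarrow> elementary L M S"
  unfolding elementary_def by (meson lists_mono subset_iff subset_trans)

lemma elementary_converse: "elementary L M R \<Longrightarrow> elementary L M (R\<inverse>)"
proof -
  assume R: "elementary L M R"
  have "qftp_tuple L M (map fst l) = qftp_tuple L M (map snd l)" if "l \<in> lists (R\<inverse>)" for l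
  proof -
    have "map prod.swap l \<in> lists R" using that by auto
    hence "qftp_tuple L M (map fst (map prod.swap l)) = qftp_tuple L M (map snd (map prod.swap l))"
      using R unfolding elementary_def by blast
    thus ?thesis by (simp add: comp_def)
  qed
  thus "elementary L M (R\<inverse>)" using R by (auto simp: elementary_def)
qed

lemma elementary_finite:
  assumes "R \<subseteq> points M \<times> points M" "\<And>F. finite F \<Longrightarrow> F \<subseteq> R \<Longrightarrow> elementary L M F"
  shows "elementary L M R"
  unfolding elementary_def
proof (intro conjI ballI)
  fix l assume "l \<in> lists R"
  hence "elementary L M (set l)" by (intro assms(2)) auto
  thus "qftp_tuple L M (map fst l) = qftp_tuple L M (map snd l)" by (auto simp: elementary_def)
qed (rule assms(1))

lemma elementary_sat:
  fixes p :: "('f, 'r, nat) qf"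
  assumes "elementary L M R" "set l \<subseteq> R" "wf_qf L {..<length l} p"
  shows "sat M (\<lambda>i. map fst l ! i) p = sat M (\<lambda>i. map snd l ! i) p"
proof -
  have "l \<in> lists R" using assms(2) by auto
  hence "qftp_tuple L M (map fst l) = qftp_tuple L M (map snd l)"
    using assms(1) unfolding elementary_def by blast
  hence "qftp L M {..<length l} (\<lambda>i. map fst l ! i) = qftp L M {..<length l} (\<lambda>i. map snd l ! i)"
    by (simp add: qftp_tuple_def)
  thus ?thesis using assms(3) unfolding qftp_eq_iff by blast
qed

lemma elementary_pair:
  assumes "elementary L M R" "(x, x') \<in> R" "(y, y') \<in> R"
  shows "x = y \<longleftrightarrow> x' = y'"
  using elementary_sat[OF assms(1), of "[(x, x'), (y, y')]" "Eq (Var 0) (Var 1)"] assms by simp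

lemma elementary_fun:
  assumes "elementary L M R" "set l \<subseteq> R" "(y, y') \<in> R" "(f, length l) \<in> fun_syms L"
  shows "y = funs M f (map fst l) \<longleftrightarrow> y' = funs M f (map snd l)"
proof -
  have "map (\<lambda>i. map fst l ! i) [0..<length l] = map fst l" "map (\<lambda>i. map snd l ! i) [0..<length l] = map snd l"
    by (auto intro!: nth_equalityI)
  thus ?thesis
    using elementary_sat[OF assms(1), of "(y, y') # l" "Eq (Var 0) (Fn f (map (\<lambda>i. Var (Suc i)) [0..<length l]))"] assms
    by (simp add: comp_def)
qed

lemma elementary_rel:
  assumes "elementary L M R" "set l \<subseteq> R" "(r, length l) \<in> rel_syms L"
  shows "rels M r (map fst l) \<longleftrightarrow> rels M r (map snd l)"
proof -
  have "map (\<lambda>i. map fst l ! i) [0..<length l] = map fst l" "map (\<lambda>i. map snd l ! i) [0..<length l] = map snd l"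
    by (auto intro!: nth_equalityI)
  thus ?thesis
    using elementary_sat[OF assms(1,2), of "Rel r (map (\<lambda>i. Var i) [0..<length l])"] assms(3)
    by (simp add: comp_def)
qed

lemma eval_automorphism:
  assumes "is_structure L M" "L_isom L g M M" "wf_trm L V t" "v ` V \<subseteq> points M"
  shows "eval_trm M v t \<in> points M \<and> eval_trm M (g \<circ> v) t = g (eval_trm M v t)"
  using assms(3)
proof (induction t)
  case (Fn f ts)
  have IH: "\<forall>t \<in> set ts. eval_trm M v t \<in> points M \<and> eval_trm M (g \<circ> v) t = g (eval_trm M v t)"
    using Fn by (metis wf_trm.simps(2))
  hence t: "map (eval_trm M v) ts \<in> tuples (points M) (length ts)" by (auto simp: tuples_def)
  have f: "(f, length ts) \<in> fun_syms L" using Fn by simp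
  have "funs M f (map (eval_trm M v) ts) \<in> points M"
    using assms(1) f t unfolding is_structure_def by fastforce
  moreover have "g (funs M f (map (eval_trm M v) ts)) = funs M f (map g (map (eval_trm M v) ts))"
    using assms(2) f t unfolding L_isom_def by fastforce
  moreover have "map g (map (eval_trm M v) ts) = map (eval_trm M (g \<circ> v)) ts" using IH by auto
  ultimately show ?case unfolding eval_trm.simps sat.simps by metis
qed (use assms(4) in auto)

lemma sat_automorphism:
  assumes "is_structure L M" "L_isom L g M M" "wf_qf L V p" "v ` V \<subseteq> points M"
  shows "sat M (g \<circ> v) p = sat M v p"
  using assms(3)
proof (induction p)
  case (Eq s t)
  have "inj_on g (points M)" using assms(2) by (simp add: L_isom_def bij_betw_def)
  moreover have "eval_trm M v t \<in> points M \<and> eval_trm M (g \<circ> v) t = g (eval_trm M v t)"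
    "eval_trm M v s \<in> points M \<and> eval_trm M (g \<circ> v) s = g (eval_trm M v s)"
    using eval_automorphism[OF assms(1,2) _ assms(4)] Eq by auto
  ultimately show ?case by (simp add: inj_on_eq_iff del: comp_apply)
next
  case (Rel r ts)
  have IH: "\<forall>t \<in> set ts. eval_trm M v t \<in> points M \<and> eval_trm M (g \<circ> v) t = g (eval_trm M v t)"
    using eval_automorphism[OF assms(1,2) _ assms(4)] Rel by simp
  hence t: "map (eval_trm M v) ts \<in> tuples (points M) (length ts)" by (auto simp: tuples_def)
  have "rels M r (map (eval_trm M v) ts) = rels M r (map g (map (eval_trm M v) ts))"
    using assms(2) Rel t unfolding L_isom_def by fastforce
  moreover have "map g (map (eval_trm M v) ts) = map (eval_trm M (g \<circ> v)) ts" using IH by auto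
  ultimately show ?case unfolding eval_trm.simps sat.simps by metis
qed auto

lemma automorphism_elementary:
  assumes "is_structure L M" "L_isom L g M M" "S \<subseteq> points M"
  shows "elementary L M ((\<lambda>x. (x, g x)) ` S)"
proof -
  have g: "g ` S \<subseteq> points M" using assms(2,3) by (auto simp: L_isom_def bij_betw_def)
  have "qftp L M S (\<lambda>x. x) = qftp L M S g"
    unfolding qftp_eq_iff using sat_automorphism[OF assms(1,2), of S _ "\<lambda>x. x"] assms(3) by (simp add: comp_def)
  thus ?thesis using qftp_elementary[of "\<lambda>x. x" S M g L] assms(3) g by simp
qed

section \<open>Back-and-forth in an uncountable quasiminimal structure\<close>

locale uncountable_quasiminimal =
  fixes L :: "('f, 'r) language" and M :: "('f, 'r, 'm) cl_structure"
  assumes quasiminimal: "quasiminimal L M"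
    and uncountable_points: "uncountable (points M)"
begin

abbreviation P :: "'m set" where "P \<equiv> points M"

abbreviation el :: "('m \<times> 'm) set \<Rightarrow> bool" where "el \<equiv> elementary L M"

lemma is_struct: "is_structure L M"
  using quasiminimal by (simp add: quasiminimal_def weakly_quasiminimal_def)

lemma cl_ext: "A \<subseteq> P \<Longrightarrow> A \<subseteq> cl M A" and cl_P: "A \<subseteq> P \<Longrightarrow> cl M A \<subseteq> P"
  and cl_mono: "A \<subseteq> B \<Longrightarrow> B \<subseteq> P \<Longrightarrow> cl M A \<subseteq> cl M B"
  and cl_idem: "A \<subseteq> P \<Longrightarrow> cl M (cl M A) = cl M A"
  and cl_fin: "A \<subseteq> P \<Longrightarrow> x \<in> cl M A \<Longrightarrow> \<exists>F \<subseteq> A. finite F \<and> x \<in> cl M F"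
  and cl_exch: "A \<subseteq> P \<Longrightarrow> x \<in> P \<Longrightarrow> y \<in> P \<Longrightarrow> x \<in> cl M (insert y A) \<Longrightarrow> x \<notin> cl M A \<Longrightarrow> y \<in> cl M (insert x A)"
proof -
  have "pregeometry P (cl M)" using quasiminimal by (simp add: quasiminimal_def weakly_quasiminimal_def)
  thus "A \<subseteq> P \<Longrightarrow> A \<subseteq> cl M A" "A \<subseteq> P \<Longrightarrow> cl M A \<subseteq> P"
    "A \<subseteq> B \<Longrightarrow> B \<subseteq> P \<Longrightarrow> cl M A \<subseteq> cl M B" "A \<subseteq> P \<Longrightarrow> cl M (cl M A) = cl M A"
    "A \<subseteq> P \<Longrightarrow> x \<in> cl M A \<Longrightarrow> \<exists>F \<subseteq> A. finite F \<and> x \<in> cl M F"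
    "A \<subseteq> P \<Longrightarrow> x \<in> P \<Longrightarrow> y \<in> P \<Longrightarrow> x \<in> cl M (insert y A) \<Longrightarrow> x \<notin> cl M A \<Longrightarrow> y \<in> cl M (insert x A)"
    unfolding pregeometry_def by (simp; blast)+
qed

lemma cl_closed_cl: "A \<subseteq> P \<Longrightarrow> cl_closed M (cl M A)"
  by (simp add: cl_closed_def cl_P cl_idem)

lemma countable_cl:
  assumes "A \<subseteq> P" "countable A"
  shows "countable (cl M A)"
proof -
  have "cl M A \<subseteq> (\<Union>F \<in> {F. F \<subseteq> A \<and> finite F}. cl M F)" using cl_fin assms by fastforce
  moreover have "countable {F. F \<subseteq> A \<and> finite F}"
    using countable_Collect_finite_subset[OF assms(2)] by (simp add: conj_commute)
  moreover have "countable (cl M F)" if "F \<subseteq> A" "finite F" for F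
    using quasiminimal that assms(1) by (auto simp: quasiminimal_def weakly_quasiminimal_def QM3_def)
  ultimately have "countable (\<Union>F \<in> {F. F \<subseteq> A \<and> finite F}. cl M F)" by (intro countable_UN) auto
  thus ?thesis using \<open>cl M A \<subseteq> _\<close> countable_subset by blast
qed

lemma el_P: "el R \<Longrightarrow> fst ` R \<subseteq> P" "el R \<Longrightarrow> snd ` R \<subseteq> P"
  by (auto simp: elementary_def)

lemma conv_image: "fst ` R\<inverse> = snd ` R" "snd ` R\<inverse> = fst ` R"
  by force+

lemma el_cl_1:
  assumes S: "el S" and B: "B \<subseteq> S" and y: "(y, y') \<in> S" and in_cl: "y \<in> cl M (fst ` B)"
  shows "y' \<in> cl M (snd ` B)"
proof -
  have BP: "fst ` B \<subseteq> P" "snd ` B \<subseteq> P"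
    by (rule subset_trans[OF image_mono[OF B]], rule el_P[OF S])+
  obtain G where G: "G \<subseteq> fst ` B" "finite G" "y \<in> cl M G" using cl_fin[OF BP(1) in_cl] by blast
  from finite_subset_image[OF G(2,1)] obtain F where F: "F \<subseteq> B" "finite F" "G = fst ` F" by blast
  obtain l where l: "set l = F" using finite_list[OF F(2)] by blast
  have FP: "fst ` F \<subseteq> P" "snd ` F \<subseteq> P" by (rule subset_trans[OF image_mono[OF F(1)]], rule BP)+
  hence lP: "map fst l \<in> lists P" "map snd l \<in> lists P" using l by auto
  have yP: "y \<in> P" "y' \<in> P" using S y by (auto simp: elementary_def)
  have "(y, y') # l \<in> lists S" using l F(1) B y by auto
  hence "qftp_tuple L M (map fst ((y, y') # l)) = qftp_tuple L M (map snd ((y, y') # l))"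
    using S unfolding elementary_def by blast
  hence "qftp_tuple L M (y # map fst l) = qftp_tuple L M (y' # map snd l)" by simp
  moreover have "QM1 L M" using quasiminimal by (simp add: quasiminimal_def weakly_quasiminimal_def)
  ultimately have "y \<in> cl M (set (map fst l)) \<longleftrightarrow> y' \<in> cl M (set (map snd l))"
    using lP yP unfolding QM1_def by blast
  hence "y' \<in> cl M (snd ` F)" using F(3) G(3) l by simp
  thus ?thesis using cl_mono[OF image_mono[OF F(1)] BP(2)] by blast
qed

lemma el_cl:
  assumes R: "el R" and A: "A \<subseteq> R" and x: "(x, x') \<in> R"
  shows "x \<in> cl M (fst ` A) \<longleftrightarrow> x' \<in> cl M (snd ` A)"
proof -
  have "el (R\<inverse>)" "A\<inverse> \<subseteq> R\<inverse>" "(x', x) \<in> R\<inverse>" using R A x elementary_converse by auto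
  from el_cl_1[OF this] el_cl_1[OF R A x] show ?thesis by (auto simp: conv_image)
qed

lemma el_countable: "el R \<Longrightarrow> countable (fst ` R) \<Longrightarrow> countable R"
proof -
  assume R: "el R" and c: "countable (fst ` R)"
  have "inj_on fst R" using elementary_pair[OF R] by (auto simp: inj_on_def)
  thus ?thesis using c countable_image_inj_on by blast
qed

lemma enumeration:
  assumes "countable R"
  obtains I :: "nat set" and h h' where "(\<lambda>i. (h i, h' i)) ` I = R" "h ` I = fst ` R" "h' ` I = snd ` R"
proof -
  define I where "I = to_nat_on R ` R"
  define e where "e = (\<lambda>i. from_nat_into R i)"
  have "e ` I = R" using assms by (auto simp: I_def e_def image_image)
  hence "(\<lambda>i. (fst (e i), snd (e i))) ` I = R" "(\<lambda>i. fst (e i)) ` I = fst ` R" "(\<lambda>i. snd (e i)) ` I = snd ` R"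
    by (auto simp: image_image[symmetric])
  thus ?thesis by (rule that)
qed

lemma qftp_fam:
  assumes R: "(\<lambda>i. (h i, h' i)) ` I = R" "R \<subseteq> P \<times> P" and b: "length b = length b'" "set b \<subseteq> P" "set b' \<subseteq> P"
  shows "qftp_fam_tuple L M I h b = qftp_fam_tuple L M I h' b' \<longleftrightarrow> el (R +@ (zip b b'))"
proof -
  have "(\<lambda>i. (b ! i, b' ! i)) ` {..<length b} = set (zip b b')" using b(1) by (auto simp: set_zip image_iff)
  hence "(\<lambda>i. (case_sum h ((!) b) i, case_sum h' ((!) b') i)) ` (I <+> {..<length b}) = R +@ (zip b b')"
    using R(1) by (auto simp: Plus_def image_Un image_image)
  moreover have "case_sum h ((!) b) ` (I <+> {..<length b}) \<subseteq> P" "case_sum h' ((!) b') ` (I <+> {..<length b}) \<subseteq> P"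
    using R b by (auto simp: Plus_def image_Un image_image)
  ultimately show ?thesis
    using qftp_elementary[of "case_sum h ((!) b)" "I <+> {..<length b}" M "case_sum h' ((!) b')" L] b(1)
    by (simp add: qftp_fam_tuple_def)
qed

lemma el_generic:
  assumes R: "el R" "countable (fst ` R)" "cl_closed M (fst ` R)" "cl_closed M (snd ` R)"
    and x: "x \<in> P" "x \<notin> fst ` R" "x' \<in> P" "x' \<notin> snd ` R"
  shows "el (insert (x, x') R)"
proof -
  obtain I :: "nat set" and h h' where I: "(\<lambda>i. (h i, h' i)) ` I = R" "h ` I = fst ` R" "h' ` I = snd ` R"
    using enumeration[OF el_countable[OF R(1,2)]] by metis
  have "qftp L M I h = qftp L M I h'" using qftp_elementary[of h I M h' L] I R(1) el_P[OF R(1)] by simp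
  hence "cl_closed M (h ` I) \<and> cl_closed M (h' ` I) \<and> qftp L M I h = qftp L M I h'" using R I by simp
  moreover have "QM4 L M" using quasiminimal by (simp add: quasiminimal_def weakly_quasiminimal_def)
  ultimately have "\<forall>a \<in> P - h ` I. \<forall>a' \<in> P - h' ` I. qftp_fam_tuple L M I h [a] = qftp_fam_tuple L M I h' [a']"
    unfolding QM4_def by blast
  hence "qftp_fam_tuple L M I h [x] = qftp_fam_tuple L M I h' [x']" using x I by simp
  thus ?thesis using qftp_fam[OF I(1), of "[x]" "[x']"] R(1) x by (simp add: elementary_def)
qed

lemma el_algebraic:
  assumes R: "el (R \<union> S)" "countable (fst ` R)" "cl_closed M (fst ` R) \<or> fst ` R = {}" "cl_closed M (snd ` R) \<or> snd ` R = {}"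
    and S: "finite S" and x: "x \<in> cl M (fst ` (R \<union> S))"
  shows "\<exists>x'. el (insert (x, x') (R \<union> S))"
proof -
  have elR: "el R" "el S" using R(1) elementary_mono by blast+
  obtain I :: "nat set" and h h' where I: "(\<lambda>i. (h i, h' i)) ` I = R" "h ` I = fst ` R" "h' ` I = snd ` R"
    using enumeration[OF el_countable[OF elR(1) R(2)]] by metis
  obtain l where l: "set l = S" using finite_list S by blast
  have lP: "set (map fst l) \<subseteq> P" "set (map snd l) \<subseteq> P" using l el_P[OF elR(2)] by auto
  have RP: "R \<subseteq> P \<times> P" using elR(1) by (simp add: elementary_def)
  have zl: "zip (map fst l) (map snd l) = l" by (simp add: zip_map_fst_snd)
  have "qftp L M I h = qftp L M I h'" using qftp_elementary[of h I M h' L] I elR(1) el_P[OF elR(1)] by simp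
  moreover have "qftp_fam_tuple L M I h (map fst l) = qftp_fam_tuple L M I h' (map snd l)"
    using qftp_fam[OF I(1) RP _ lP] R(1) l zl by simp
  moreover have xc: "x \<in> cl M (h ` I +@ (map fst l))" using x I l by (simp add: image_Un)
  moreover have "QM5 L M" using quasiminimal by (simp add: quasiminimal_def weakly_quasiminimal_def)
  moreover have "map fst l \<in> lists P" "map snd l \<in> lists P" using lP by auto
  moreover have "(cl_closed M (h ` I) \<or> h ` I = {}) \<and> (cl_closed M (h' ` I) \<or> h' ` I = {})" using R I by simp
  ultimately have "\<exists>x' \<in> P. qftp_fam_tuple L M I h (map fst l @ [x]) = qftp_fam_tuple L M I h' (map snd l @ [x'])"
    unfolding QM5_def by blast
  then obtain x' where x': "x' \<in> P" "qftp_fam_tuple L M I h (map fst l @ [x]) = qftp_fam_tuple L M I h' (map snd l @ [x'])"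
    by blast
  have xP: "x \<in> P" using x cl_P[of "fst ` (R \<union> S)"] el_P[OF R(1)] by blast
  have "el (R +@ (zip (map fst l @ [x]) (map snd l @ [x'])))"
    using x' qftp_fam[OF I(1) RP, of "map fst l @ [x]" "map snd l @ [x']"] lP xP by simp
  moreover have "R +@ (zip (map fst l @ [x]) (map snd l @ [x'])) = insert (x, x') (R \<union> S)" using zl l by simp
  ultimately show ?thesis by metis
qed

text \<open>A stage of the back-and-forth: \<open>R\<close> is kept and the finite part
  \<open>S\<close> is enlarged within its closure. The condition on the domain implies the one on
  the range (\<open>finite_ext_snd\<close>), so the notion is symmetric under converse.\<close>

definition finite_ext :: "('m \<times> 'm) set \<Rightarrow> ('m \<times> 'm) set \<Rightarrow> ('m \<times> 'm) set \<Rightarrow> bool" where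
  "finite_ext R S U \<longleftrightarrow> finite U \<and> S \<subseteq> U \<and> el (R \<union> U) \<and> fst ` (R \<union> U) \<subseteq> cl M (fst ` (R \<union> S))"

lemma finite_ext_snd:
  assumes "finite_ext R S U"
  shows "snd ` (R \<union> U) \<subseteq> cl M (snd ` (R \<union> S))"
proof
  fix y assume "y \<in> snd ` (R \<union> U)"
  then obtain p where p: "p \<in> R \<union> U" "y = snd p" by blast
  hence x: "(fst p, y) \<in> R \<union> U" by simp
  have "el (R \<union> U)" "R \<union> S \<subseteq> R \<union> U" using assms by (auto simp: finite_ext_def)
  from el_cl[OF this x] show "y \<in> cl M (snd ` (R \<union> S))"
    using assms p(1) unfolding finite_ext_def image_subset_iff by blast
qed

lemma finite_ext_converse: "finite_ext R S U \<Longrightarrow> finite_ext (R\<inverse>) (S\<inverse>) (U\<inverse>)"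
  using finite_ext_snd[of R S U] elementary_converse[of L M "R \<union> U"]
  by (auto simp: finite_ext_def converse_Un[symmetric] conv_image)

lemma forth:
  assumes R: "countable (fst ` R)" "cl_closed M (fst ` R) \<or> fst ` R = {}" "cl_closed M (snd ` R) \<or> snd ` R = {}"
    and U: "finite_ext R S U"
  shows "\<exists>U'. finite_ext R S U' \<and> U \<subseteq> U' \<and> (x \<in> cl M (fst ` (R \<union> S)) \<longrightarrow> x \<in> fst ` (R \<union> U'))"
proof (cases "x \<in> cl M (fst ` (R \<union> S))")
  case True
  have u: "finite U" "S \<subseteq> U" "el (R \<union> U)" "fst ` (R \<union> U) \<subseteq> cl M (fst ` (R \<union> S))"
    using U by (simp_all add: finite_ext_def)
  have "fst ` (R \<union> S) \<subseteq> fst ` (R \<union> U)" using u(2) by blast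
  from cl_mono[OF this el_P(1)[OF u(3)]] True have "x \<in> cl M (fst ` (R \<union> U))" ..
  from el_algebraic[OF u(3) R u(1) this] obtain x' where "el (insert (x, x') (R \<union> U))" ..
  hence "finite_ext R S (insert (x, x') U)" using u True by (auto simp: finite_ext_def)
  thus ?thesis by (intro exI[of _ "insert (x, x') U"]) auto
qed (use U in blast)

text \<open>Each point of the closure is algebraic over the current stage, where QM5 supplies its
  image. The two closures are enumerated simultaneously, and the step back is \<open>forth\<close>
  for the converse relation.\<close>

lemma back_and_forth:
  assumes R: "el (R \<union> S)" "countable (fst ` R)" "cl_closed M (fst ` R) \<or> fst ` R = {}" "cl_closed M (snd ` R) \<or> snd ` R = {}"
    and S: "finite S"
  shows "\<exists>T. el T \<and> R \<union> S \<subseteq> T \<and> fst ` T = cl M (fst ` (R \<union> S)) \<and> snd ` T = cl M (snd ` (R \<union> S))"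
proof -
  have elR: "el R" by (rule elementary_mono[OF R(1)]) simp
  have RSP: "fst ` (R \<union> S) \<subseteq> P" "snd ` (R \<union> S) \<subseteq> P" using el_P[OF R(1)] by auto
  have cR: "countable (snd ` R)" using el_countable[OF elR R(2)] by simp
  define A where "A = cl M (fst ` (R \<union> S))"
  define B where "B = cl M (snd ` (R \<union> S))"
  have cA: "countable A" "countable B"
    unfolding A_def B_def using countable_cl RSP R(2) cR S by (auto simp: image_Un countable_finite)
  \<comment> \<open>The membership guards cover an empty closure, for which the enumeration takes an
    arbitrary value.\<close>
  define Q where "Q n U U' \<longleftrightarrow> U \<subseteq> U' \<and> (from_nat_into A n \<in> A \<longrightarrow> from_nat_into A n \<in> fst ` (R \<union> U')) \<and>
    (from_nat_into B n \<in> B \<longrightarrow> from_nat_into B n \<in> snd ` (R \<union> U'))" for n U U'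
  have "\<exists>U. \<forall>n. finite_ext R S (U n) \<and> Q n (U n) (U (Suc n))"
  proof (rule dependent_nat_choice)
    have "finite_ext R S S" using S R(1) cl_ext[OF RSP(1)] by (simp add: finite_ext_def)
    thus "\<exists>U. finite_ext R S U" ..
    fix U n assume U: "finite_ext R S U"
    obtain V where V: "finite_ext R S V" "U \<subseteq> V" "from_nat_into A n \<in> A \<longrightarrow> from_nat_into A n \<in> fst ` (R \<union> V)"
      using forth[OF R(2-4) U] unfolding A_def by blast
    obtain W where W: "finite_ext (R\<inverse>) (S\<inverse>) W" "V\<inverse> \<subseteq> W" "from_nat_into B n \<in> B \<longrightarrow> from_nat_into B n \<in> fst ` (R\<inverse> \<union> W)"
      using forth[OF _ _ _ finite_ext_converse[OF V(1)], of "from_nat_into B n"] R cR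
      unfolding B_def converse_Un[symmetric] conv_image by blast
    have "finite_ext R S (W\<inverse>)" using finite_ext_converse[OF W(1)] by simp
    moreover have VW: "V \<subseteq> W\<inverse>" using W(2) by auto
    moreover have "fst ` (R\<inverse> \<union> W) = snd ` (R \<union> W\<inverse>)" by (simp add: image_Un conv_image)
    moreover have "fst ` (R \<union> V) \<subseteq> fst ` (R \<union> W\<inverse>)" using VW by blast
    ultimately show "\<exists>U'. finite_ext R S U' \<and> Q n U U'"
      unfolding Q_def using U V(2,3) W(3) by (intro exI[of _ "W\<inverse>"]) blast
  qed
  then obtain U where U: "\<And>n. finite_ext R S (U n)" "\<And>n. Q n (U n) (U (Suc n))" by blast
  have Un: "S \<subseteq> U n" "el (R \<union> U n)" "fst ` (R \<union> U n) \<subseteq> A" "snd ` (R \<union> U n) \<subseteq> B" "R \<union> U n \<subseteq> R \<union> U (Suc n)" for n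
    using U(1)[of n] finite_ext_snd[OF U(1)[of n]] U(2)[of n] by (auto simp: finite_ext_def A_def B_def Q_def)
  define T where "T = (\<Union>n. R \<union> U n)"
  have "el T"
  proof (rule elementary_finite)
    have "R \<union> U n \<subseteq> P \<times> P" for n using Un(2)[of n] unfolding elementary_def by (rule conjunct1)
    thus "T \<subseteq> P \<times> P" unfolding T_def by fast
    fix F assume F: "finite F" "F \<subseteq> T"
    from finite_subset_chain[OF Un(5) F[unfolded T_def]] obtain n where "F \<subseteq> R \<union> U n" ..
    thus "el F" by (rule elementary_mono[OF Un(2)])
  qed
  moreover have "R \<union> S \<subseteq> T" using Un(1)[of 0] unfolding T_def by blast
  moreover have "fst ` T = A"
  proof
    show "fst ` T \<subseteq> A" unfolding T_def image_UN by (rule UN_least) (rule Un(3))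
    show "A \<subseteq> fst ` T"
    proof
      fix a assume a: "a \<in> A"
      then obtain n where "from_nat_into A n = a" using from_nat_into_surj[OF _ a] cA by blast
      hence "a \<in> fst ` (R \<union> U (Suc n))" using U(2)[of n] a by (simp add: Q_def)
      thus "a \<in> fst ` T" unfolding T_def image_UN by (rule UN_I[OF UNIV_I])
    qed
  qed
  moreover have "snd ` T = B"
  proof
    show "snd ` T \<subseteq> B" unfolding T_def image_UN by (rule UN_least) (rule Un(4))
    show "B \<subseteq> snd ` T"
    proof
      fix a assume a: "a \<in> B"
      then obtain n where "from_nat_into B n = a" using from_nat_into_surj[OF _ a] cA by blast
      hence "a \<in> snd ` (R \<union> U (Suc n))" using U(2)[of n] a by (simp add: Q_def)
      thus "a \<in> snd ` T" unfolding T_def image_UN by (rule UN_I[OF UNIV_I])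
    qed
  qed
  ultimately show ?thesis unfolding A_def B_def by blast
qed

definition closed_el :: "('m \<times> 'm) set \<Rightarrow> bool" where
  "closed_el R \<longleftrightarrow> el R \<and> countable (fst ` R) \<and> cl_closed M (fst ` R) \<and> cl_closed M (snd ` R)"

lemma closed_el_converse: "closed_el R \<Longrightarrow> closed_el (R\<inverse>)"
  using el_countable[of R] elementary_converse[of L M R] by (auto simp: closed_el_def conv_image)

text \<open>The range is countable and the structure is not, so a new \<open>x\<close> can be
  matched with some \<open>x'\<close> outside the range. QM4 makes the extension elementary, and
  back-and-forth closes it.\<close>

lemma closed_el_step:
  assumes R: "closed_el R" and x: "x \<in> P"
  shows "\<exists>T. closed_el T \<and> R \<subseteq> T \<and> x \<in> fst ` T"
proof (cases "x \<in> fst ` R")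
  case False
  have "countable (snd ` R)" using el_countable[of R] R by (simp add: closed_el_def)
  then obtain x' where x': "x' \<in> P" "x' \<notin> snd ` R" using uncountable_points by (meson countable_subset subsetI)
  have "el (R \<union> {(x, x')})" using el_generic[OF _ _ _ _ x False x'] R by (simp add: closed_el_def)
  then obtain T where T: "el T" "R \<union> {(x, x')} \<subseteq> T" "fst ` T = cl M (fst ` (R \<union> {(x, x')}))"
    "snd ` T = cl M (snd ` (R \<union> {(x, x')}))"
    using back_and_forth[of R "{(x, x')}"] R by (auto simp: closed_el_def)
  have sub: "fst ` (R \<union> {(x, x')}) \<subseteq> P" "snd ` (R \<union> {(x, x')}) \<subseteq> P" "countable (fst ` (R \<union> {(x, x')}))"
    using R x x' el_P[of R] by (auto simp: closed_el_def)
  hence "closed_el T" using T cl_closed_cl countable_cl by (simp add: closed_el_def)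
  thus ?thesis using T(2) by force
qed (use R in blast)

lemma closed_el_union:
  assumes R: "\<And>n. closed_el (R n)" and inc: "\<And>n. R n \<subseteq> R (Suc n)"
  shows "closed_el (\<Union>n. R n)"
proof -
  note fin = finite_subset_chain[of R, OF inc]
  have "el (\<Union>n. R n)"
  proof (rule elementary_finite)
    show "(\<Union>n. R n) \<subseteq> P \<times> P" using R by (auto simp: closed_el_def elementary_def)
    show "el F" if "finite F" "F \<subseteq> (\<Union>n. R n)" for F
      using fin[OF that] R elementary_mono unfolding closed_el_def by blast
  qed
  moreover have "countable (fst ` (\<Union>n. R n))" using R by (simp add: image_UN closed_el_def)
  moreover
  have "cl_closed M (f ` (\<Union>n. R n))" if f: "\<And>n. cl_closed M (f ` R n)" for f
    unfolding cl_closed_def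
  proof
    show sub: "f ` (\<Union>n. R n) \<subseteq> P" using f by (auto simp: cl_closed_def)
    show "cl M (f ` (\<Union>n. R n)) = f ` (\<Union>n. R n)"
    proof
      show "cl M (f ` (\<Union>n. R n)) \<subseteq> f ` (\<Union>n. R n)"
      proof
        fix x assume "x \<in> cl M (f ` (\<Union>n. R n))"
        from cl_fin[OF sub this] obtain G where G: "G \<subseteq> f ` (\<Union>n. R n)" "finite G" "x \<in> cl M G" by blast
        from finite_subset_image[OF G(2,1)] obtain F where F: "F \<subseteq> (\<Union>n. R n)" "finite F" "G = f ` F" by blast
        from fin[OF F(2,1)] obtain n where "F \<subseteq> R n" ..
        hence "G \<subseteq> f ` R n" unfolding F(3) by (rule image_mono)
        hence "cl M G \<subseteq> f ` R n" using cl_mono[of G "f ` R n"] f[of n] by (simp add: cl_closed_def)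
        thus "x \<in> f ` (\<Union>n. R n)" using G(3) by blast
      qed
    qed (rule cl_ext[OF sub])
  qed
  from this[of fst] this[of snd] have "cl_closed M (fst ` (\<Union>n. R n))" "cl_closed M (snd ` (\<Union>n. R n))"
    using R by (simp_all add: closed_el_def)
  ultimately show ?thesis by (simp add: closed_el_def)
qed

lemma closed_el_extend:
  assumes R: "closed_el R" and B: "countable B" "B \<subseteq> P"
  shows "\<exists>T. closed_el T \<and> R \<subseteq> T \<and> B \<subseteq> fst ` T \<and> B \<subseteq> snd ` T"
proof -
  have step: "\<exists>T'. closed_el T' \<and> T \<subseteq> T' \<and> (x \<in> P \<longrightarrow> x \<in> fst ` T' \<and> x \<in> snd ` T')" if "closed_el T" for x T
  proof (cases "x \<in> P")
    case True
    obtain T' where T': "closed_el T'" "T \<subseteq> T'" "x \<in> fst ` T'" using closed_el_step[OF \<open>closed_el T\<close> True] by blast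
    obtain W where W: "closed_el W" "T'\<inverse> \<subseteq> W" "x \<in> fst ` W"
      using closed_el_step[OF closed_el_converse[OF T'(1)] True] by blast
    have TW: "T' \<subseteq> W\<inverse>" using W(2) by auto
    hence "x \<in> fst ` W\<inverse>" using T'(3) image_mono by blast
    thus ?thesis using T'(2) TW W(3) closed_el_converse[OF W(1)]
      by (intro exI[of _ "W\<inverse>"]) (simp add: conv_image)
  qed (use that in blast)
  define Q where "Q n T T' \<longleftrightarrow> T \<subseteq> T' \<and>
    (from_nat_into B n \<in> P \<longrightarrow> from_nat_into B n \<in> fst ` T' \<and> from_nat_into B n \<in> snd ` T')" for n T T'
  have "\<exists>T. \<forall>n. (closed_el (T n) \<and> (n = 0 \<longrightarrow> T n = R)) \<and> Q n (T n) (T (Suc n))"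
  proof (rule dependent_nat_choice)
    show "\<exists>T'. (closed_el T' \<and> (Suc n = 0 \<longrightarrow> T' = R)) \<and> Q n T T'" if "closed_el T \<and> (n = 0 \<longrightarrow> T = R)" for n T
      using step[of T "from_nat_into B n"] that by (simp add: Q_def)
  qed (use R in simp)
  then obtain T where T: "T 0 = R" "\<And>n. closed_el (T n)" "\<And>n. Q n (T n) (T (Suc n))" by blast
  have "b \<in> fst ` (\<Union>n. T n) \<and> b \<in> snd ` (\<Union>n. T n)" if bB: "b \<in> B" for b
  proof -
    obtain n where "from_nat_into B n = b" using from_nat_into_surj[OF B(1) bB] by blast
    hence "b \<in> fst ` T (Suc n) \<and> b \<in> snd ` T (Suc n)" using T(3)[of n] bB B(2) by (auto simp: Q_def)
    thus ?thesis by (simp only: image_UN) blast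
  qed
  moreover have "closed_el (\<Union>n. T n)" using T by (intro closed_el_union) (simp_all add: Q_def)
  moreover have "R \<subseteq> (\<Union>n. T n)" using T(1) by blast
  ultimately show ?thesis by (intro exI[of _ "\<Union>n. T n"]) (simp add: subset_iff)
qed

text \<open>A value \<open>y\<close> of a function at arguments in the closed countable set
  \<open>K\<close> cannot be outside \<open>K\<close>: by QM4 it would have the same type over
  \<open>K\<close> as every other point outside, and all these points would be values at the same
  arguments.\<close>

lemma closed_fun:
  assumes "cl_closed M H" "set xs \<subseteq> H" "(f, length xs) \<in> fun_syms L"
  shows "funs M f xs \<in> H"
proof -
  have P: "set xs \<subseteq> P" using assms by (auto simp: cl_closed_def)
  define K where "K = cl M (set xs)"
  define y where "y = funs M f xs"
  have yP: "y \<in> P" using is_struct assms(3) P unfolding is_structure_def y_def tuples_def by fastforce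
  have K: "cl_closed M K" "countable K" "set xs \<subseteq> K" "K \<subseteq> P"
    unfolding K_def using cl_closed_cl P countable_cl cl_ext cl_P by (auto simp: countable_finite)
  have "y \<in> K"
  proof (rule ccontr)
    assume y: "y \<notin> K"
    obtain y' where y': "y' \<in> P" "y' \<notin> insert y K" using uncountable_points K(2) by (meson countable_insert countable_subset subsetI)
    have Kid: "fst ` ((\<lambda>x. (x, x)) ` K) = K" "snd ` ((\<lambda>x. (x, x)) ` K) = K" by (simp_all add: image_image)
    have "L_isom L (\<lambda>x. x) M M" by (auto simp: L_isom_def bij_betw_def)
    hence "el ((\<lambda>x. (x, x)) ` K)" using automorphism_elementary is_struct K(4) by blast
    hence "el (insert (y, y') ((\<lambda>x. (x, x)) ` K))"
      using el_generic[of "(\<lambda>x. (x, x)) ` K" y y'] K y y' yP unfolding Kid by blast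
    from elementary_fun[OF this, of "map (\<lambda>x. (x, x)) xs" y y' f] have "y = funs M f xs \<longleftrightarrow> y' = funs M f xs"
      using K(3) assms(3) by (auto simp: comp_def)
    thus False using y' by (simp add: y_def)
  qed
  moreover have "K \<subseteq> H" unfolding K_def using cl_mono[of "set xs" H] assms by (simp add: cl_closed_def)
  ultimately show ?thesis by (auto simp: y_def)
qed

lemma closed_substructure_iff: "closed_substructure L M H \<longleftrightarrow> cl_closed M H"
  using closed_fun[of H] unfolding closed_substructure_def tuples_def by fastforce

end

subsection \<open>Members of the generated class\<close>

lemma closed_embedding_id:
  assumes "closed_embedding L (\<lambda>x. x) N U"
  shows "cl_closed U (points N)" "\<And>A. A \<subseteq> points N \<Longrightarrow> cl N A = cl U A"
    "\<And>f n xs. (f, n) \<in> fun_syms L \<Longrightarrow> xs \<in> tuples (points N) n \<Longrightarrow> funs N f xs = funs U f xs"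
    "\<And>r n xs. (r, n) \<in> rel_syms L \<Longrightarrow> xs \<in> tuples (points N) n \<Longrightarrow> rels N r xs = rels U r xs"
    "\<And>f n xs. (f, n) \<in> fun_syms L \<Longrightarrow> xs \<in> tuples (points N) n \<Longrightarrow> funs U f xs \<in> points N"
  using assms unfolding closed_embedding_def closed_substructure_def isom_def L_isom_def by fastforce+

lemma closed_embedding_idI:
  assumes "cl_closed U (points N)" "\<And>A. A \<subseteq> points N \<Longrightarrow> cl N A = cl U A"
    "\<And>f n xs. (f, n) \<in> fun_syms L \<Longrightarrow> xs \<in> tuples (points N) n \<Longrightarrow> funs N f xs = funs U f xs"
    "\<And>r n xs. (r, n) \<in> rel_syms L \<Longrightarrow> xs \<in> tuples (points N) n \<Longrightarrow> rels N r xs = rels U r xs"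
    "\<And>f n xs. (f, n) \<in> fun_syms L \<Longrightarrow> xs \<in> tuples (points N) n \<Longrightarrow> funs U f xs \<in> points N"
  shows "closed_embedding L (\<lambda>x. x) N U"
  using assms unfolding closed_embedding_def closed_substructure_def isom_def L_isom_def
  by (auto simp: bij_betw_def)

text \<open>The closure properties that pass directly to closed substructures, isomorphic copies and
  unions of chains; they are carried through the induction over the generated class.\<close>

definition closure_structure :: "('f, 'r) language \<Rightarrow> ('f, 'r, 'a) cl_structure \<Rightarrow> bool" where
  "closure_structure L N \<longleftrightarrow> is_structure L N \<and>
     (\<forall>A \<subseteq> points N. A \<subseteq> cl N A \<and> cl N A \<subseteq> points N) \<and>
     (\<forall>A B. A \<subseteq> B \<and> B \<subseteq> points N \<longrightarrow> cl N A \<subseteq> cl N B)"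

lemma closed_embedding_restr:
  assumes E: "closed_embedding L (\<lambda>x. x) N U" and closed: "closed_substructure L U S" and U: "closure_structure L U"
  shows "closed_embedding L (\<lambda>x. x) (restr N (S \<inter> points N)) (restr U S)"
    "closed_substructure L N (S \<inter> points N)"
proof -
  have S: "cl_closed U S" "\<And>f n xs. (f, n) \<in> fun_syms L \<Longrightarrow> xs \<in> tuples S n \<Longrightarrow> funs U f xs \<in> S"
    using closed by (auto simp: closed_substructure_def)
  have idem: "\<And>A B. A \<subseteq> B \<Longrightarrow> B \<subseteq> points U \<Longrightarrow> cl U A \<subseteq> cl U B" "\<And>A. A \<subseteq> points U \<Longrightarrow> A \<subseteq> cl U A"
    using U by (auto simp: closure_structure_def)
  note e = closed_embedding_id[OF E]
  have NU: "points N \<subseteq> points U" "S \<subseteq> points U" "cl U (points N) = points N" "cl U S = S"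
    using e(1) S(1) by (auto simp: cl_closed_def)
  have "cl U (S \<inter> points N) \<subseteq> S \<inter> points N"
    using idem(1)[of "S \<inter> points N" S] idem(1)[of "S \<inter> points N" "points N"] NU by blast
  moreover have "S \<inter> points N \<subseteq> cl U (S \<inter> points N)" using idem(2)[of "S \<inter> points N"] NU by blast
  ultimately have cl: "cl U (S \<inter> points N) = S \<inter> points N" by blast
  have t: "xs \<in> tuples S n" "xs \<in> tuples (points N) n" if "xs \<in> tuples (S \<inter> points N) n" for xs n
    using that by (auto simp: tuples_def)
  show "closed_embedding L (\<lambda>x. x) (restr N (S \<inter> points N)) (restr U S)"
  proof (rule closed_embedding_idI)
    show "cl_closed (restr U S) (points (restr N (S \<inter> points N)))" using cl by (simp add: cl_closed_def)
    show "funs (restr U S) f xs \<in> points (restr N (S \<inter> points N))"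
      if "(f, n) \<in> fun_syms L" "xs \<in> tuples (points (restr N (S \<inter> points N))) n" for f n xs
      using that S(2)[of f n xs] e(5)[of f n xs] t[of xs n] by simp
  qed (use e(2-4) t in auto)
  show "closed_substructure L N (S \<inter> points N)"
    unfolding closed_substructure_def
  proof (intro conjI ballI, goal_cases)
    case 1
    show ?case using cl e(2)[of "S \<inter> points N"] by (simp add: cl_closed_def)
  next
    case (2 p)
    have "funs N f xs \<in> S \<inter> points N" if "(f, n) \<in> fun_syms L" "xs \<in> tuples (S \<inter> points N) n" for f n xs
      using that S(2)[of f n xs] e(3)[of f n xs] e(5)[of f n xs] t[of xs n] by simp
    thus ?case using 2 by auto
  qed
qed

lemma isomD:
  assumes "isom L g N N'"
  shows "bij_betw g (points N) (points N')" "\<And>A. A \<subseteq> points N \<Longrightarrow> cl N' (g ` A) = g ` cl N A"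
    "\<And>f n xs. (f, n) \<in> fun_syms L \<Longrightarrow> xs \<in> tuples (points N) n \<Longrightarrow> g (funs N f xs) = funs N' f (map g xs)"
    "\<And>r n xs. (r, n) \<in> rel_syms L \<Longrightarrow> xs \<in> tuples (points N) n \<Longrightarrow> rels N r xs = rels N' r (map g xs)"
  using assms unfolding isom_def L_isom_def by fastforce+

lemma tuples_image: "xs \<in> tuples (g ` S) n \<Longrightarrow> \<exists>ys \<in> tuples S n. xs = map g ys"
proof -
  assume xs: "xs \<in> tuples (g ` S) n"
  hence "xs \<in> lists (g ` S)" by (auto simp: tuples_def)
  hence "xs \<in> map g ` lists S" by (simp only: lists_image)
  then obtain ys where "xs = map g ys" "ys \<in> lists S" by (elim imageE)
  thus ?thesis using xs by (auto simp: tuples_def)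
qed

lemma closure_structure_isom:
  assumes N: "closure_structure L N" and i: "isom L g N N'"
  shows "closure_structure L N'"
proof -
  note g = isomD[OF i]
  have img: "g ` points N = points N'" using g(1) by (simp add: bij_betw_def)
  have N': "is_structure L N" "\<And>A. A \<subseteq> points N \<Longrightarrow> A \<subseteq> cl N A \<and> cl N A \<subseteq> points N"
    "\<And>A B. A \<subseteq> B \<Longrightarrow> B \<subseteq> points N \<Longrightarrow> cl N A \<subseteq> cl N B"
    using N by (auto simp: closure_structure_def)
  have "funs N' f xs \<in> points N'" if f: "(f, n) \<in> fun_syms L" "xs \<in> tuples (points N') n" for f n xs
  proof -
    obtain ys where ys: "ys \<in> tuples (points N) n" "xs = map g ys" using tuples_image f(2) img by metis
    hence "funs N f ys \<in> points N" using N'(1) f(1) by (auto simp: is_structure_def)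
    thus ?thesis using g(3)[OF f(1) ys(1)] ys(2) img by (metis imageI)
  qed
  moreover have "A \<subseteq> cl N' A \<and> cl N' A \<subseteq> points N'" if "A \<subseteq> points N'" for A
  proof -
    obtain B where B: "B \<subseteq> points N" "A = g ` B" using \<open>A \<subseteq> points N'\<close> img by (metis subset_imageE)
    have "g ` B \<subseteq> g ` cl N B" "g ` cl N B \<subseteq> g ` points N" using N'(2)[OF B(1)] by (simp_all add: image_mono)
    thus ?thesis unfolding B(2) g(2)[OF B(1)] img ..
  qed
  moreover have "cl N' A \<subseteq> cl N' B" if AB: "A \<subseteq> B" "B \<subseteq> points N'" for A B
  proof -
    obtain E where E: "E \<subseteq> points N" "B = g ` E" using AB(2) img by (metis subset_imageE)
    obtain D where D: "D \<subseteq> E" "A = g ` D" using AB(1) E(2) by (metis subset_imageE)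
    show ?thesis using N'(3)[OF D(1) E(1)] g(2)[of D] g(2)[of E] D E by auto
  qed
  ultimately show ?thesis by (auto simp: closure_structure_def is_structure_def)
qed

lemma closure_structure_restr:
  assumes N: "closure_structure L N" and S: "closed_substructure L N S"
  shows "closure_structure L (restr N S)"
proof -
  have S': "S \<subseteq> points N" "cl N S = S" using S by (auto simp: closed_substructure_def cl_closed_def)
  have "cl N A \<subseteq> S" if "A \<subseteq> S" for A
    using N S' that unfolding closure_structure_def by (metis)
  moreover have "cl N A \<subseteq> cl N B" if "A \<subseteq> B" "B \<subseteq> S" for A B
    using N S'(1) that unfolding closure_structure_def by (meson order_trans)
  moreover have "A \<subseteq> cl N A" if "A \<subseteq> S" for A
    using N S'(1) that unfolding closure_structure_def by (meson order_trans)
  moreover have "is_structure L (restr N S)" using S by (simp add: is_structure_def closed_substructure_def)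
  ultimately show ?thesis by (simp add: closure_structure_def)
qed

lemma isom_restr:
  assumes i: "isom L g N N'" and T: "closed_substructure L N' T" and N: "closure_structure L N"
  shows "closed_substructure L N {x \<in> points N. g x \<in> T}" "isom L g (restr N {x \<in> points N. g x \<in> T}) (restr N' T)"
proof -
  define S where "S = {x \<in> points N. g x \<in> T}"
  note g = isomD[OF i]
  have T': "T \<subseteq> points N'" "cl N' T = T" "\<And>f n xs. (f, n) \<in> fun_syms L \<Longrightarrow> xs \<in> tuples T n \<Longrightarrow> funs N' f xs \<in> T"
    using T unfolding closed_substructure_def cl_closed_def by fastforce+
  have SN: "S \<subseteq> points N" by (auto simp: S_def)
  have gS: "g ` S = T" using g(1) T'(1) by (auto simp: S_def bij_betw_def)
  have tS: "xs \<in> tuples (points N) n" "map g xs \<in> tuples T n" if "xs \<in> tuples S n" for xs n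
    using that by (auto simp: S_def tuples_def)
  have "cl N S \<subseteq> points N" using N SN by (simp add: closure_structure_def)
  moreover have "g ` cl N S = T" using g(2)[OF SN] gS T'(2) by simp
  ultimately have "cl N S \<subseteq> S" by (auto simp: S_def)
  moreover have "S \<subseteq> cl N S" using N SN by (simp add: closure_structure_def)
  ultimately have "cl_closed N S" using SN by (auto simp: cl_closed_def)
  moreover have "funs N f xs \<in> S" if f: "(f, n) \<in> fun_syms L" "xs \<in> tuples S n" for f n xs
  proof -
    have "funs N f xs \<in> points N" using N f(1) tS[OF f(2)] unfolding closure_structure_def is_structure_def by auto
    moreover have "g (funs N f xs) \<in> T" using g(3)[OF f(1)] tS[OF f(2)] T'(3)[OF f(1)] by simp
    ultimately show ?thesis by (simp add: S_def)
  qed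
  ultimately show "closed_substructure L N {x \<in> points N. g x \<in> T}"
    unfolding closed_substructure_def S_def[symmetric] by auto
  have "bij_betw g S T" using bij_betw_subset[OF g(1) SN gS] .
  thus "isom L g (restr N {x \<in> points N. g x \<in> T}) (restr N' T)"
    unfolding S_def[symmetric] isom_def L_isom_def using g(2-4) tS(1) SN by auto
qed

lemma closed_chain_finite:
  assumes chain: "closed_chain L Ns" and F: "finite F" "F \<subseteq> (\<Union>N \<in> Ns. points N)"
  shows "\<exists>N \<in> Ns. F \<subseteq> points N"
  using F
proof (induction rule: finite_induct)
  case empty
  thus ?case using chain by (auto simp: closed_chain_def)
next
  case (insert x F)
  then obtain N N' where N: "N \<in> Ns" "F \<subseteq> points N" "N' \<in> Ns" "x \<in> points N'" by auto
  hence "closed_embedding L (\<lambda>x. x) N N' \<or> closed_embedding L (\<lambda>x. x) N' N"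
    using chain by (simp add: closed_chain_def)
  hence "points N \<subseteq> points N' \<or> points N' \<subseteq> points N"
    by (auto simp: closed_embedding_def closed_substructure_def cl_closed_def)
  thus ?case using N by blast
qed

lemma closure_structure_chain:
  assumes N: "\<And>N. N \<in> Ns \<Longrightarrow> closure_structure L N" and chain: "closed_chain L Ns" and U: "is_chain_union L Ns U"
  shows "closure_structure L U"
proof -
  have pU: "points U = (\<Union>N \<in> Ns. points N)" and E: "\<And>N. N \<in> Ns \<Longrightarrow> closed_embedding L (\<lambda>x. x) N U"
    and clU: "\<And>A. A \<subseteq> points U \<Longrightarrow> cl U A = (\<Union>F \<in> {F. F \<subseteq> A \<and> finite F}. cl U F)"
    using U unfolding is_chain_union_def by blast+
  have "funs U f xs \<in> points U" if f: "(f, n) \<in> fun_syms L" "xs \<in> tuples (points U) n" for f n xs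
  proof -
    have "finite (set xs)" "set xs \<subseteq> (\<Union>N \<in> Ns. points N)" using f(2) pU by (auto simp: tuples_def)
    from closed_chain_finite[OF chain this] obtain N where N: "N \<in> Ns" "set xs \<subseteq> points N" by blast
    hence "xs \<in> tuples (points N) n" using f(2) by (auto simp: tuples_def)
    from closed_embedding_id(5)[OF E[OF N(1)] f(1) this] show ?thesis using pU N(1) by blast
  qed
  moreover have fin: "F \<subseteq> cl U F \<and> cl U F \<subseteq> points U" if F: "F \<subseteq> points U" "finite F" for F
  proof -
    obtain K where K: "K \<in> Ns" "F \<subseteq> points K" using closed_chain_finite[OF chain F(2)] F(1) pU by blast
    have "F \<subseteq> cl K F \<and> cl K F \<subseteq> points K" using N[OF K(1)] K(2) by (simp add: closure_structure_def)
    thus ?thesis using closed_embedding_id(2)[OF E[OF K(1)] K(2)] pU K(1) by blast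
  qed
  moreover have "A \<subseteq> cl U A" if A: "A \<subseteq> points U" for A
  proof
    fix x assume x: "x \<in> A"
    hence "x \<in> cl U {x}" using fin[of "{x}"] A by auto
    thus "x \<in> cl U A" unfolding clU[OF A] using x by (intro UN_I[of "{x}"]) auto
  qed
  moreover have "cl U A \<subseteq> points U" if A: "A \<subseteq> points U" for A
    unfolding clU[OF A] using fin A by (intro UN_least) auto
  moreover have "cl U A \<subseteq> cl U B" if AB: "A \<subseteq> B" "B \<subseteq> points U" for A B
  proof -
    have "A \<subseteq> points U" using AB by blast
    thus ?thesis using AB by (simp only: clU) (rule UN_mono, auto)
  qed
  ultimately show ?thesis by (auto simp: closure_structure_def is_structure_def)
qed

text \<open>Induction on the generation of the class. Under an isomorphism the closed substructure
  is pulled back; in a union of a chain it is the union of its intersections with the members, which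
  again form a chain of closed embeddings.\<close>

lemma generated_class_restr:
  fixes L :: "('f, 'r) language" and N :: "('f, 'r, 'a) cl_structure"
  assumes M0: "closure_structure L M\<^sub>0" and N: "generated_class L M\<^sub>0 N"
  shows "closure_structure L N \<and> (\<forall>T. closed_substructure L N T \<longrightarrow> generated_class L M\<^sub>0 (restr N T))"
  using N
proof induction
  case (closed_substr S g N)
  have S: "closure_structure L (restr M\<^sub>0 S)" using closure_structure_restr[OF M0 closed_substr(1)] .
  have "generated_class L M\<^sub>0 (restr N T)" if "closed_substructure L N T" for T
  proof -
    define S' where "S' = {x \<in> S. g x \<in> T}"
    have S': "closed_substructure L (restr M\<^sub>0 S) S'" "isom L g (restr (restr M\<^sub>0 S) S') (restr N T)"
      using isom_restr[OF closed_substr(2) that S] by (simp_all add: S'_def)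
    have "closed_substructure L M\<^sub>0 S'" using S'(1) closed_substr(1)
      unfolding closed_substructure_def cl_closed_def by auto
    thus ?thesis by (rule generated_class.closed_substr) (use S'(2) in simp)
  qed
  thus ?case using closure_structure_isom[OF S closed_substr(2)] by blast
next
  case (isomorphic N g N')
  hence N: "closure_structure L N" by blast
  have "generated_class L M\<^sub>0 (restr N' T)" if "closed_substructure L N' T" for T
  proof -
    note r = isom_restr[OF isomorphic(2) that N]
    have "generated_class L M\<^sub>0 (restr N {x \<in> points N. g x \<in> T})" using isomorphic.IH r(1) by blast
    thus ?thesis using r(2) by (rule generated_class.isomorphic)
  qed
  thus ?case using closure_structure_isom[OF N isomorphic(2)] by blast
next
  case (chain_union Ns U)
  have N: "\<And>N. N \<in> Ns \<Longrightarrow> closure_structure L N" using chain_union.IH by blast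
  have cU: "closure_structure L U" using closure_structure_chain[OF N chain_union(2,3)] .
  have pU: "points U = (\<Union>N \<in> Ns. points N)" and E: "\<And>N. N \<in> Ns \<Longrightarrow> closed_embedding L (\<lambda>x. x) N U"
    and clU: "\<And>A. A \<subseteq> points U \<Longrightarrow> cl U A = (\<Union>F \<in> {F. F \<subseteq> A \<and> finite F}. cl U F)"
    using chain_union(3) unfolding is_chain_union_def by blast+
  have "generated_class L M\<^sub>0 (restr U T)" if T: "closed_substructure L U T" for T
  proof -
    have T': "cl_closed U T" "\<And>f n xs. (f, n) \<in> fun_syms L \<Longrightarrow> xs \<in> tuples T n \<Longrightarrow> funs U f xs \<in> T" "T \<subseteq> points U"
      using T unfolding closed_substructure_def cl_closed_def by fastforce+
    define R where "R N = restr N (T \<inter> points N)" for N :: "('f, 'r, 'a) cl_structure"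
    have R: "closed_embedding L (\<lambda>x. x) (R N) (restr U T)" "closed_substructure L N (T \<inter> points N)" if "N \<in> Ns" for N
      unfolding R_def using closed_embedding_restr[OF E[OF that] T cU] .
    have RN: "generated_class L M\<^sub>0 (R N)" if "N \<in> Ns" for N
      using chain_union.IH R(2)[OF that] that by (simp add: R_def)
    have RR: "closed_embedding L (\<lambda>x. x) (R N) (R N')"
      if K: "N \<in> Ns" "N' \<in> Ns" "closed_embedding L (\<lambda>x. x) N N'" for N N'
    proof -
      have "points N \<subseteq> points N'" using closed_embedding_id(1)[OF K(3)] by (simp add: cl_closed_def)
      hence eq: "T \<inter> points N' \<inter> points N = T \<inter> points N" by blast
      have "closed_embedding L (\<lambda>x. x) (restr N (T \<inter> points N' \<inter> points N)) (restr N' (T \<inter> points N'))"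
        by (rule closed_embedding_restr(1)[OF K(3) R(2)[OF K(2)] N[OF K(2)]])
      thus ?thesis unfolding R_def eq .
    qed
    have "closed_chain L (R ` Ns)"
      using chain_union(2) RR unfolding closed_chain_def by (auto 0 3)
    moreover have "is_chain_union L (R ` Ns) (restr U T)"
      unfolding is_chain_union_def
    proof (intro conjI allI impI ballI)
      show "points (restr U T) = (\<Union>N \<in> R ` Ns. points N)" using T'(3) pU by (auto simp: R_def)
      show "closed_embedding L (\<lambda>x. x) N (restr U T)" if "N \<in> R ` Ns" for N using R(1) that by blast
      show "cl (restr U T) A = (\<Union>F \<in> {F. F \<subseteq> A \<and> finite F}. cl (restr U T) F)" if "A \<subseteq> points (restr U T)" for A
        using clU[of A] that T'(3) by simp
    qed
    ultimately show ?thesis by (rule generated_class.chain_union[rotated]) (use RN in auto)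
  qed
  thus ?case using cU by blast
qed

section \<open>Elementary maps extended to automorphisms of the monster model\<close>

locale uncountable_monster =
  fixes L :: "('f, 'r) language" and M\<^sub>0 :: "('f, 'r, 'b) cl_structure" and \<delta> :: "'d rel"
    and M :: "('f, 'r, 'm) cl_structure"
  assumes monster: "monster_model L M\<^sub>0 \<delta> M"
    and base_quasiminimal: "quasiminimal L M\<^sub>0"
    and uncountable_points: "uncountable (points M)"
begin

sublocale uncountable_quasiminimal L M
  using monster uncountable_points by unfold_locales (auto simp: monster_model_def)

lemma closed_class:
  assumes "cl_closed M H" shows "generated_class L M\<^sub>0 (restr M H)"
proof -
  have "pregeometry (points M\<^sub>0) (cl M\<^sub>0)" "is_structure L M\<^sub>0"
    using base_quasiminimal by (auto simp: quasiminimal_def weakly_quasiminimal_def)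
  hence "closure_structure L M\<^sub>0" by (simp add: closure_structure_def pregeometry_def)
  moreover have "generated_class L M\<^sub>0 M" using monster by (simp add: monster_model_def quasiminimal_class_def)
  ultimately show ?thesis using generated_class_restr[of L M\<^sub>0 M] closed_substructure_iff[of H] assms by simp
qed

lemma countable_small: "countable A \<Longrightarrow> (card_of A, \<delta>) \<in> ordLess"
proof -
  assume "countable A"
  hence "(card_of A, natLeq) \<in> ordLeq"
    using countable_card_le_natLeq by blast
  thus ?thesis using monster ordLeq_ordLess_trans by (auto simp: monster_model_def)
qed

text \<open>Every closed set is closed under the functions, and its restriction belongs to the
  generated class; only infinite dimension and size remain as conditions.\<close>

lemma submodel_iff:
  "H \<in> submodels L M\<^sub>0 \<delta> M \<longleftrightarrow>
    cl_closed M H \<and> (\<exists>B \<subseteq> H. infinite B \<and> cl_independent (cl M) B) \<and> (card_of H, \<delta>) \<in> ordLess"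
  unfolding submodels_def quasiminimal_class_def infinite_dimensional_def
  using closed_class closed_substructure_iff by auto

lemma closed_el_isom:
  assumes R: "closed_el R"
  shows "\<exists>g. (\<forall>(x, y) \<in> R. g x = y) \<and> isom L g (restr M (fst ` R)) (restr M (snd ` R))"
proof -
  define g where "g x = (THE y. (x, y) \<in> R)" for x
  have el: "el R" and H: "cl_closed M (fst ` R)" "cl_closed M (snd ` R)" using R by (auto simp: closed_el_def)
  have g: "g x = y" if "(x, y) \<in> R" for x y
    unfolding g_def
  proof (rule the_equality)
    show "(x, y) \<in> R" by (rule that)
    show "z = y" if "(x, z) \<in> R" for z using elementary_pair[OF el that \<open>(x, y) \<in> R\<close>] by simp
  qed
  have gR: "(x, g x) \<in> R" if "x \<in> fst ` R" for x using that g by force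
  have P: "fst ` R \<subseteq> P" "snd ` R \<subseteq> P" using el_P[OF el] .
  have l: "set (map (\<lambda>x. (x, g x)) xs) \<subseteq> R" if "xs \<in> tuples (fst ` R) n" for xs n
  proof -
    have "set xs \<subseteq> fst ` R" using that by (simp add: tuples_def)
    thus ?thesis unfolding set_map using gR by (intro image_subsetI) (rule gR, rule subsetD)
  qed
  have fs: "map fst (map (\<lambda>x. (x, g x)) xs) = xs" "map snd (map (\<lambda>x. (x, g x)) xs) = map g xs" for xs
    by (simp_all add: comp_def)
  have "bij_betw g (fst ` R) (snd ` R)"
    unfolding bij_betw_def
  proof
    show "inj_on g (fst ` R)"
    proof (rule inj_onI)
      fix x y assume "x \<in> fst ` R" "y \<in> fst ` R" "g x = g y"
      thus "x = y" using elementary_pair[OF el gR[of x] gR[of y]] by simp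
    qed
    show "g ` fst ` R = snd ` R" using g by (force simp: image_image)
  qed
  moreover have "g (funs M f xs) = funs M f (map g xs)" if f: "(f, n) \<in> fun_syms L" "xs \<in> tuples (fst ` R) n" for f n xs
  proof -
    have len: "length xs = n" "set xs \<subseteq> fst ` R" using f(2) by (auto simp: tuples_def)
    hence "funs M f xs \<in> fst ` R" using closed_fun[OF H(1), of xs f] f(1) by simp
    from elementary_fun[OF el l[OF f(2)] gR[OF this], of f] show ?thesis using len f(1) unfolding fs by simp
  qed
  moreover have "rels M r xs = rels M r (map g xs)" if r: "(r, n) \<in> rel_syms L" "xs \<in> tuples (fst ` R) n" for r n xs
  proof -
    have "length xs = n" using r(2) by (auto simp: tuples_def)
    thus ?thesis using elementary_rel[OF el l[OF r(2)], of r] r(1) unfolding fs by simp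
  qed
  moreover have "cl M (g ` A) = g ` cl M A" if A: "A \<subseteq> fst ` R" for A
  proof -
    define S where "S = (\<lambda>x. (x, g x)) ` A"
    have S: "S \<subseteq> R" "fst ` S = A" "snd ` S = g ` A" using A gR by (auto simp: S_def image_image)
    have sub: "cl M A \<subseteq> fst ` R" "cl M (g ` A) \<subseteq> snd ` R"
      using cl_mono[OF A P(1)] cl_mono[OF image_mono[OF S(1), of snd] P(2)] H S(3) by (simp_all add: cl_closed_def)
    have iff: "x \<in> cl M A \<longleftrightarrow> y \<in> cl M (g ` A)" if "(x, y) \<in> R" for x y
      using el_cl[OF el S(1) that] S(2,3) by simp
    show ?thesis
    proof
      show "cl M (g ` A) \<subseteq> g ` cl M A"
      proof
        fix y assume y: "y \<in> cl M (g ` A)"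
        then obtain x where "(x, y) \<in> R" using sub(2) by force
        thus "y \<in> g ` cl M A" using iff y g by blast
      qed
      show "g ` cl M A \<subseteq> cl M (g ` A)" using iff gR sub(1) by blast
    qed
  qed
  ultimately have "isom L g (restr M (fst ` R)) (restr M (snd ` R))" by (auto simp: isom_def L_isom_def)
  thus ?thesis using g by blast
qed

lemma ex_independent: "\<exists>B \<subseteq> P. countable B \<and> infinite B \<and> cl_independent (cl M) B"
proof -
  obtain B0 where B0: "B0 \<subseteq> P" "infinite B0" "cl_independent (cl M) B0"
    using monster by (auto simp: monster_model_def quasiminimal_def infinite_dimensional_def)
  obtain B where B: "B \<subseteq> B0" "countable B" "infinite B"
    using B0(2) infinite_countable_subset' by blast
  have ind: "cl_independent (cl M) B"
    unfolding cl_independent_def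
  proof
    fix b assume b: "b \<in> B"
    hence "b \<notin> cl M (B0 - {b})" using B0(3) B(1) by (auto simp: cl_independent_def)
    moreover have "cl M (B - {b}) \<subseteq> cl M (B0 - {b})" by (rule cl_mono) (use B(1) B0(1) in auto)
    ultimately show "b \<notin> cl M (B - {b})" by blast
  qed
  have "B \<subseteq> P" using B(1) B0(1) by blast
  thus ?thesis using B ind by blast
qed

text \<open>Model homogeneity concerns infinite-dimensional submodels. So the map is first extended
  until its domain and its range contain a countable infinite independent set.\<close>

lemma closed_el_automorphism:
  assumes R: "closed_el R"
  shows "\<exists>f \<in> automorphisms L M. \<forall>(x, y) \<in> R. f x = y"
proof -
  obtain B where BP: "B \<subseteq> P" and B: "countable B" "infinite B" and ind: "cl_independent (cl M) B"
    using ex_independent by blast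
  obtain T where T: "closed_el T" "R \<subseteq> T" "B \<subseteq> fst ` T" "B \<subseteq> snd ` T"
    using closed_el_extend[OF R B(1) BP] by blast
  have elT: "el T" and ctT: "countable (fst ` T)" and clT: "cl_closed M (fst ` T)" "cl_closed M (snd ` T)"
    using T(1) by (auto simp: closed_el_def)
  have ct2: "countable (snd ` T)" using el_countable[OF elT ctT] by simp
  have "fst ` T \<in> submodels L M\<^sub>0 \<delta> M" "snd ` T \<in> submodels L M\<^sub>0 \<delta> M"
    unfolding submodel_iff using clT countable_small[OF ctT] countable_small[OF ct2] T(3,4) B(2) ind by blast+
  moreover obtain g where g: "\<forall>(x, y) \<in> T. g x = y" "isom L g (restr M (fst ` T)) (restr M (snd ` T))"
    using closed_el_isom[OF T(1)] by blast
  moreover have "model_homogeneous L M\<^sub>0 \<delta> M" using monster by (simp add: monster_model_def)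
  ultimately obtain f where f: "f \<in> automorphisms L M" "\<forall>x \<in> fst ` T. f x = g x"
    unfolding model_homogeneous_def by blast
  have "f x = y" if "(x, y) \<in> R" for x y
  proof -
    have "(x, y) \<in> T" using that T(2) by blast
    thus ?thesis using f(2) g(1) by force
  qed
  thus ?thesis using f(1) by blast
qed

lemma el_automorphism:
  assumes R: "el (R \<union> S)" "countable (fst ` R)" "cl_closed M (fst ` R) \<or> fst ` R = {}" "cl_closed M (snd ` R) \<or> snd ` R = {}"
    and S: "finite S"
  shows "\<exists>f \<in> automorphisms L M. \<forall>(x, y) \<in> R \<union> S. f x = y"
proof -
  obtain T where T: "el T" "R \<union> S \<subseteq> T" "fst ` T = cl M (fst ` (R \<union> S))" "snd ` T = cl M (snd ` (R \<union> S))"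
    using back_and_forth[OF assms] by blast
  have P: "fst ` (R \<union> S) \<subseteq> P" "snd ` (R \<union> S) \<subseteq> P" using el_P[OF R(1)] .
  have "countable (fst ` (R \<union> S))" using R(2) S by (simp add: image_Un countable_finite)
  hence "closed_el T" using T P cl_closed_cl countable_cl by (simp add: closed_el_def)
  from closed_el_automorphism[OF this] obtain f where f: "f \<in> automorphisms L M" "\<forall>(x, y) \<in> T. f x = y" ..
  have "\<forall>(x, y) \<in> R \<union> S. f x = y" by (rule ballI) (rule bspec[OF f(2)], rule subsetD[OF T(2)])
  thus ?thesis using f(1) by (rule bexI)
qed

end

subsection \<open>The geometry of the monster model\<close>

lemma automorphismD:
  assumes "g \<in> automorphisms L M"
  shows "bij_betw g (points M) (points M)"
    "\<And>f n xs. (f, n) \<in> fun_syms L \<Longrightarrow> xs \<in> tuples (points M) n \<Longrightarrow> g (funs M f xs) = funs M f (map g xs)"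
    "\<And>r n xs. (r, n) \<in> rel_syms L \<Longrightarrow> xs \<in> tuples (points M) n \<Longrightarrow> rels M r xs = rels M r (map g xs)"
  using assms unfolding automorphisms_def L_isom_def by fastforce+

lemma automorphismI:
  assumes "bij_betw g (points M) (points M)"
    "\<And>f n xs. (f, n) \<in> fun_syms L \<Longrightarrow> xs \<in> tuples (points M) n \<Longrightarrow> g (funs M f xs) = funs M f (map g xs)"
    "\<And>r n xs. (r, n) \<in> rel_syms L \<Longrightarrow> xs \<in> tuples (points M) n \<Longrightarrow> rels M r xs = rels M r (map g xs)"
  shows "g \<in> automorphisms L M"
  using assms unfolding automorphisms_def L_isom_def by auto

context uncountable_monster
begin

text \<open>The closure operator and the automorphisms, with the elements of the type which are not
  points of the structure added as loops and fixed points.\<close>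

definition C :: "'m set \<Rightarrow> 'm set" where
  "C A = cl M (A \<inter> P) \<union> - P"

definition Aut :: "('m \<Rightarrow> 'm) set" where
  "Aut = {f \<in> automorphisms L M. bij f \<and> (\<forall>x. x \<notin> P \<longrightarrow> f x = x)}"

lemma C_points: "C A \<inter> P = cl M (A \<inter> P)"
  using cl_P[of "A \<inter> P"] by (auto simp: C_def)

lemma automorphism_bij: "f \<in> automorphisms L M \<Longrightarrow> bij_betw f P P"
  by (simp add: automorphisms_def L_isom_def)

lemma automorphism_el: "f \<in> automorphisms L M \<Longrightarrow> S \<subseteq> P \<Longrightarrow> el ((\<lambda>x. (x, f x)) ` S)"
  using automorphism_elementary[OF is_struct] by (simp add: automorphisms_def)

text \<open>Members of \<open>automorphisms\<close> are arbitrary off the points. Replacing them by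
  the identity there gives permutations of the whole type.\<close>

lemma automorphism_extends:
  assumes "g \<in> automorphisms L M"
  shows "\<exists>f \<in> Aut. \<forall>x \<in> P. f x = g x"
proof -
  define f where "f x = (if x \<in> P then g x else x)" for x
  have g: "bij_betw g P P" using automorphism_bij assms .
  hence "bij_betw f P P" by (rule bij_betw_cong[THEN iffD1, rotated]) (simp add: f_def)
  moreover have "bij_betw f (-P) (-P)" by (rule bij_betw_cong[THEN iffD1, OF _ bij_betw_id]) (simp add: f_def)
  ultimately have "bij_betw f (P \<union> - P) (P \<union> - P)" by (rule bij_betw_combine) auto
  hence bij: "bij f" by simp
  have gP: "funs M h xs \<in> P" if "(h, n) \<in> fun_syms L" "xs \<in> tuples P n" for h n xs
    using is_struct that by (auto simp: is_structure_def)
  have m: "map f xs = map g xs" if "xs \<in> tuples P n" for xs n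
    unfolding map_eq_conv using that by (simp add: tuples_def f_def subset_iff)
  have "f \<in> automorphisms L M"
  proof (rule automorphismI[OF \<open>bij_betw f P P\<close>])
    show "f (funs M h xs) = funs M h (map f xs)" if "(h, n) \<in> fun_syms L" "xs \<in> tuples P n" for h n xs
      unfolding m[OF that(2)] using automorphismD(2)[OF assms that] gP[OF that] by (simp add: f_def)
    show "rels M h xs = rels M h (map f xs)" if "(h, n) \<in> rel_syms L" "xs \<in> tuples P n" for h n xs
      unfolding m[OF that(2)] by (rule automorphismD(3)[OF assms that])
  qed
  thus ?thesis using bij by (intro bexI[of _ f]) (auto simp: Aut_def f_def)
qed

lemma Aut_P: "f \<in> Aut \<Longrightarrow> f ` P = P" "f \<in> Aut \<Longrightarrow> f x \<in> P \<longleftrightarrow> x \<in> P"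
proof -
  assume f: "f \<in> Aut"
  hence "bij_betw f P P" "bij f" "\<forall>x. x \<notin> P \<longrightarrow> f x = x" using automorphism_bij by (auto simp: Aut_def)
  thus "f ` P = P" "f x \<in> P \<longleftrightarrow> x \<in> P" by (auto simp: bij_betw_def)
qed

lemma Aut_cl:
  assumes f: "f \<in> Aut" and A: "A \<subseteq> P"
  shows "f ` cl M A = cl M (f ` A)"
proof -
  have el: "el ((\<lambda>x. (x, f x)) ` P)" using f automorphism_el by (simp add: Aut_def)
  have iff: "x \<in> cl M A \<longleftrightarrow> f x \<in> cl M (f ` A)" if "x \<in> P" for x
    using el_cl[OF el image_mono[OF A], of x "f x"] that by (simp add: image_image)
  have fA: "f ` A \<subseteq> P" using Aut_P(1)[OF f] A by blast
  show ?thesis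
  proof
    show "f ` cl M A \<subseteq> cl M (f ` A)" using iff cl_P[OF A] by blast
    show "cl M (f ` A) \<subseteq> f ` cl M A"
    proof
      fix y assume y: "y \<in> cl M (f ` A)"
      then obtain x where "x \<in> P" "y = f x" using cl_P[OF fA] Aut_P(1)[OF f] by blast
      thus "y \<in> f ` cl M A" using iff y by blast
    qed
  qed
qed

lemma Aut_id: "id \<in> Aut"
  by (auto simp: Aut_def automorphisms_def L_isom_def bij_betw_def)

lemma Aut_comp: assumes f: "f \<in> Aut" and g: "g \<in> Aut" shows "f \<circ> g \<in> Aut"
proof -
  have aut: "f \<in> automorphisms L M" "g \<in> automorphisms L M" using f g by (simp_all add: Aut_def)
  have P: "g ` P = P" using Aut_P(1) g .
  have t: "map g xs \<in> tuples P n" if "xs \<in> tuples P n" for xs n using that P by (auto simp: tuples_def)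
  have "f \<circ> g \<in> automorphisms L M"
  proof (rule automorphismI)
    show "bij_betw (f \<circ> g) P P" by (rule bij_betw_trans) (use aut automorphism_bij in auto)
    show "(f \<circ> g) (funs M h xs) = funs M h (map (f \<circ> g) xs)" if "(h, n) \<in> fun_syms L" "xs \<in> tuples P n" for h n xs
      using automorphismD(2)[OF aut(2) that] automorphismD(2)[OF aut(1) that(1) t[OF that(2)]] by simp
    show "rels M h xs = rels M h (map (f \<circ> g) xs)" if "(h, n) \<in> rel_syms L" "xs \<in> tuples P n" for h n xs
      using automorphismD(3)[OF aut(2) that] automorphismD(3)[OF aut(1) that(1) t[OF that(2)]] by simp
  qed
  thus ?thesis using f g bij_comp by (auto simp: Aut_def)
qed

lemma Aut_inv: assumes f: "f \<in> Aut" shows "iv f \<in> Aut"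
proof -
  have bij: "bij f" and aut: "f \<in> automorphisms L M" using f by (simp_all add: Aut_def)
  hence i: "f (iv f x) = x" "iv f (f x) = x" for x by (simp_all add: bij_is_surj surj_f_inv_f bij_is_inj)
  have P: "iv f x \<in> P \<longleftrightarrow> x \<in> P" for x using Aut_P(2)[OF f, of "iv f x"] i by simp
  have t: "map (iv f) xs \<in> tuples P n" if "xs \<in> tuples P n" for xs n using that P by (auto simp: tuples_def)
  have m: "map f (map (iv f) xs) = xs" for xs using i by (simp add: comp_def)
  have "bij_betw (iv f) P P" using P i by (intro bij_betwI[of _ _ _ f]) (auto simp: Aut_P(2)[OF f])
  moreover have "iv f (funs M h xs) = funs M h (map (iv f) xs)" if "(h, n) \<in> fun_syms L" "xs \<in> tuples P n" for h n xs
  proof -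
    have "f (funs M h (map (iv f) xs)) = funs M h (map f (map (iv f) xs))"
      by (rule automorphismD(2)[OF aut that(1) t[OF that(2)]])
    thus ?thesis unfolding m using i by metis
  qed
  moreover have "rels M h xs = rels M h (map (iv f) xs)" if "(h, n) \<in> rel_syms L" "xs \<in> tuples P n" for h n xs
  proof -
    have "rels M h (map (iv f) xs) = rels M h (map f (map (iv f) xs))"
      by (rule automorphismD(3)[OF aut that(1) t[OF that(2)]])
    thus ?thesis unfolding m by simp
  qed
  ultimately have "iv f \<in> automorphisms L M" by (intro automorphismI) auto
  moreover have "iv f x = x" if "x \<notin> P" for x
  proof -
    have "f x = x" using f that by (simp add: Aut_def)
    thus ?thesis using i(2)[of x] by simp
  qed
  ultimately show ?thesis using bij_imp_bij_inv[OF bij] by (simp add: Aut_def)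
qed

sublocale closure_geometry C
proof
  fix A B :: "'m set" and x y
  show "A \<subseteq> C A" using cl_ext[of "A \<inter> P"] by (auto simp: C_def)
  show "C A \<subseteq> C B" if "A \<subseteq> B"
  proof -
    have "cl M (A \<inter> P) \<subseteq> cl M (B \<inter> P)" by (rule cl_mono) (use that in auto)
    thus ?thesis unfolding C_def by blast
  qed
  show "C (C A) = C A" unfolding C_def[of "C A"] C_points using cl_idem[of "A \<inter> P"] by (simp add: C_def)
  show "\<exists>F \<subseteq> A. finite F \<and> x \<in> C F" if "x \<in> C A"
  proof (cases "x \<in> P")
    case True
    hence "x \<in> cl M (A \<inter> P)" using that by (simp add: C_def)
    then obtain F where F: "F \<subseteq> A \<inter> P" "finite F" "x \<in> cl M F" using cl_fin[of "A \<inter> P" x] by auto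
    hence "F \<inter> P = F" by blast
    thus ?thesis using F by (intro exI[of _ F]) (auto simp: C_def)
  next
    case False
    thus ?thesis by (intro exI[of _ "{}"]) (simp add: C_def)
  qed
  show "y \<in> C (insert x A)" if "x \<in> C (insert y A)" "x \<notin> C A"
  proof (cases "y \<in> P")
    case True
    have x: "x \<in> P" using that(2) by (auto simp: C_def)
    have "x \<in> cl M (insert y (A \<inter> P))" "x \<notin> cl M (A \<inter> P)" using that x True by (auto simp: C_def)
    hence "y \<in> cl M (insert x (A \<inter> P))" using cl_exch[of "A \<inter> P" x y] x True by simp
    thus ?thesis using x by (simp add: C_def)
  qed (simp add: C_def)
qed

lemma countable_C: "countable A \<Longrightarrow> countable (C A \<inter> P)"
  unfolding C_points by (rule countable_cl) auto

lemma Aut_C: assumes f: "f \<in> Aut" shows "f ` C A = C (f ` A)"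
proof -
  have bij: "bij f" using f by (simp add: Aut_def)
  have "f ` (A \<inter> P) = f ` A \<inter> P" using Aut_P[OF f] by auto
  moreover have "f ` (- P) = - P" using Aut_P(1)[OF f] bij_image_Compl_eq[OF bij] by metis
  ultimately show ?thesis using Aut_cl[OF f, of "A \<inter> P"] by (simp add: C_def image_Un)
qed

lemma graph_images: "fst ` ((\<lambda>x. (x, f x)) ` S) = S" "snd ` ((\<lambda>x. (x, f x)) ` S) = f ` S"
  by (simp_all add: image_image)

sublocale homogeneous_geometry C Aut P
proof
  fix f g :: "'m \<Rightarrow> 'm" and A and x x' :: 'm
  show "id \<in> Aut" by (rule Aut_id)
  show "f \<circ> g \<in> Aut" if "f \<in> Aut" "g \<in> Aut" using Aut_comp that .
  show "bij f" if "f \<in> Aut" using that by (simp add: Aut_def)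
  show "iv f \<in> Aut" if "f \<in> Aut" using Aut_inv that .
  show "f ` C A = C (f ` A)" if "f \<in> Aut" using Aut_C that .
  show "x \<in> C {}" if "x \<notin> P" using that by (simp add: C_def)
  show "f x = x" if "f \<in> Aut" "x \<notin> P" using that by (simp add: Aut_def)
  show "countable (C A \<inter> P)" if "countable A" using countable_C that .
  show "\<exists>x. x \<notin> C A" if "countable A"
  proof (rule ccontr)
    assume "\<nexists>x. x \<notin> C A"
    hence "C A \<inter> P = P" by blast
    thus False using countable_C[OF that] uncountable_points by simp
  qed
  show "\<exists>g \<in> Aut. (\<forall>y \<in> C A. g y = f y) \<and> g x = x'" if A: "countable A" and f: "f \<in> Aut" and x: "x \<notin> C A" "x' \<notin> C (f ` A)"
  proof -
    define R where "R = (\<lambda>y. (y, f y)) ` cl M (A \<inter> P)"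
    have f': "f \<in> automorphisms L M" using f by (simp add: Aut_def)
    have AP: "f ` (A \<inter> P) = f ` A \<inter> P" using Aut_P[OF f] by auto
    have R: "fst ` R = cl M (A \<inter> P)" "snd ` R = cl M (f ` A \<inter> P)"
      using Aut_cl[OF f, of "A \<inter> P"] AP unfolding R_def graph_images by simp_all
    have cR: "el R" "cl_closed M (fst ` R)" "cl_closed M (snd ` R)" "countable (fst ` R)"
      unfolding R using automorphism_el[OF f'] cl_P[of "A \<inter> P"] cl_closed_cl countable_cl A by (auto simp: R_def)
    have "x \<in> P" "x \<notin> fst ` R" "x' \<in> P" "x' \<notin> snd ` R" using x by (auto simp: R C_def)
    hence "el (insert (x, x') R)" using el_generic cR by blast
    hence "\<exists>g \<in> automorphisms L M. \<forall>(y, y') \<in> R \<union> {(x, x')}. g y = y'"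
      by (intro el_automorphism) (use cR in auto)
    then obtain g where g: "g \<in> automorphisms L M" "\<forall>(y, y') \<in> R \<union> {(x, x')}. g y = y'" by blast
    obtain h where h: "h \<in> Aut" "\<forall>x \<in> P. h x = g x" using automorphism_extends g(1) by blast
    have "h y = f y" if "y \<in> C A" for y
    proof (cases "y \<in> P")
      case True
      hence "(y, f y) \<in> R" using that by (simp add: R_def C_def)
      thus ?thesis using g(2) h(2) True by auto
    next
      case False
      thus ?thesis using h(1) f by (simp add: Aut_def)
    qed
    moreover have "h x = x'" using g(2) h(2) \<open>x \<in> P\<close> by auto
    ultimately show ?thesis using h(1) by blast
  qed
  show "\<exists>f \<in> Aut. \<forall>x \<in> C A +@ bs. f x = \<phi> x"
    if A: "countable A" and \<phi>: "C (\<phi> ` C A) = \<phi> ` C A"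
      and fin: "\<And>F. finite F \<Longrightarrow> F \<subseteq> C A +@ bs \<Longrightarrow> \<exists>f \<in> Aut. \<forall>x \<in> F. f x = \<phi> x" for \<phi> and bs :: "'m list"
  proof -
    define R where "R = (\<lambda>y. (y, \<phi> y)) ` cl M (A \<inter> P)"
    define S where "S = (\<lambda>y. (y, \<phi> y)) ` (set bs \<inter> P)"
    have single: "\<exists>f \<in> Aut. f x = \<phi> x" if "x \<in> C A +@ bs" for x using fin[of "{x}"] that by simp
    have off: "\<phi> x = x" if "x \<in> C A +@ bs" "x \<notin> P" for x
      using single[OF that(1)] that(2) by (auto simp: Aut_def)
    have on: "\<phi> x \<in> P" if "x \<in> C A +@ bs" "x \<in> P" for x
      using single[OF that(1)] that(2) Aut_P(2) by metis
    have dom: "cl M (A \<inter> P) \<subseteq> C A" "cl M (A \<inter> P) \<subseteq> P" using cl_P[of "A \<inter> P"] by (auto simp: C_def)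
    have "el (R \<union> S)"
    proof (rule elementary_finite)
      show "R \<union> S \<subseteq> P \<times> P" using on dom by (auto simp: R_def S_def)
      fix F assume F: "finite F" "F \<subseteq> R \<union> S"
      have "fst ` F \<subseteq> fst ` (R \<union> S)" using F(2) by (rule image_mono)
      also have "\<dots> \<subseteq> (C A +@ bs) \<inter> P" using dom by (auto simp: R_def S_def)
      finally have FP: "fst ` F \<subseteq> C A +@ bs" "fst ` F \<subseteq> P" by auto
      then obtain f where f: "f \<in> Aut" "\<forall>x \<in> fst ` F. f x = \<phi> x" using fin[of "fst ` F"] F(1) by auto
      have "F \<subseteq> (\<lambda>x. (x, f x)) ` P"
      proof
        fix p assume p: "p \<in> F"
        have "p = (fst p, \<phi> (fst p))" using p F(2) by (auto simp: R_def S_def)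
        hence "p = (fst p, f (fst p))" using f(2) p by auto
        thus "p \<in> (\<lambda>x. (x, f x)) ` P" using FP(2) p by blast
      qed
      moreover have "el ((\<lambda>x. (x, f x)) ` P)" using f(1) automorphism_el by (simp add: Aut_def)
      ultimately show "el F" by (rule elementary_mono[rotated])
    qed
    moreover have "cl_closed M (fst ` R)" "countable (fst ` R)"
      unfolding R_def graph_images using cl_closed_cl countable_cl A by auto
    moreover have "cl_closed M (snd ` R)"
    proof -
      have "\<phi> ` C A \<inter> P = \<phi> ` cl M (A \<inter> P)"
      proof
        show "\<phi> ` C A \<inter> P \<subseteq> \<phi> ` cl M (A \<inter> P)"
        proof
          fix y assume "y \<in> \<phi> ` C A \<inter> P"
          then obtain x where x: "x \<in> C A" "y = \<phi> x" "y \<in> P" by blast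
          hence "x \<in> P" using off[of x] by (cases "x \<in> P") auto
          thus "y \<in> \<phi> ` cl M (A \<inter> P)" using x by (auto simp: C_def)
        qed
        show "\<phi> ` cl M (A \<inter> P) \<subseteq> \<phi> ` C A \<inter> P" using dom on by blast
      qed
      moreover have "C (\<phi> ` C A) \<inter> P = cl M (\<phi> ` C A \<inter> P)" by (rule C_points)
      ultimately have "cl M (\<phi> ` cl M (A \<inter> P)) = \<phi> ` cl M (A \<inter> P)" using \<phi> by simp
      moreover have "\<phi> ` cl M (A \<inter> P) \<subseteq> P" using dom on by blast
      ultimately show ?thesis unfolding R_def graph_images by (simp add: cl_closed_def)
    qed
    moreover have "finite S" by (simp add: S_def)
    ultimately have "\<exists>g \<in> automorphisms L M. \<forall>(y, y') \<in> R \<union> S. g y = y'" by (intro el_automorphism) auto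
    then obtain g where g: "g \<in> automorphisms L M" "\<forall>(y, y') \<in> R \<union> S. g y = y'" by blast
    obtain h where h: "h \<in> Aut" "\<forall>x \<in> P. h x = g x" using automorphism_extends g(1) by blast
    have "h y = \<phi> y" if y: "y \<in> C A +@ bs" for y
    proof (cases "y \<in> P")
      case True
      hence "(y, \<phi> y) \<in> R \<union> S" using y by (auto simp: R_def S_def C_def)
      from bspec[OF g(2) this] show ?thesis using h(2) True by simp
    next
      case False
      thus ?thesis using h(1) off[OF y] by (simp add: Aut_def)
    qed
    thus ?thesis using h(1) by blast
  qed
qed

end

section \<open>Rigidity from specializations; bounded closure and the given closure\<close>

locale zariski_monster =
  fixes L :: "('f, 'r) language" and M\<^sub>0 :: "('f, 'r, 'b) cl_structure" and \<delta> :: "'d rel"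
    and M :: "('f, 'r, 'm) cl_structure"
  assumes base: "quasiminimal L M\<^sub>0"
    and monster: "monster_model L M\<^sub>0 \<delta> M"
    and Zariski: "Zariski_like (monster_universe L M\<^sub>0 \<delta> M)"
    and nontrivial: "nontrivial_pregeometry (monster_universe L M\<^sub>0 \<delta> M)"
begin

abbreviation X :: "('m, 'd) universe" where "X \<equiv> monster_universe L M\<^sub>0 \<delta> M"

lemma X_simps [simp]: "elems X = points M" "auts X = automorphisms L M" "models X = submodels L M\<^sub>0 \<delta> M" "bound X = \<delta>"
  by (simp_all add: monster_universe_def)

lemma small_subset: "small X B \<Longrightarrow> A \<subseteq> B \<Longrightarrow> small X A"
  unfolding small_def using card_of_mono1 ordLeq_ordLess_trans by blast

lemma countable_small': "countable A \<Longrightarrow> small X A"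
proof -
  assume "countable A"
  hence "(card_of A, natLeq) \<in> ordLeq" using countable_card_le_natLeq by blast
  moreover have "(natLeq, \<delta>) \<in> ordLess" using monster by (simp add: monster_model_def)
  ultimately show ?thesis unfolding small_def X_simps by (rule ordLeq_ordLess_trans)
qed

text \<open>In a small structure every set of realizations is small, so \<open>bcl\<close> is
  constant and the pregeometry would be trivial. Uncountability of the points follows.\<close>

lemma points_not_small: "\<not> small X (points M)"
proof
  assume s: "small X (points M)"
  obtain A where A: "A \<subseteq> points M" "A \<noteq> {}" "bcl X A \<noteq> (\<Union>a \<in> A. bcl X {a})"
    using nontrivial by (auto simp: nontrivial_pregeometry_def)
  have "bcl X B = points M" for B unfolding bcl_def X_simps using small_subset[OF s] by auto
  thus False using A by auto
qed

sublocale uncountable_monster L M\<^sub>0 \<delta> M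
  using base monster countable_small' points_not_small by unfold_locales auto

lemma same_gtp_iff:
  assumes "A \<subseteq> P" "set a \<subseteq> P"
  shows "same_gtp X A a b \<longleftrightarrow> eqv A a b"
proof
  assume "same_gtp X A a b"
  then obtain f where f: "f \<in> automorphisms L M" "\<forall>x \<in> A. f x = x" "map f a = b"
    by (auto simp: same_gtp_def auts_over_def)
  obtain g where g: "g \<in> Aut" "\<forall>x \<in> P. g x = f x" using automorphism_extends f(1) by blast
  have "map g a = map f a" using g(2) assms(2) by auto
  thus "eqv A a b" using f g assms(1) by (intro eqvI[of g]) (auto simp: fixg_def)
next
  assume "eqv A a b"
  then obtain g where g: "g \<in> fixg A" "map g a = b" by (rule eqvE)
  have "g \<in> automorphisms L M" using fixgD(1)[OF g(1)] by (simp add: Aut_def)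
  thus "same_gtp X A a b" using g(2) fixgD(2)[OF g(1)] by (auto simp: same_gtp_def auts_over_def)
qed

lemma not_in_C_P: "x \<notin> C A \<Longrightarrow> x \<in> P"
  by (auto simp: C_def)

lemma C_countable_classes:
  fixes n :: nat
  assumes B: "finite B"
  defines "E \<equiv> {(u, v). u \<in> tuples P n \<and> v \<in> tuples P n \<and> eqv (C B) u v}"
  shows "small X (tuples P n // E)"
proof -
  have "ctbl_gen (C B)" using ctbl_gen_C0 B by (simp add: countable_finite)
  then obtain W where W: "countable W" "\<forall>w. set w \<subseteq> P \<longrightarrow> (\<exists>g \<in> fixg (C B). map g w \<in> W)"
    using countably_many_types by blast
  have "tuples P n // E \<subseteq> (\<lambda>w. E `` {w}) ` W"
  proof
    fix c assume "c \<in> tuples P n // E"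
    then obtain u where u: "u \<in> tuples P n" "c = E `` {u}" by (auto simp: quotient_def)
    obtain g where g: "g \<in> fixg (C B)" "map g u \<in> W" using W(2) u(1) by (auto simp: tuples_def)
    have "eqv (C B) u (map g u)" by (rule eqvI[OF g(1) refl])
    hence "eqv (C B) u v \<longleftrightarrow> eqv (C B) (map g u) v" for v using eqv_trans eqv_sym by blast
    moreover have "map g u \<in> tuples P n" using u(1) Aut_P(2)[OF fixgD(1)[OF g(1)]] by (auto simp: tuples_def)
    ultimately have "c = E `` {map g u}" using u by (auto simp: E_def)
    thus "c \<in> (\<lambda>w. E `` {w}) ` W" using g(2) by blast
  qed
  from countable_subset[OF this countable_image[OF W(1)]] show ?thesis by (rule countable_small')
qed

text \<open>Conjugacy over \<open>C (set b)\<close> has countably many classes and is invariant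
  under automorphisms fixing \<open>b\<close>, so it is coarser than equality of Lascar types over
  \<open>b\<close>. Tuples of the same Lascar type are therefore conjugate with \<open>x\<close>
  fixed, and \<open>[x]\<close> itself is the required extension of its type.\<close>

lemma indep_closure:
  assumes b: "set b \<subseteq> P" and x: "x \<in> C (set b)" "x \<in> P" and Y: "Y \<subseteq> P"
  shows "indep X [x] (set b) Y"
proof -
  have "\<not> Lascar_splits X [x] D (set b)" if D: "D \<subseteq> P" for D
  proof
    assume "Lascar_splits X [x] D (set b)"
    then obtain u v where uv: "u \<in> lists D" "v \<in> lists D" "same_Lt X (set b) u v"
      "\<not> same_tp X (set b) ([x] @ u) ([x] @ v)" by (auto simp: Lascar_splits_def)
    define n where "n = length u"
    define E where "E = {(u, v). u \<in> tuples P n \<and> v \<in> tuples P n \<and> eqv (C (set b)) u v}"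
    have "equiv (tuples P n) E"
    proof (rule equivI)
      show "E \<subseteq> tuples P n \<times> tuples P n" by (auto simp: E_def)
      show "refl_on (tuples P n) E" by (rule refl_onI) (auto simp: E_def eqv_refl)
      show "sym E" by (rule symI) (auto simp: E_def intro: eqv_sym)
      show "trans E" by (rule transI) (auto simp: E_def intro: eqv_trans)
    qed
    moreover have "(map f p, map f q) \<in> E" if f: "f \<in> auts_over X (set b)" and pq: "(p, q) \<in> E" for f p q
    proof -
      have "f \<in> automorphisms L M" "\<forall>x \<in> set b. f x = x" using f by (auto simp: auts_over_def)
      then obtain g where g: "g \<in> Aut" "\<forall>x \<in> P. g x = f x" using automorphism_extends by blast
      have "g ` set b = set b" using g(2) b \<open>\<forall>x \<in> set b. f x = x\<close> by (auto simp: image_iff subset_iff)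
      hence gC: "g ` C (set b) = C (set b)" using Aut_C[OF g(1)] by simp
      have "eqv (C (set b)) p q" using pq by (simp add: E_def)
      from eqv_image[OF g(1) this] have e: "eqv (C (set b)) (map g p) (map g q)" unfolding gC .
      have t: "map f r = map g r" "map g r \<in> tuples P n" if "r \<in> tuples P n" for r
        using that g Aut_P(2)[OF g(1)] by (auto simp: tuples_def)
      have pq': "p \<in> tuples P n" "q \<in> tuples P n" using pq by (simp_all add: E_def)
      show ?thesis unfolding t(1)[OF pq'(1)] t(1)[OF pq'(2)] using e t(2)[OF pq'(1)] t(2)[OF pq'(2)] by (simp add: E_def)
    qed
    ultimately have "E \<in> bounded_equivs X (set b) (length u)"
      using C_countable_classes[of "set b" n] unfolding bounded_equivs_def X_simps E_def n_def by auto
    hence "(u, v) \<in> E" using uv(3) by (auto simp: same_Lt_def)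
    then obtain g where g: "g \<in> fixg (C (set b))" "map g u = v" by (auto simp: E_def elim: eqvE)
    have "same_tp X (set b) ([x] @ u) ([x] @ v)"
      unfolding same_tp_def
    proof (intro allI impI)
      fix F assume F: "F \<subseteq> set b"
      have "g \<in> fixg F" using g(1) F in_C[of _ "set b"] by (auto simp: fixg_def)
      moreover have "map g ([x] @ u) = [x] @ v" using g x(1) by (auto simp: fixg_def)
      ultimately have "eqv F ([x] @ u) ([x] @ v)" by (rule eqvI)
      thus "same_gtp X F ([x] @ u) ([x] @ v)"
      proof (subst same_gtp_iff)
        show "F \<subseteq> P" using F b by blast
        show "set ([x] @ u) \<subseteq> P" using x(2) uv(1) D by auto
      qed
    qed
    thus False using uv(4) by blast
  qed
  moreover have "same_tp X (set b \<union> Y) [x] [x]"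
    unfolding same_tp_def
  proof (intro allI impI)
    fix F assume "F \<subseteq> set b \<union> Y"
    hence "F \<subseteq> P" using b Y by blast
    thus "same_gtp X F [x] [x]" using same_gtp_iff[of F "[x]" "[x]"] eqv_refl x(2) by simp
  qed
  ultimately show ?thesis unfolding indep_def X_simps using x(2)
    by (intro exI[of _ "set b"]) auto
qed

lemma rigid_swap:
  assumes B: "finite B" and x: "x \<in> C B" and y: "y \<in> C B" and f: "f \<in> Aut" "\<And>b. b \<in> B \<Longrightarrow> f b = b"
    and swap: "f x = y" "f y = x"
  shows "x = y"
proof (cases "x \<in> P")
  case False
  thus ?thesis using f(1) swap(1) by (simp add: Aut_def)
next
  case True
  hence yP: "y \<in> P" using Aut_P(2)[OF f(1)] swap(1) by blast
  obtain b where b: "set b = B \<inter> P" using finite_list[of "B \<inter> P"] B by blast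
  have xb: "x \<in> C (set b)" using x True by (auto simp: b C_def)
  obtain \<C> where \<C>: "ZL1 X \<C>" "ZL8 X \<C>" using Zariski by (auto simp: Zariski_like_def)
  have "infinite P" using uncountable_points countable_finite by blast
  \<comment> \<open>The index set in ZL8 is a set of elements of the structure, so two distinct
    points serve as indices.\<close>
  then obtain i where "i \<in> P" by fastforce
  moreover have "infinite (P - {i})" using \<open>infinite P\<close> by simp
  ultimately obtain j where ij: "i \<in> P" "j \<in> P" "i \<noteq> j" by (metis DiffE ex_in_conv finite.emptyI singletonI)
  \<comment> \<open>The constant family is independent over \<open>b\<close>, because an element of
    the closure of \<open>b\<close> is free from everything over \<open>b\<close>, even from itself.
    The target family takes both values \<open>x\<close> and \<open>y\<close>, so a common
    specialization would have to send \<open>x\<close> to both.\<close>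
  define a where "a = (\<lambda>k :: 'm. [x])"
  define a' where "a' k = (if k = i then [x] else [y])" for k
  have aut: "id \<in> automorphisms L M" "f \<in> automorphisms L M" using Aut_id f(1) by (simp_all add: Aut_def)
  have fb: "map f b = b" by (rule map_idI) (use f(2) b in blast)
  \<comment> \<open>By ZL1 the irreducible sets are invariant, so automorphisms restrict to
    specializations; this covers each member of the family separately.\<close>
  have spec: "specialization X \<C> S g" if g: "g \<in> automorphisms L M" and S: "S \<subseteq> P" for S g
  proof -
    have "g ` S \<subseteq> P" using automorphism_bij[OF g] S by (auto simp: bij_betw_def)
    moreover have "map g as \<in> D" if "D \<in> \<C>" "as \<in> D" for D as
    proof -
      have "map g ` D = D" using \<C>(1) that(1) g by (simp add: ZL1_def gdefinable_def auts_over_def)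
      thus ?thesis using that(2) by blast
    qed
    ultimately show ?thesis using S by (auto simp: specialization_def)
  qed
  have "small X {i, j}" by (rule countable_small') simp
  moreover have "\<forall>k \<in> {i, j}. a k \<in> lists (elems X) \<and> a' k \<in> lists (elems X)"
    using True yP by (auto simp: a_def a'_def)
  moreover have "indep_family X (set b) {i, j} a"
    unfolding indep_family_def
  proof
    fix k
    have "(\<Union>l \<in> {i, j} - {k}. set (a l)) \<subseteq> P" using True by (auto simp: a_def)
    thus "indep X (a k) (set b) (\<Union>l \<in> {i, j} - {k}. set (a l))"
      unfolding a_def using indep_closure[of b x] b xb True by simp
  qed
  moreover have "indiscernible X (set b) {i, j} a"
    unfolding indiscernible_def a_def auts_over_def using aut(1) by auto
  moreover have "indiscernible X (set b) {i, j} a'"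
    unfolding indiscernible_def
  proof (intro allI impI)
    fix p assume p: "bij_betw p {i, j} {i, j}"
    have "p i \<in> {i, j}" "p j \<in> {i, j}" "p i \<noteq> p j" using p ij(3) by (auto simp: bij_betw_def inj_on_def)
    then consider "p i = i" "p j = j" | "p i = j" "p j = i" by (elim insertE emptyE) auto
    thus "\<exists>g \<in> auts_over X (set b). \<forall>k \<in> {i, j}. map g (a' k) = a' (p k)"
    proof cases
      case 1
      thus ?thesis using aut(1) by (intro bexI[of _ id]) (auto simp: auts_over_def)
    next
      case 2
      thus ?thesis using aut(2) ij(3) swap f(2) b by (intro bexI[of _ f]) (auto simp: auts_over_def a'_def)
    qed
  qed
  moreover have "\<forall>k \<in> {i, j}. spec X \<C> (a k @ b) (a' k @ b)"
  proof
    fix k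
    show "spec X \<C> (a k @ b) (a' k @ b)"
    proof (cases "k = i")
      case True
      have "specialization X \<C> (set (a k @ b)) id" by (rule spec[OF aut(1)]) (use \<open>x \<in> P\<close> b in \<open>auto simp: a_def\<close>)
      thus ?thesis unfolding spec_def by (intro exI[of _ id]) (use True in \<open>simp add: a_def a'_def\<close>)
    next
      case False
      have "specialization X \<C> (set (a k @ b)) f" by (rule spec[OF aut(2)]) (use \<open>x \<in> P\<close> b in \<open>auto simp: a_def\<close>)
      thus ?thesis unfolding spec_def by (intro exI[of _ f]) (use False fb swap(1) in \<open>simp add: a_def a'_def\<close>)
    qed
  qed
  moreover have "strongly_good X \<C> b b"
  proof -
    have "special_iso X \<C> (set b) id" using spec[OF aut(1), of "set b"] b by (auto simp: special_iso_def)
    hence "spec_iso X \<C> b b" unfolding spec_iso_def by (intro exI[of _ id]) simp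
    thus ?thesis by (intro strongly_good.regular strongly_regular.iso)
  qed
  moreover have "rk X (set b) (set b) \<le> 1" by (simp add: rk_def)
  ultimately have "spec_family X \<C> {i, j} (\<lambda>k. b @ a k) (\<lambda>k. b @ a' k)"
    using \<C>(2) unfolding ZL8_def by blast
  then obtain h where "\<forall>k \<in> {i, j}. map h (b @ a k) = b @ a' k" by (auto simp: spec_family_def)
  hence "map h (b @ a i) = b @ a' i" "map h (b @ a j) = b @ a' j" by simp_all
  hence "h x = x" "h x = y" using ij(3) by (simp_all add: a_def a'_def)
  thus ?thesis by simp
qed

sublocale rigid_geometry C Aut P
  by unfold_locales (rule rigid_swap)

text \<open>By finite character the closure is a union of countable sets indexed by the finite lists
  over \<open>A\<close>, and for infinite \<open>A\<close> there are no more such lists than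
  elements of \<open>A\<close>.\<close>

lemma cl_small:
  assumes A: "A \<subseteq> P" "small X A"
  shows "small X (cl M A)"
proof (cases "finite A")
  case True
  thus ?thesis using countable_small' countable_cl[OF A(1)] by (simp add: countable_finite)
next
  case False
  define T where "T n = {l. length l = n \<and> set l \<subseteq> A}" for n :: nat
  have T: "(card_of (T n), card_of A) \<in> ordLeq" for n
  proof (induction n)
    case 0
    have "T 0 = {[]}" by (auto simp: T_def)
    hence "countable (T 0)" by simp
    hence "(card_of (T 0), natLeq) \<in> ordLeq" using countable_card_le_natLeq by blast
    moreover have "(natLeq, card_of A) \<in> ordLeq" using False infinite_iff_natLeq_ordLeq by blast
    ultimately show ?case by (rule ordLeq_transitive)
  next
    case (Suc n)
    have "T (Suc n) \<subseteq> (\<lambda>(x, l). x # l) ` (A \<times> T n)" by (auto simp: T_def length_Suc_conv)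
    hence "(card_of (T (Suc n)), card_of (A \<times> T n)) \<in> ordLeq"
      using card_of_mono1 card_of_image ordLeq_transitive by blast
    moreover have "(card_of (A \<times> T n), card_of A) \<in> ordLeq"
      by (rule card_of_Times_ordLeq_infinite_Field)
        (use False Suc card_of_Card_order[of A] card_of_card_order_on[of A] in
          \<open>simp_all add: Field_card_of card_of_mono1\<close>)
    ultimately show ?case by (rule ordLeq_transitive)
  qed
  have nat: "(natLeq, card_of A) \<in> ordLeq" using False infinite_iff_natLeq_ordLeq by blast
  have ctbl: "(card_of B, card_of A) \<in> ordLeq" if "countable B" for B :: "'z set"
  proof -
    have "(card_of B, natLeq) \<in> ordLeq" using that countable_card_le_natLeq by blast
    thus ?thesis using nat by (rule ordLeq_transitive)
  qed
  have "cl M A \<subseteq> (\<Union>n. \<Union>l \<in> T n. cl M (set l))"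
  proof
    fix x assume "x \<in> cl M A"
    then obtain F where F: "F \<subseteq> A" "finite F" "x \<in> cl M F" using cl_fin[OF A(1)] by blast
    obtain l where "set l = F" using finite_list[OF F(2)] by blast
    hence "l \<in> T (length l)" "x \<in> cl M (set l)" using F by (auto simp: T_def)
    thus "x \<in> (\<Union>n. \<Union>l \<in> T n. cl M (set l))" by blast
  qed
  moreover have "(card_of (\<Union>n. \<Union>l \<in> T n. cl M (set l)), card_of A) \<in> ordLeq"
  proof (rule card_of_UNION_ordLeq_infinite[OF False])
    show "(card_of (UNIV :: nat set), card_of A) \<in> ordLeq" by (rule ctbl) simp
    have c: "countable (cl M (set l))" if "l \<in> T n" for l n
      using countable_cl[of "set l"] that A(1) by (auto simp: T_def countable_finite)
    have "(card_of (\<Union>l \<in> T n. cl M (set l)), card_of A) \<in> ordLeq" for n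
      by (rule card_of_UNION_ordLeq_infinite[OF False T]) (intro ballI ctbl c)
    thus "\<forall>n \<in> UNIV. (card_of (\<Union>l \<in> T n. cl M (set l)), card_of A) \<in> ordLeq" by (rule ballI)
  qed
  ultimately have "(card_of (cl M A), card_of A) \<in> ordLeq" using card_of_mono1 ordLeq_transitive by blast
  thus ?thesis using A(2) unfolding small_def by (rule ordLeq_ordLess_trans)
qed

text \<open>Outside \<open>cl M A\<close> there is only one weak type over \<open>A\<close>. If it
  had few realizations, the complement of the small set \<open>cl M A\<close> would be small, and so
  would the whole structure.\<close>

lemma bcl_sub_cl:
  assumes A: "A \<subseteq> P" "small X A"
  shows "bcl X A \<subseteq> cl M A"
proof
  fix z assume z: "z \<in> bcl X A"
  show "z \<in> cl M A"
  proof (rule ccontr)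
    assume n: "z \<notin> cl M A"
    have zP: "z \<in> P" using z by (simp add: bcl_def)
    have "w \<in> {b \<in> P. same_tp X A [z] [b]}" if w: "w \<in> P - cl M A" for w
    proof -
      have "same_gtp X F [z] [w]" if F: "F \<subseteq> A" "finite F" for F
      proof -
        have FP: "F \<inter> P = F" "cl M F \<subseteq> cl M A" using F A(1) cl_mono by blast+
        have "z \<notin> C F" "w \<notin> C F" using n w FP zP by (auto simp: C_def)
        hence "indl (C F) [z]" "indl (C F) [w]" by (simp_all add: indl_Cons)
        then obtain g where g: "g \<in> fixg (C F)" "map g [z] = [w]"
          using generic_list_fix[of "C F" "[z]" "[w]"] ctbl_gen_C0[of F] F(2) by (auto simp: countable_finite)
        have "g \<in> fixg F" using fixg_mono[OF ext[of F]] g(1) by (rule subsetD)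
        hence "eqv F [z] [w]" using g(2) by (rule eqvI)
        moreover have "F \<subseteq> P" using F A(1) by blast
        ultimately show ?thesis using same_gtp_iff[of F "[z]"] zP by simp
      qed
      thus ?thesis using w by (simp add: same_tp_def)
    qed
    hence "P - cl M A \<subseteq> {b \<in> P. same_tp X A [z] [b]}" by blast
    moreover have "small X {b \<in> P. same_tp X A [z] [b]}" using z by (simp add: bcl_def)
    ultimately have "small X (P - cl M A)" using small_subset by blast
    moreover have "small X (cl M A)" using cl_small A .
    moreover have "Card_order \<delta>" "(natLeq, \<delta>) \<in> ordLess" using monster by (auto simp: monster_model_def)
    moreover have "infinite (Field \<delta>)"
    proof -
      have "(natLeq, \<delta>) \<in> ordLeq" using calculation(4) by (rule ordLess_imp_ordLeq)
      hence "(natLeq, card_of (Field \<delta>)) \<in> ordLeq"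
        using ordIso_symmetric[OF card_of_Field_ordIso[OF calculation(3)]] by (rule ordLeq_ordIso_trans)
      thus ?thesis using infinite_iff_natLeq_ordLeq by blast
    qed
    ultimately have "small X ((P - cl M A) \<union> cl M A)"
      unfolding small_def X_simps by (intro card_of_Un_ordLess_infinite_Field)
    hence "small X P" by (rule small_subset) blast
    thus False using points_not_small by blast
  qed
qed

lemma cl_sub_bcl: 
  assumes a: "a \<in> P" shows "cl M {a} \<subseteq> bcl X {a}"
proof
  fix z assume z: "z \<in> cl M {a}"
  have zP: "z \<in> P" using z cl_P[of "{a}"] a by blast
  have "{b \<in> P. same_tp X {a} [z] [b]} \<subseteq> cl M {a}"
  proof clarify
    fix b assume b: "b \<in> P" "same_tp X {a} [z] [b]"
    hence "same_gtp X {a} [z] [b]" by (simp add: same_tp_def)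
    hence "eqv {a} [z] [b]" using same_gtp_iff[of "{a}" "[z]"] a zP by simp
    then obtain g where g: "g \<in> fixg {a}" "g z = b" by (auto elim: eqvE)
    have "g ` cl M {a} = cl M {a}" using Aut_cl[OF fixgD(1)[OF g(1)], of "{a}"] a fixgD(2)[OF g(1), of a] by simp
    thus "b \<in> cl M {a}" using z g(2) by blast
  qed
  moreover have "countable (cl M {a})" using countable_cl[of "{a}"] a by simp
  ultimately have "small X {b \<in> P. same_tp X {a} [z] [b]}" by (rule countable_small'[OF countable_subset])
  thus "z \<in> bcl X {a}" using zP by (simp add: bcl_def)
qed

lemma nontrivial_closure:
  "\<exists>F z. finite F \<and> z \<in> C F \<and> z \<notin> C {} \<and> (\<forall>a \<in> F. z \<notin> C {a})"
proof -
  obtain A where A: "A \<subseteq> P" "A \<noteq> {}" "small X A" "bcl X A \<noteq> (\<Union>a \<in> A. bcl X {a})"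
    using nontrivial by (auto simp: nontrivial_pregeometry_def)
  have "bcl X {a} \<subseteq> bcl X A" if "a \<in> A" for a
  proof
    fix z assume z: "z \<in> bcl X {a}"
    have "{b \<in> P. same_tp X A [z] [b]} \<subseteq> {b \<in> P. same_tp X {a} [z] [b]}" using that by (auto simp: same_tp_def)
    hence "small X {b \<in> P. same_tp X A [z] [b]}" by (rule small_subset[rotated]) (use z in \<open>simp add: bcl_def\<close>)
    thus "z \<in> bcl X A" using z by (simp add: bcl_def)
  qed
  then obtain z where z: "z \<in> bcl X A" "\<forall>a \<in> A. z \<notin> bcl X {a}" using A(4) by blast
  have "z \<in> cl M A" using bcl_sub_cl A(1,3) z(1) by blast
  then obtain F where F: "F \<subseteq> A" "finite F" "z \<in> cl M F" using cl_fin A(1) by blast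
  have n: "z \<notin> C {a}" if "a \<in> A" for a
  proof
    assume "z \<in> C {a}"
    moreover have "a \<in> P" "z \<in> P" using that A(1) z(1) by (auto simp: bcl_def)
    ultimately have "z \<in> cl M {a}" by (simp add: C_def)
    thus False using z(2) that cl_sub_bcl[OF \<open>a \<in> P\<close>] by blast
  qed
  obtain a where "a \<in> A" using A(2) by blast
  hence "z \<notin> C {}" using n C_mono_in[of z "{}" "{a}"] by blast
  moreover have "F \<inter> P = F" using F(1) A(1) by blast
  ultimately show ?thesis using F n by (intro exI[of _ F] exI[of _ z]) (auto simp: C_def)
qed

end

subsection \<open>Codes of differences\<close>

locale nontrivial_geometry = rigid_geometry +
  assumes nontrivial_closure: "\<exists>F z. finite F \<and> z \<in> C F \<and> z \<notin> C {} \<and> (\<forall>a \<in> F. z \<notin> C {a})"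
begin

definition loc :: "'a \<Rightarrow> 'a set \<Rightarrow> 'a set" where
  "loc d A = C (insert d A)"

text \<open>A dependent family is shrunk until one element \<open>x\<close> is essential for
  \<open>z\<close>. After adjoining a point \<open>d\<close> independent of the family, modularity
  replaces the remaining elements by a single point \<open>e\<close>, so that \<open>z\<close> is a
  third point on the line of \<open>x\<close> and \<open>e\<close> over \<open>d\<close>.\<close>

lemma third_over_point:
  "\<exists>d x y z. d \<notin> C {} \<and> x \<notin> C {d} \<and> y \<notin> C {d, x} \<and> z \<in> C {d, x, y} \<and> z \<notin> C {d, x} \<and> z \<notin> C {d, y}"
proof -
  obtain F z where Fz: "finite F" "z \<in> C F" "z \<notin> C {}" "\<forall>a \<in> F. z \<notin> C {a}" using nontrivial_closure by blast
  have "\<exists>G x S. G = insert x S \<and> G \<subseteq> F \<and> z \<in> C G \<and> z \<notin> C S" using Fz(1,2)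
  proof (induction F rule: finite_induct)
    case empty
    thus ?case using Fz(3) by blast
  next
    case (insert x F)
    show ?case
    proof (cases "z \<in> C F")
      case True
      thus ?thesis using insert.IH by blast
    next
      case False
      thus ?thesis using insert.prems by blast
    qed
  qed
  then obtain x S where S: "insert x S \<subseteq> F" "z \<in> C (insert x S)" "z \<notin> C S" by blast
  have finS: "finite S" using S(1) Fz(1) finite_subset by auto
  obtain d where d: "d \<notin> C (insert x S)" using unctbl[of "insert x S"] finS by (auto simp: countable_finite)
  have d0: "d \<notin> C {}" using d C_mono_in[of d "{}" "insert x S"] by blast
  have "z \<in> C (insert d (insert x S))" by (rule C_mono_in[OF S(2)]) blast
  then obtain e where e: "e \<in> C (insert d S)" "z \<in> C {d, x, e}" using modular_over_point[OF d0 finS] by blast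
  have zx: "z \<notin> C {d, x}"
  proof
    assume "z \<in> C {d, x}"
    moreover have "z \<notin> C {x}" using Fz(4) S(1) by blast
    ultimately have "d \<in> C (insert z {x})" using exch by blast
    moreover have "insert z {x} \<subseteq> C (insert x S)" using S(2) in_C[of x "insert x S"] by simp
    ultimately show False using d C_sub by blast
  qed
  have ze: "z \<notin> C {d, e}"
  proof
    assume "z \<in> C {d, e}"
    moreover have "{d, e} \<subseteq> C (insert d S)" using e(1) in_C[of d "insert d S"] by simp
    ultimately have "z \<in> C (insert d S)" using C_sub by blast
    hence "d \<in> C (insert z S)" using exch S(3) by blast
    moreover have "insert z S \<subseteq> C (insert x S)" using S(2) ext[of "insert x S"] by simp
    ultimately show False using d C_sub by blast
  qed
  have "x \<notin> C {d}"
  proof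
    assume "x \<in> C {d}"
    hence "x \<in> C {d, e}" by (rule C_mono_in) blast
    hence "{d, x, e} \<subseteq> C {d, e}" using ext[of "{d, e}"] by simp
    thus False using e(2) ze C_sub by blast
  qed
  moreover have "e \<notin> C {d, x}"
  proof
    assume "e \<in> C {d, x}"
    hence "{d, x, e} \<subseteq> C {d, x}" using ext[of "{d, x}"] by simp
    thus False using e(2) zx C_sub by blast
  qed
  ultimately show ?thesis using d0 e(2) zx ze by blast
qed

text \<open>All independent triples are conjugate, so one line with a third point yields a third
  point on every line over every base point.\<close>

lemma third_over:
  assumes "d \<notin> C {}" "x \<notin> C {d}" "y \<notin> C {d, x}"
  shows "\<exists>z \<in> C {d, x, y}. z \<notin> C {d, x} \<and> z \<notin> C {d, y}"
proof -
  obtain d0 x0 y0 z0 where 0: "d0 \<notin> C {}" "x0 \<notin> C {d0}" "y0 \<notin> C {d0, x0}"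
    "z0 \<in> C {d0, x0, y0}" "z0 \<notin> C {d0, x0}" "z0 \<notin> C {d0, y0}"
    using third_over_point by blast
  have "indl {} [d0, x0, y0]" "indl {} [d, x, y]" using 0(1-3) assms by (simp_all add: indl_Cons insert_commute)
  hence "\<exists>g \<in> Aut. (\<forall>y \<in> C {}. g y = id y) \<and> map g [d0, x0, y0] = [d, x, y]"
    using generic_list[of "{}" id "[d0, x0, y0]" "[d, x, y]"] G_id by simp
  then obtain g where g: "g \<in> Aut" "g d0 = d" "g x0 = x" "g y0 = y" by auto
  have "g z0 \<in> C {d, x, y}" "g z0 \<notin> C {d, x}" "g z0 \<notin> C {d, y}"
    using G_C_mem[OF g(1), of z0 "{d0, x0, y0}"] G_C_mem[OF g(1), of z0 "{d0, x0}"]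
      G_C_mem[OF g(1), of z0 "{d0, y0}"] 0(4-6) g by simp_all
  thus ?thesis by blast
qed

lemma local_geometry:
  assumes "indl {} [d, o']"
  shows "modular_geometry (loc d) o'"
proof -
  have d: "d \<notin> C {}" "o' \<notin> C {d}" using assms by (simp_all add: indl_Cons)
  show ?thesis
  proof
    fix A B F S :: "'a set" and x y
    show "A \<subseteq> loc d A" using ext[of "insert d A"] by (simp add: loc_def)
    show "loc d A \<subseteq> loc d B" if "A \<subseteq> B" unfolding loc_def by (rule mono) (use that in blast)
    show "loc d (loc d A) = loc d A"
      unfolding loc_def by (rule C_eqI) (use ext[of "insert d (C (insert d A))"] ext[of "insert d A"] in auto)
    show "\<exists>F \<subseteq> A. finite F \<and> x \<in> loc d F" if x: "x \<in> loc d A"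
    proof -
      obtain F where F: "F \<subseteq> insert d A" "finite F" "x \<in> C F" using fin[of x "insert d A"] x unfolding loc_def by blast
      have "x \<in> C (insert d (F - {d}))" by (rule C_mono_in[OF F(3)]) blast
      thus ?thesis using F by (intro exI[of _ "F - {d}"]) (auto simp: loc_def)
    qed
    show "y \<in> loc d (insert x A)" if "x \<in> loc d (insert y A)" "x \<notin> loc d A"
      using exch[of x y "insert d A"] that by (simp add: loc_def insert_commute)
    show "\<exists>e \<in> loc d S. y \<in> loc d {x, e}" if "finite S" "y \<in> loc d (insert x S)"
      using modular_over_point[OF d(1) that(1), of y x] that(2) by (simp add: loc_def)
    show "\<exists>z \<in> loc d {x, y}. z \<notin> loc d {x} \<and> z \<notin> loc d {y}" if "x \<notin> loc d {}" "y \<notin> loc d {x}"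
      using third_over[OF d(1), of x y] that by (simp add: loc_def)
    show "\<exists>x. x \<notin> loc d F" if "finite F"
      unfolding loc_def by (rule unctbl) (use that in \<open>simp add: countable_finite\<close>)
    show "o' \<notin> loc d {}" using d by (simp add: loc_def)
  qed
qed

definition vecs :: "'a \<Rightarrow> 'a \<Rightarrow> ('a set \<times> 'a set) set" where
  "vecs d o' = modular_geometry.vect (loc d) o'"

definition rep :: "'a \<Rightarrow> 'a \<Rightarrow> 'a \<Rightarrow> 'a \<Rightarrow> bool" where
  "rep d o' = modular_geometry.vrep (loc d) o'"

definition veq :: "'a \<Rightarrow> 'a \<Rightarrow> ('a set \<times> 'a set) \<times> ('a set \<times> 'a set) \<Rightarrow> ('a set \<times> 'a set) \<times> ('a set \<times> 'a set) \<Rightarrow> bool" where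
  "veq d o' = generic_addition.deq (vecs d o') (modular_geometry.vadd (loc d) o') (modular_geometry.vgen (loc d) o')"

definition vsum :: "'a \<Rightarrow> 'a \<Rightarrow> ('a set \<times> 'a set) \<times> ('a set \<times> 'a set) \<Rightarrow> ('a set \<times> 'a set) \<times> ('a set \<times> 'a set) \<Rightarrow>
    ('a set \<times> 'a set) \<times> ('a set \<times> 'a set) \<Rightarrow> bool" where
  "vsum d o' = generic_addition.dsum (vecs d o') (modular_geometry.vadd (loc d) o') (modular_geometry.vgen (loc d) o')"

definition push :: "('a \<Rightarrow> 'a) \<Rightarrow> ('a set \<times> 'a set) \<times> ('a set \<times> 'a set) \<Rightarrow> ('a set \<times> 'a set) \<times> ('a set \<times> 'a set)" where
  "push f = map_prod (map_prod ((`) f) ((`) f)) (map_prod ((`) f) ((`) f))"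

lemma veq_addition:
  assumes "indl {} [d, o']"
  shows "generic_addition (vecs d o') (modular_geometry.vadd (loc d) o') (modular_geometry.vgen (loc d) o')"
proof -
  interpret V: modular_geometry "loc d" o' by (rule local_geometry[OF assms])
  show ?thesis unfolding vecs_def by (rule V.vec.generic_addition_axioms)
qed

lemma veq_refl: "indl {} [d, o'] \<Longrightarrow> p \<in> vecs d o' \<times> vecs d o' \<Longrightarrow> veq d o' p p"
  unfolding veq_def by (rule generic_addition.deq_refl[OF veq_addition])

lemma veq_sym: "indl {} [d, o'] \<Longrightarrow> veq d o' p q \<Longrightarrow> veq d o' q p"
  unfolding veq_def by (rule generic_addition.deq_sym[OF veq_addition])

lemma veq_trans: "indl {} [d, o'] \<Longrightarrow> veq d o' p q \<Longrightarrow> veq d o' q r \<Longrightarrow> veq d o' p r"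
  unfolding veq_def by (rule generic_addition.deq_trans[OF veq_addition])

lemma veq_inj: "indl {} [d, o'] \<Longrightarrow> veq d o' (v, t) (w, t) \<Longrightarrow> v = w"
  unfolding veq_def by (rule generic_addition.deq_inj[OF veq_addition])

lemma indl_image: "f \<in> Aut \<Longrightarrow> indl {} xs \<Longrightarrow> indl {} (map f xs)"
  using dm_image[of f "{}" xs] by (simp add: indl_def)

lemma loc_map:
  assumes f: "f \<in> Aut" and b: "indl {} [d, o']"
  shows "addition_map (vecs d o') (modular_geometry.vadd (loc d) o') (modular_geometry.vgen (loc d) o')
    (vecs (f d) (f o')) (modular_geometry.vadd (loc (f d)) (f o')) (modular_geometry.vgen (loc (f d)) (f o'))
    (map_prod ((`) f) ((`) f))"
  unfolding vecs_def
proof (rule geometry_iso_addition)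
  show "modular_geometry (loc d) o'" by (rule local_geometry[OF b])
  show "modular_geometry (loc (f d)) (f o')" by (rule local_geometry) (use indl_image[OF f b] in simp)
  show "inj f" using G_bij[OF f] by (rule bij_is_inj)
  show "f ` loc d A = loc (f d) (f ` A)" for A using G_C[OF f, of "insert d A"] by (simp add: loc_def)
qed simp

lemma veq_push: "f \<in> Aut \<Longrightarrow> indl {} [d, o'] \<Longrightarrow> veq d o' p q \<Longrightarrow> veq (f d) (f o') (push f p) (push f q)"
  unfolding veq_def push_def by (rule addition_map.h_deq[OF loc_map])

lemma vsum_push: "f \<in> Aut \<Longrightarrow> indl {} [d, o'] \<Longrightarrow> vsum d o' p q r \<Longrightarrow> vsum (f d) (f o') (push f p) (push f q) (push f r)"
  unfolding vsum_def push_def by (rule addition_map.h_dsum[OF loc_map])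

lemma rep_iff:
  assumes "indl {} [d, o']"
  shows "rep d o' x x' \<longleftrightarrow> x \<notin> C {d, o'} \<and> x' \<in> C {d, o', x} \<and> x' \<notin> C {d, o'} \<and> x' \<notin> C {d, x}"
  unfolding rep_def using modular_geometry.vrep_def[OF local_geometry[OF assms]] by (simp add: loc_def)

lemma rep_map:
  assumes f: "f \<in> Aut" and b: "indl {} [d, o']" and r: "rep d o' x x'"
  shows "rep (f d) (f o') (f x) (f x')"
proof -
  have b': "indl {} [f d, f o']" using indl_image[OF f b] by simp
  show ?thesis
    using r G_C_mem[OF f, of x "{d, o'}"] G_C_mem[OF f, of x' "{d, o', x}"] G_C_mem[OF f, of x' "{d, o'}"]
      G_C_mem[OF f, of x' "{d, x}"]
    by (simp add: rep_iff[OF b] rep_iff[OF b'])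
qed

lemma vecs_iff:
  assumes "indl {} [d, o']"
  shows "v \<in> vecs d o' \<longleftrightarrow> (\<exists>x x'. rep d o' x x' \<and> v = (C {d, x}, C {d, x'}))"
  unfolding vecs_def rep_def using modular_geometry.vect_def[OF local_geometry[OF assms]] by (auto simp: loc_def)

lemma vgen_iff:
  assumes "indl {} [d, o']" "rep d o' x x'"
  shows "modular_geometry.vgen (loc d) o' (C {d, x}, C {d, x'}) F \<longleftrightarrow> x \<notin> C (insert d (insert o' (\<Union>(fst ` F))))"
proof -
  interpret V: modular_geometry "loc d" o' by (rule local_geometry[OF assms(1)])
  have "V.vgen (loc d {x}, loc d {x'}) F \<longleftrightarrow> x \<notin> V.vspan F" using V.vgen_rep assms(2) by (simp add: rep_def)
  thus ?thesis by (simp add: loc_def V.vspan_def)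
qed

text \<open>The tuple \<open>[d, o, x, x', y, y']\<close> codes the difference of two vectors over the base \<open>(d, o)\<close>.\<close>

definition difference :: "'a list \<Rightarrow> ('a set \<times> 'a set) \<times> ('a set \<times> 'a set)" where
  "difference a = ((C {a ! 0, a ! 2}, C {a ! 0, a ! 3}), (C {a ! 0, a ! 4}, C {a ! 0, a ! 5}))"

definition codes :: "'a list \<Rightarrow> bool" where
  "codes a \<longleftrightarrow> length a = 6 \<and> indl {} [a ! 0, a ! 1] \<and> rep (a ! 0) (a ! 1) (a ! 2) (a ! 3) \<and> rep (a ! 0) (a ! 1) (a ! 4) (a ! 5)"

text \<open>The base is part of the tuple and is preserved by the relation, so no parameter remains
  and the relation is invariant under all automorphisms. Tuples that are no codes are related to
  themselves only, which makes it an equivalence on all 6-tuples.\<close>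

definition difference_rel :: "'a list rel" where
  "difference_rel = {(a, b). a \<in> tuples P 6 \<and> b \<in> tuples P 6 \<and> (a = b \<or> codes a \<and> codes b \<and>
     a ! 0 = b ! 0 \<and> a ! 1 = b ! 1 \<and> veq (a ! 0) (a ! 1) (difference a) (difference b))}"

lemma six: "length a = 6 \<Longrightarrow> a = [a ! 0, a ! 1, a ! 2, a ! 3, a ! 4, a ! 5]"
  by (auto simp: list_eq_iff_nth_eq less_Suc_eq numeral_eq_Suc)

lemma codes_iff: "codes [d, o', x, x', y, y'] \<longleftrightarrow> indl {} [d, o'] \<and> rep d o' x x' \<and> rep d o' y y'"
  by (simp add: codes_def)

lemma difference_simp: "difference [d, o', x, x', y, y'] = ((C {d, x}, C {d, x'}), (C {d, y}, C {d, y'}))"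
  by (simp add: difference_def)

lemma rep_P: "indl {} [d, o'] \<Longrightarrow> rep d o' x x' \<Longrightarrow> x \<in> P \<and> x' \<in> P"
  using rep_iff not_loop_P by blast

lemma codes_tuple: 
  assumes "codes a" shows "a \<in> tuples P 6"
proof -
  have "length a = 6" and b: "indl {} [a ! 0, a ! 1]" using assms by (simp_all add: codes_def)
  moreover have "a ! 0 \<in> P" "a ! 1 \<in> P" using b not_loop_P by (auto simp: indl_Cons)
  moreover have "a ! 2 \<in> P" "a ! 3 \<in> P" "a ! 4 \<in> P" "a ! 5 \<in> P" using assms rep_P[OF b] by (auto simp: codes_def)
  ultimately have "set [a ! 0, a ! 1, a ! 2, a ! 3, a ! 4, a ! 5] \<subseteq> P" by simp
  moreover have "set a = set [a ! 0, a ! 1, a ! 2, a ! 3, a ! 4, a ! 5]"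
    by (rule arg_cong[where f = set]) (rule six, fact)
  ultimately have "set a \<subseteq> P" by (simp only:)
  thus ?thesis using \<open>length a = 6\<close> by (simp add: tuples_def)
qed

lemma difference_vecs: "codes a \<Longrightarrow> difference a \<in> vecs (a ! 0) (a ! 1) \<times> vecs (a ! 0) (a ! 1)"
  using vecs_iff by (auto simp: codes_def difference_def)

lemma ex_code:
  assumes "indl {} [d, o']" "p \<in> vecs d o' \<times> vecs d o'"
  shows "\<exists>a. codes a \<and> a ! 0 = d \<and> a ! 1 = o' \<and> difference a = p"
proof -
  obtain x x' y y' where r: "rep d o' x x'" "rep d o' y y'" "p = ((C {d, x}, C {d, x'}), (C {d, y}, C {d, y'}))"
    using assms vecs_iff by (cases p) auto
  thus ?thesis using assms(1) by (intro exI[of _ "[d, o', x, x', y, y']"]) (simp add: codes_iff difference_simp)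
qed

lemma codes_map: "f \<in> Aut \<Longrightarrow> codes a \<Longrightarrow> codes (map f a)"
  using indl_image[of f "[a ! 0, a ! 1]"] rep_map[of f "a ! 0" "a ! 1"] by (simp add: codes_def)

lemma difference_map: "f \<in> Aut \<Longrightarrow> length a = 6 \<Longrightarrow> difference (map f a) = push f (difference a)"
  using G_C[of f] by (simp add: difference_def push_def)

lemma tuples_map: "f \<in> Aut \<Longrightarrow> a \<in> tuples P n \<Longrightarrow> map f a \<in> tuples P n"
  using G_P by (auto simp: tuples_def)

lemma difference_rel_map:
  assumes f: "f \<in> Aut" and ab: "(a, b) \<in> difference_rel"
  shows "(map f a, map f b) \<in> difference_rel"
proof (cases "a = b")
  case True
  thus ?thesis using ab tuples_map[OF f] by (simp add: difference_rel_def)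
next
  case False
  hence c: "codes a" "codes b" "a ! 0 = b ! 0" "a ! 1 = b ! 1" "veq (a ! 0) (a ! 1) (difference a) (difference b)"
    and t: "a \<in> tuples P 6" "b \<in> tuples P 6"
    using ab False unfolding difference_rel_def mem_Collect_eq case_prod_conv by blast+
  have l: "length a = 6" "length b = 6" "indl {} [a ! 0, a ! 1]" using c by (simp_all add: codes_def)
  have "veq (f (a ! 0)) (f (a ! 1)) (difference (map f a)) (difference (map f b))"
    using veq_push[OF f l(3) c(5)] difference_map[OF f] l by simp
  thus ?thesis using codes_map[OF f] c tuples_map[OF f] t l by (simp add: difference_rel_def)
qed

lemma difference_rel_equiv: "equiv (tuples P 6) difference_rel"
proof (rule equivI)
  show "difference_rel \<subseteq> tuples P 6 \<times> tuples P 6" by (auto simp: difference_rel_def)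
  show "refl_on (tuples P 6) difference_rel" by (rule refl_onI) (auto simp: difference_rel_def)
  show "sym difference_rel"
    by (rule symI) (auto simp: difference_rel_def codes_def intro: veq_sym)
  show "trans difference_rel"
    by (rule transI) (auto simp: difference_rel_def codes_def intro: veq_trans)
qed

end

section \<open>Ranks of codes, computed in an abstract universe of imaginaries\<close>

lemma not_splits_self: "\<not> splits Z [c] B {c}"
proof
  assume "splits Z [c] B {c}"
  then obtain b b' where b: "same_tp Z {c} b b'" "\<not> same_tp Z {c} ([c] @ b) ([c] @ b')"
    by (auto simp: splits_def)
  hence "same_gtp Z {c} b b'" by (simp add: same_tp_def)
  then obtain f where f: "f \<in> auts Z" "f c = c" "map f b = b'" by (auto simp: same_gtp_def auts_over_def)
  have "same_tp Z {c} ([c] @ b) ([c] @ b')"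
    unfolding same_tp_def same_gtp_def auts_over_def using f by auto
  thus False using b(2) by blast
qed

lemma U_rank_le_1:
  assumes "\<And>B B' B''. B \<in> models Z \<Longrightarrow> B' \<in> models Z \<Longrightarrow> B'' \<in> models Z \<Longrightarrow> D \<subseteq> B \<Longrightarrow> B \<subseteq> B' \<Longrightarrow> B' \<subseteq> B'' \<Longrightarrow>
    ns_indep Z a B B' \<or> ns_indep Z a B' B''"
  shows "U_rank Z a D \<le> 1"
proof -
  have "n \<le> 1" if B: "B \<in> models Z" "D \<subseteq> B" and n: "U_ge Z n a B" for n B
  proof (rule ccontr)
    assume "\<not> n \<le> 1"
    then obtain m where "n = Suc (Suc m)" by (cases n; cases "n - 1") auto
    thus False using n assms[OF B(1)] B(2) by auto
  qed
  hence "U_model Z a B \<le> 1" if "B \<in> models Z" "D \<subseteq> B" for B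
    unfolding U_model_def using that by (intro Sup_least) (auto simp: one_enat_def)
  thus ?thesis unfolding U_rank_def by (intro Sup_least) auto
qed

lemma U_rank_ge_1:
  assumes "B \<in> models Z" "D \<subseteq> B" "B' \<in> models Z" "B \<subseteq> B'" "\<not> ns_indep Z a B B'"
  shows "1 \<le> U_rank Z a D"
proof -
  have "U_ge Z 1 a B" using assms by auto
  hence "1 \<le> U_model Z a B" unfolding U_model_def one_enat_def by (intro Sup_upper) auto
  also have "\<dots> \<le> U_rank Z a D" unfolding U_rank_def using assms(1,2) by (intro Sup_upper) auto
  finally show ?thesis .
qed

text \<open>Length 1 represents real elements, and length 6 represents codes of differences.\<close>

definition tup :: "'a set \<Rightarrow> 'a list set" where
  "tup A = tuples A 1 \<union> tuples A 6"

lemma tup_set: "a \<in> tup A \<Longrightarrow> set a \<subseteq> A" and tup_mono: "A \<subseteq> B \<Longrightarrow> tup A \<subseteq> tup B"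
  by (auto simp: tup_def tuples_def)

text \<open>An abstract form of the second stage of imaginaries: its elements are values
  \<open>k a\<close> of tuples of points, its automorphisms are those induced from the geometry, and
  \<open>Md\<close> consists of the point sets of the models, which need not be countable.\<close>

locale coded_universe = nontrivial_geometry +
  fixes Z :: "('c, 'd) universe" and k :: "'a list \<Rightarrow> 'c" and Md :: "'a set set"
  assumes Z_elems: "elems Z = k ` tup P"
    and Z_auts: "g \<in> auts Z \<Longrightarrow> \<exists>f \<in> Aut. \<forall>a \<in> tup P. g (k a) = k (map f a)"
    and Z_lift: "f \<in> Aut \<Longrightarrow> \<exists>g \<in> auts Z. \<forall>a \<in> tup P. g (k a) = k (map f a)"
    and Z_models: "models Z = (\<lambda>A. k ` tup A) ` Md"
    and k_eq: "a \<in> tup P \<Longrightarrow> b \<in> tup P \<Longrightarrow> k a = k b \<longleftrightarrow> a = b \<or> (a, b) \<in> difference_rel"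
    and Md_closed: "A \<in> Md \<Longrightarrow> C A \<inter> P = A"
    and Md_model: "A \<in> Md \<Longrightarrow> finite S \<Longrightarrow> S \<subseteq> A \<Longrightarrow> \<exists>K. model K \<and> S \<subseteq> K \<and> K \<inter> P \<subseteq> A"
    and ex_Md: "\<exists>B. countable B \<and> (\<forall>D. countable D \<longrightarrow> B \<subseteq> D \<longrightarrow> model (C D) \<and> C D \<inter> P \<in> Md)"
begin

lemma Md_P: "A \<in> Md \<Longrightarrow> A \<subseteq> P"
  using Md_closed by blast

lemma Md_C: "A \<in> Md \<Longrightarrow> S \<subseteq> A \<Longrightarrow> x \<in> C S \<Longrightarrow> x \<in> P \<Longrightarrow> x \<in> A"
  using Md_closed[of A] C_mono_in[of x S A] by blast

lemma tup_map: "f \<in> Aut \<Longrightarrow> a \<in> tup P \<Longrightarrow> map f a \<in> tup P"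
  using tuples_map by (auto simp: tup_def)

lemma single_tup: "x \<in> A \<Longrightarrow> [x] \<in> tup A"
  by (simp add: tup_def tuples_def)

lemma k_single: "x \<in> P \<Longrightarrow> y \<in> P \<Longrightarrow> k [x] = k [y] \<longleftrightarrow> x = y"
  using k_eq[of "[x]" "[y]"] single_tup[of _ P] by (auto simp: difference_rel_def tuples_def)

lemma codes_tup: "codes a \<Longrightarrow> a \<in> tup P"
  using codes_tuple by (auto simp: tup_def)

lemma codes_tupA: "codes a \<Longrightarrow> set a \<subseteq> A \<Longrightarrow> a \<in> tup A"
  by (auto simp: tup_def tuples_def codes_def)

lemma k_codes: "codes a \<Longrightarrow> codes b \<Longrightarrow> a ! 0 = b ! 0 \<Longrightarrow> a ! 1 = b ! 1 \<Longrightarrow>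
    k a = k b \<longleftrightarrow> veq (a ! 0) (a ! 1) (difference a) (difference b)"
  using k_eq[OF codes_tup codes_tup] codes_tuple veq_refl[OF _ difference_vecs]
  by (auto simp: difference_rel_def codes_def)

lemma k_map: "h \<in> Aut \<Longrightarrow> a \<in> tup P \<Longrightarrow> b \<in> tup P \<Longrightarrow> k a = k b \<Longrightarrow> k (map h a) = k (map h b)"
  using Z_lift[of h] by metis

lemma lists_codes: "\<beta> \<in> lists (k ` tup A) \<Longrightarrow> \<exists>bs. set bs \<subseteq> tup A \<and> \<beta> = map k bs"
proof -
  assume "\<beta> \<in> lists (k ` tup A)"
  hence "\<beta> \<in> map k ` lists (tup A)" by (simp only: lists_image)
  then obtain bs where "\<beta> = map k bs" "bs \<in> lists (tup A)" by (elim imageE)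
  thus ?thesis by auto
qed

lemma same_gtp_codesI:
  assumes f: "f \<in> Aut" and F: "\<And>c. c \<in> F \<Longrightarrow> \<exists>a \<in> tup P. c = k a \<and> k (map f a) = k a" and bs: "set bs \<subseteq> tup P"
  shows "same_gtp Z F (map k bs) (map k (map (map f) bs))"
proof -
  obtain g where g: "g \<in> auts Z" "\<forall>a \<in> tup P. g (k a) = k (map f a)" using Z_lift[OF f] by blast
  have "g c = c" if "c \<in> F" for c using F[OF that] g(2) by metis
  moreover have "map g (map k bs) = map k (map (map f) bs)" using g(2) bs by auto
  ultimately show ?thesis using g(1) by (auto simp: same_gtp_def auts_over_def)
qed

lemma same_gtp_codesD:
  assumes "same_gtp Z F (map k bs) \<gamma>" "set bs \<subseteq> tup P"
  shows "\<exists>f \<in> Aut. (\<forall>a \<in> tup P. k a \<in> F \<longrightarrow> k (map f a) = k a) \<and> \<gamma> = map k (map (map f) bs)"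
proof -
  obtain g where g: "g \<in> auts Z" "\<forall>c \<in> F. g c = c" "map g (map k bs) = \<gamma>"
    using assms(1) by (auto simp: same_gtp_def auts_over_def)
  obtain f where f: "f \<in> Aut" "\<forall>a \<in> tup P. g (k a) = k (map f a)" using Z_auts[OF g(1)] by blast
  have "map g (map k bs) = map k (map (map f) bs)" using f(2) assms(2) by auto
  thus ?thesis using f g by (intro bexI[of _ f]) auto
qed

text \<open>Conjugate codes need not have conjugate representatives inside \<open>A\<close>. The
  representatives of \<open>bs\<close> are first moved by some \<open>f\<close> to representatives
  of the codes of \<open>cs\<close>, possibly outside \<open>A\<close>, and are then moved into a
  countable model below \<open>A\<close>.\<close>

lemma conjugate_representatives:
  assumes A: "A \<in> Md" and S: "finite S" "S \<inter> P \<subseteq> A" and bs: "set bs \<subseteq> tup A" and cs: "set cs \<subseteq> tup A"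
    and same: "same_gtp Z ((\<lambda>x. k [x]) ` (S \<inter> P)) (map k bs) (map k cs)"
  shows "\<exists>f \<in> fixg S. map k cs = map k (map (map f) bs) \<and> set (concat (map (map f) bs)) \<subseteq> A"
proof -
  have AP: "tup A \<subseteq> tup P" using tup_mono Md_P[OF A] by blast
  hence bsP: "set bs \<subseteq> tup P" and csP: "set cs \<subseteq> tup P" using bs cs by blast+
  obtain f where f: "f \<in> Aut" "\<forall>a \<in> tup P. k a \<in> (\<lambda>x. k [x]) ` (S \<inter> P) \<longrightarrow> k (map f a) = k a"
    "map k cs = map k (map (map f) bs)" using same_gtp_codesD[OF same bsP] by (elim bexE conjE)
  have "f x = x" if x: "x \<in> S" for x
  proof (cases "x \<in> P")
    case True
    hence "k [x] \<in> (\<lambda>x. k [x]) ` (S \<inter> P)" using x by (intro imageI) simp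
    from f(2)[rule_format, OF single_tup[OF True] this] show ?thesis using k_single[of "f x" x] G_P[OF f(1)] True by simp
  next
    case False
    thus ?thesis by (rule off_fix[OF f(1)])
  qed
  hence fS: "f \<in> fixg S" using f(1) by (simp add: fixg_def)
  \<comment> \<open>The second motion fixes the entries of \<open>cs\<close>, so it keeps the codes
    that \<open>f\<close> has already reached.\<close>
  define T where "T = S +@ (concat cs)"
  define u where "u = concat (map (map f) bs)"
  have csA: "set (concat cs) \<subseteq> A" using cs tup_set[of _ A] by auto
  hence TA: "T \<inter> P \<subseteq> A" using S(2) by (auto simp: T_def)
  have finT: "finite T" using S(1) by (simp add: T_def)
  obtain K where K: "model K" "T \<inter> P \<subseteq> K" "K \<inter> P \<subseteq> A" using Md_model[OF A _ TA] finT by auto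
  have "T \<subseteq> K" using K(2) off_loop C_mono_in[of _ "{}" K] modelD(2)[OF K(1)] by blast
  then obtain e where e: "eqv T u e" "set e \<subseteq> K" using into_model0[OF K(1) finT] by metis
  obtain h where h: "h \<in> fixg T" "map h u = e" using eqvE[OF e(1)] .
  have "u = map f (concat bs)" by (simp add: u_def map_concat)
  moreover have "set (concat bs) \<subseteq> P" using bsP tup_set[of _ P] by auto
  ultimately have "set u \<subseteq> P" using G_P[OF f(1)] by auto
  hence "set e \<subseteq> P" by (rule eqv_P[OF e(1)])
  hence eA: "set e \<subseteq> A" using e(2) K(3) by blast
  have "S \<subseteq> T" by (auto simp: T_def)
  hence "h \<circ> f \<in> fixg S" using fixg_comp fixg_mono h(1) fS by blast
  moreover have "map k cs = map k (map (map (h \<circ> f)) bs)"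
  proof (rule nth_equalityI)
    show len: "length (map k cs) = length (map k (map (map (h \<circ> f)) bs))" using f(3) by (metis length_map)
    fix i assume i: "i < length (map k cs)"
    hence i': "i < length cs" "i < length bs" using len by simp_all
    have "bs ! i \<in> tup P" "cs ! i \<in> tup P" using i' bsP csP nth_mem by blast+
    moreover have eq: "k (cs ! i) = k (map f (bs ! i))"
      using arg_cong[OF f(3), of "\<lambda>l. l ! i"] i' by simp
    ultimately have "k (map h (map f (bs ! i))) = k (map h (cs ! i))"
      using k_map[OF fixgD(1)[OF h(1)], of "map f (bs ! i)" "cs ! i"] tup_map[OF f(1)] by simp
    moreover have "map h (cs ! i) = cs ! i"
      by (rule fixg_map[OF h(1)]) (use i' nth_mem in \<open>auto simp: T_def\<close>)
    ultimately show "map k cs ! i = map k (map (map (h \<circ> f)) bs) ! i" using i' by simp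
  qed
  moreover have "concat (map (map (h \<circ> f)) bs) = e"
    using h(2) by (simp add: u_def map_concat comp_def)
  ultimately show ?thesis using eA by (intro bexI[of _ "h \<circ> f"]) auto
qed

text \<open>The only part of the code outside \<open>A\<close> is the pair \<open>p, p'\<close>, of
  rank 1 over \<open>A'\<close>. A base of this pair in a countable model, together with the other
  entries, gives a finite set over which the code does not split: conjugate parameters from
  \<open>A'\<close> are conjugate by a map fixing all entries of the code.\<close>

lemma free_code_ns_indep:
  assumes A: "A \<in> Md" "A' \<in> Md" "A \<subseteq> A'" and c: "codes [d, o', p, p', q, q']"
    and in_A: "{d, o', q, q'} \<subseteq> A" and p: "p \<notin> A'"
  shows "ns_indep Z [k [d, o', p, p', q, q']] (k ` tup A) (k ` tup A')"
proof -
  define c where "c = [d, o', p, p', q, q']"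
  have base: "indl {} [d, o']" and rep: "rep d o' p p'" using assms(4) by (simp_all add: codes_iff)
  have pp: "p \<in> P" "p' \<in> P" using rep_P[OF base rep] by simp_all
  have p': "p' \<in> C {d, o', p}" using rep rep_iff[OF base] by simp
  obtain K where K: "model K" "{d, o', q, q'} \<subseteq> K" "K \<inter> P \<subseteq> A"
    using Md_model[OF A(1) _ in_A] by auto
  have dm1: "dm T [p, p'] = 1" if T: "T \<inter> P \<subseteq> A'" "{d, o'} \<subseteq> C T" for T
  proof -
    have "C T = C (T \<inter> P)" using C_P by simp
    hence "p \<notin> C T" using p Md_C[OF A(2) T(1)] pp(1) by blast
    moreover have "{d, o', p} \<subseteq> C (insert p T)"
      using T(2) mono[of T "insert p T"] in_C[of p "insert p T"] by blast
    hence "p' \<in> C (insert p T)" using p' C_sub by blast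
    ultimately show ?thesis by simp
  qed
  obtain A0 where A0: "finite A0" "A0 \<subseteq> K" "dm A0 [p, p'] = dm K [p, p']" "base A0 [p, p']"
    using ex_base[OF K(1), of "[p, p']"] pp by auto
  have "dm K [p, p'] = 1" by (rule dm1) (use K A(3) in_C in auto)
  hence dA0: "dm A0 [p, p'] = 1" using A0(3) by simp
  define S where "S = A0 \<union> {d, o', q, q'}"
  define F0 where "F0 = (\<lambda>x. k [x]) ` (S \<inter> P)"
  have S: "finite S" "S \<inter> P \<subseteq> A" using A0 K by (auto simp: S_def)
  have "\<not> splits Z [k c] (k ` tup A') F0"
  proof
    assume "splits Z [k c] (k ` tup A') F0"
    then obtain \<beta> \<gamma> where bg: "\<beta> \<in> lists (k ` tup A')" "\<gamma> \<in> lists (k ` tup A')" "same_tp Z F0 \<beta> \<gamma>"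
      "\<not> same_tp Z F0 ([k c] @ \<beta>) ([k c] @ \<gamma>)" by (auto simp: splits_def)
    obtain bs cs where bs: "set bs \<subseteq> tup A'" "\<beta> = map k bs" and cs: "set cs \<subseteq> tup A'" "\<gamma> = map k cs"
      using lists_codes bg(1,2) by meson
    have "finite F0" using S(1) by (simp add: F0_def)
    hence "same_gtp Z F0 \<beta> \<gamma>" using bg(3) by (simp add: same_tp_def)
    hence same: "same_gtp Z ((\<lambda>x. k [x]) ` (S \<inter> P)) (map k bs) (map k cs)" by (simp add: bs cs F0_def)
    have SA': "S \<inter> P \<subseteq> A'" using S(2) A(3) by blast
    obtain f where f: "f \<in> fixg S" "map k cs = map k (map (map f) bs)" "set (concat (map (map f) bs)) \<subseteq> A'"
      using conjugate_representatives[OF A(2) S(1) SA' bs(1) cs(1) same] by blast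
    \<comment> \<open>Appending the other entries to the parameters forces the conjugation given by
      \<open>base\<close> to fix them too, and with \<open>p\<close>, \<open>p'\<close> also the
      code.\<close>
    define b where "b = concat bs @ [d, o', q, q']"
    have bA: "set b \<subseteq> A'" using bs(1) tup_set[of _ A'] in_A A(3) by (auto simp: b_def)
    have fb: "map f b = map f (concat bs) @ [d, o', q, q']" using fixgD(2)[OF f(1)] by (simp add: b_def S_def)
    hence fbA: "set (map f b) \<subseteq> A'" using f(3) in_A A(3) by (auto simp: map_concat)
    have "eqv A0 b (map f b)" by (rule eqvI[OF subsetD[OF fixg_mono f(1)] refl]) (auto simp: S_def)
    moreover have "dm (A0 +@ b +@ (map f b)) [p, p'] = dm A0 [p, p']"
      unfolding dA0
    proof (rule dm1)
      show "(A0 +@ b +@ (map f b)) \<inter> P \<subseteq> A'" using A0(2) K(3) A(3) bA fbA by blast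
      show "{d, o'} \<subseteq> C (A0 +@ b +@ (map f b))" by (rule subset_trans[OF _ ext]) (simp add: b_def)
    qed
    ultimately have "eqv A0 ([p, p'] @ b) ([p, p'] @ map f b)" using A0(4) unfolding base_def by blast
    then obtain g where g: "g \<in> fixg A0" "map g ([p, p'] @ b) = [p, p'] @ map f b" by (rule eqvE)
    hence gp: "g p = p" "g p' = p'" "map g b = map f b" by simp_all
    have gd: "g d = d" "g o' = o'" "g q = q" "g q' = q'" and gbs: "map g (concat bs) = map f (concat bs)"
      using gp(3) fixgD(2)[OF f(1)] by (simp_all add: b_def S_def)
    have gm: "map (map g) bs = map (map f) bs" using gbs by auto
    have gG: "g \<in> Aut" using fixgD(1)[OF g(1)] .
    have bsP: "set bs \<subseteq> tup P" using bs(1) tup_mono[OF Md_P[OF A(2)]] by blast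
    have "same_gtp Z F (map k (c # bs)) (map k (map (map g) (c # bs)))" if F: "F \<subseteq> F0" for F
    proof (rule same_gtp_codesI[OF gG])
      show "set (c # bs) \<subseteq> tup P" using bsP codes_tup[OF assms(4)] by (simp add: c_def)
      fix z assume "z \<in> F"
      then obtain x where x: "x \<in> S" "x \<in> P" "z = k [x]" using F by (auto simp: F0_def)
      have "g x = x" using x(1) fixgD(2)[OF g(1)] gd by (auto simp: S_def)
      thus "\<exists>a \<in> tup P. z = k a \<and> k (map g a) = k a"
        using x single_tup by (intro bexI[of _ "[x]"]) simp_all
    qed
    moreover have "map g c = c" using gp gd by (simp add: c_def)
    ultimately have "same_tp Z F0 ([k c] @ \<beta>) ([k c] @ \<gamma>)"
      using gm f(2) by (simp add: same_tp_def bs cs)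
    thus False using bg(4) by blast
  qed
  moreover have "k ` tup A \<union> k ` tup A' = k ` tup A'" using tup_mono[OF A(3)] by blast
  moreover have "F0 \<subseteq> k ` tup A" unfolding F0_def by (intro image_subsetI imageI single_tup) (rule subsetD[OF S(2)])
  moreover have "finite F0" using S(1) by (simp add: F0_def)
  ultimately show ?thesis unfolding ns_indep_def c_def[symmetric] by (intro exI[of _ F0]) simp
qed

text \<open>A model containing the base contains a vector \<open>(q, q')\<close> generic over the
  vectors of the code, and by \<open>deq_rep\<close> the difference can be rewritten with this
  vector as subtrahend. Only \<open>p\<close> then matters, as \<open>p'\<close> is algebraic over
  it and the base.\<close>

lemma model_representative:
  assumes A: "A \<in> Md" and c: "codes a" and in_A: "a ! 0 \<in> A" "a ! 1 \<in> A"
  shows "\<exists>p p' q q'. codes [a ! 0, a ! 1, p, p', q, q'] \<and> {q, q'} \<subseteq> A \<and> k [a ! 0, a ! 1, p, p', q, q'] = k a"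
proof -
  define d where "d = a ! 0"
  define o' where "o' = a ! 1"
  have base: "indl {} [d, o']" and reps: "rep d o' (a ! 2) (a ! 3)" "rep d o' (a ! 4) (a ! 5)"
    using c by (simp_all add: codes_def d_def o'_def)
  obtain K where K: "model K" "{d, o'} \<subseteq> K" "K \<inter> P \<subseteq> A"
    using Md_model[OF A, of "{d, o'}"] in_A by (auto simp: d_def o'_def)
  have "\<not> K \<subseteq> C {d, o', a ! 2, a ! 4}" using K(1) by (simp add: model_def)
  then obtain q where q: "q \<in> K" "q \<notin> C {d, o', a ! 2, a ! 4}" by blast
  have "q \<in> P" using not_loop_P q(2) by blast
  hence qA: "q \<in> A" using q(1) K(3) by blast
  have "q \<notin> C {d, o'}" using q(2) C_mono_in[of q "{d, o'}"] by blast
  moreover have "d \<notin> C {}" "o' \<notin> C {d}" using base by (simp_all add: indl_Cons)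
  ultimately obtain q' where q': "q' \<in> C {d, o', q}" "q' \<notin> C {d, o'}" "q' \<notin> C {d, q}" using third_over by blast
  have "{d, o', q} \<subseteq> A" using in_A qA by (simp add: d_def o'_def)
  hence q'A: "q' \<in> A" using Md_C[OF A] q' not_loop_P by blast
  have rq: "rep d o' q q'" using \<open>q \<notin> C {d, o'}\<close> q' by (simp add: rep_iff[OF base])
  interpret V: generic_addition "vecs d o'" "modular_geometry.vadd (loc d) o'" "modular_geometry.vgen (loc d) o'"
    by (rule veq_addition[OF base])
  define t where "t = (C {d, q}, C {d, q'})"
  have diff: "difference a = ((C {d, a ! 2}, C {d, a ! 3}), (C {d, a ! 4}, C {d, a ! 5}))"
    by (simp add: difference_def d_def)
  have "modular_geometry.vgen (loc d) o' t {fst (difference a), snd (difference a)}"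
    unfolding t_def vgen_iff[OF base rq]
  proof
    assume "q \<in> C (insert d (insert o' (\<Union>(fst ` {fst (difference a), snd (difference a)}))))"
    moreover have "insert d (insert o' (\<Union>(fst ` {fst (difference a), snd (difference a)}))) \<subseteq> C {d, o', a ! 2, a ! 4}"
    proof -
      have "C {d, a ! 2} \<subseteq> C {d, o', a ! 2, a ! 4}" "C {d, a ! 4} \<subseteq> C {d, o', a ! 2, a ! 4}" by (rule mono; blast)+
      thus ?thesis using in_C[of _ "{d, o', a ! 2, a ! 4}"] by (simp add: diff)
    qed
    ultimately show False using q(2) C_sub by blast
  qed
  moreover have "difference a \<in> vecs d o' \<times> vecs d o'" using difference_vecs[OF c] by (simp add: d_def o'_def)
  ultimately obtain y where y: "veq d o' (y, t) (difference a)"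
    using V.deq_rep[of "difference a" t] by (auto simp: veq_def)
  hence "y \<in> vecs d o'" by (auto simp: veq_def V.deq_def)
  then obtain p p' where p: "rep d o' p p'" "y = (C {d, p}, C {d, p'})" using vecs_iff[OF base] by blast
  have code: "codes [d, o', p, p', q, q']" using base p rq by (simp add: codes_iff)
  have "veq d o' (difference [d, o', p, p', q, q']) (difference a)" using y p by (simp add: difference_simp t_def)
  hence "k [d, o', p, p', q, q'] = k a" using k_codes[OF code c] by (simp add: d_def o'_def)
  thus ?thesis using code qA q'A unfolding d_def o'_def by blast
qed

text \<open>In a chain of three models the second either misses \<open>p\<close>, and then the first
  step is free, or contains \<open>p\<close> and hence the code itself, and a type with its
  realization among the parameters does not split over it.\<close>

lemma code_U_rank_le_1:
  assumes c: "codes a" shows "U_rank Z [k a] {k [a ! 0], k [a ! 1]} \<le> 1"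
proof (rule U_rank_le_1)
  fix B B' B'' assume B: "B \<in> models Z" "B' \<in> models Z" "B'' \<in> models Z" "{k [a ! 0], k [a ! 1]} \<subseteq> B" "B \<subseteq> B'" "B' \<subseteq> B''"
  obtain A A' where A: "A \<in> Md" "B = k ` tup A" "A' \<in> Md" "B' = k ` tup A'"
    using B(1,2) unfolding Z_models by (elim imageE)
  have single: "x \<in> D" if "k [x] \<in> k ` tup D" "x \<in> P" "D \<in> Md" for x D
  proof -
    obtain b where b: "b \<in> tup D" "k [x] = k b" using \<open>k [x] \<in> k ` tup D\<close> by blast
    have "b \<in> tup P" using b(1) tup_mono[OF Md_P[OF that(3)]] by blast
    hence "b = [x]" using k_eq[OF single_tup[OF that(2)]] b(2) by (auto simp: difference_rel_def tuples_def)
    thus ?thesis using b(1) by (auto simp: tup_def tuples_def)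
  qed
  have aP: "a ! 0 \<in> P" "a ! 1 \<in> P" using codes_tuple[OF c] nth_mem[of _ a] by (auto simp: tuples_def)
  have in_A: "a ! 0 \<in> A" "a ! 1 \<in> A" using single[OF _ aP(1) A(1)] single[OF _ aP(2) A(1)] B(4) A(2) by auto
  have AA': "A \<subseteq> A'"
  proof
    fix x assume x: "x \<in> A"
    hence "k [x] \<in> B" unfolding A(2) by (intro imageI single_tup)
    hence "k [x] \<in> k ` tup A'" using B(5) A(4) by blast
    thus "x \<in> A'" by (rule single[OF _ subsetD[OF Md_P[OF A(1)] x] A(3)])
  qed
  obtain p p' q q' where r: "codes [a ! 0, a ! 1, p, p', q, q']" "{q, q'} \<subseteq> A" "k [a ! 0, a ! 1, p, p', q, q'] = k a"
    using model_representative[OF A(1) c in_A] by blast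
  show "ns_indep Z [k a] B B' \<or> ns_indep Z [k a] B' B''"
  proof (cases "p \<in> A'")
    case False
    have "{a ! 0, a ! 1, q, q'} \<subseteq> A" using r(2) in_A by simp
    from free_code_ns_indep[OF A(1,3) AA' r(1) this False] show ?thesis unfolding r(3) A(2,4) by (rule disjI1)
  next
    case True
    have b: "indl {} [a ! 0, a ! 1]" "rep (a ! 0) (a ! 1) p p'" using r(1) by (simp_all add: codes_iff)
    have "{a ! 0, a ! 1, p} \<subseteq> A'" using True in_A AA' by blast
    moreover have "p' \<in> C {a ! 0, a ! 1, p}" using b rep_iff by blast
    ultimately have "p' \<in> A'" using Md_C[OF A(3)] rep_P[OF b] by blast
    hence "set [a ! 0, a ! 1, p, p', q, q'] \<subseteq> A'" using True in_A AA' r(2) by auto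
    hence "k a \<in> B'" using codes_tupA[OF r(1)] r(3) A(4) by (metis imageI)
    thus ?thesis using not_splits_self[of Z "k a"] unfolding ns_indep_def
      by (intro disjI2 exI[of _ "{k a}"]) auto
  qed
qed

text \<open>The code of a difference with \<open>p\<close> generic over a model \<open>A\<close>
  lies in a larger model. Over every finite part of \<open>A\<close> it has a different conjugate,
  obtained by moving \<open>p\<close> into \<open>A\<close>. The code and this conjugate witness
  splitting, since the code equals only one of them.\<close>

lemma code_U_rank_ge_1:
  assumes base: "indl {} [d, o']"
  shows "\<exists>a. codes a \<and> a ! 0 = d \<and> a ! 1 = o' \<and> 1 \<le> U_rank Z [k a] {k [d], k [o']}"
proof -
  have do_P: "d \<in> P" "o' \<in> P" using base not_loop_P by (auto simp: indl_Cons)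
  obtain B where B: "countable B" "\<And>D. countable D \<Longrightarrow> B \<subseteq> D \<Longrightarrow> model (C D) \<and> C D \<inter> P \<in> Md"
    using ex_Md by blast
  define K where "K = C (B \<union> {d, o'})"
  have K: "model K" "K \<inter> P \<in> Md" unfolding K_def using B(2)[OF _ Un_upper1, of "{d, o'}"] B(1) by simp_all
  have do_K: "d \<in> K" "o' \<in> K" unfolding K_def by (intro in_C; simp)+
  define A where "A = K \<inter> P"
  have A: "A \<in> Md" using K(2) by (simp add: A_def)
  have third: "\<exists>q'. rep d o' q q'" if "q \<notin> C {d, o'}" for q
  proof -
    have "d \<notin> C {}" "o' \<notin> C {d}" using base by (simp_all add: indl_Cons)
    then obtain q' where "q' \<in> C {d, o', q}" "q' \<notin> C {d, o'}" "q' \<notin> C {d, q}" using third_over \<open>q \<notin> C {d, o'}\<close> by blast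
    thus ?thesis using \<open>q \<notin> C {d, o'}\<close> by (auto simp: rep_iff[OF base])
  qed
  have "\<not> K \<subseteq> C {d, o'}" using K(1) by (simp add: model_def)
  then obtain q where q: "q \<in> K" "q \<notin> C {d, o'}" by blast
  obtain q' where q': "rep d o' q q'" using third q(2) by blast
  obtain p where p: "p \<notin> C K" using unctbl_gen[OF modelD(1)[OF K(1)], of "{}"] by auto
  have "{d, o'} \<subseteq> K" using do_K by simp
  hence "p \<notin> C {d, o'}" using p C_mono_in[of p "{d, o'}" K] by blast
  then obtain p' where p': "rep d o' p p'" using third by blast
  have pp: "p \<in> P" "p' \<in> P" "q \<in> P" "q' \<in> P" using rep_P[OF base] p' q' by blast+
  have "q' \<in> C {d, o', q}" using q' rep_iff[OF base] by blast
  moreover have "{d, o', q} \<subseteq> K" using do_K q(1) by simp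
  ultimately have q'K: "q' \<in> K" using C_mono_in[of q' "{d, o', q}" K] modelD(2)[OF K(1)] by blast
  define a where "a = [d, o', p, p', q, q']"
  have a: "codes a" unfolding a_def using base p' q' by (simp add: codes_iff)
  define A' where "A' = C (B \<union> {d, o', p, p'}) \<inter> P"
  have A': "A' \<in> Md" unfolding A'_def using B(2)[OF _ Un_upper1, of "{d, o', p, p'}"] B(1) by simp
  have KK': "K \<subseteq> C (B \<union> {d, o', p, p'})" unfolding K_def by (rule mono) auto
  moreover have "{p, p'} \<subseteq> C (B \<union> {d, o', p, p'})" by (rule subset_trans[OF _ ext]) simp
  ultimately have KA': "K \<inter> P \<subseteq> A'" "p \<in> A'" "p' \<in> A'" using pp by (auto simp: A'_def)
  have AA': "A \<subseteq> A'" using KA'(1) by (simp add: A_def)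
  have "set a \<subseteq> A'" using do_P do_K pp q(1) q'K KA' by (auto simp: a_def)
  hence aA': "a \<in> tup A'" using codes_tupA[OF a] by blast
  have "splits Z [k a] (k ` tup A \<union> k ` tup A') F" if F: "F \<subseteq> k ` tup A" "finite F" for F
  proof -
    obtain G where G: "G \<subseteq> tup A" "finite G" "F = k ` G" using finite_subset_image[OF F(2,1)] by blast
    define S where "S = \<Union>(set ` G) \<union> {d, o', q, q'}"
    have S: "finite S" "S \<subseteq> K" using G(1,2) tup_set[of _ A] do_K q(1) q'K by (auto simp: S_def A_def)
    have "\<not> K \<subseteq> C S" using K(1) S(1) by (simp add: model_def)
    then obtain p2 where p2: "p2 \<in> K" "p2 \<notin> C S" by blast
    have "p \<notin> C S" using p C_mono_in[OF _ S(2)] by blast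
    \<comment> \<open>The point \<open>p2\<close> lies in the model but is generic over the
      representatives of \<open>F\<close> and the remaining entries, so \<open>p\<close> can be
      moved to it with all of these fixed.\<close>
    hence "indl (C S) [p]" "indl (C S) [p2]" using p2 by (simp_all add: indl_Cons)
    then obtain f where f: "f \<in> fixg (C S)" "f p = p2"
      using generic_list_fix[of "C S" "[p]" "[p2]"] ctbl_gen_C0[of S] S(1) by (auto simp: countable_finite)
    have fS: "f x = x" if "x \<in> S" for x by (rule fixgD(2)[OF f(1) in_C[OF that]])
    have fG: "f \<in> Aut" using fixgD(1)[OF f(1)] .
    have fx: "f d = d" "f o' = o'" "f q = q" "f q' = q'" using fS by (simp_all add: S_def)
    define a' where "a' = [d, o', p2, f p', q, q']"
    have fa: "map f a = a'" using fx f(2) by (simp add: a_def a'_def)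
    have a': "codes a'" using codes_map[OF fG a] fa by simp
    have r2: "rep d o' p2 (f p')" using a' by (simp add: a'_def codes_iff)
    have "f p' \<in> C {d, o', p2}" using r2 rep_iff[OF base] by blast
    moreover have "{d, o', p2} \<subseteq> K" using do_K p2(1) by simp
    ultimately have "f p' \<in> K" using C_mono_in[of "f p'" "{d, o', p2}" K] modelD(2)[OF K(1)] by blast
    moreover have "p2 \<in> P" "f p' \<in> P" using rep_P[OF base r2] by simp_all
    ultimately have "set a' \<subseteq> A" using do_P do_K pp q(1) q'K p2(1) by (auto simp: a'_def A_def)
    hence "a' \<in> tup A'" using codes_tupA[OF a'] AA' by blast
    hence in_l: "[k a] \<in> lists (k ` tup A \<union> k ` tup A')" "[k a'] \<in> lists (k ` tup A \<union> k ` tup A')"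
      using aA' by auto
    have "same_gtp Z F1 (map k [a]) (map k (map (map f) [a]))" if F1: "F1 \<subseteq> F" for F1
    proof (rule same_gtp_codesI[OF fG])
      show "set [a] \<subseteq> tup P" using codes_tup[OF a] by simp
      fix z assume "z \<in> F1"
      then obtain b where b: "b \<in> G" "z = k b" using F1 G(3) by blast
      have "map f b = b" by (rule map_idI, rule fS) (use b(1) in \<open>auto simp: S_def\<close>)
      moreover have "b \<in> tup P" using b(1) G(1) tup_mono[OF Md_P[OF A]] by blast
      ultimately show "\<exists>b \<in> tup P. z = k b \<and> k (map f b) = k b" using b(2) by auto
    qed
    hence same: "same_tp Z F [k a] [k a']" using fa by (simp add: same_tp_def)
    have "\<not> same_tp Z F ([k a] @ [k a]) ([k a] @ [k a'])"
    proof
      assume "same_tp Z F ([k a] @ [k a]) ([k a] @ [k a'])"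
      hence "same_gtp Z {} [k a, k a] [k a, k a']" by (simp add: same_tp_def)
      hence "k a = k a'" by (auto simp: same_gtp_def)
      \<comment> \<open>The two codes have the same subtrahend, so their equality would give equal
        minuends and put \<open>p\<close> into the closure of \<open>d\<close> and
        \<open>p2\<close>.\<close>
      hence "veq d o' (difference a) (difference a')" using k_codes[OF a a'] by (simp add: a_def a'_def)
      hence "C {d, p} = C {d, p2}"
        using veq_inj[OF base] by (simp add: a_def a'_def difference_simp) blast
      hence "p \<in> C {d, p2}" using in_C[of p "{d, p}"] by simp
      moreover have "{d, p2} \<subseteq> K" using do_K p2(1) by simp
      ultimately show False using p C_mono_in by blast
    qed
    thus ?thesis using in_l same unfolding splits_def by blast
  qed
  hence "\<not> ns_indep Z [k a] (k ` tup A) (k ` tup A')" unfolding ns_indep_def by blast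
  moreover have "{k [d], k [o']} \<subseteq> k ` tup A" using do_P do_K single_tup[of _ A] by (auto simp: A_def)
  ultimately have "1 \<le> U_rank Z [k a] {k [d], k [o']}"
    using U_rank_ge_1[of "k ` tup A" Z _ "k ` tup A'"] A A' Z_models tup_mono[OF AA'] by blast
  thus ?thesis using a by (intro exI[of _ a]) (simp add: a_def)
qed

end

section \<open>The group of codes\<close>

context coded_universe
begin

lemma gdefinable_codes:
  assumes do_P: "d \<in> P" "o' \<in> P" and S: "\<And>as. as \<in> S \<Longrightarrow> set as \<subseteq> tup P"
    and inv: "\<And>f as. f \<in> Aut \<Longrightarrow> f d = d \<Longrightarrow> f o' = o' \<Longrightarrow> as \<in> S \<Longrightarrow> map (map f) as \<in> S"
  shows "gdefinable Z {k [d], k [o']} (map k ` S)"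
  unfolding gdefinable_def
proof
  fix g assume g: "g \<in> auts_over Z {k [d], k [o']}"
  obtain f where f: "f \<in> Aut" "\<forall>a \<in> tup P. g (k a) = k (map f a)" using Z_auts[of g] g by (auto simp: auts_over_def)
  have fix1: "f d = d" "f o' = o'"
    using g f(2) single_tup[of d P] single_tup[of o' P] do_P k_single G_P[OF f(1)] by (auto simp: auts_over_def)
  have m: "map g (map k as) = map k (map (map f) as)" if "as \<in> S" for as using S[OF that] f(2) by auto
  show "map g ` map k ` S = map k ` S"
  proof
    show "map g ` map k ` S \<subseteq> map k ` S"
      unfolding image_image using m inv[OF f(1) fix1] by (intro image_subsetI) (simp only: imageI)
    show "map k ` S \<subseteq> map g ` map k ` S"
    proof clarify
      fix as assume as: "as \<in> S"
      have "iv f d = d" "iv f o' = o'" using inv_app(1)[OF f(1), of d] inv_app(1)[OF f(1), of o'] fix1 by simp_all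
      hence as': "map (map (iv f)) as \<in> S" using inv[OF G_inv[OF f(1)]] as by blast
      have "map (map f) (map (map (iv f)) as) = as" using f(1) by (simp add: comp_def)
      hence "map k as = map g (map k (map (map (iv f)) as))" using m[OF as'] by simp
      thus "map k as \<in> map g ` map k ` S" using as' by blast
    qed
  qed
qed

lemma coded_group: "\<exists>D G. gdefinable_group Z D G \<and> one_dimensional Z D G"
proof -
  obtain d where d: "d \<notin> C {}" using unctbl[of "{}"] by auto
  obtain o' where o': "o' \<notin> C {d}" using unctbl[of "{d}"] by auto
  have base: "indl {} [d, o']" using d o' by (simp add: indl_Cons)
  have do_P: "d \<in> P" "o' \<in> P" using not_loop_P d o' by blast+
  interpret V: generic_addition "vecs d o'" "modular_geometry.vadd (loc d) o'" "modular_geometry.vgen (loc d) o'"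
    by (rule veq_addition[OF base])
  define W where "W = vecs d o' \<times> vecs d o'"
  define S where "S = {a. codes a \<and> a ! 0 = d \<and> a ! 1 = o'}"
  have S_W: "difference a \<in> W" if "a \<in> S" for a using difference_vecs[of a] that by (simp add: S_def W_def)
  have S_eq: "k a = k b \<longleftrightarrow> veq d o' (difference a) (difference b)" if "a \<in> S" "b \<in> S" for a b
    using k_codes[of a b] that by (simp add: S_def)
  \<comment> \<open>Each difference gets a chosen 6-tuple over the fixed base. The imaginary
    \<open>k (code p)\<close> is independent of the choice and agrees for equal differences.\<close>
  define code where "code p = (SOME a. a \<in> S \<and> difference a = p)" for p
  have code: "code p \<in> S" "difference (code p) = p" if "p \<in> W" for p
  proof -
    have "\<exists>a. a \<in> S \<and> difference a = p" using ex_code[OF base] that by (auto simp: S_def W_def)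
    from someI_ex[OF this] show "code p \<in> S" "difference (code p) = p" by (simp_all add: code_def)
  qed
  have k: "\<forall>p \<in> W. \<forall>q \<in> W. (k \<circ> code) p = (k \<circ> code) q \<longleftrightarrow> V.deq p q"
    using S_eq[OF code(1) code(1)] code(2) by (simp add: veq_def)
  have k_code: "k (code (difference a)) = k a" if "a \<in> S" for a
    using S_eq[OF code(1)[OF S_W[OF that]] that] code(2)[OF S_W[OF that]] veq_refl[OF base] S_W[OF that]
    by (simp add: W_def)
  define G where "G = V.dgroup (k \<circ> code)"
  define D where "D = {k [d], k [o']}"
  define T where "T = {[a, b, c] | a b c. a \<in> S \<and> b \<in> S \<and> c \<in> S \<and> vsum d o' (difference a) (difference b) (difference c)}"
  have group: "group G" unfolding G_def by (rule V.dgroup_group) (use k in \<open>simp add: W_def\<close>)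
  have "k ` code ` W = k ` S"
  proof
    show "k ` S \<subseteq> k ` code ` W" using k_code S_W by (metis image_eqI image_subsetI)
  qed (use code(1) in blast)
  hence car: "carrier G = k ` S" by (simp add: G_def V.dgroup_def W_def image_comp)
  have "{[x, y, x \<otimes>\<^bsub>G\<^esub> y] | x y. x \<in> carrier G \<and> y \<in> carrier G} =
    {[k (code p), k (code q), k (code r)] | p q r. vsum d o' p q r}"
    using V.dgroup_graph[of "k \<circ> code"] k by (simp add: G_def W_def vsum_def)
  also have "\<dots> = map k ` T"
  proof
    show "{[k (code p), k (code q), k (code r)] | p q r. vsum d o' p q r} \<subseteq> map k ` T"
    proof clarify
      fix p q r assume s: "vsum d o' p q r"
      hence "p \<in> W" "q \<in> W" "r \<in> W" by (simp_all add: vsum_def V.dsum_def W_def)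
      hence "[code p, code q, code r] \<in> T" unfolding T_def using code s by simp
      thus "[k (code p), k (code q), k (code r)] \<in> map k ` T" by (rule image_eqI[rotated]) simp
    qed
    show "map k ` T \<subseteq> {[k (code p), k (code q), k (code r)] | p q r. vsum d o' p q r}"
    proof clarify
      fix l assume "l \<in> T"
      then obtain a b c where l: "l = [a, b, c]" "a \<in> S" "b \<in> S" "c \<in> S"
        "vsum d o' (difference a) (difference b) (difference c)" by (auto simp: T_def)
      thus "\<exists>p q r. map k l = [k (code p), k (code q), k (code r)] \<and> vsum d o' p q r"
        using k_code by (intro exI[of _ "difference a"] exI[of _ "difference b"] exI[of _ "difference c"]) simp
    qed
  qed
  finally have graph: "{[x, y, x \<otimes>\<^bsub>G\<^esub> y] | x y. x \<in> carrier G \<and> y \<in> carrier G} = map k ` T" .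
  have S_map: "map f a \<in> S" "difference (map f a) = push f (difference a)"
    if "f \<in> Aut" "f d = d" "f o' = o'" "a \<in> S" for f a
  proof -
    have l: "length a = 6" using that by (simp add: S_def codes_def)
    thus "map f a \<in> S" using that codes_map[of f a] by (simp add: S_def)
    show "difference (map f a) = push f (difference a)" by (rule difference_map[OF that(1) l])
  qed
  have S_tup: "S \<subseteq> tup P" using codes_tup by (auto simp: S_def)
  have "gdefinable Z {k [d], k [o']} (map k ` (\<lambda>a. [a]) ` S)"
    by (rule gdefinable_codes[OF do_P]) (use S_tup S_map in auto)
  moreover have "map k ` (\<lambda>a. [a]) ` S = {[x] | x. x \<in> carrier G}" unfolding car image_image by auto
  ultimately have def_car: "gdefinable Z D {[x] | x. x \<in> carrier G}" by (simp add: D_def)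
  have "gdefinable Z {k [d], k [o']} (map k ` T)"
  proof (rule gdefinable_codes[OF do_P])
    show "set as \<subseteq> tup P" if "as \<in> T" for as using that S_tup by (auto simp: T_def)
    fix f as assume f: "f \<in> Aut" "f d = d" "f o' = o'" and "as \<in> T"
    then obtain a b c where l: "as = [a, b, c]" "a \<in> S" "b \<in> S" "c \<in> S"
      "vsum d o' (difference a) (difference b) (difference c)" by (auto simp: T_def)
    have "vsum d o' (push f (difference a)) (push f (difference b)) (push f (difference c))"
      using vsum_push[OF f(1) base l(5)] f(2,3) by simp
    thus "map (map f) as \<in> T" unfolding T_def using S_map[OF f] l by simp
  qed
  hence def_graph: "gdefinable Z D {[x, y, x \<otimes>\<^bsub>G\<^esub> y] | x y. x \<in> carrier G \<and> y \<in> carrier G}"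
    unfolding graph D_def .
  have elems: "carrier G \<subseteq> elems Z" "D \<subseteq> elems Z"
    using S_tup single_tup[OF do_P(1)] single_tup[OF do_P(2)] by (auto simp: Z_elems D_def car)
  have le: "U_rank Z [x] D \<le> 1" if "x \<in> carrier G" for x
    using code_U_rank_le_1 that by (auto simp: car D_def S_def)
  obtain a where a: "a \<in> S" "1 \<le> U_rank Z [k a] D"
    using code_U_rank_ge_1[OF base] by (auto simp: D_def S_def)
  have ka: "k a \<in> carrier G" using a car by blast
  have "gdefinable_group Z D G" unfolding gdefinable_group_def
    using group elems def_car def_graph by (simp add: D_def)
  moreover have "one_dimensional Z D G"
    unfolding one_dimensional_def
  proof
    have "U_rank Z [k a] D = 1" using a(2) le[OF ka] by (rule antisym[rotated])
    thus "\<exists>x. generic_in Z D {[x] | x. x \<in> carrier G} [x]"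
      unfolding generic_in_def using ka le by (intro exI[of _ "k a"]) auto
    show "\<forall>x. generic_in Z D {[x] | x. x \<in> carrier G} [x] \<longrightarrow> U_rank Z [x] D = 1"
    proof (intro allI impI)
      fix x assume x: "generic_in Z D {[x] | x. x \<in> carrier G} [x]"
      hence "x \<in> carrier G" "U_rank Z [k a] D \<le> U_rank Z [x] D" using ka by (auto simp: generic_in_def)
      thus "U_rank Z [x] D = 1" using le a(2) by (meson antisym order_trans)
    qed
  qed
  ultimately show ?thesis by blast
qed

end

subsection \<open>Imaginaries\<close>

lemma tuples_1: "tuples A (Suc 0) = (\<lambda>x. [x]) ` A"
  by (auto simp: tuples_def length_Suc_conv)

lemma equiv_Field: "equiv A E \<Longrightarrow> Field E = A"
  by (auto simp: equiv_def refl_on_def Field_def)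

lemma eq_rel_equiv: "equiv (tuples (elems X) 1) (eq_rel X)"
  unfolding One_nat_def tuples_1 by (auto simp: equiv_def refl_on_def sym_def trans_def eq_rel_def)

lemma eq_rel_map:
  assumes "bij_betw f (elems X) (elems X)" "a \<in> tuples (elems X) 1" "b \<in> tuples (elems X) 1"
  shows "(map f a, map f b) \<in> eq_rel X \<longleftrightarrow> (a, b) \<in> eq_rel X"
  using assms by (auto simp: tuples_1 eq_rel_def bij_betw_def inj_on_eq_iff)

lemma imag_eq_iff: "equiv A E \<Longrightarrow> a \<in> A \<Longrightarrow> b \<in> A \<Longrightarrow> imag E a = imag E b \<longleftrightarrow> (a, b) \<in> E"
  by (simp add: imag_def eq_equiv_class_iff)

lemma real_imag_eq_iff: "x \<in> elems X \<Longrightarrow> y \<in> elems X \<Longrightarrow> real_imag X x = real_imag X y \<longleftrightarrow> x = y"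
  unfolding real_imag_def by (subst imag_eq_iff[OF eq_rel_equiv]) (auto simp: tuples_1 eq_rel_def)

lemma eq_rel_Field: "Field (eq_rel X) = (\<lambda>x. [x]) ` elems X"
  using equiv_Field[OF eq_rel_equiv[of X]] by (simp add: tuples_1)

lemma imags_eq_rel:
  assumes A: "A \<subseteq> elems X" shows "imags X {eq_rel X} A = real_imag X ` A"
proof
  show "imags X {eq_rel X} A \<subseteq> real_imag X ` A"
  proof
    fix z assume "z \<in> imags X {eq_rel X} A"
    then obtain a where a: "a \<in> Field (eq_rel X)" "set a \<subseteq> A" "z = imag (eq_rel X) a"
      unfolding imags_def by blast
    then obtain x where "a = [x]" unfolding eq_rel_Field by blast
    thus "z \<in> real_imag X ` A" using a(2,3) by (simp add: real_imag_def)
  qed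
  show "real_imag X ` A \<subseteq> imags X {eq_rel X} A"
  proof
    fix z assume "z \<in> real_imag X ` A"
    then obtain x where x: "x \<in> A" "z = imag (eq_rel X) [x]" by (auto simp: real_imag_def)
    hence "[x] \<in> Field (eq_rel X)" "set [x] \<subseteq> A" using A by (auto simp: eq_rel_Field)
    thus "z \<in> imags X {eq_rel X} A" using x(2) unfolding imags_def by blast
  qed
qed

lemma eq_universe_simps [simp]:
  "elems (eq_universe X \<E>) = imags X \<E> (elems X)" "auts (eq_universe X \<E>) = eq_auts X \<E>"
  "models (eq_universe X \<E>) = imags X \<E> ` models X"
  by (simp_all add: eq_universe_def)

text \<open>The lift acts on classes by direct image and keeps the tag of the sort. Invariance of
  each relation in both directions makes the image of a class the class of the image.\<close>

lemma eq_aut_lift: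
  assumes f: "f \<in> auts X" "bij_betw f (elems X) (elems X)" and eq: "eq_rel X \<in> \<E>"
    and \<E>: "\<And>E. E \<in> \<E> \<Longrightarrow> \<exists>n. equiv (tuples (elems X) n) E \<and>
      (\<forall>a \<in> tuples (elems X) n. \<forall>b \<in> tuples (elems X) n. (map f a, map f b) \<in> E \<longleftrightarrow> (a, b) \<in> E)"
  shows "\<exists>g \<in> eq_auts X \<E>. \<forall>E \<in> \<E>. \<forall>a \<in> Field E. g (imag E a) = imag E (map f a)"
proof -
  define g where "g z = (fst z, map f ` snd z)" for z :: "'a imag"
  have img: "f ` elems X = elems X" and inj: "inj_on f (elems X)" using f(2) by (simp_all add: bij_betw_def)
  have t_map: "map f a \<in> tuples (elems X) n" if "a \<in> tuples (elems X) n" for a n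
    using that img by (auto simp: tuples_def)
  have t_surj: "\<exists>a \<in> tuples (elems X) n. b = map f a" if "b \<in> tuples (elems X) n" for b n
    using that tuples_image[of b f "elems X" n] img by simp
  have g: "g (imag E a) = imag E (map f a)" "map f a \<in> Field E" if E: "E \<in> \<E>" and a: "a \<in> Field E" for E a
  proof -
    obtain n where n: "equiv (tuples (elems X) n) E"
      "\<forall>a \<in> tuples (elems X) n. \<forall>b \<in> tuples (elems X) n. (map f a, map f b) \<in> E \<longleftrightarrow> (a, b) \<in> E"
      using \<E>[OF E] by blast
    note F = equiv_Field[OF n(1)]
    have sub: "b \<in> tuples (elems X) n" if "(c, b) \<in> E" for b c using that F by (auto simp: Field_def)
    have "map f ` (E `` {a}) = E `` {map f a}"
    proof
      show "map f ` (E `` {a}) \<subseteq> E `` {map f a}" using n(2) a sub unfolding F by blast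
      show "E `` {map f a} \<subseteq> map f ` (E `` {a})"
      proof
        fix b assume "b \<in> E `` {map f a}"
        hence b: "(map f a, b) \<in> E" by simp
        then obtain c where c: "c \<in> tuples (elems X) n" "b = map f c" using t_surj sub by blast
        hence "(a, c) \<in> E" using n(2) a b unfolding F by blast
        thus "b \<in> map f ` (E `` {a})" using c(2) by blast
      qed
    qed
    thus "g (imag E a) = imag E (map f a)" by (simp add: g_def imag_def)
    show "map f a \<in> Field E" using t_map a unfolding F by blast
  qed
  have set_F: "set a \<subseteq> elems X" if "E \<in> \<E>" "a \<in> Field E" for E a
    using \<E>[OF that(1)] that(2) equiv_Field by (auto simp: tuples_def)
  have im: "imags X \<E> (elems X) = {imag E a | E a. E \<in> \<E> \<and> a \<in> Field E}" using set_F unfolding imags_def by blast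
  have "bij_betw g (imags X \<E> (elems X)) (imags X \<E> (elems X))"
    unfolding bij_betw_def
  proof
    show "inj_on g (imags X \<E> (elems X))"
    proof (rule inj_onI)
      fix z w assume "z \<in> imags X \<E> (elems X)" "w \<in> imags X \<E> (elems X)" and eq: "g z = g w"
      then obtain E a E' b where z: "E \<in> \<E>" "a \<in> Field E" "z = imag E a" and w: "E' \<in> \<E>" "b \<in> Field E'" "w = imag E' b"
        unfolding im by blast
      have EE: "E' = E" using eq z w by (simp add: g_def imag_def)
      obtain n where n: "equiv (tuples (elems X) n) E"
        "\<forall>a \<in> tuples (elems X) n. \<forall>b \<in> tuples (elems X) n. (map f a, map f b) \<in> E \<longleftrightarrow> (a, b) \<in> E"
        using \<E>[OF z(1)] by blast
      note F = equiv_Field[OF n(1)]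
      have ab: "a \<in> tuples (elems X) n" "b \<in> tuples (elems X) n" using z(2) w(2) EE F by simp_all
      have "imag E (map f a) = imag E (map f b)" using eq g z w EE by simp
      hence "(map f a, map f b) \<in> E" using imag_eq_iff[OF n(1)] t_map ab by blast
      hence "(a, b) \<in> E" using n(2) ab by blast
      thus "z = w" using imag_eq_iff[OF n(1) ab] z w EE by simp
    qed
    show "g ` imags X \<E> (elems X) = imags X \<E> (elems X)"
    proof
      show "g ` imags X \<E> (elems X) \<subseteq> imags X \<E> (elems X)" unfolding im using g by blast
      show "imags X \<E> (elems X) \<subseteq> g ` imags X \<E> (elems X)"
      proof
        fix z assume "z \<in> imags X \<E> (elems X)"
        then obtain E b where z: "E \<in> \<E>" "b \<in> Field E" "z = imag E b" unfolding im by blast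
        obtain n where n: "equiv (tuples (elems X) n) E" using \<E>[OF z(1)] by blast
        note F = equiv_Field[OF n]
        obtain a where a: "a \<in> tuples (elems X) n" "b = map f a" using t_surj z(2) F by blast
        hence "a \<in> Field E" using F by simp
        thus "z \<in> g ` imags X \<E> (elems X)"
          unfolding im using g(1)[OF z(1)] z a(2) by (intro image_eqI[of _ _ "imag E a"]) auto
      qed
    qed
  qed
  moreover have "g (real_imag X x) = real_imag X (f x)" if "x \<in> elems X" for x
    unfolding real_imag_def using g(1)[OF eq, of "[x]"] that equiv_Field[OF eq_rel_equiv] by (auto simp: tuples_1)
  moreover have "z \<in> imag E ` Field E \<longleftrightarrow> g z \<in> imag E ` Field E"
    if E: "E \<in> \<E>" and z: "z \<in> imags X \<E> (elems X)" for E z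
  proof -
    obtain E' a where a: "E' \<in> \<E>" "a \<in> Field E'" "z = imag E' a" using z unfolding im by blast
    have fst: "w \<in> imag E ` Field E \<Longrightarrow> fst w = E" for w :: "'a imag" by (auto simp: imag_def)
    show ?thesis
    proof (cases "E = E'")
      case True
      thus ?thesis using a g[OF a(1,2)] by auto
    next
      case False
      hence "fst z \<noteq> E" "fst (g z) \<noteq> E" using a(3) by (auto simp: g_def imag_def)
      thus ?thesis using fst by blast
    qed
  qed
  ultimately have "g \<in> eq_auts X \<E>" unfolding eq_auts_def using f(1) g(1) by auto
  thus ?thesis using g(1) by blast
qed

text \<open>An invariant relation is a union of Galois types over the empty set; \<open>G\<close> is
  the set of these types, and it is countable because there are only countably many types of tuples
  of the relevant length.\<close>

lemma admissible_relI:
  assumes n: "1 \<le> n" and E: "equiv (tuples (elems X) n) E"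
    and inv: "\<And>f a b. f \<in> auts X \<Longrightarrow> (a, b) \<in> E \<Longrightarrow> (map f a, map f b) \<in> E"
    and refl: "\<And>a. a \<in> tuples (elems X) (2 * n) \<Longrightarrow> a \<in> gtp X {} a"
    and ctbl: "countable (gtp X {} ` tuples (elems X) (2 * n))"
  shows "admissible_rel X E"
proof -
  define G where "G = {gtp X {} (a @ b) | a b. (a, b) \<in> E}"
  have t: "a @ b \<in> tuples (elems X) (2 * n)" if "a \<in> tuples (elems X) n" "b \<in> tuples (elems X) n" for a b
    using that by (auto simp: tuples_def)
  have E_t: "a \<in> tuples (elems X) n" "b \<in> tuples (elems X) n" if "(a, b) \<in> E" for a b
    using that equiv_Field[OF E] by (auto simp: Field_def)
  have G: "G \<subseteq> gtp X {} ` tuples (elems X) (2 * n)" using t E_t by (auto simp: G_def)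
  have "(a, b) \<in> E \<longleftrightarrow> gtp X {} (a @ b) \<in> G" if a: "a \<in> tuples (elems X) n" and b: "b \<in> tuples (elems X) n" for a b
  proof
    assume "gtp X {} (a @ b) \<in> G"
    then obtain c e where c: "(c, e) \<in> E" "gtp X {} (a @ b) = gtp X {} (c @ e)" by (auto simp: G_def)
    have "a @ b \<in> gtp X {} (c @ e)" using refl[OF t[OF a b]] c(2) by simp
    then obtain f where f: "f \<in> auts X" "map f (c @ e) = a @ b" by (auto simp: gtp_def same_gtp_def auts_over_def)
    have "length (map f c) = length a" using E_t[OF c(1)] a by (simp add: tuples_def)
    hence "map f c = a" "map f e = b" using f(2) by auto
    thus "(a, b) \<in> E" using inv[OF f(1) c(1)] by simp
  qed (auto simp: G_def)
  moreover have "countable G" using countable_subset[OF G ctbl] .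
  ultimately show ?thesis unfolding admissible_rel_def using n E inv G by (intro exI[of _ n]) blast
qed

section \<open>The two stages of imaginaries over the monster model\<close>

context zariski_monster
begin

sublocale nontrivial_geometry C Aut P
  by unfold_locales (rule nontrivial_closure)

definition \<E> :: "'m list rel set" where
  "\<E> = {eq_rel X, difference_rel}"

definition Y :: "('m imag, 'd) universe" where
  "Y = eq_universe X \<E>"

text \<open>The codes are already imaginaries of the first stage. The second stage is formed with
  equality alone, so it is a copy of the first.\<close>

definition Z :: "('m imag imag, 'd) universe" where
  "Z = eq_universe Y {eq_rel Y}"

definition sort :: "'m list \<Rightarrow> 'm list rel" where
  "sort a = (if length a = 1 then eq_rel X else difference_rel)"

definition \<iota> :: "'m list \<Rightarrow> 'm imag" where
  "\<iota> a = imag (sort a) a"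

lemma eq_rel_X: "equiv (tuples P 1) (eq_rel X)"
  using eq_rel_equiv[of X] by simp

lemma tup_sort: "A \<subseteq> P \<Longrightarrow> a \<in> tup A \<longleftrightarrow> sort a \<in> \<E> \<and> a \<in> Field (sort a) \<and> set a \<subseteq> A"
  using equiv_Field[OF eq_rel_X] equiv_Field[OF difference_rel_equiv]
  by (auto simp: tup_def sort_def \<E>_def tuples_def)

lemma imags_X: 
  assumes "A \<subseteq> P" shows "imags X \<E> A = \<iota> ` tup A"
proof
  have s: "sort a = E" if "E \<in> \<E>" "a \<in> Field E" for E a
    using that equiv_Field[OF eq_rel_X] equiv_Field[OF difference_rel_equiv]
    by (auto simp: sort_def \<E>_def tuples_def)
  show "imags X \<E> A \<subseteq> \<iota> ` tup A"
  proof
    fix z assume "z \<in> imags X \<E> A"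
    then obtain E a where a: "E \<in> \<E>" "a \<in> Field E" "set a \<subseteq> A" "z = imag E a" by (auto simp: imags_def)
    hence "a \<in> tup A" "z = \<iota> a" using tup_sort[OF assms] s by (auto simp: \<iota>_def)
    thus "z \<in> \<iota> ` tup A" by blast
  qed
  show "\<iota> ` tup A \<subseteq> imags X \<E> A" using tup_sort[OF assms] by (auto simp: imags_def \<iota>_def)
qed

lemma Y_elems: "elems Y = \<iota> ` tup P"
  using imags_X[of P] by (simp add: Y_def)

lemma difference_rel_length: "(a, b) \<in> difference_rel \<Longrightarrow> length a = 6 \<and> length b = 6"
  by (auto simp: difference_rel_def tuples_def)

lemma \<iota>_eq: "a \<in> tup P \<Longrightarrow> b \<in> tup P \<Longrightarrow> \<iota> a = \<iota> b \<longleftrightarrow> a = b \<or> (a, b) \<in> difference_rel"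
proof -
  assume a: "a \<in> tup P" and b: "b \<in> tup P"
  obtain x where "x \<in> P" using uncountable_points by fastforce
  hence "([x], [x]) \<in> eq_rel X" by (simp add: eq_rel_def)
  hence ne: "eq_rel X \<noteq> difference_rel" using difference_rel_length[of "[x]" "[x]"] by auto
  consider "a \<in> tuples P 1" "b \<in> tuples P 1" | "a \<in> tuples P 6" "b \<in> tuples P 6" |
    "a \<in> tuples P 1" "b \<in> tuples P 6" | "a \<in> tuples P 6" "b \<in> tuples P 1" using a b by (auto simp: tup_def)
  thus ?thesis
  proof cases
    case 1
    hence "\<iota> a = imag (eq_rel X) a" "\<iota> b = imag (eq_rel X) b" by (simp_all add: \<iota>_def sort_def tuples_def)
    moreover have "(a, b) \<in> eq_rel X \<longleftrightarrow> a = b" using 1 by (auto simp: eq_rel_def tuples_1)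
    moreover have "(a, b) \<notin> difference_rel" using 1 difference_rel_length[of a b] by (auto simp: tuples_def)
    ultimately show ?thesis using imag_eq_iff[OF eq_rel_X 1] by simp
  next
    case 2
    hence "\<iota> a = imag difference_rel a" "\<iota> b = imag difference_rel b" by (simp_all add: \<iota>_def sort_def tuples_def)
    moreover have "(a, b) \<in> difference_rel" if "a = b" using that 2 by (simp add: difference_rel_def)
    ultimately show ?thesis using imag_eq_iff[OF difference_rel_equiv 2] by auto
  next
    case 3
    hence "\<iota> a \<noteq> \<iota> b" "a \<noteq> b" using ne by (auto simp: \<iota>_def sort_def tuples_def imag_def)
    thus ?thesis using 3 difference_rel_length[of a b] by (auto simp: tuples_def)
  next
    case 4
    hence "\<iota> a \<noteq> \<iota> b" "a \<noteq> b" using ne by (auto simp: \<iota>_def sort_def tuples_def imag_def)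
    thus ?thesis using 4 difference_rel_length[of a b] by (auto simp: tuples_def)
  qed
qed

lemma Y_auts:
  assumes g: "g \<in> auts Y" shows "\<exists>f \<in> Aut. \<forall>a \<in> tup P. g (\<iota> a) = \<iota> (map f a)"
proof -
  obtain h where h: "h \<in> automorphisms L M" "\<forall>E \<in> \<E>. \<forall>a \<in> Field E. g (imag E a) = imag E (map h a)"
    using g by (auto simp: Y_def eq_auts_def)
  obtain f where f: "f \<in> Aut" "\<forall>x \<in> P. f x = h x" using automorphism_extends h(1) by blast
  have "g (\<iota> a) = \<iota> (map f a)" if a: "a \<in> tup P" for a
  proof -
    have m: "map f a = map h a" using f(2) tup_set[OF a] by auto
    have "g (\<iota> a) = imag (sort a) (map h a)" using h(2) tup_sort[of P a] a by (simp add: \<iota>_def)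
    thus ?thesis unfolding m by (simp add: \<iota>_def sort_def)
  qed
  thus ?thesis using f(1) by blast
qed

lemma Y_lift:
  assumes f: "f \<in> Aut" shows "\<exists>g \<in> auts Y. \<forall>a \<in> tup P. g (\<iota> a) = \<iota> (map f a)"
proof -
  have aut: "f \<in> auts X" using f by (simp add: Aut_def)
  have bij: "bij_betw f (elems X) (elems X)" using automorphism_bij aut by simp
  have "\<exists>g \<in> eq_auts X \<E>. \<forall>E \<in> \<E>. \<forall>a \<in> Field E. g (imag E a) = imag E (map f a)"
  proof (rule eq_aut_lift[OF aut bij])
    show "eq_rel X \<in> \<E>" by (simp add: \<E>_def)
    fix E assume "E \<in> \<E>"
    then consider "E = eq_rel X" | "E = difference_rel" by (auto simp: \<E>_def)
    thus "\<exists>n. equiv (tuples (elems X) n) E \<and>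
      (\<forall>a \<in> tuples (elems X) n. \<forall>b \<in> tuples (elems X) n. (map f a, map f b) \<in> E \<longleftrightarrow> (a, b) \<in> E)"
    proof cases
      case 1
      thus ?thesis using eq_rel_equiv[of X] eq_rel_map[OF bij] by (intro exI[of _ 1]) simp
    next
      case 2
      have "(a, b) \<in> difference_rel" if "(map f a, map f b) \<in> difference_rel" for a b
      proof -
        have "map (iv f) (map f c) = c" for c using f by (simp add: comp_def)
        thus ?thesis using difference_rel_map[OF G_inv[OF f] that] by simp
      qed
      thus ?thesis using 2 difference_rel_equiv difference_rel_map[OF f]
        by (intro exI[of _ 6]) auto
    qed
  qed
  then obtain g where g: "g \<in> eq_auts X \<E>" "\<forall>E \<in> \<E>. \<forall>a \<in> Field E. g (imag E a) = imag E (map f a)" by blast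
  have "g (\<iota> a) = \<iota> (map f a)" if "a \<in> tup P" for a
    using g(2) tup_sort[of P a] that by (simp add: \<iota>_def sort_def)
  thus ?thesis using g(1) by (auto simp: Y_def)
qed

lemma Y_gtp: "set as \<subseteq> tup P \<Longrightarrow> gtp Y {} (map \<iota> as) = {map \<iota> (map (map f) as) | f. f \<in> Aut}"
proof -
  assume as: "set as \<subseteq> tup P"
  have m: "map g (map \<iota> as) = map \<iota> (map (map f) as)" if "\<forall>a \<in> tup P. g (\<iota> a) = \<iota> (map f a)" for f g
    using that as by auto
  show ?thesis
  proof
    show "gtp Y {} (map \<iota> as) \<subseteq> {map \<iota> (map (map f) as) | f. f \<in> Aut}"
    proof
      fix b assume "b \<in> gtp Y {} (map \<iota> as)"
      then obtain g where g: "g \<in> auts Y" "map g (map \<iota> as) = b" by (auto simp: gtp_def same_gtp_def auts_over_def)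
      thus "b \<in> {map \<iota> (map (map f) as) | f. f \<in> Aut}" using Y_auts[OF g(1)] m by blast
    qed
    show "{map \<iota> (map (map f) as) | f. f \<in> Aut} \<subseteq> gtp Y {} (map \<iota> as)"
    proof clarify
      fix f assume f: "f \<in> Aut"
      obtain g where g: "g \<in> auts Y" "\<forall>a \<in> tup P. g (\<iota> a) = \<iota> (map f a)" using Y_lift[OF f] by blast
      show "map \<iota> (map (map f) as) \<in> gtp Y {} (map \<iota> as)"
        using g(1) m[OF g(2)] by (auto simp: gtp_def same_gtp_def auts_over_def)
    qed
  qed
qed

lemma X_gtp: "set a \<subseteq> P \<Longrightarrow> gtp X {} a = {map f a | f. f \<in> Aut}"
  using same_gtp_iff[of "{}" a] by (auto simp: gtp_def eqv_def fixg_def)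

lemma orbit_map: "h \<in> Aut \<Longrightarrow> {F (h' \<circ> h) | h'. h' \<in> Aut} = {F f | f. f \<in> Aut}"
proof
  assume h: "h \<in> Aut"
  show "{F (h' \<circ> h) | h'. h' \<in> Aut} \<subseteq> {F f | f. f \<in> Aut}" using G_comp h by blast
  show "{F f | f. f \<in> Aut} \<subseteq> {F (h' \<circ> h) | h'. h' \<in> Aut}"
  proof clarify
    fix f assume f: "f \<in> Aut"
    have "(f \<circ> iv h) \<circ> h = f" using h by (auto simp: fun_eq_iff)
    thus "\<exists>h'. F f = F (h' \<circ> h) \<and> h' \<in> Aut" using G_comp[OF f G_inv[OF h]] by metis
  qed
qed

lemma countable_orbits: "\<exists>W. countable W \<and> (\<forall>w. set w \<subseteq> P \<longrightarrow> (\<exists>g \<in> Aut. map g w \<in> W))"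
proof -
  have "ctbl_gen (C {})" by (rule ctbl_gen_C0) simp
  from countably_many_types[OF this] obtain W where "countable W"
    "\<forall>w. set w \<subseteq> P \<longrightarrow> (\<exists>g \<in> fixg (C {}). map g w \<in> W)" by (elim exE conjE)
  moreover have "fixg (C {}) \<subseteq> Aut" by (auto simp: fixg_def)
  ultimately show ?thesis by (intro exI[of _ W]) blast
qed

lemma countable_X_gtp: "countable (gtp X {} ` tuples P n)"
proof -
  obtain W where W: "countable W" "\<And>w. set w \<subseteq> P \<Longrightarrow> \<exists>g \<in> Aut. map g w \<in> W" using countable_orbits by blast
  have "gtp X {} ` tuples P n \<subseteq> gtp X {} ` W"
  proof clarify
    fix w assume "w \<in> tuples P n"
    hence w: "set w \<subseteq> P" by (simp add: tuples_def)
    obtain h where h: "h \<in> Aut" "map h w \<in> W" using W(2)[OF w] by blast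
    have "set (map h w) \<subseteq> P" using w Aut_P(2)[OF h(1)] by auto
    hence "gtp X {} (map h w) = {map (h' \<circ> h) w | h'. h' \<in> Aut}" using X_gtp by simp
    also have "\<dots> = gtp X {} w" using orbit_map[OF h(1), of "\<lambda>f. map f w"] X_gtp[OF w] by simp
    finally show "gtp X {} w \<in> gtp X {} ` W" using h(2) by blast
  qed
  from countable_subset[OF this countable_image[OF W(1)]] show ?thesis .
qed

lemma countable_Y_gtp: "countable (gtp Y {} ` tuples (elems Y) 2)"
proof -
  obtain W where W: "countable W" "\<And>w. set w \<subseteq> P \<Longrightarrow> \<exists>g \<in> Aut. map g w \<in> W" using countable_orbits by blast
  \<comment> \<open>A pair of imaginaries is given by one concatenated tuple of representatives and
    the position \<open>n\<close> where it is cut, since the two sorts have representatives of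
    different lengths.\<close>
  define T where "T = (\<lambda>(n, w). gtp Y {} [\<iota> (take n w), \<iota> (drop n w)]) ` ((UNIV :: nat set) \<times> W)"
  have "gtp Y {} ` tuples (elems Y) 2 \<subseteq> T"
  proof clarify
    fix l assume "l \<in> tuples (elems Y) 2"
    hence "l \<in> tuples (\<iota> ` tup P) 2" by (simp add: Y_elems)
    then obtain as where as: "as \<in> tuples (tup P) 2" "l = map \<iota> as" using tuples_image by blast
    then obtain a b where ab: "as = [a, b]" "a \<in> tup P" "b \<in> tup P"
      by (auto simp: tuples_def numeral_2_eq_2 length_Suc_conv)
    have "set (a @ b) \<subseteq> P" using ab tup_set[of _ P] by auto
    then obtain h where h: "h \<in> Aut" "map h (a @ b) \<in> W" using W(2) by blast
    have m: "map h a \<in> tup P" "map h b \<in> tup P" using ab tuples_map[OF h(1)] by (auto simp: tup_def)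
    have "gtp Y {} l = {map \<iota> (map (map f) as) | f. f \<in> Aut}" using Y_gtp[of as] as ab by simp
    also have "\<dots> = {map \<iota> (map (map (h' \<circ> h)) as) | h'. h' \<in> Aut}"
      using orbit_map[OF h(1), of "\<lambda>f. map \<iota> (map (map f) as)"] by simp
    also have "\<dots> = gtp Y {} (map \<iota> [map h a, map h b])" using Y_gtp[of "[map h a, map h b]"] m ab by simp
    also have "\<dots> = gtp Y {} [\<iota> (take (length a) (map h (a @ b))), \<iota> (drop (length a) (map h (a @ b)))]" by simp
    also have "\<dots> \<in> T" unfolding T_def using h(2) by (intro image_eqI[of _ _ "(length a, map h (a @ b))"]) simp_all
    finally show "gtp Y {} l \<in> T" .
  qed
  moreover have "countable T" unfolding T_def using W(1) by simp
  ultimately show ?thesis by (rule countable_subset)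
qed

lemma admissible_X: "admissible X \<E>"
  unfolding admissible_def
proof (intro conjI ballI)
  show "countable \<E>" "eq_rel X \<in> \<E>" by (simp_all add: \<E>_def)
  have refl: "a \<in> gtp X {} a" if "a \<in> tuples P n" for a n
  proof -
    have "a = map id a" by simp
    thus ?thesis using X_gtp[of a] that Aut_id by (auto simp: tuples_def)
  qed
  fix E assume "E \<in> \<E>"
  then consider "E = eq_rel X" | "E = difference_rel" by (auto simp: \<E>_def)
  thus "admissible_rel X E"
  proof cases
    case 1
    have "admissible_rel X (eq_rel X)"
    proof (rule admissible_relI[of 1])
      show "(map f a, map f b) \<in> eq_rel X" if "f \<in> auts X" "(a, b) \<in> eq_rel X" for f a b
        using that automorphism_bij[of f] by (auto simp: eq_rel_def bij_betw_def)
    qed (use eq_rel_equiv[of X] refl countable_X_gtp in simp_all)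
    thus ?thesis by (simp add: 1)
  next
    case 2
    have "admissible_rel X difference_rel"
    proof (rule admissible_relI[of 6])
      show "(map f a, map f b) \<in> difference_rel" if f: "f \<in> auts X" "(a, b) \<in> difference_rel" for f a b
      proof -
        obtain g where g: "g \<in> Aut" "\<forall>x \<in> P. g x = f x" using automorphism_extends f(1) by auto
        have m: "map f a = map g a" "map f b = map g b"
          using g(2) f(2) by (auto simp: difference_rel_def tuples_def subset_iff)
        show ?thesis unfolding m by (rule difference_rel_map[OF g(1) f(2)])
      qed
    qed (use difference_rel_equiv refl countable_X_gtp in simp_all)
    thus ?thesis by (simp add: 2)
  qed
qed

lemma Y_aut_bij: "g \<in> auts Y \<Longrightarrow> bij_betw g (elems Y) (elems Y)"
  by (auto simp: Y_def eq_auts_def)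

lemma admissible_Y: "admissible Y {eq_rel Y}"
  unfolding admissible_def
proof (intro conjI ballI)
  fix E assume "E \<in> {eq_rel Y}"
  have "admissible_rel Y (eq_rel Y)"
  proof (rule admissible_relI[of 1])
    show "(map f a, map f b) \<in> eq_rel Y" if f: "f \<in> auts Y" "(a, b) \<in> eq_rel Y" for f a b
    proof -
      obtain x where x: "x \<in> elems Y" "a = [x]" "b = [x]" using f(2) unfolding eq_rel_def by blast
      hence "f x \<in> elems Y" using Y_aut_bij[OF f(1)] unfolding bij_betw_def by blast
      thus ?thesis using x(2,3) unfolding eq_rel_def by (intro CollectI exI[of _ "f x"]) simp
    qed
    show "a \<in> gtp Y {} a" if a: "a \<in> tuples (elems Y) (2 * 1)" for a
    proof -
      have "a \<in> tuples (\<iota> ` tup P) 2" using a by (simp add: Y_elems)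
      then obtain as where as: "as \<in> tuples (tup P) 2" "a = map \<iota> as" using tuples_image by blast
      hence "gtp Y {} a = {map \<iota> (map (map f) as) | f. f \<in> Aut}" using Y_gtp[of as] by (simp add: tuples_def)
      moreover have "a = map \<iota> (map (map id) as)" using as(2) by simp
      ultimately show ?thesis using Aut_id by blast
    qed
  qed (use eq_rel_equiv[of Y] countable_Y_gtp in simp_all)
  thus "admissible_rel Y E" using \<open>E \<in> _\<close> by simp
qed simp_all

lemma independent_list:
  assumes "cl_independent (cl M) B" "B \<subseteq> P" "distinct es" "S +@ es \<subseteq> B" "S \<inter> set es = {}"
  shows "indl S es"
  using assms(3-5)
proof (induction es arbitrary: S)
  case (Cons x xs)
  have "x \<notin> cl M (B - {x})" using assms(1) Cons.prems(2) by (auto simp: cl_independent_def)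
  moreover have "cl M S \<subseteq> cl M (B - {x})" by (rule cl_mono) (use Cons.prems assms(2) in auto)
  moreover have "S \<inter> P = S" "x \<in> P" using Cons.prems(2) assms(2) by auto
  ultimately have "x \<notin> C S" by (auto simp: C_def)
  moreover have "indl (insert x S) xs" by (rule Cons.IH) (use Cons.prems in auto)
  ultimately show ?case by (simp add: indl_Cons)
qed simp

lemma independent_model:
  assumes B: "cl_independent (cl M) B" "B \<subseteq> P" "infinite B" and D: "countable D" "B \<subseteq> D"
  shows "model (C D)"
proof (rule infinite_dim_model[OF D(1)])
  fix n
  obtain T where T: "T \<subseteq> B" "finite T" "card T = n" using infinite_arbitrarily_large[OF B(3)] by blast
  obtain es where es: "set es = T" "distinct es" using finite_distinct_list[OF T(2)] by blast
  have "indl {} es" by (rule independent_list[OF B(1,2)]) (use es T in auto)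
  moreover have "set es \<subseteq> C D" using ext[of D] es(1) T(1) D(2) by blast
  moreover have "length es = n" using es T(3) distinct_card[OF es(2)] by simp
  ultimately show "\<exists>es. set es \<subseteq> C D \<and> indl {} es \<and> length es = n" by blast
qed

text \<open>Models are only bounded, whereas the theory of types was developed over countably
  generated sets. The closure of \<open>S\<close> and a countable infinite independent subset of the
  model is such a set inside it.\<close>

lemma submodel_model:
  assumes A: "A \<in> submodels L M\<^sub>0 \<delta> M" and S: "finite S" "S \<subseteq> A"
  shows "\<exists>K. model K \<and> S \<subseteq> K \<and> K \<inter> P \<subseteq> A"
proof -
  obtain B0 where A': "cl_closed M A" "B0 \<subseteq> A" "infinite B0" "cl_independent (cl M) B0"
    using A unfolding submodel_iff by blast
  have AP: "A \<subseteq> P" "cl M A = A" using A'(1) by (auto simp: cl_closed_def)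
  obtain B where B: "B \<subseteq> B0" "countable B" "infinite B" using infinite_countable_subset'[OF A'(3)] by blast
  have "cl_independent (cl M) B"
    unfolding cl_independent_def
  proof
    fix b assume b: "b \<in> B"
    have "cl M (B - {b}) \<subseteq> cl M (B0 - {b})" by (rule cl_mono) (use A'(2) AP(1) B(1) in auto)
    thus "b \<notin> cl M (B - {b})" using A'(4) B(1) b by (auto simp: cl_independent_def)
  qed
  hence "model (C (S \<union> B))"
    by (rule independent_model) (use A'(2) AP(1) B S(1) in \<open>auto simp: countable_finite\<close>)
  moreover have "C (S \<union> B) \<inter> P \<subseteq> A"
  proof -
    have "cl M ((S \<union> B) \<inter> P) \<subseteq> cl M A" by (rule cl_mono) (use S(2) B(1) A'(2) AP in auto)
    thus ?thesis unfolding C_points AP(2) .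
  qed
  moreover have "S \<subseteq> C (S \<union> B)" using ext[of "S \<union> B"] by blast
  ultimately show ?thesis by blast
qed

lemma ex_submodel:
  "\<exists>B. countable B \<and> (\<forall>D. countable D \<longrightarrow> B \<subseteq> D \<longrightarrow> model (C D) \<and> C D \<inter> P \<in> submodels L M\<^sub>0 \<delta> M)"
proof -
  obtain B where B: "B \<subseteq> P" "countable B" "infinite B" "cl_independent (cl M) B" using ex_independent by blast
  have "model (C D) \<and> C D \<inter> P \<in> submodels L M\<^sub>0 \<delta> M" if D: "countable D" "B \<subseteq> D" for D
  proof
    show "model (C D)" using independent_model B D by blast
    have "B \<subseteq> C D \<inter> P" using D(2) B(1) ext[of D] by blast
    moreover have "cl_closed M (C D \<inter> P)" unfolding C_points by (rule cl_closed_cl) simp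
    ultimately show "C D \<inter> P \<in> submodels L M\<^sub>0 \<delta> M"
      unfolding submodel_iff using B(3,4) countable_small[OF C_ctbl[OF D(1)]] by blast
  qed
  thus ?thesis using B(2) by blast
qed

sublocale coded: coded_universe C Aut P Z "real_imag Y \<circ> \<iota>" "submodels L M\<^sub>0 \<delta> M"
proof unfold_locales
  have ZE: "elems Z = real_imag Y ` elems Y" using imags_eq_rel[of "elems Y" Y] by (simp add: Z_def)
  thus "elems Z = (real_imag Y \<circ> \<iota>) ` tup P" by (simp add: Y_elems image_comp)
  have \<iota>Y: "\<iota> a \<in> elems Y" if "a \<in> tup P" for a using that by (simp add: Y_elems)
  show "\<exists>f \<in> Aut. \<forall>a \<in> tup P. g ((real_imag Y \<circ> \<iota>) a) = (real_imag Y \<circ> \<iota>) (map f a)" if g: "g \<in> auts Z" for g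
  proof -
    obtain h where h: "h \<in> auts Y" "\<forall>x \<in> elems Y. g (real_imag Y x) = real_imag Y (h x)"
      using g by (auto simp: Z_def eq_auts_def)
    obtain f where f: "f \<in> Aut" "\<forall>a \<in> tup P. h (\<iota> a) = \<iota> (map f a)" using Y_auts[OF h(1)] by blast
    show ?thesis using f h(2) \<iota>Y by (intro bexI[of _ f]) auto
  qed
  show "\<exists>g \<in> auts Z. \<forall>a \<in> tup P. g ((real_imag Y \<circ> \<iota>) a) = (real_imag Y \<circ> \<iota>) (map f a)" if f: "f \<in> Aut" for f
  proof -
    obtain h where h: "h \<in> auts Y" "\<forall>a \<in> tup P. h (\<iota> a) = \<iota> (map f a)" using Y_lift[OF f] by blast
    note bij = Y_aut_bij[OF h(1)]
    have "\<exists>g \<in> eq_auts Y {eq_rel Y}. \<forall>E \<in> {eq_rel Y}. \<forall>a \<in> Field E. g (imag E a) = imag E (map h a)"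
    proof (rule eq_aut_lift[OF h(1) bij])
      fix E assume "E \<in> {eq_rel Y}"
      thus "\<exists>n. equiv (tuples (elems Y) n) E \<and>
        (\<forall>a \<in> tuples (elems Y) n. \<forall>b \<in> tuples (elems Y) n. (map h a, map h b) \<in> E \<longleftrightarrow> (a, b) \<in> E)"
        using eq_rel_equiv[of Y] eq_rel_map[OF bij] by (intro exI[of _ 1]) simp
    qed simp
    then obtain g where g: "g \<in> auts Z" "\<forall>a \<in> Field (eq_rel Y). g (imag (eq_rel Y) a) = imag (eq_rel Y) (map h a)"
      by (auto simp: Z_def)
    have "g (real_imag Y x) = real_imag Y (h x)" if "x \<in> elems Y" for x
    proof -
      have "[x] \<in> Field (eq_rel Y)" using that equiv_Field[OF eq_rel_equiv[of Y]] by (auto simp: tuples_1)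
      thus ?thesis using g(2) by (simp add: real_imag_def)
    qed
    thus ?thesis using g(1) h(2) \<iota>Y by (intro bexI[of _ g]) auto
  qed
  show "models Z = (\<lambda>A. (real_imag Y \<circ> \<iota>) ` tup A) ` submodels L M\<^sub>0 \<delta> M"
  proof -
    have AP: "A \<subseteq> P" if "A \<in> submodels L M\<^sub>0 \<delta> M" for A using that unfolding submodel_iff cl_closed_def by blast
    have "imags Y {eq_rel Y} (imags X \<E> A) = (real_imag Y \<circ> \<iota>) ` tup A" if A: "A \<in> submodels L M\<^sub>0 \<delta> M" for A
    proof -
      have "\<iota> ` tup A \<subseteq> elems Y" using tup_mono[OF AP[OF A]] by (auto simp: Y_elems)
      thus ?thesis using imags_X[OF AP[OF A]] imags_eq_rel[of "\<iota> ` tup A" Y] by (simp add: image_comp)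
    qed
    moreover have "models Z = (\<lambda>A. imags Y {eq_rel Y} (imags X \<E> A)) ` submodels L M\<^sub>0 \<delta> M"
      by (simp add: Z_def Y_def image_image)
    ultimately show ?thesis by simp
  qed
  show "(real_imag Y \<circ> \<iota>) a = (real_imag Y \<circ> \<iota>) b \<longleftrightarrow> a = b \<or> (a, b) \<in> difference_rel" if "a \<in> tup P" "b \<in> tup P" for a b
    using real_imag_eq_iff[OF \<iota>Y[OF that(1)] \<iota>Y[OF that(2)]] \<iota>_eq[OF that] by simp
  show "C A \<inter> P = A" if "A \<in> submodels L M\<^sub>0 \<delta> M" for A
  proof -
    have "A \<subseteq> P" "cl M A = A" using that unfolding submodel_iff cl_closed_def by blast+
    hence "A \<inter> P = A" by blast
    thus ?thesis using C_points[of A] \<open>cl M A = A\<close> by simp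
  qed
  show "\<exists>K. model K \<and> S \<subseteq> K \<and> K \<inter> P \<subseteq> A" if "A \<in> submodels L M\<^sub>0 \<delta> M" "finite S" "S \<subseteq> A" for A S
    using submodel_model that .
  show "\<exists>B. countable B \<and> (\<forall>D. countable D \<longrightarrow> B \<subseteq> D \<longrightarrow> model (C D) \<and> C D \<inter> P \<in> submodels L M\<^sub>0 \<delta> M)"
    by (rule ex_submodel)
qed

theorem group_exists:
  "\<exists>\<E> \<E>' D G. admissible X \<E> \<and> admissible (eq_universe X \<E>) \<E>' \<and>
     gdefinable_group (eq_universe (eq_universe X \<E>) \<E>') D G \<and>
     one_dimensional (eq_universe (eq_universe X \<E>) \<E>') D G"
  using coded.coded_group admissible_X admissible_Y unfolding Z_def Y_def by blast

end

theorem theorem4p19: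
  fixes L :: "('f, 'r) language"
    and M\<^sub>0 :: "('f, 'r, 'b) cl_structure"
    and M :: "('f, 'r, 'm) cl_structure"
    and \<delta> :: "'d rel"
    and \<MM> :: "('m, 'd) universe"
  assumes "countable_language L"
    and "quasiminimal L M\<^sub>0"
    and "monster_model L M\<^sub>0 \<delta> M"
    and "\<MM> = monster_universe L M\<^sub>0 \<delta> M"
    and "Zariski_like \<MM>"
    and "nontrivial_pregeometry \<MM>"
  shows "\<exists>\<E> \<E>' D G.
           admissible \<MM> \<E> \<and>
           admissible (eq_universe \<MM> \<E>) \<E>' \<and>
           gdefinable_group (eq_universe (eq_universe \<MM> \<E>) \<E>') D G \<and>
           one_dimensional (eq_universe (eq_universe \<MM> \<E>) \<E>') D G"
proof -
  interpret zariski_monster L M\<^sub>0 \<delta> M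
    using assms by unfold_locales simp_all
  show ?thesis unfolding assms(4) by (rule group_exists)
qed

end
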